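(* Assume $c$, $\Omega$, $\bar\Omega$, $\operatorname{spt}\rho$, $\operatorname{spt}\bar\rho$ satisfy (Twist), (Nondeg), (DomConv) and (QQConv). There is a universal constant $C>0$ with the following property. Let $u$ be a $c$-convex function on $\Omega$ and $m$ a $c$-function with focus $\bar x\in\operatorname{spt}\bar\rho$, and suppose $S:=\{u\le m\}$ is compactly contained in $\Omega$. Let $x_0$ be any point in the interior of $S$ and let $v\in T^*_{\bar x}\bar M$ have unit length. Then $$(m(x_0)-u(x_0))^n\ \le\ \frac{C}{l([S]_{\bar x},v)}\;\frac{d\big(p_{(x_0,\bar x)},\,\Pi^{v}_{[S]_{\bar x}}\cup\Pi^{-v}_{[S]_{\bar x}}\big)}{d\big(\Pi^{v}_{[S]_{\bar x}},\,\Pi^{-v}_{[S]_{\bar x}}\big)}\;|S|_{\mathcal L}\,|\partial_cu(S)|_{\mathcal L}.$$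
   Context: Setting. $(M,g)$ and $(\bar M,\bar g)$ are $n$-dimensional Riemannian manifolds, $\Omega\subset M$ and $\bar\Omega\subset\bar M$ are bounded subdomains with compact closures $\Omega^{\mathrm{cl}},\bar\Omega^{\mathrm{cl}}$. $\rho,\bar\rho\ge 0$ are measurable functions (densities of probability measures on $M$, $\bar M$) with supports $\operatorname{spt}\rho\subset\Omega$, $\operatorname{spt}\bar\rho\subset\bar\Omega$; $0<\alpha_1\le\alpha_2$ are fixed constants with $\alpha_1\le\rho(x)/\bar\rho(\bar x)\le\alpha_2$ a.e. on the product of the supports. $|\cdot|_{\mathcal L}$ denotes Riemannian volume. The cost $c:\Omega^{\mathrm{cl}}\times\bar\Omega^{\mathrm{cl}}\to\mathbb R$ is "$C^3$" in the sense that all mixed derivatives of order 2 in one variable and order 1 in the other are continuous on $\Omega^{\mathrm{cl}}\times\bar\Omega^{\mathrm{cl}}$. $D$ and $\bar D$ denote the differentials in the first and second variable. Notation: $p_{(x,\bar x)}:=-\bar Dc(x,\bar x)\in T^*_{\bar x}\bar M$, $\bar p_{(x,\bar x)}:=-Dc(x,\bar x)\in T^*_xM$; for $A\subset\Omega$, $[A]_{\bar x}:=-\bar Dc(A,\bar x)$; for $\bar A\subset\bar\Omega$, $[\bar A]_x:=-Dc(x,\bar A)$. (Twist): $\bar x\mapsto -Dc(x_0,\bar x)$ is injective on $\bar\Omega$ for each $x_0\in\Omega$, and $x\mapsto-\bar Dc(x,\bar x_0)$ is injective on $\Omega$ for each $\bar x_0\in\bar\Omega$. For $\bar p\in[\bar\Omega]_{x_0}$,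 $exp^c_{x_0}(\bar p)\in\bar\Omega$ is the unique point with $-Dc(x_0,exp^c_{x_0}(\bar p))=\bar p$; for $p\in[\Omega]_{\bar x_0}$, $exp^c_{\bar x_0}(p)\in\Omega$ is the unique point with $-\bar Dc(exp^c_{\bar x_0}(p),\bar x_0)=p$. (Nondeg): for every $(x,\bar x)\in\Omega^{\mathrm{cl}}\times\bar\Omega^{\mathrm{cl}}$ the linear maps $-\bar DDc(x,\bar x):T_{\bar x}\bar M\to T^*_xM$ and its adjoint $-D\bar Dc(x,\bar x):T_xM\to T^*_{\bar x}\bar M$ are invertible. Put $\mathcal M_{x,\bar x}:=[-\bar DDc(x,\bar x)]^{-1}:T^*_xM\to T_{\bar x}\bar M$. $c$-segments: for $x_0,x_1\in\Omega$ and $\bar x\in\bar\Omega$ the $c$-segment with respect to $\bar x$ from $x_0$ to $x_1$ is $s\mapsto exp^c_{\bar x}((1-s)p_{(x_0,\bar x)}+s\,p_{(x_1,\bar x)})$, $s\in[0,1]$; for $\bar x_0,\bar x_1\in\bar\Omega$ and $x\in\Omega$ the $c$-segment with respect to $x$ from $\bar x_0$ to $\bar x_1$ is $t\mapsto exp^c_x((1-t)\bar p_{(x,\bar x_0)}+t\,\bar p_{(x,\bar x_1)})$. A set $A\subset\Omega$ is $c$-convex with respect to $\bar x$ if it contains all $c$-segments with respect to $\bar x$ between its points (equivalently $[A]_{\bar x}$ is convex); similarly for $\bar A\subset\bar\Omega$ with respect to $x\in\Omega$; $c$-convex with respect to a set means with respect to each of its points. (DomConv): $\Omega$ and $\bar\Omega$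 are $c$-convex with respect to each other, $\operatorname{spt}\bar\rho$ is $c$-convex with respect to $\Omega$, and $\operatorname{spt}\bar\rho\subset\bar\Omega^{\mathrm{int}}$ (compact containment). (QQConv): there is a constant $M_0\ge1$ such that for all $x,x_0,x_1\in\Omega$, $\bar x,\bar x_0,\bar x_1\in\bar\Omega$ and $s,t\in[0,1]$, $$-c(x,\bar x(t))+c(x,\bar x_0)-(-c(x_0,\bar x(t))+c(x_0,\bar x_0))\le M_0t\,\big(-c(x,\bar x_1)+c(x,\bar x_0)-(-c(x_0,\bar x_1)+c(x_0,\bar x_0))\big)_+,$$ $$-c(x(s),\bar x)+c(x_0,\bar x)-(-c(x(s),\bar x_0)+c(x_0,\bar x_0))\le M_0s\,\big(-c(x_1,\bar x)+c(x_0,\bar x)-(-c(x_1,\bar x_0)+c(x_0,\bar x_0))\big)_+,$$ where $\bar x(t)$ is the $c$-segment with respect to $x_0$ from $\bar x_0$ to $\bar x_1$, and $x(s)$ is the $c$-segment with respect to $\bar x_0$ from $x_0$ to $x_1$. Universal constant: one depending only on $\Omega,\bar\Omega,\operatorname{spt}\rho,\operatorname{spt}\bar\rho$, $n$, $\alpha_1,\alpha_2$, $M_0$ (itself regarded as universal), $\sup|\det\mathcal M_{x,\bar x}|^{\pm1}$ and $\sup\|\mathcal M_{x,\bar x}^{\pm1}\|$ over $\Omega^{\mathrm{cl}}\times\bar\Omega^{\mathrm{cl}}$, and $\|c\|_{C^3(\Omega^{\mathrm{cl}}\times\bar\Omega^{\mathrm{cl}})}$. $c$-convex functions: a $c$-function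 with focus $\bar x_0\in\bar\Omega$ is a function $m(x)=-c(x,\bar x_0)+\lambda_0$, $\lambda_0\in\mathbb R$. A real function $u$ on $\Omega$ is $c$-convex if for each $x_0\in\Omega$ there is a $c$-function $m$ with $m(x_0)=u(x_0)$ and $m\le u$ on $\Omega$; such $m$ is supporting to $u$ at $x_0$. $\partial_cu(x)$ is the set of $\bar x\in\bar\Omega$ for which there is a $c$-function with focus $\bar x$ supporting to $u$ at $x$, and $\partial_cu(A)=\bigcup_{x\in A}\partial_cu(x)$. Convex geometry notation: $T^*_{\bar x}\bar M$ carries the inner product $\bar g_{\bar x}$; lengths and distances $d$ there are taken with respect to it. For a convex subset $\mathcal A$ of an inner product space $V$ and $0\neq v\in V$, $\Pi^v_{\mathcal A}$ is the supporting hyperplane to $\mathcal A$ with outward pointing normal direction $v$; if $\mathcal A$ is closed and convex, $l(\mathcal A,v)$ is the maximum of the lengths of segments contained in $\mathcal A$ parallel to $v$. Under the hypotheses $[S]_{\bar x}$ is convex. *)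

theory Defs
  imports "HOL-Analysis.Analysis"
begin

section \<open>Smooth functions on open subsets of Euclidean space\<close>

definition partial :: "'n::finite \<Rightarrow> (real^'n \<Rightarrow> real) \<Rightarrow> real^'n \<Rightarrow> real" where
  "partial i f y = frechet_derivative f (at y) (axis i 1)"

primrec Ck_on :: "nat \<Rightarrow> (real^'n::finite) set \<Rightarrow> (real^'n \<Rightarrow> real) \<Rightarrow> bool" where
  "Ck_on 0 V f \<longleftrightarrow> continuous_on V f"
| "Ck_on (Suc k) V f \<longleftrightarrow> (\<forall>y\<in>V. f differentiable at y) \<and> (\<forall>i. Ck_on k V (partial i f))"

definition smooth_on :: "(real^'n::finite) set \<Rightarrow> (real^'n \<Rightarrow> real) \<Rightarrow> bool" where
  "smooth_on V f \<longleftrightarrow> (\<forall>k. Ck_on k V f)"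


section \<open>Riemannian manifolds\<close>

text \<open>A manifold is a Hausdorff, second countable topological space (the type \<open>'m\<close>) with a smooth
  atlas of charts \<open>(U, \<phi>)\<close>. One chart of the atlas is chosen around every point \<open>x\<close>; the spaces
  \<open>T\<^sub>x M\<close> and \<open>T\<^sup>*\<^sub>x M\<close> are both \<open>real^'n\<close>, the components being those in the chosen
  chart at \<open>x\<close>. The metric at \<open>x\<close> is its Gram matrix \<open>gram M x\<close> in the chosen chart.\<close>

type_synonym ('m, 'n) chart = "'m set \<times> ('m \<Rightarrow> real^'n)"

record ('m, 'n) rmfd =
  charts :: "('m, 'n::finite) chart set"
  gram :: "'m \<Rightarrow> real^'n^'n"

definition chart_inv :: "('m, 'n::finite) chart \<Rightarrow> real^'n \<Rightarrow> 'm" where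
  "chart_inv \<kappa> = inv_into (fst \<kappa>) (snd \<kappa>)"

definition chart_at :: "('m, 'n::finite) rmfd \<Rightarrow> 'm \<Rightarrow> ('m, 'n) chart" where
  "chart_at M x = (SOME \<kappa>. \<kappa> \<in> charts M \<and> x \<in> fst \<kappa>)"

text \<open>The components of the metric at \<open>x\<close> in an arbitrary chart \<open>\<kappa>\<close> around \<open>x\<close>.\<close>

definition gram_in :: "('m, 'n::finite) rmfd \<Rightarrow> ('m, 'n) chart \<Rightarrow> 'm \<Rightarrow> real^'n^'n" where
  "gram_in M \<kappa> x =
     (let J = jacobian (snd (chart_at M x) \<circ> chart_inv \<kappa>) (at (snd \<kappa> x))
      in transpose J ** gram M x ** J)"

definition riemannian_manifold ::
  "('m::{t2_space,second_countable_topology}, 'n::finite) rmfd \<Rightarrow> bool" where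
  "riemannian_manifold M \<longleftrightarrow>
     (\<Union>\<kappa>\<in>charts M. fst \<kappa>) = UNIV \<and>
     (\<forall>\<kappa>\<in>charts M. open (fst \<kappa>) \<and> open (snd \<kappa> ` fst \<kappa>) \<and>
        homeomorphism (fst \<kappa>) (snd \<kappa> ` fst \<kappa>) (snd \<kappa>) (chart_inv \<kappa>)) \<and>
     (\<forall>\<kappa>\<in>charts M. \<forall>\<kappa>'\<in>charts M. \<forall>i.
        smooth_on (snd \<kappa> ` (fst \<kappa> \<inter> fst \<kappa>')) (\<lambda>y. snd \<kappa>' (chart_inv \<kappa> y) $ i)) \<and>
     (\<forall>x. transpose (gram M x) = gram M x \<and> (\<forall>v. v \<noteq> 0 \<longrightarrow> v \<bullet> (gram M x *v v) > 0)) \<and>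
     (\<forall>\<kappa>\<in>charts M. \<forall>i j.
        smooth_on (snd \<kappa> ` fst \<kappa>) (\<lambda>y. gram_in M \<kappa> (chart_inv \<kappa> y) $ i $ j))"

text \<open>Riemannian volume: the Borel measure that is \<open>sqrt (det g) dy\<close> in every chart, completed.\<close>

definition riem_vol ::
  "('m::{t2_space,second_countable_topology}, 'n::finite) rmfd \<Rightarrow> 'm measure" where
  "riem_vol M = completion (THE \<mu>. sets \<mu> = sets borel \<and>
     (\<forall>\<kappa>\<in>charts M. \<forall>B\<in>sets borel. B \<subseteq> fst \<kappa> \<longrightarrow>
        emeasure \<mu> B = (\<integral>\<^sup>+ y. ennreal (sqrt (det (gram_in M \<kappa> (chart_inv \<kappa> y))))
                            * indicator (snd \<kappa> ` B) y \<partial>lborel)))"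

text \<open>Christoffel symbols of the Levi-Civita connection in the chart \<open>\<kappa>\<close> at the coordinate \<open>y\<close>.\<close>

definition christoffel ::
  "('m, 'n::finite) rmfd \<Rightarrow> ('m, 'n) chart \<Rightarrow> real^'n \<Rightarrow> 'n \<Rightarrow> 'n \<Rightarrow> 'n \<Rightarrow> real" where
  "christoffel M \<kappa> y l i j =
     (let G = (\<lambda>y. gram_in M \<kappa> (chart_inv \<kappa> y))
      in 1/2 * (\<Sum>m\<in>UNIV. matrix_inv (G y) $ l $ m *
           (partial i (\<lambda>y. G y $ j $ m) y + partial j (\<lambda>y. G y $ i $ m) y
            - partial m (\<lambda>y. G y $ i $ j) y)))"

text \<open>A bounded domain with compact closure. Boundedness for the Riemannian distance is not listed
  because it holds for every connected set with compact closure.\<close>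

definition bounded_domain :: "'m::topological_space set \<Rightarrow> bool" where
  "bounded_domain \<Omega> \<longleftrightarrow> open \<Omega> \<and> connected \<Omega> \<and> \<Omega> \<noteq> {} \<and> compact (closure \<Omega>)"

definition compactly_contained :: "'m::topological_space set \<Rightarrow> 'm set \<Rightarrow> bool" where
  "compactly_contained A B \<longleftrightarrow> compact (closure A) \<and> closure A \<subseteq> interior B"


section \<open>Convex geometry in \<open>real^'n\<close> with the inner product given by a Gram matrix \<open>H\<close>\<close>

definition ip :: "real^'n::finite^'n \<Rightarrow> real^'n \<Rightarrow> real^'n \<Rightarrow> real" where
  "ip H p q = p \<bullet> (H *v q)"

definition nrm :: "real^'n::finite^'n \<Rightarrow> real^'n \<Rightarrow> real" where
  "nrm H p = sqrt (ip H p p)"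

definition opnorm ::
  "real^'n::finite^'n \<Rightarrow> real^'n^'n \<Rightarrow> real^'n^'n \<Rightarrow> real" where
  "opnorm H H' A = Sup {nrm H' (A *v p) | p. nrm H p \<le> 1}"

definition set_distance ::
  "real^'n::finite^'n \<Rightarrow> (real^'n) set \<Rightarrow> (real^'n) set \<Rightarrow> real" where
  "set_distance H P Q = Inf {nrm H (p - q) | p q. p \<in> P \<and> q \<in> Q}"

definition supporting_hyperplane ::
  "real^'n::finite^'n \<Rightarrow> (real^'n) set \<Rightarrow> real^'n \<Rightarrow> (real^'n) set" where
  "supporting_hyperplane H K v = {p. ip H p v = (SUP q\<in>K. ip H q v)}"

definition max_segment ::
  "real^'n::finite^'n \<Rightarrow> (real^'n) set \<Rightarrow> real^'n \<Rightarrow> real" where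
  "max_segment H K v =
     Sup {nrm H (q - p) | p q. closed_segment p q \<subseteq> K \<and> (\<exists>t. q - p = t *\<^sub>R v)}"

text \<open>The Gram matrix of the inner product on \<open>T\<^sup>*\<^sub>x M\<close>.\<close>

definition cogram :: "('m, 'n::finite) rmfd \<Rightarrow> 'm \<Rightarrow> real^'n^'n" where
  "cogram M x = matrix_inv (gram M x)"


section \<open>Derivatives of the cost\<close>

text \<open>The definitions below are not symmetric in the two variables of \<open>c\<close>; the version with the
  variables exchanged is obtained by exchanging the manifolds and replacing \<open>c\<close> by \<open>flip c\<close>.\<close>

definition flip :: "('a \<Rightarrow> 'b \<Rightarrow> real) \<Rightarrow> 'b \<Rightarrow> 'a \<Rightarrow> real" where
  "flip c x' x = c x x'"

definition loc :: "('m, 'n::finite) chart \<Rightarrow> ('k, 'n) chart \<Rightarrow> ('m \<Rightarrow> 'k \<Rightarrow> real)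
    \<Rightarrow> real^'n \<Rightarrow> real^'n \<Rightarrow> real" where
  "loc \<kappa> \<kappa>' c y z = c (chart_inv \<kappa> y) (chart_inv \<kappa>' z)"

definition pd1 :: "'n::finite \<Rightarrow> (real^'n \<Rightarrow> real^'n \<Rightarrow> real) \<Rightarrow> real^'n \<Rightarrow> real^'n \<Rightarrow> real" where
  "pd1 i f y z = partial i (\<lambda>y. f y z) y"

definition pd2 :: "'n::finite \<Rightarrow> (real^'n \<Rightarrow> real^'n \<Rightarrow> real) \<Rightarrow> real^'n \<Rightarrow> real^'n \<Rightarrow> real" where
  "pd2 k f y z = partial k (\<lambda>z. f y z) z"

text \<open>The covector \<open>Dc(x, x')\<close>, for \<open>x\<close> in the open domain, and \<open>-Dc(x, x')\<close>.\<close>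

definition Dc :: "('m, 'n::finite) rmfd \<Rightarrow> ('m \<Rightarrow> 'k \<Rightarrow> real) \<Rightarrow> 'm \<Rightarrow> 'k \<Rightarrow> real^'n" where
  "Dc M c x x' = (\<chi> i. partial i (\<lambda>y. c (chart_inv (chart_at M x) y) x') (snd (chart_at M x) x))"

definition mom :: "('m, 'n::finite) rmfd \<Rightarrow> ('m \<Rightarrow> 'k \<Rightarrow> real) \<Rightarrow> 'm \<Rightarrow> 'k \<Rightarrow> real^'n" where
  "mom M c x x' = - Dc M c x x'"

text \<open>Derivatives of \<open>c\<close> are taken on the open set \<open>\<Omega> \<times> \<Omega>'\<close>; as usual, they are said to be
  continuous on the product of the closures if they extend continuously to it.\<close>

definition extends_cont :: "('m::topological_space, 'n::finite) chart
    \<Rightarrow> ('k::topological_space, 'n) chart \<Rightarrow> 'm set \<Rightarrow> 'k set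
    \<Rightarrow> (real^'n \<Rightarrow> real^'n \<Rightarrow> real) \<Rightarrow> bool" where
  "extends_cont \<kappa> \<kappa>' \<Omega> \<Omega>' F \<longleftrightarrow>
     (\<exists>G. continuous_on
            (snd \<kappa> ` (fst \<kappa> \<inter> closure \<Omega>) \<times> snd \<kappa>' ` (fst \<kappa>' \<inter> closure \<Omega>')) G \<and>
          (\<forall>y \<in> snd \<kappa> ` (fst \<kappa> \<inter> \<Omega>). \<forall>z \<in> snd \<kappa>' ` (fst \<kappa>' \<inter> \<Omega>'). G (y, z) = F y z))"

text \<open>The derivatives of order 1 in the second and order at most 2 in the first variable. Only mixed
  third order derivatives are required, so pure second derivatives are not assumed to exist.\<close>

definition C3_half :: "('m::topological_space, 'n::finite) rmfd
    \<Rightarrow> ('k::topological_space, 'n) rmfd \<Rightarrow> 'm set \<Rightarrow> 'k set \<Rightarrow> ('m \<Rightarrow> 'k \<Rightarrow> real) \<Rightarrow> bool" where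
  "C3_half M M' \<Omega> \<Omega>' c \<longleftrightarrow>
     (\<forall>\<kappa>\<in>charts M. \<forall>\<kappa>'\<in>charts M'. \<forall>i j k.
        (\<forall>y \<in> snd \<kappa> ` (fst \<kappa> \<inter> \<Omega>). \<forall>z \<in> snd \<kappa>' ` (fst \<kappa>' \<inter> \<Omega>').
           (\<lambda>z. loc \<kappa> \<kappa>' c y z) differentiable at z \<and>
           (\<lambda>y. pd2 k (loc \<kappa> \<kappa>' c) y z) differentiable at y \<and>
           (\<lambda>y. pd1 j (pd2 k (loc \<kappa> \<kappa>' c)) y z) differentiable at y) \<and>
        extends_cont \<kappa> \<kappa>' \<Omega> \<Omega>' (pd2 k (loc \<kappa> \<kappa>' c)) \<and>
        extends_cont \<kappa> \<kappa>' \<Omega> \<Omega>' (pd1 j (pd2 k (loc \<kappa> \<kappa>' c))) \<and>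
        extends_cont \<kappa> \<kappa>' \<Omega> \<Omega>' (pd1 i (pd1 j (pd2 k (loc \<kappa> \<kappa>' c)))))"

definition C3_cost :: "('m::topological_space, 'n::finite) rmfd
    \<Rightarrow> ('k::topological_space, 'n) rmfd \<Rightarrow> 'm set \<Rightarrow> 'k set \<Rightarrow> ('m \<Rightarrow> 'k \<Rightarrow> real) \<Rightarrow> bool" where
  "C3_cost M M' \<Omega> \<Omega>' c \<longleftrightarrow>
     continuous_on (closure \<Omega> \<times> closure \<Omega>') (\<lambda>(x, x'). c x x') \<and>
     C3_half M M' \<Omega> \<Omega>' c \<and> C3_half M' M \<Omega>' \<Omega> (flip c)"

text \<open>For \<open>(x, x')\<close> in the product of the closures, \<open>DDbar M M' \<Omega> \<Omega>' c x x'\<close> is the matrix of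
  the linear map \<open>T\<^sub>x M \<rightarrow> T\<^sup>*\<^bsub>x'\<^esub> M'\<close> obtained by differentiating in \<open>x\<close> the differential of
  \<open>c\<close> in \<open>x'\<close>. The limit is the value of the continuous extension.\<close>

definition DDbar :: "('m, 'n::finite) rmfd \<Rightarrow> ('k, 'n) rmfd \<Rightarrow> 'm set \<Rightarrow> 'k set
    \<Rightarrow> ('m \<Rightarrow> 'k \<Rightarrow> real) \<Rightarrow> 'm \<Rightarrow> 'k \<Rightarrow> real^'n^'n" where
  "DDbar M M' \<Omega> \<Omega>' c x x' =
     (let \<kappa> = chart_at M x; \<kappa>' = chart_at M' x'
      in \<chi> k i. Lim (at (snd \<kappa> x, snd \<kappa>' x') within
                     snd \<kappa> ` (fst \<kappa> \<inter> \<Omega>) \<times> snd \<kappa>' ` (fst \<kappa>' \<inter> \<Omega>'))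
                   (\<lambda>(y, z). pd1 i (pd2 k (loc \<kappa> \<kappa>' c)) y z))"

text \<open>The covariant Hessian in the first variable of the differential in the second one, as a
  trilinear form on \<open>T\<^sub>x M \<times> T\<^sub>x M \<times> T\<^bsub>x'\<^esub> M'\<close>.\<close>

definition D2Dbar :: "('m, 'n::finite) rmfd \<Rightarrow> ('k, 'n) rmfd
    \<Rightarrow> ('m \<Rightarrow> 'k \<Rightarrow> real) \<Rightarrow> 'm \<Rightarrow> 'k \<Rightarrow> real^'n \<Rightarrow> real^'n \<Rightarrow> real^'n \<Rightarrow> real" where
  "D2Dbar M M' c x x' v w v' =
     (let \<kappa> = chart_at M x; \<kappa>' = chart_at M' x'; f = loc \<kappa> \<kappa>' c; y = snd \<kappa> x; z = snd \<kappa>' x'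
      in \<Sum>i\<in>UNIV. \<Sum>j\<in>UNIV. \<Sum>k\<in>UNIV.
           (pd1 i (pd1 j (pd2 k f)) y z
            - (\<Sum>l\<in>UNIV. christoffel M \<kappa> y l i j * pd1 l (pd2 k f) y z)) * v $ i * w $ j * v' $ k)"

definition C3_half_norm :: "('m, 'n::finite) rmfd \<Rightarrow> ('k, 'n) rmfd
    \<Rightarrow> 'm set \<Rightarrow> 'k set \<Rightarrow> ('m \<Rightarrow> 'k \<Rightarrow> real) \<Rightarrow> real" where
  "C3_half_norm M M' \<Omega> \<Omega>' c =
     (SUP (x, x') \<in> \<Omega> \<times> \<Omega>'. nrm (cogram M' x') (Dc M' (flip c) x' x)) +
     (SUP (x, x') \<in> \<Omega> \<times> \<Omega>'. opnorm (gram M x) (cogram M' x') (DDbar M M' \<Omega> \<Omega>' c x x')) +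
     (SUP (x, x') \<in> \<Omega> \<times> \<Omega>'. Sup {\<bar>D2Dbar M M' c x x' v w v'\<bar> | v w v'.
        nrm (gram M x) v \<le> 1 \<and> nrm (gram M x) w \<le> 1 \<and> nrm (gram M' x') v' \<le> 1})"

text \<open>By continuity the suprema over the open set equal those over the product of the closures.\<close>

definition C3_norm :: "('m, 'n::finite) rmfd \<Rightarrow> ('k, 'n) rmfd
    \<Rightarrow> 'm set \<Rightarrow> 'k set \<Rightarrow> ('m \<Rightarrow> 'k \<Rightarrow> real) \<Rightarrow> real" where
  "C3_norm M M' \<Omega> \<Omega>' c =
     (SUP (x, x') \<in> \<Omega> \<times> \<Omega>'. \<bar>c x x'\<bar>) +
     C3_half_norm M M' \<Omega> \<Omega>' c + C3_half_norm M' M \<Omega>' \<Omega> (flip c)"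

text \<open>The matrix of \<open>-D'Dc(x, x') : T\<^bsub>x'\<^esub> M' \<rightarrow> T\<^sup>*\<^sub>x M\<close>, where \<open>D'\<close> is the differential in
  the second variable, and of its inverse.\<close>

definition mDbarD :: "('m, 'n::finite) rmfd \<Rightarrow> ('k, 'n) rmfd \<Rightarrow> 'm set \<Rightarrow> 'k set
    \<Rightarrow> ('m \<Rightarrow> 'k \<Rightarrow> real) \<Rightarrow> 'm \<Rightarrow> 'k \<Rightarrow> real^'n^'n" where
  "mDbarD M M' \<Omega> \<Omega>' c x x' = - DDbar M' M \<Omega>' \<Omega> (flip c) x' x"

definition Minv :: "('m, 'n::finite) rmfd \<Rightarrow> ('k, 'n) rmfd \<Rightarrow> 'm set \<Rightarrow> 'k set
    \<Rightarrow> ('m \<Rightarrow> 'k \<Rightarrow> real) \<Rightarrow> 'm \<Rightarrow> 'k \<Rightarrow> real^'n^'n" where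
  "Minv M M' \<Omega> \<Omega>' c x x' = matrix_inv (mDbarD M M' \<Omega> \<Omega>' c x x')"

text \<open>The absolute value of the determinant of \<open>Minv\<close> with respect to orthonormal bases of
  \<open>T\<^sup>*\<^sub>x M\<close> and \<open>T\<^bsub>x'\<^esub> M'\<close>.\<close>

definition abs_det_Minv :: "('m, 'n::finite) rmfd \<Rightarrow> ('k, 'n) rmfd \<Rightarrow> 'm set \<Rightarrow> 'k set
    \<Rightarrow> ('m \<Rightarrow> 'k \<Rightarrow> real) \<Rightarrow> 'm \<Rightarrow> 'k \<Rightarrow> real" where
  "abs_det_Minv M M' \<Omega> \<Omega>' c x x' =
     \<bar>det (Minv M M' \<Omega> \<Omega>' c x x')\<bar> * sqrt (det (gram M x)) * sqrt (det (gram M' x'))"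

definition sup_det :: "('m::topological_space, 'n::finite) rmfd
    \<Rightarrow> ('k::topological_space, 'n) rmfd \<Rightarrow> 'm set \<Rightarrow> 'k set \<Rightarrow> ('m \<Rightarrow> 'k \<Rightarrow> real) \<Rightarrow> real" where
  "sup_det M M' \<Omega> \<Omega>' c =
     (SUP (x, x') \<in> closure \<Omega> \<times> closure \<Omega>'. abs_det_Minv M M' \<Omega> \<Omega>' c x x')"

definition sup_inv_det :: "('m::topological_space, 'n::finite) rmfd
    \<Rightarrow> ('k::topological_space, 'n) rmfd \<Rightarrow> 'm set \<Rightarrow> 'k set \<Rightarrow> ('m \<Rightarrow> 'k \<Rightarrow> real) \<Rightarrow> real" where
  "sup_inv_det M M' \<Omega> \<Omega>' c =
     (SUP (x, x') \<in> closure \<Omega> \<times> closure \<Omega>'. inverse (abs_det_Minv M M' \<Omega> \<Omega>' c x x'))"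

definition sup_norm :: "('m::topological_space, 'n::finite) rmfd
    \<Rightarrow> ('k::topological_space, 'n) rmfd \<Rightarrow> 'm set \<Rightarrow> 'k set \<Rightarrow> ('m \<Rightarrow> 'k \<Rightarrow> real) \<Rightarrow> real" where
  "sup_norm M M' \<Omega> \<Omega>' c =
     (SUP (x, x') \<in> closure \<Omega> \<times> closure \<Omega>'.
        opnorm (cogram M x) (gram M' x') (Minv M M' \<Omega> \<Omega>' c x x'))"

definition sup_inv_norm :: "('m::topological_space, 'n::finite) rmfd
    \<Rightarrow> ('k::topological_space, 'n) rmfd \<Rightarrow> 'm set \<Rightarrow> 'k set \<Rightarrow> ('m \<Rightarrow> 'k \<Rightarrow> real) \<Rightarrow> real" where
  "sup_inv_norm M M' \<Omega> \<Omega>' c =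
     (SUP (x, x') \<in> closure \<Omega> \<times> closure \<Omega>'.
        opnorm (gram M' x') (cogram M x) (mDbarD M M' \<Omega> \<Omega>' c x x'))"


section \<open>Conditions on the cost and the domains\<close>

definition twist :: "('m, 'n::finite) rmfd \<Rightarrow> ('k, 'n) rmfd \<Rightarrow> 'm set \<Rightarrow> 'k set
    \<Rightarrow> ('m \<Rightarrow> 'k \<Rightarrow> real) \<Rightarrow> bool" where
  "twist M M' \<Omega> \<Omega>' c \<longleftrightarrow>
     (\<forall>x\<in>\<Omega>. inj_on (mom M c x) \<Omega>') \<and> (\<forall>x'\<in>\<Omega>'. inj_on (mom M' (flip c) x') \<Omega>)"

definition nondeg :: "('m::topological_space, 'n::finite) rmfd
    \<Rightarrow> ('k::topological_space, 'n) rmfd \<Rightarrow> 'm set \<Rightarrow> 'k set \<Rightarrow> ('m \<Rightarrow> 'k \<Rightarrow> real) \<Rightarrow> bool" where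
  "nondeg M M' \<Omega> \<Omega>' c \<longleftrightarrow>
     (\<forall>x\<in>closure \<Omega>. \<forall>x'\<in>closure \<Omega>'.
        invertible (mDbarD M M' \<Omega> \<Omega>' c x x') \<and> invertible (mDbarD M' M \<Omega>' \<Omega> (flip c) x' x))"

text \<open>\<open>cexp M \<Omega>' c x p\<close> is meaningful for \<open>x \<in> \<Omega>\<close> and \<open>p \<in> mom M c x ` \<Omega>'\<close>.\<close>

definition cexp :: "('m, 'n::finite) rmfd \<Rightarrow> 'k set \<Rightarrow> ('m \<Rightarrow> 'k \<Rightarrow> real) \<Rightarrow> 'm \<Rightarrow> real^'n \<Rightarrow> 'k" where
  "cexp M \<Omega>' c x p = the_inv_into \<Omega>' (mom M c x) p"

definition cseg :: "('m, 'n::finite) rmfd \<Rightarrow> 'k set \<Rightarrow> ('m \<Rightarrow> 'k \<Rightarrow> real)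
    \<Rightarrow> 'm \<Rightarrow> 'k \<Rightarrow> 'k \<Rightarrow> real \<Rightarrow> 'k" where
  "cseg M \<Omega>' c x x0' x1' t =
     cexp M \<Omega>' c x ((1 - t) *\<^sub>R mom M c x x0' + t *\<^sub>R mom M c x x1')"

text \<open>\<open>A \<subseteq> \<Omega>'\<close> is \<open>c\<close>-convex with respect to the points of \<open>X \<subseteq> \<Omega>\<close>. The first
  conjunct says that the \<open>c\<close>-segment is defined at \<open>t\<close>.\<close>

definition c_convex_wrt :: "('m, 'n::finite) rmfd \<Rightarrow> 'k set \<Rightarrow> ('m \<Rightarrow> 'k \<Rightarrow> real)
    \<Rightarrow> 'm set \<Rightarrow> 'k set \<Rightarrow> bool" where
  "c_convex_wrt M \<Omega>' c X A \<longleftrightarrow>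
     (\<forall>x\<in>X. \<forall>x0'\<in>A. \<forall>x1'\<in>A. \<forall>t\<in>{0..1}.
        (1 - t) *\<^sub>R mom M c x x0' + t *\<^sub>R mom M c x x1' \<in> mom M c x ` \<Omega>' \<and>
        cseg M \<Omega>' c x x0' x1' t \<in> A)"

text \<open>\<open>X'\<close> stands for the support of the second density.\<close>

definition dom_conv :: "('m::topological_space, 'n::finite) rmfd
    \<Rightarrow> ('k::topological_space, 'n) rmfd \<Rightarrow> 'm set \<Rightarrow> 'k set \<Rightarrow> 'k set \<Rightarrow> ('m \<Rightarrow> 'k \<Rightarrow> real)
    \<Rightarrow> bool" where
  "dom_conv M M' \<Omega> \<Omega>' X' c \<longleftrightarrow>
     c_convex_wrt M \<Omega>' c \<Omega> \<Omega>' \<and> c_convex_wrt M' \<Omega> (flip c) \<Omega>' \<Omega> \<and>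
     c_convex_wrt M \<Omega>' c \<Omega> X' \<and> compactly_contained X' \<Omega>'"

definition qqconv :: "('m, 'n::finite) rmfd \<Rightarrow> ('k, 'n) rmfd \<Rightarrow> 'm set \<Rightarrow> 'k set
    \<Rightarrow> real \<Rightarrow> ('m \<Rightarrow> 'k \<Rightarrow> real) \<Rightarrow> bool" where
  "qqconv M M' \<Omega> \<Omega>' M0 c \<longleftrightarrow>
     (\<forall>x\<in>\<Omega>. \<forall>x0\<in>\<Omega>. \<forall>x1\<in>\<Omega>. \<forall>x'\<in>\<Omega>'. \<forall>x0'\<in>\<Omega>'. \<forall>x1'\<in>\<Omega>'. \<forall>s\<in>{0..1}. \<forall>t\<in>{0..1}.
        (let xt = cseg M \<Omega>' c x0 x0' x1' t
         in - c x xt + c x x0' - (- c x0 xt + c x0 x0')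
            \<le> M0 * t * max 0 (- c x x1' + c x x0' - (- c x0 x1' + c x0 x0'))) \<and>
        (let xs = cseg M' \<Omega> (flip c) x0' x0 x1 s
         in - c xs x' + c x0 x' - (- c xs x0' + c x0 x0')
            \<le> M0 * s * max 0 (- c x1 x' + c x0 x' - (- c x1 x0' + c x0 x0'))))"


section \<open>\<open>c\<close>-convex functions\<close>

definition c_function :: "'m set \<Rightarrow> ('m \<Rightarrow> 'k \<Rightarrow> real) \<Rightarrow> 'k \<Rightarrow> ('m \<Rightarrow> real) \<Rightarrow> bool" where
  "c_function \<Omega> c x' m \<longleftrightarrow> (\<exists>a. \<forall>x\<in>\<Omega>. m x = - c x x' + a)"

definition supporting :: "'m set \<Rightarrow> ('m \<Rightarrow> real) \<Rightarrow> 'm \<Rightarrow> ('m \<Rightarrow> real) \<Rightarrow> bool" where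
  "supporting \<Omega> u x0 m \<longleftrightarrow> m x0 = u x0 \<and> (\<forall>x\<in>\<Omega>. m x \<le> u x)"

definition c_convex_fun :: "'m set \<Rightarrow> 'k set \<Rightarrow> ('m \<Rightarrow> 'k \<Rightarrow> real) \<Rightarrow> ('m \<Rightarrow> real) \<Rightarrow> bool" where
  "c_convex_fun \<Omega> \<Omega>' c u \<longleftrightarrow>
     (\<forall>x0\<in>\<Omega>. \<exists>x'\<in>\<Omega>'. \<exists>m. c_function \<Omega> c x' m \<and> supporting \<Omega> u x0 m)"

definition c_subdiff :: "'m set \<Rightarrow> 'k set \<Rightarrow> ('m \<Rightarrow> 'k \<Rightarrow> real) \<Rightarrow> ('m \<Rightarrow> real)
    \<Rightarrow> 'm set \<Rightarrow> 'k set" where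
  "c_subdiff \<Omega> \<Omega>' c u A =
     (\<Union>x\<in>A. {x'\<in>\<Omega>'. \<exists>m. c_function \<Omega> c x' m \<and> supporting \<Omega> u x m})"


section \<open>Densities\<close>

definition prob_density ::
  "('m::{t2_space,second_countable_topology}, 'n::finite) rmfd \<Rightarrow> ('m \<Rightarrow> real) \<Rightarrow> bool" where
  "prob_density M \<rho> \<longleftrightarrow> \<rho> \<in> borel_measurable (riem_vol M) \<and> (\<forall>x. 0 \<le> \<rho> x) \<and>
     (\<integral>\<^sup>+ x. ennreal (\<rho> x) \<partial>riem_vol M) = 1"

text \<open>The support of the measure with density \<open>\<rho>\<close>.\<close>

definition spt ::
  "('m::{t2_space,second_countable_topology}, 'n::finite) rmfd \<Rightarrow> ('m \<Rightarrow> real) \<Rightarrow> 'm set" where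
  "spt M \<rho> = {x. \<forall>U. open U \<and> x \<in> U \<longrightarrow>
     0 < emeasure (density (riem_vol M) (\<lambda>x. ennreal (\<rho> x))) U}"

definition ratio_bounds ::
  "('m::{t2_space,second_countable_topology}, 'n::finite) rmfd
    \<Rightarrow> ('k::{t2_space,second_countable_topology}, 'n) rmfd \<Rightarrow> real \<Rightarrow> real
    \<Rightarrow> ('m \<Rightarrow> real) \<Rightarrow> ('k \<Rightarrow> real) \<Rightarrow> bool" where
  "ratio_bounds M M' \<alpha>1 \<alpha>2 \<rho> \<rho>' \<longleftrightarrow>
     (AE (x, x') in riem_vol M \<Otimes>\<^sub>M riem_vol M'.
        x \<in> spt M \<rho> \<longrightarrow> x' \<in> spt M' \<rho>' \<longrightarrow> \<alpha>1 \<le> \<rho> x / \<rho>' x' \<and> \<rho> x / \<rho>' x' \<le> \<alpha>2)"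

end

(*
  This is Aleksandrov's estimate in the coordinates p = -D'c(x, x') on Omega and orthonormal coordinates
  y near x' on the target. Quasiconvexity makes the image K of the section S convex and the sublevel sets of
  y |-> c(p0, y) - c(p, y) convex. For every direction e this gives a c-function supporting K at its extreme
  point p1 in direction e whose focus y satisfies -D_p c(p1, y) + D_p c(p1, x') = t e with
  t >= C h / <e, p1 - p0>, where h = m(x0) - u(x0).
  Its value at x0 is at least m(x0) - h, and a local support is a global one, so the focus lies in the
  c-subdifferential of S. Applied to a frame obtained by a greedy choice of directions adapted to K and
  starting with v, the convex hull (in the coordinates D_p c(p0, .)) of the foci has volume at least
  C h^n l / (d |K|). The remaining factor 1 / width is harmless because K lies in a ball whose radius is
  controlled by the C^3 norm of c.
*)
theory Submission
  imports Defs
begin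

section \<open>Change of variables for a finite index type\<close>

text \<open>A support of u at a point outside S may have its focus anywhere in the target, whereas
  the gradient map is close to the identity only near x'. The focus is therefore pulled towards x'
  along its own c-segment in steps of relative length 1 / (2 M0): by (QQConv) each step keeps at
  least half of the depth at x0, so a universal number k of steps costs a factor 2^k. That the focus
  lies exactly in direction e comes from separation: the admissible foci at an extreme point form a
  compact convex set in gradient coordinates, and approaching the point from outside along any \<xi>
  with \<xi> . e > 0 yields a focus on the side of \<xi>; a ray of e missing the set would
  contradict this. A focus that is too deep is moved back by the intermediate value theorem. The
  constant has to be fixed before c. Beyond n and M0, the patch radius \<rho>, the closeness
  \<epsilon> and k are chosen from the C^3 norm, the bound on the inverse mixed derivative and
  compactness of the closure of X'. As only mixed derivatives of c are assumed, a derivative in one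
  variable is paired with a fixed tangent vector and then differentiated covariantly in the
  other.\<close>

typedef ('n::finite) windex = "{..<CARD('n)} :: nat set"
  by (rule exI[of _ 0]) simp

text \<open>The order comes from the representation by natural numbers. Together with the
  \<open>wellorder\<close> instance it gives an index type of the same cardinality that satisfies
  the sort constraint of \<open>has_absolute_integral_change_of_variables\<close>.\<close>

instantiation windex :: (finite) linorder
begin
definition "x \<le> y \<longleftrightarrow> Rep_windex x \<le> Rep_windex y"
definition "x < y \<longleftrightarrow> Rep_windex x < Rep_windex y"
instance
  by standard (auto simp: less_eq_windex_def less_windex_def Rep_windex_inject)
end

instance windex :: (finite) finite
proof
  have "Abs_windex ` {..<CARD('a)} = (UNIV :: 'a windex set)"
    by (rule type_definition.Abs_image[OF type_definition_windex])
  then show "finite (UNIV :: 'a windex set)"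
    by (metis finite_imageI finite_lessThan)
qed

instance windex :: (finite) wellorder
proof
  fix P :: "'a windex \<Rightarrow> bool" and a
  assume step: "\<And>x. (\<And>y. y < x \<Longrightarrow> P y) \<Longrightarrow> P x"
  show "P a"
    by (induction a rule: measure_induct_rule[of Rep_windex]) (metis step less_windex_def)
qed

lemma card_windex [simp]: "CARD('n::finite windex) = CARD('n)"
  using type_definition.card[OF type_definition_windex] by simp

definition widx :: "'n::finite windex \<Rightarrow> 'n" where
  "widx = (SOME e. bij e)"

lemma bij_widx: "bij (widx :: 'n::finite windex \<Rightarrow> 'n)"
proof -
  have "\<exists>e. bij (e :: 'n windex \<Rightarrow> 'n)"
    by (rule finite_same_card_bij[OF finite finite]) simp
  then show ?thesis
    unfolding widx_def by (rule someI_ex)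
qed

definition reindex :: "real^'n::finite \<Rightarrow> real^'n windex" where
  "reindex x = (\<chi> j. x $ widx j)"

definition unreindex :: "real^'n::finite windex \<Rightarrow> real^'n" where
  "unreindex x = (\<chi> i. x $ inv widx i)"

lemma inv_widx [simp]: "inv widx (widx j) = j"
  by (rule inv_f_f[OF bij_is_inj[OF bij_widx]])

lemma widx_inv [simp]: "widx (inv widx i) = i"
  by (rule surj_f_inv_f[OF bij_is_surj[OF bij_widx]])

lemma reindex_unreindex [simp]: "reindex (unreindex x) = x"
  by (simp add: reindex_def unreindex_def vec_eq_iff)

lemma unreindex_reindex [simp]: "unreindex (reindex x) = x"
  by (simp add: reindex_def unreindex_def vec_eq_iff)

lemma bounded_linear_reindex: "bounded_linear reindex"
  by (intro linear_conv_bounded_linear[THEN iffD1] linearI) (simp_all add: reindex_def vec_eq_iff)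

lemma bounded_linear_unreindex: "bounded_linear unreindex"
  by (intro linear_conv_bounded_linear[THEN iffD1] linearI) (simp_all add: unreindex_def vec_eq_iff)

lemma reindex_measurable [measurable]: "reindex \<in> borel_measurable borel"
  by (intro borel_measurable_continuous_onI linear_continuous_on bounded_linear_reindex)

lemma unreindex_measurable [measurable]: "unreindex \<in> borel_measurable borel"
  by (intro borel_measurable_continuous_onI linear_continuous_on bounded_linear_unreindex)

lemma prod_Basis_cart:
  fixes f :: "real^'n::finite \<Rightarrow> real"
  shows "(\<Prod>b\<in>Basis. f b) = (\<Prod>i\<in>UNIV. f (axis i 1))"
proof -
  have B: "(Basis :: (real^'n) set) = range (\<lambda>i. axis i 1)"
    by (auto simp: Basis_vec_def)
  have "inj (\<lambda>i::'n. axis i (1::real))"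
    by (auto simp: inj_on_def axis_eq_axis)
  then show ?thesis
    unfolding B by (subst prod.reindex) auto
qed

text \<open>Relabelling coordinates maps boxes to boxes with the same side lengths, and a Borel
  measure with these values on boxes is \<open>lborel\<close>.\<close>

lemma distr_reindex: "distr lborel borel (reindex :: real^'n::finite \<Rightarrow> _) = lborel"
proof (rule sym, rule lborel_eqI)
  fix l u :: "real^'n windex"
  assume le: "\<And>b. b \<in> Basis \<Longrightarrow> l \<bullet> b \<le> u \<bullet> b"
  then have le': "l $ j \<le> u $ j" for j
    by (auto simp: Basis_vec_def cart_eq_inner_axis)
  have eq: "reindex -` box l u = box (unreindex l) (unreindex u)"
  proof (intro set_eqI iffI)
    fix x assume "x \<in> box (unreindex l) (unreindex u)"
    then have "l $ inv widx (widx j) < x $ widx j \<and> x $ widx j < u $ inv widx (widx j)" for j :: "'n windex"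
      by (simp add: mem_box_cart unreindex_def del: inv_widx)
    then show "x \<in> reindex -` box l u"
      by (simp add: mem_box_cart reindex_def)
  next
    fix x assume "x \<in> reindex -` box l u"
    then have "l $ inv widx i < x $ widx (inv widx i) \<and> x $ widx (inv widx i) < u $ inv widx i" for i :: 'n
      by (simp add: mem_box_cart reindex_def del: widx_inv)
    then show "x \<in> box (unreindex l) (unreindex u)"
      by (simp add: mem_box_cart unreindex_def)
  qed
  have "emeasure (distr lborel borel reindex) (box l u) = emeasure lborel (box (unreindex l) (unreindex u))"
    by (simp add: emeasure_distr eq)
  also have "\<dots> = ennreal (\<Prod>b\<in>Basis. (unreindex u - unreindex l) \<bullet> b)"
    by (subst emeasure_lborel_box_eq)
      (auto simp: Basis_vec_def unreindex_def inner_axis le' axis_eq_axis inner_diff_left)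
  also have "(\<Prod>b\<in>Basis. (unreindex u - unreindex l) \<bullet> b) = (\<Prod>i\<in>UNIV. (unreindex u - unreindex l) $ i)"
    by (simp add: prod_Basis_cart inner_axis)
  also have "\<dots> = (\<Prod>j\<in>UNIV. (unreindex u - unreindex l) $ widx j)"
    by (rule prod.reindex_bij_betw[OF bij_widx, symmetric])
  also have "\<dots> = (\<Prod>j\<in>UNIV. (u - l) $ j)"
    by (simp add: unreindex_def)
  also have "\<dots> = (\<Prod>b\<in>Basis. (u - l) \<bullet> b)"
    by (simp add: prod_Basis_cart inner_axis)
  finally show "emeasure (distr lborel borel reindex) (box l u) = (\<Prod>b\<in>Basis. (u - l) \<bullet> b)" .
qed simp

text \<open>Conjugation by e turns each transposition into a transposition, so a product of n of
  them remains one and the parity is unchanged.\<close>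

lemma sign_conj_bij:
  assumes e: "bij (e :: 'a \<Rightarrow> 'b)" and "permutation p"
  shows "sign (e \<circ> p \<circ> inv e) = sign p"
proof -
  have inv: "inv e (e x) = x" "e (inv e y) = y" for x y
    using e by (simp_all add: bij_is_inj bij_is_surj surj_f_inv_f)
  have conj: "swapidseq n (e \<circ> p \<circ> inv e)" if "swapidseq n p" for n p
    using that
  proof induction
    case id
    have "e \<circ> id \<circ> inv e = id"
      by (auto simp: fun_eq_iff inv)
    then show ?case by (simp only: swapidseq.id)
  next
    case (comp_Suc n p a b)
    have "e \<circ> (Transposition.transpose a b \<circ> p) \<circ> inv e = Transposition.transpose (e a) (e b) \<circ> (e \<circ> p \<circ> inv e)"
      using bij_is_inj[OF e] by (auto simp: fun_eq_iff Transposition.transpose_def inj_eq)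
    moreover have "e a \<noteq> e b"
      using comp_Suc bij_is_inj[OF e] by (auto simp: inj_eq)
    ultimately show ?case
      using comp_Suc.IH swapidseq.comp_Suc by metis
  qed
  from assms(2) obtain n where n: "swapidseq n p"
    by (auto simp: permutation_def)
  have "evenperm p = even n" "evenperm (e \<circ> p \<circ> inv e) = even n"
    using evenperm_unique[OF n] evenperm_unique[OF conj[OF n]] by auto
  then show ?thesis
    by (simp add: sign_def)
qed

text \<open>Rows and columns are relabelled simultaneously; conjugation by e is a sign preserving
  bijection between the index sets of the two Leibniz sums.\<close>

lemma det_reindex:
  fixes A :: "real^'n::finite^'n" and e :: "'m::finite \<Rightarrow> 'n"
  assumes e: "bij e"
  shows "det (\<chi> i j. A $ e i $ e j) = det A"
proof -
  have inv: "inv e (e x) = x" "e (inv e y) = y" for x y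
    using e by (simp_all add: bij_is_inj bij_is_surj surj_f_inv_f)
  have bij: "bij_betw (\<lambda>p. e \<circ> p \<circ> inv e) {p. p permutes (UNIV::'m set)} {p. p permutes (UNIV::'n set)}"
  proof (rule bij_betwI[where g = "\<lambda>p. inv e \<circ> p \<circ> e"])
    show "(\<lambda>p. e \<circ> p \<circ> inv e) \<in> {p. p permutes UNIV} \<rightarrow> {p. p permutes UNIV}"
      using e by (auto intro!: bij_imp_permutes bij_comp bij_imp_bij_inv permutes_bij simp del: o_apply)
    show "(\<lambda>p. inv e \<circ> p \<circ> e) \<in> {p. p permutes UNIV} \<rightarrow> {p. p permutes UNIV}"
      using e by (auto intro!: bij_imp_permutes bij_comp bij_imp_bij_inv permutes_bij simp del: o_apply)
  qed (auto simp: fun_eq_iff inv)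
  have "det A = (\<Sum>p | p permutes (UNIV::'m set). of_int (sign (e \<circ> p \<circ> inv e)) * (\<Prod>i\<in>UNIV. A $ i $ (e \<circ> p \<circ> inv e) i))"
    unfolding det_def by (rule sum.reindex_bij_betw[OF bij, symmetric])
  also have "\<dots> = (\<Sum>p | p permutes (UNIV::'m set). of_int (sign p) * (\<Prod>i\<in>UNIV. A $ e i $ e (p i)))"
  proof (rule sum.cong[OF refl])
    fix p :: "'m \<Rightarrow> 'm" assume "p \<in> {p. p permutes UNIV}"
    then have "sign (e \<circ> p \<circ> inv e) = sign p"
      by (intro sign_conj_bij[OF e]) (auto simp: permutation_permutes)
    moreover have "(\<Prod>i\<in>UNIV. A $ i $ (e \<circ> p \<circ> inv e) i) = (\<Prod>i\<in>UNIV. A $ e i $ e (p i))"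
      by (subst prod.reindex_bij_betw[OF e, symmetric]) (simp add: inv)
    ultimately show "of_int (sign (e \<circ> p \<circ> inv e)) * (\<Prod>i\<in>UNIV. A $ i $ (e \<circ> p \<circ> inv e) i) =
        of_int (sign p) * (\<Prod>i\<in>UNIV. A $ e i $ e (p i))" by simp
  qed
  finally show ?thesis
    by (simp add: det_def)
qed

text \<open>If one of the two is infinite, neither can be finite. This lets an equivalence between
  statements on integrals with a finite value settle the infinite case too.\<close>

lemma ennreal_eqI_real:
  assumes "\<And>r. 0 \<le> r \<Longrightarrow> A = ennreal r \<longleftrightarrow> B = ennreal r"
  shows "A = B"
proof (cases A)
  case (real r)
  then show ?thesis using assms[of r] by simp
next
  case top
  show ?thesis
  proof (cases B)
    case (real r)
    then show ?thesis using assms[of r] by simp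
  qed (use top in simp)
qed

text \<open>The gauge integral version is for absolutely integrable functions into
  \<open>real^'m\<close>, so g is regarded as a function into \<open>real^1\<close>. For nonnegative
  measurable functions both kinds of integral have the same finite values.\<close>

lemma nn_integral_change_of_variables_wo:
  fixes f :: "real^'n::{finite,wellorder} \<Rightarrow> real^'n::_" and g :: "real^'n::_ \<Rightarrow> real"
  assumes S: "S \<in> sets borel"
    and der: "\<And>x. x \<in> S \<Longrightarrow> (f has_derivative f' x) (at x within S)"
    and inj: "inj_on f S"
    and g0: "\<And>x. 0 \<le> g x"
    and m1: "(\<lambda>x. indicator (f ` S) x * g x) \<in> borel_measurable borel"
    and m2: "(\<lambda>x. indicator S x * (\<bar>det (matrix (f' x))\<bar> * g (f x))) \<in> borel_measurable borel"
  shows "(\<integral>\<^sup>+x. ennreal (g x) * indicator (f ` S) x \<partial>lborel) =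
    (\<integral>\<^sup>+x. ennreal (\<bar>det (matrix (f' x))\<bar> * g (f x)) * indicator S x \<partial>lborel)"
proof -
  let ?F = "\<lambda>x. indicator (f ` S) x * g x"
  let ?G = "\<lambda>x. indicator S x * (\<bar>det (matrix (f' x))\<bar> * g (f x))"
  have eqF: "(\<integral>\<^sup>+x. ennreal (g x) * indicator (f ` S) x \<partial>lborel) = (\<integral>\<^sup>+x. ennreal (?F x) \<partial>lborel)"
    by (rule nn_integral_cong) (auto simp: indicator_def)
  have eqG: "(\<integral>\<^sup>+x. ennreal (\<bar>det (matrix (f' x))\<bar> * g (f x)) * indicator S x \<partial>lborel) = (\<integral>\<^sup>+x. ennreal (?G x) \<partial>lborel)"
    by (rule nn_integral_cong) (auto simp: indicator_def)
  have nF: "0 \<le> ?F x" and nG: "0 \<le> ?G x" for x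
    using g0 by auto
  let ?v = "\<lambda>x. vec (g x) :: real^1"
  have key: "(?F has_integral r) UNIV \<longleftrightarrow> (?G has_integral r) UNIV" for r
  proof -
    have cv: "(\<lambda>x. \<bar>det (matrix (f' x))\<bar> *\<^sub>R ?v (f x)) absolutely_integrable_on S \<and>
           integral S (\<lambda>x. \<bar>det (matrix (f' x))\<bar> *\<^sub>R ?v (f x)) = vec r
     \<longleftrightarrow> ?v absolutely_integrable_on (f ` S) \<and> integral (f ` S) ?v = vec r"
      using S by (intro has_absolute_integral_change_of_variables[OF _ der inj]) auto
    have e1: "(\<lambda>x. \<bar>det (matrix (f' x))\<bar> *\<^sub>R ?v (f x)) = (\<lambda>x. vec (\<bar>det (matrix (f' x))\<bar> * g (f x)))"
      by (auto simp: vec_eq_iff)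
    \<comment> \<open>For nonnegative components integrability and absolute integrability
      coincide.\<close>
    have vecint: "((\<lambda>x. vec (h x) :: real^1) absolutely_integrable_on T \<and> integral T (\<lambda>x. vec (h x) :: real^1) = vec r)
      \<longleftrightarrow> ((\<lambda>x. indicator T x * h x) has_integral r) UNIV" if h: "\<And>x. 0 \<le> h x"
      for h :: "real^'n::_ \<Rightarrow> real" and T
    proof -
      have 1: "((\<lambda>x. indicator T x * h x) has_integral r) UNIV \<longleftrightarrow> (h has_integral r) T"
        by (subst has_integral_restrict_UNIV[symmetric], rule has_integral_cong) (auto simp: indicator_def)
      have 2: "(\<lambda>x. vec (h x) :: real^1) absolutely_integrable_on T \<longleftrightarrow> (\<lambda>x. vec (h x) :: real^1) integrable_on T"
      proof
        assume "(\<lambda>x. vec (h x) :: real^1) integrable_on T"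
        then show "(\<lambda>x. vec (h x) :: real^1) absolutely_integrable_on T"
          by (rule nonnegative_absolutely_integrable) (auto simp: h Basis_vec_def inner_axis)
      qed (simp add: absolutely_integrable_on_def)
      have 3: "((\<lambda>x. vec (h x) :: real^1) has_integral vec r) T \<longleftrightarrow> (h has_integral r) T"
      proof
        assume "((\<lambda>x. vec (h x) :: real^1) has_integral vec r) T"
        from has_integral_linear[OF this bounded_linear_vec_nth[of 1]]
        show "(h has_integral r) T" by (simp add: o_def)
      next
        assume *: "(h has_integral r) T"
        have "bounded_linear (vec :: real \<Rightarrow> real^1)"
          by (intro linear_conv_bounded_linear[THEN iffD1] linearI) (auto simp: vec_eq_iff)
        from has_integral_linear[OF * this]
        show "((\<lambda>x. vec (h x) :: real^1) has_integral vec r) T"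
          by (auto simp: o_def)
      qed
      show ?thesis
        using 1 2 3 by (auto simp: has_integral_iff)
    qed
    have g1: "\<And>x. 0 \<le> \<bar>det (matrix (f' x))\<bar> * g (f x)"
      using g0 by auto
    show ?thesis
      using cv unfolding e1 vecint[OF g0] vecint[OF g1] by auto
  qed
  have nn: "(\<integral>\<^sup>+x. ennreal (H x) \<partial>lborel) = ennreal r \<longleftrightarrow> (H has_integral r) UNIV"
    if "H \<in> borel_measurable borel" "\<And>x. 0 \<le> H x" "0 \<le> r" for H :: "real^'n::_ \<Rightarrow> real" and r
    using nn_integral_has_integral[of H r] nn_integral_has_integral_lborel[of H r] that by auto
  have "(\<integral>\<^sup>+x. ennreal (?F x) \<partial>lborel) = ennreal r \<longleftrightarrow> (\<integral>\<^sup>+x. ennreal (?G x) \<partial>lborel) = ennreal r" if "0 \<le> r" for r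
    using nn[OF m1 nF that] nn[OF m2 nG that] key by simp
  then have "(\<integral>\<^sup>+x. ennreal (?F x) \<partial>lborel) = (\<integral>\<^sup>+x. ennreal (?G x) \<partial>lborel)"
    by (rule ennreal_eqI_real)
  then show ?thesis
    by (simp add: eqF eqG)
qed

text \<open>Conjugation with \<open>reindex\<close> reduces to the well-ordered case: it preserves
  Lebesgue measure, and the Jacobian determinant is invariant under relabelling rows and columns
  together.\<close>

lemma nn_integral_change_of_variables:
  fixes f :: "real^'n::finite \<Rightarrow> real^'n" and g :: "real^'n \<Rightarrow> real"
  assumes S: "S \<in> sets borel"
    and der: "\<And>x. x \<in> S \<Longrightarrow> (f has_derivative f' x) (at x within S)"
    and inj: "inj_on f S"
    and g0: "\<And>x. 0 \<le> g x"
    and m1: "(\<lambda>x. indicator (f ` S) x * g x) \<in> borel_measurable borel"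
    and m2: "(\<lambda>x. indicator S x * (\<bar>det (matrix (f' x))\<bar> * g (f x))) \<in> borel_measurable borel"
  shows "(\<integral>\<^sup>+x. ennreal (g x) * indicator (f ` S) x \<partial>lborel) =
    (\<integral>\<^sup>+x. ennreal (\<bar>det (matrix (f' x))\<bar> * g (f x)) * indicator S x \<partial>lborel)"
proof -
  let ?R = "reindex :: real^'n \<Rightarrow> real^'n windex" and ?U = "unreindex :: real^'n windex \<Rightarrow> real^'n"
  let ?S = "?U -` S" and ?f = "\<lambda>x. ?R (f (?U x))" and ?f' = "\<lambda>x h. ?R (f' (?U x) (?U h))"
  have img: "?f ` ?S = ?U -` (f ` S)"
  proof (intro set_eqI iffI)
    fix x assume "x \<in> ?U -` (f ` S)"
    then obtain y where "?U x = f y" "y \<in> S" by auto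
    then have "x = ?f (?R y)" "?R y \<in> ?S" by (metis reindex_unreindex unreindex_reindex, simp)
    then show "x \<in> ?f ` ?S" by blast
  qed auto
  have detR: "det (matrix (?f' x)) = det (matrix (f' (?U x)))" for x
  proof -
    have "?U (axis j 1) = axis (widx j) 1" for j
    proof -
      have "(inv widx i = j) = (i = widx j)" for i :: 'n
        by auto
      then show ?thesis
        by (simp add: unreindex_def vec_eq_iff axis_def)
    qed
    then have "matrix (?f' x) = (\<chi> i j. matrix (f' (?U x)) $ widx i $ widx j)"
      unfolding matrix_def by (simp add: reindex_def)
    then show ?thesis
      by (simp add: det_reindex[OF bij_widx])
  qed
  have mU: "?U -` A \<in> sets borel" if "A \<in> sets borel" for A
    using measurable_sets_borel[OF unreindex_measurable that] .
  have *: "(\<integral>\<^sup>+x. ennreal (g (?U x)) * indicator (?f ` ?S) x \<partial>lborel) =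
    (\<integral>\<^sup>+x. ennreal (\<bar>det (matrix (?f' x))\<bar> * g (?U (?f x))) * indicator ?S x \<partial>lborel)"
  proof (rule nn_integral_change_of_variables_wo)
    show "?S \<in> sets borel" using S by (rule mU)
    show "(?f has_derivative ?f' x) (at x within ?S)" if "x \<in> ?S" for x
    proof -
      have 1: "(?U has_derivative ?U) (at x within ?S)"
        by (rule bounded_linear_imp_has_derivative[OF bounded_linear_unreindex])
      have "(f has_derivative f' (?U x)) (at (?U x) within ?U ` ?S)"
        by (rule has_derivative_subset[OF der]) (use that in auto)
      from diff_chain_within[OF 1 this]
      have "(f \<circ> ?U has_derivative f' (?U x) \<circ> ?U) (at x within ?S)" .
      from diff_chain_within[OF this bounded_linear_imp_has_derivative[OF bounded_linear_reindex]]
      show ?thesis by (simp add: o_def)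
    qed
    show "inj_on ?f ?S"
    proof (rule inj_onI)
      fix x y assume "x \<in> ?S" "y \<in> ?S" "?f x = ?f y"
      then have "f (?U x) = f (?U y)" by (metis unreindex_reindex)
      then have "?U x = ?U y" using inj \<open>x \<in> ?S\<close> \<open>y \<in> ?S\<close> by (auto dest: inj_onD)
      then show "x = y" by (metis reindex_unreindex)
    qed
    show "0 \<le> g (?U x)" for x by (rule g0)
    have "(\<lambda>x. indicator (f ` S) (?U x) * g (?U x)) \<in> borel_measurable borel"
      using measurable_compose[OF unreindex_measurable m1] .
    then show "(\<lambda>x. indicator (?f ` ?S) x * g (?U x)) \<in> borel_measurable borel"
      unfolding img by (simp add: indicator_def)
    have "(\<lambda>x. indicator S (?U x) * (\<bar>det (matrix (f' (?U x)))\<bar> * g (f (?U x)))) \<in> borel_measurable borel"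
      using measurable_compose[OF unreindex_measurable m2] .
    also have "(\<lambda>x. indicator S (?U x) * (\<bar>det (matrix (f' (?U x)))\<bar> * g (f (?U x)))) =
       (\<lambda>x. indicator ?S x * (\<bar>det (matrix (?f' x))\<bar> * g (?U (?f x))))"
      by (simp add: indicator_def detR)
    finally show "(\<lambda>x. indicator ?S x * (\<bar>det (matrix (?f' x))\<bar> * g (?U (?f x)))) \<in> borel_measurable borel" .
  qed
  have tr: "(\<integral>\<^sup>+x. H (?U x) \<partial>lborel) = (\<integral>\<^sup>+x. H x \<partial>lborel)" if [measurable]: "H \<in> borel_measurable borel" for H :: "real^'n \<Rightarrow> ennreal"
    by (subst distr_reindex[symmetric], subst nn_integral_distr) auto
  have "(\<integral>\<^sup>+x. ennreal (g x) * indicator (f ` S) x \<partial>lborel) = (\<integral>\<^sup>+x. ennreal (indicator (f ` S) x * g x) \<partial>lborel)"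
    by (rule nn_integral_cong) (auto simp: indicator_def)
  also have "\<dots> = (\<integral>\<^sup>+x. ennreal (indicator (f ` S) (?U x) * g (?U x)) \<partial>lborel)"
    by (rule tr[symmetric]) (use m1 in measurable)
  also have "\<dots> = (\<integral>\<^sup>+x. ennreal (g (?U x)) * indicator (?f ` ?S) x \<partial>lborel)"
    unfolding img by (rule nn_integral_cong) (auto simp: indicator_def)
  also note *
  also have "(\<integral>\<^sup>+x. ennreal (\<bar>det (matrix (?f' x))\<bar> * g (?U (?f x))) * indicator ?S x \<partial>lborel) =
     (\<integral>\<^sup>+x. ennreal (indicator S (?U x) * (\<bar>det (matrix (f' (?U x)))\<bar> * g (f (?U x)))) \<partial>lborel)"
    by (rule nn_integral_cong) (auto simp: indicator_def detR)
  also have "\<dots> = (\<integral>\<^sup>+x. ennreal (indicator S x * (\<bar>det (matrix (f' x))\<bar> * g (f x))) \<partial>lborel)"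
    by (rule tr) (use m2 in measurable)
  also have "\<dots> = (\<integral>\<^sup>+x. ennreal (\<bar>det (matrix (f' x))\<bar> * g (f x)) * indicator S x \<partial>lborel)"
    by (rule nn_integral_cong) (auto simp: indicator_def)
  finally show ?thesis .
qed

section \<open>The estimate in coordinates\<close>

lemma emeasure_affine_image:
  fixes A :: "real^'n::finite^'n"
  assumes "det A \<noteq> 0" "compact S"
  shows "emeasure lborel ((\<lambda>x. a + A *v x) ` S) = ennreal \<bar>det A\<bar> * emeasure lborel S"
proof -
  let ?f = "\<lambda>x. a + A *v x"
  have lin: "bounded_linear ((*v) A)"
    by (simp add: matrix_vector_mul_bounded_linear)
  have der: "(?f has_derivative (*v) A) (at x within S)" for x
    by (auto intro!: derivative_eq_intros bounded_linear_imp_has_derivative[OF lin])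
  have inj: "inj_on ?f S"
  proof (rule inj_onI)
    fix x y assume "?f x = ?f y"
    then have "A *v x = A *v y" by simp
    then show "x = y"
      using assms(1) by (metis invertible_det_nz inj_matrix_vector_mult injD)
  qed
  have cfS: "compact (?f ` S)"
    by (intro compact_continuous_image continuous_intros linear_continuous_on lin assms)
  have [measurable]: "S \<in> sets borel" "?f ` S \<in> sets borel"
    using assms cfS by (auto intro: borel_compact)
  have "(\<integral>\<^sup>+x. ennreal 1 * indicator (?f ` S) x \<partial>lborel) =
    (\<integral>\<^sup>+x. ennreal (\<bar>det (matrix ((*v) A))\<bar> * 1) * indicator S x \<partial>lborel)"
    by (rule nn_integral_change_of_variables[OF _ der inj]) auto
  then show ?thesis
    by (simp add: nn_integral_cmult_indicator)
qed

text \<open>The image of t is the average of the n points a + n t_i b_i, each on the segment from a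
  to a + b_i because n t_i \<le> 1; hence the side 1 / n of the cube.\<close>

lemma convex_contains_parallelepiped:
  fixes b :: "'n::finite \<Rightarrow> real^'n"
  assumes K: "convex K" and a: "a \<in> K" and b: "\<And>i. a + b i \<in> K"
  shows "(\<lambda>t. a + transpose (\<chi> i. b i) *v t) ` cbox 0 (vec (1 / CARD('n))) \<subseteq> K"
proof clarify
  fix t :: "real^'n" assume "t \<in> cbox 0 (vec (1 / CARD('n)))"
  then have t: "0 \<le> t $ i" "t $ i \<le> 1 / CARD('n)" for i
    by (auto simp: mem_box_cart)
  let ?n = "real CARD('n)"
  have n: "?n > 0" by simp
  have pt: "a + (?n * t $ i) *\<^sub>R b i \<in> K" for i
  proof -
    have "(1 - ?n * t $ i) *\<^sub>R a + (?n * t $ i) *\<^sub>R (a + b i) \<in> K"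
      using t[of i] n by (intro convexD[OF K a b]) (auto simp: field_simps)
    then show ?thesis by (simp add: algebra_simps)
  qed
  have "(\<Sum>i\<in>UNIV. (1 / ?n) *\<^sub>R (a + (?n * t $ i) *\<^sub>R b i)) \<in> K"
    by (rule convex_sum[OF _ K]) (use pt in auto)
  also have "(\<Sum>i\<in>UNIV. (1 / ?n) *\<^sub>R (a + (?n * t $ i) *\<^sub>R b i)) = a + (\<Sum>i\<in>UNIV. t $ i *\<^sub>R b i)"
  proof -
    have "(\<Sum>i\<in>(UNIV::'n set). (1 / ?n) *\<^sub>R a) = a"
      by (simp only: sum_constant_scaleR) simp
    then show ?thesis
      by (simp add: scaleR_add_right sum.distrib)
  qed
  also have "(\<Sum>i\<in>UNIV. t $ i *\<^sub>R b i) = transpose (\<chi> i. b i) *v t"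
    by (simp add: vec_eq_iff matrix_vector_mult_def transpose_def sum_component mult.commute)
  finally show "a + transpose (\<chi> i. b i) *v t \<in> K" .
qed

lemma emeasure_cube: "emeasure lborel (cbox 0 (vec r :: real^'n::finite)) = ennreal (r ^ CARD('n))" if "r \<ge> 0"
proof -
  have "\<forall>b\<in>Basis. (0 :: real^'n) \<bullet> b \<le> vec r \<bullet> b"
    using that by (auto simp: Basis_vec_def inner_axis)
  then show ?thesis
    by (subst emeasure_lborel_cbox_eq) (simp add: prod_Basis_cart inner_axis)
qed

lemma emeasure_parallelepiped:
  fixes b :: "'n::finite \<Rightarrow> real^'n"
  assumes "det (\<chi> i. b i) \<noteq> 0"
  shows "emeasure lborel ((\<lambda>t. a + transpose (\<chi> i. b i) *v t) ` cbox 0 (vec (1 / CARD('n)))) =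
    ennreal (\<bar>det (\<chi> i. b i)\<bar> / CARD('n) ^ CARD('n))"
proof -
  have "emeasure lborel ((\<lambda>t. a + transpose (\<chi> i. b i) *v t) ` cbox 0 (vec (1 / CARD('n)))) =
     ennreal \<bar>det (\<chi> i. b i)\<bar> * ennreal ((1 / CARD('n)) ^ CARD('n))"
    using assms by (subst emeasure_affine_image) (auto simp: det_transpose emeasure_cube compact_cbox)
  then show ?thesis
    by (simp add: ennreal_mult'[symmetric] power_divide)
qed

text \<open>State of a Gram-Schmidt process inside K. Each edge b_i equals h_i e_i modulo the span
  of the earlier directions; this is recorded only through determinants with arbitrary remaining
  rows c, a form that is stable under adding a row. The width bound leaves out i0, whose direction
  is prescribed and not chosen by maximality.\<close>

definition frame_inv :: "(real^'n::finite) set \<Rightarrow> real^'n \<Rightarrow> 'n set \<Rightarrow> 'n \<Rightarrow>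
    ('n \<Rightarrow> real^'n) \<Rightarrow> ('n \<Rightarrow> real^'n) \<Rightarrow> ('n \<Rightarrow> real) \<Rightarrow> bool" where
  "frame_inv K a I i0 e b h \<longleftrightarrow>
     (\<forall>i\<in>I. \<forall>j\<in>I. e i \<bullet> e j = (if i = j then 1 else 0)) \<and>
     (\<forall>i\<in>I. a + b i \<in> K \<and> 0 < h i) \<and>
     (\<forall>i\<in>I - {i0}. \<forall>p\<in>K. \<bar>e i \<bullet> (p - a)\<bar> \<le> h i) \<and>
     (\<forall>c. det (\<chi> i. if i \<in> I then b i else c i) =
        (\<Prod>i\<in>I. h i) * det (\<chi> i. if i \<in> I then e i else c i))"

text \<open>The new edge runs from a to the point of K farthest from the affine span of a and the
  directions found so far; maximality of its distance H gives the width bound in the new direction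
  u.\<close>

lemma frame_inv_step:
  fixes K :: "(real^'n::finite) set"
  assumes K: "compact K" "interior K \<noteq> {}" and a: "a \<in> K"
    and inv: "frame_inv K a I i0 e b h" and fin: "finite I" and jI: "j \<notin> I" and iI: "i0 \<in> I"
  shows "\<exists>u q H. frame_inv K a (insert j I) i0 (e(j := u)) (b(j := q)) (h(j := H))"
proof -
  have on: "\<And>i k. i \<in> I \<Longrightarrow> k \<in> I \<Longrightarrow> e i \<bullet> e k = (if i = k then 1 else 0)" and
    bK: "\<And>i. i \<in> I \<Longrightarrow> a + b i \<in> K \<and> 0 < h i" and
    wd: "\<And>i p. i \<in> I - {i0} \<Longrightarrow> p \<in> K \<Longrightarrow> \<bar>e i \<bullet> (p - a)\<bar> \<le> h i" and
    dt: "\<And>c. det (\<chi> i. if i \<in> I then b i else c i) =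
        (\<Prod>i\<in>I. h i) * det (\<chi> i. if i \<in> I then e i else c i)"
    using inv unfolding frame_inv_def by blast+
  define r where "r x = x - (\<Sum>i\<in>I. (e i \<bullet> x) *\<^sub>R e i)" for x
  have r_orth: "e k \<bullet> r x = 0" if "k \<in> I" for k x
  proof -
    have "e k \<bullet> (\<Sum>i\<in>I. (e i \<bullet> x) *\<^sub>R e i) = (\<Sum>i\<in>I. (e i \<bullet> x) * (e k \<bullet> e i))"
      by (simp add: inner_sum_right)
    also have "\<dots> = (\<Sum>i\<in>I. if k = i then e i \<bullet> x else 0)"
      by (rule sum.cong) (use on that in auto)
    also have "\<dots> = e k \<bullet> x"
      using fin that by simp
    finally show ?thesis by (simp add: r_def inner_diff_right)
  qed
  have r_span: "x - r x \<in> span (e ` I)" for x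
  proof -
    have "(\<Sum>i\<in>I. (e i \<bullet> x) *\<^sub>R e i) \<in> span (e ` I)"
      by (intro span_sum span_scale span_base imageI)
    then show ?thesis by (simp add: r_def)
  qed
  have contr: "continuous_on K (\<lambda>p. norm (r (p - a)))"
    unfolding r_def by (intro continuous_intros)
  obtain q where q: "q \<in> K" and qmax: "\<And>p. p \<in> K \<Longrightarrow> norm (r (p - a)) \<le> norm (r (q - a))"
    using continuous_attains_sup[OF K(1) _ contr] a by auto
  define H where "H = norm (r (q - a))"
  \<comment> \<open>Otherwise K would lie in a translate of a proper subspace, against its nonempty
    interior.\<close>
  have "H > 0"
  proof (rule ccontr)
    assume "\<not> H > 0"
    then have r0: "r (p - a) = 0" if "p \<in> K" for p
      using qmax[OF that] by (simp add: H_def)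
    have "card (e ` I) < CARD('n)"
    proof -
      have "card (e ` I) \<le> card I" by (rule card_image_le[OF fin])
      also have "\<dots> < card (insert j I)" using fin jI by simp
      also have "\<dots> \<le> CARD('n)" by (rule card_mono) auto
      finally show ?thesis .
    qed
    then have "dim (span (e ` I)) < DIM(real^'n)"
      using dim_le_card[of "e ` I" "e ` I"] fin by (simp add: span_superset)
    then have "span (e ` I) \<noteq> UNIV"
      by (metis dim_UNIV less_irrefl)
    moreover have "span (e ` I) \<subseteq> UNIV" by simp
    ultimately have "span (e ` I) \<subset> UNIV" by blast
    then obtain w where w: "w \<noteq> 0" "\<And>x. x \<in> span (e ` I) \<Longrightarrow> orthogonal w x"
      using orthogonal_to_subspace_exists_gen[of "e ` I" UNIV] by (auto simp: span_UNIV)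
    obtain z where z: "z \<in> interior K" using K(2) by auto
    then obtain d where d: "d > 0" "cball z d \<subseteq> K"
      by (meson mem_interior_cball)
    have zK: "z \<in> K" using d by auto
    have zw: "z + (d / norm w) *\<^sub>R w \<in> K"
      using d w(1) by (intro subsetD[OF d(2)]) (auto simp: dist_norm)
    have inK: "w \<bullet> (p - a) = 0" if "p \<in> K" for p
    proof -
      have "p - a \<in> span (e ` I)" using r_span[of "p - a"] r0[OF that] by simp
      from w(2)[OF this] show ?thesis by (simp add: orthogonal_def)
    qed
    have "w \<bullet> ((d / norm w) *\<^sub>R w) = 0"
      using inK[OF zw] inK[OF zK] by (simp add: inner_diff_right inner_add_right)
    then show False using w(1) d(1) by simp
  qed
  define u where "u = (1 / H) *\<^sub>R r (q - a)"
  have u1: "u \<bullet> u = 1"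
    using \<open>H > 0\<close> by (simp add: u_def H_def dot_square_norm power2_eq_square)
  have ru: "r (q - a) = H *\<^sub>R u" using \<open>H > 0\<close> by (simp add: u_def)
  have uo: "e k \<bullet> u = 0" "u \<bullet> e k = 0" if "k \<in> I" for k
    using r_orth[OF that] by (auto simp: u_def inner_commute)
  define e' b' h' where "e' = e(j := u)" and "b' = b(j := q - a)" and "h' = h(j := H)"
  have ne: "i \<noteq> j" if "i \<in> I" for i using jI that by auto
  have on': "e' i \<bullet> e' k = (if i = k then 1 else 0)" if "i \<in> insert j I" "k \<in> insert j I" for i k
    using that on uo u1 by (auto simp: e'_def)
  have wd': "\<bar>e' i \<bullet> (p - a)\<bar> \<le> h' i" if "i \<in> insert j I - {i0}" "p \<in> K" for i p
  proof (cases "i = j")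
    case True
    have "u \<bullet> (x - r x) = 0" for x
    proof -
      have "orthogonal u y" if "y \<in> span (e ` I)" for y
        by (rule orthogonal_to_span[OF that]) (use uo in \<open>auto simp: orthogonal_def\<close>)
      then show ?thesis using r_span by (auto simp: orthogonal_def)
    qed
    then have "u \<bullet> (p - a) = u \<bullet> r (p - a)" by (simp add: inner_diff_right)
    moreover have "norm u = 1" using u1 by (simp add: norm_eq_1)
    ultimately have "\<bar>u \<bullet> (p - a)\<bar> \<le> norm (r (p - a))"
      using Cauchy_Schwarz_ineq2[of u "r (p - a)"] by simp
    then show ?thesis using qmax[OF that(2)] True by (simp add: e'_def h'_def H_def)
  next
    case False
    then show ?thesis using wd that by (simp add: e'_def h'_def)
  qed
  have dt': "det (\<chi> i. if i \<in> insert j I then b' i else c i) =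
        (\<Prod>i\<in>insert j I. h' i) * det (\<chi> i. if i \<in> insert j I then e' i else c i)" for c :: "'n \<Rightarrow> real^'n"
  proof -
    let ?c = "c(j := q - a)"
    let ?A = "\<chi> i. if i \<in> I then e i else (c(j := H *\<^sub>R u)) i"
    have "(\<chi> i. if i \<in> insert j I then b' i else c i) = (\<chi> i. if i \<in> I then b i else ?c i)"
      using jI by (auto simp: vec_eq_iff b'_def)
    then have "det (\<chi> i. if i \<in> insert j I then b' i else c i) =
       (\<Prod>i\<in>I. h i) * det (\<chi> i. if i \<in> I then e i else ?c i)"
      using dt[of ?c] by simp
    \<comment> \<open>Row j is q - a, which is H u plus a vector in the span of the rows e_i; such a
      summand does not change the determinant.\<close>
    also have "(\<chi> i. if i \<in> I then e i else ?c i) =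
       (\<chi> k. if k = j then row j ?A + ((q - a) - r (q - a)) else row k ?A)"
      using jI by (auto simp: vec_eq_iff row_def ru)
    also have "det \<dots> = det ?A"
    proof (rule det_row_span)
      have "e ` I \<subseteq> {row k ?A |k. k \<noteq> j}"
      proof clarify
        fix i assume "i \<in> I"
        then show "\<exists>k. e i = row k ?A \<and> k \<noteq> j"
          using ne[of i] by (intro exI[of _ i]) (auto simp: vec_eq_iff row_def)
      qed
      then show "q - a - r (q - a) \<in> vec.span {row k ?A |k. k \<noteq> j}"
        unfolding span_vec_eq using r_span span_mono by blast
    qed
    also have "?A = (\<chi> i. if i = j then H *s u else (if i \<in> I then e i else c i))"
      using jI by (auto simp: vec_eq_iff scalar_mult_eq_scaleR)
    also have "det \<dots> = H * det (\<chi> i. if i = j then u else (if i \<in> I then e i else c i))"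
      by (rule det_row_mul)
    also have "(\<chi> i. if i = j then u else (if i \<in> I then e i else c i)) = (\<chi> i. if i \<in> insert j I then e' i else c i)"
      using jI by (auto simp: vec_eq_iff e'_def)
    also have "(\<Prod>i\<in>I. h i) * (H * det \<dots>) = (\<Prod>i\<in>insert j I. h' i) * det \<dots>"
    proof -
      have "(\<Prod>i\<in>insert j I. h' i) = h' j * (\<Prod>i\<in>I. h' i)"
        using fin jI by simp
      also have "(\<Prod>i\<in>I. h' i) = (\<Prod>i\<in>I. h i)"
        by (rule prod.cong) (use ne in \<open>auto simp: h'_def\<close>)
      finally show ?thesis by (simp add: h'_def)
    qed
    finally show ?thesis .
  qed
  have bK': "a + b' i \<in> K \<and> 0 < h' i" if "i \<in> insert j I" for i
    using that bK q \<open>H > 0\<close> by (auto simp: b'_def h'_def)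
  have "frame_inv K a (insert j I) i0 e' b' h'"
    unfolding frame_inv_def using on' bK' wd' dt' by blast
  then show ?thesis
    unfolding e'_def b'_def h'_def by blast
qed

lemma greedy_frame_aux:
  fixes K :: "(real^'n::finite) set"
  assumes K: "compact K" "interior K \<noteq> {}" and a: "a \<in> K" and v: "norm v = 1"
    and l: "a + l *\<^sub>R v \<in> K" "l > 0" and J: "finite J" "i0 \<notin> J"
  shows "\<exists>e b h. e i0 = v \<and> h i0 = l \<and> frame_inv K a (insert i0 J) i0 e b h"
  using J
proof (induction J)
  case empty
  have d: "det (\<chi> i. if i = i0 then l *\<^sub>R v else c i) = l * det (\<chi> i. if i = i0 then v else c i)" for c :: "'n \<Rightarrow> real^'n"
  proof -
    have "(\<chi> i. if i = i0 then l *\<^sub>R v else c i) = (\<chi> i. if i = i0 then l *s v else c i)"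
      by (simp add: vec_eq_iff)
    then show ?thesis
      using det_row_mul[of i0 l "\<lambda>_. v" c] by simp
  qed
  have "v \<bullet> v = 1" using v by (simp add: norm_eq_1)
  then have "frame_inv K a {i0} i0 (\<lambda>_. v) (\<lambda>_. l *\<^sub>R v) (\<lambda>_. l)"
    using l d by (simp add: frame_inv_def)
  then show ?case by (intro exI[of _ "\<lambda>_. v"] exI[of _ "\<lambda>_. l *\<^sub>R v"] exI[of _ "\<lambda>_. l"] conjI) auto
next
  case (insert j J)
  then obtain e b h where eh: "e i0 = v" "h i0 = l" "frame_inv K a (insert i0 J) i0 e b h"
    by auto
  from frame_inv_step[OF K a eh(3), of j] insert obtain u q H where
    "frame_inv K a (insert j (insert i0 J)) i0 (e(j := u)) (b(j := q)) (h(j := H))"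
    by auto
  moreover have "(e(j := u)) i0 = v" "(h(j := H)) i0 = l"
    using insert.prems eh by auto
  ultimately show ?case
    by (metis insert_commute)
qed

text \<open>The parallelepiped with edges b_i / n lies in K, and its volume is the product of the
  h_i over n^n because the edges are triangular with respect to the frame. The factor 2 in the width
  bound arises from comparing p and q through a.\<close>

lemma greedy_frame:
  fixes K :: "(real^'n::finite) set"
  assumes K: "compact K" "convex K" "interior K \<noteq> {}" and a: "a \<in> K" and v: "norm v = 1"
    and l: "a + l *\<^sub>R v \<in> K" "l > 0"
  obtains e h and i0 :: 'n where "e i0 = v" "\<And>i j. e i \<bullet> e j = (if i = j then 1 else 0)"
    "\<And>i. 0 < h i" "\<And>i p q. i \<noteq> i0 \<Longrightarrow> p \<in> K \<Longrightarrow> q \<in> K \<Longrightarrow> \<bar>e i \<bullet> (p - q)\<bar> \<le> 2 * h i"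
    "ennreal (l * (\<Prod>i\<in>UNIV - {i0}. h i) / CARD('n) ^ CARD('n)) \<le> emeasure lborel K"
    "\<bar>det (\<chi> i. e i)\<bar> = 1"
proof -
  obtain i0 :: 'n where True by auto
  have U: "insert i0 (UNIV - {i0}) = UNIV" by auto
  obtain e b h where e0: "e i0 = v" "h i0 = l" and fi: "frame_inv K a UNIV i0 e b h"
    using greedy_frame_aux[OF K(1,3) a v l, of "UNIV - {i0}" i0] unfolding U by auto
  have eh: "\<And>i j. e i \<bullet> e j = (if i = j then 1 else 0)"
     "\<And>i. a + b i \<in> K \<and> 0 < h i"
     "\<And>i p. i \<noteq> i0 \<Longrightarrow> p \<in> K \<Longrightarrow> \<bar>e i \<bullet> (p - a)\<bar> \<le> h i"
    using fi unfolding frame_inv_def by auto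
  have "\<forall>c. det (\<chi> i. if i \<in> UNIV then b i else c i) =
        (\<Prod>i\<in>UNIV. h i) * det (\<chi> i. if i \<in> UNIV then e i else c i)"
    using fi unfolding frame_inv_def by blast
  then have db: "det (\<chi> i. b i) = (\<Prod>i\<in>UNIV. h i) * det (\<chi> i. e i)"
    by simp
  have "orthogonal_matrix (\<chi> i. e i)"
    unfolding orthogonal_matrix_orthonormal_rows
    using eh(1) by (auto simp: row_def norm_eq_1 orthogonal_def)
  then have det1: "\<bar>det (\<chi> i. e i)\<bar> = 1"
    using det_orthogonal_matrix by fastforce
  have pos: "0 < (\<Prod>i\<in>UNIV. h i)" using eh(2) by (intro prod_pos) auto
  have detb: "\<bar>det (\<chi> i. b i)\<bar> = (\<Prod>i\<in>UNIV. h i)"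
    using db det1 pos by (simp add: abs_mult)
  have "det (\<chi> i. b i) \<noteq> 0" using detb pos by auto
  from emeasure_parallelepiped[OF this, of a]
  have "ennreal ((\<Prod>i\<in>UNIV. h i) / CARD('n) ^ CARD('n)) \<le> emeasure lborel K"
    using emeasure_mono[OF convex_contains_parallelepiped[OF K(2) a, of b], of lborel] eh(2) K(1)
    by (simp add: detb borel_compact)
  moreover have "(\<Prod>i\<in>UNIV. h i) = l * (\<Prod>i\<in>UNIV - {i0}. h i)"
    using prod.remove[of UNIV i0 h] e0(2) by simp
  ultimately have 1: "ennreal (l * (\<Prod>i\<in>UNIV - {i0}. h i) / CARD('n) ^ CARD('n)) \<le> emeasure lborel K"
    by simp
  have 2: "\<bar>e i \<bullet> (p - q)\<bar> \<le> 2 * h i" if "i \<noteq> i0" "p \<in> K" "q \<in> K" for i p q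
  proof -
    have "\<bar>e i \<bullet> (p - a)\<bar> \<le> h i" "\<bar>e i \<bullet> (q - a)\<bar> \<le> h i" using eh(3) that by auto
    then show ?thesis by (simp add: inner_diff_right)
  qed
  show ?thesis
    by (rule that[of e i0 h]) (use e0 eh 1 2 det1 in auto)
qed

text \<open>Multiplication by the transpose of the orthogonal matrix with rows e_i turns the
  perturbed matrix into the identity plus the entries g_i . e_j. Hence \<delta> comes from
  continuity of \<open>det\<close> at the identity and is the same for all frames.\<close>

lemma det_near_orthonormal:
  obtains \<delta> where "\<delta> > 0" "\<And>(e :: 'n::finite \<Rightarrow> real^'n) g.
    \<lbrakk>\<And>i j. e i \<bullet> e j = (if i = j then 1 else 0); \<And>i. norm (g i) \<le> \<delta>\<rbrakk> \<Longrightarrow>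
    1 / 2 \<le> \<bar>det (\<chi> i. e i + g i)\<bar>"
proof -
  have cont: "continuous_on UNIV (det :: real^'n^'n \<Rightarrow> real)"
    unfolding det_def by (intro continuous_intros)
  then have "isCont (det :: real^'n^'n \<Rightarrow> real) (mat 1)"
    by (simp add: continuous_on_eq_continuous_at)
  then obtain r where r: "r > 0" "\<And>X :: real^'n^'n. dist X (mat 1) < r \<Longrightarrow> dist (det X) (det (mat 1 :: real^'n^'n)) < 1/2"
    unfolding continuous_at_eps_delta by (metis half_gt_zero_iff zero_less_one)
  define N where "N = real CARD('n)"
  have N: "N \<ge> 1" by (simp add: N_def Suc_leI)
  \<comment> \<open>There are N^2 entries of size at most \<delta>, so the norm of the perturbation
    is at most r / 2.\<close>
  define \<delta> where "\<delta> = r / (2 * N * N)"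
  have "\<delta> > 0" using r N by (simp add: \<delta>_def)
  moreover have "1 / 2 \<le> \<bar>det (\<chi> i. e i + g i)\<bar>"
    if on: "\<And>i j. e i \<bullet> e j = (if i = j then 1 else 0)" and g: "\<And>i. norm (g i) \<le> \<delta>"
    for e g :: "'n \<Rightarrow> real^'n"
  proof -
    let ?E = "\<chi> i. e i"
    have orth: "orthogonal_matrix ?E"
      unfolding orthogonal_matrix_orthonormal_rows
      using on by (auto simp: row_def norm_eq_1 orthogonal_def)
    then have EE: "transpose ?E ** ?E = mat 1" "?E ** transpose ?E = mat 1"
      by (auto simp: orthogonal_matrix_def)
    define X where "X = (\<chi> i. e i + g i) ** transpose ?E"
    have Xij: "(X - mat 1) $ i $ j = g i \<bullet> e j" for i j
    proof -
      have "X $ i $ j = (e i + g i) \<bullet> e j"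
        by (simp add: X_def matrix_matrix_mult_def transpose_def inner_vec_def)
      then show ?thesis using on by (simp add: inner_add_left mat_def)
    qed
    have "norm (X - mat 1) \<le> (\<Sum>i\<in>UNIV. norm ((X - mat 1) $ i))"
      unfolding norm_vec_def by (rule L2_set_le_sum) auto
    also have "\<dots> \<le> (\<Sum>i\<in>(UNIV::'n set). N * \<delta>)"
    proof (rule sum_mono)
      fix i
      have "norm ((X - mat 1) $ i) \<le> (\<Sum>j\<in>UNIV. \<bar>(X - mat 1) $ i $ j\<bar>)"
        by (rule norm_le_l1_cart)
      also have "\<dots> \<le> (\<Sum>j\<in>(UNIV::'n set). \<delta>)"
      proof (rule sum_mono)
        fix j
        have "norm (e j) = 1" using on[of j j] by (simp add: norm_eq_1)
        then have "\<bar>g i \<bullet> e j\<bar> \<le> norm (g i)"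
          using Cauchy_Schwarz_ineq2[of "g i" "e j"] by simp
        then show "\<bar>(X - mat 1) $ i $ j\<bar> \<le> \<delta>" unfolding Xij using g[of i] by linarith
      qed
      finally show "norm ((X - mat 1) $ i) \<le> N * \<delta>" by (simp add: N_def)
    qed
    also have "\<dots> = N * N * \<delta>" by (simp add: N_def)
    also have "\<dots> < r" using r N by (simp add: \<delta>_def)
    finally have "dist X (mat 1) < r" by (simp add: dist_norm)
    from r(2)[OF this] have "\<bar>det X\<bar> \<ge> 1/2" unfolding dist_real_def det_I by linarith
    moreover have "det X = det (\<chi> i. e i + g i) * det ?E"
      by (simp add: X_def det_mul det_transpose)
    moreover have "\<bar>det ?E\<bar> = 1" using det_orthogonal_matrix[OF orth] by auto
    ultimately show ?thesis by (simp add: abs_mult)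
  qed
  ultimately show ?thesis by (rule that)
qed

section \<open>The cost near the base point, in coordinates\<close>

text \<open>In the application p are the coordinates of x, W is the target domain,
  \<open>b p w\<close> is -c(x, w) + c(x, xb) and \<open>Q p w\<close> is its gradient in p.
  \<open>near\<close> makes y |-> Q p (\<psi> y) a small Lipschitz perturbation of the identity,
  uniformly in p, and \<open>quad\<close> improves this to second order at 0. In \<open>qq\<close>
  the c-segments with respect to p0 have become line segments in the image of
  \<open>Q p0\<close>.\<close>

locale cost_patch =
  fixes P :: "(real^'n::finite) set" and W :: "'k set" and xb :: 'k
    and b :: "real^'n \<Rightarrow> 'k \<Rightarrow> real" and Q :: "real^'n \<Rightarrow> 'k \<Rightarrow> real^'n"
    and \<psi> :: "real^'n \<Rightarrow> 'k" and \<rho> \<epsilon> \<Lambda> M0 D :: real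
  assumes P: "open P" "convex P"
    and cst: "0 < \<rho>" "0 \<le> \<epsilon>" "\<epsilon> \<le> 1/4" "0 \<le> \<Lambda>" "1 \<le> M0"
    and psi: "\<And>y. y \<in> ball 0 \<rho> \<Longrightarrow> \<psi> y \<in> W" "\<psi> 0 = xb"
    and b0: "\<And>p. p \<in> P \<Longrightarrow> b p xb = 0"
    and der: "\<And>p w. p \<in> P \<Longrightarrow> w \<in> W \<Longrightarrow> ((\<lambda>p. b p w) has_derivative (\<lambda>h. Q p w \<bullet> h)) (at p)"
    and Qconv: "\<And>p. p \<in> P \<Longrightarrow> convex (Q p ` W)"
    and Qinj: "\<And>p. p \<in> P \<Longrightarrow> inj_on (Q p) W"
    and QD: "\<And>p w. p \<in> P \<Longrightarrow> w \<in> W \<Longrightarrow> norm (Q p w) \<le> D"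
    and Qcont: "\<And>y. y \<in> ball 0 \<rho> \<Longrightarrow> continuous_on P (\<lambda>p. Q p (\<psi> y))"
    and near: "\<And>p y y'. p \<in> P \<Longrightarrow> y \<in> ball 0 \<rho> \<Longrightarrow> y' \<in> ball 0 \<rho> \<Longrightarrow>
        norm (Q p (\<psi> y) - Q p (\<psi> y') - (y - y')) \<le> \<epsilon> * norm (y - y')"
    and quad: "\<And>p y. p \<in> P \<Longrightarrow> y \<in> ball 0 \<rho> \<Longrightarrow> norm (Q p (\<psi> y) - y) \<le> \<Lambda> * (norm y)\<^sup>2"
    and qq: "\<And>p p0 w0 w1 w t. p \<in> P \<Longrightarrow> p0 \<in> P \<Longrightarrow> w0 \<in> W \<Longrightarrow> w1 \<in> W \<Longrightarrow> w \<in> W \<Longrightarrow> t \<in> {0..1} \<Longrightarrow>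
        Q p0 w = (1 - t) *\<^sub>R Q p0 w0 + t *\<^sub>R Q p0 w1 \<Longrightarrow>
        b p w - b p0 w - (b p w0 - b p0 w0) \<le> M0 * t * max 0 (b p w1 - b p0 w1 - (b p w0 - b p0 w0))"
begin

lemma Q_center [simp]: "p \<in> P \<Longrightarrow> Q p xb = 0"
  using quad[of p 0] psi cst by simp

lemma xb_in [simp]: "xb \<in> W"
  using psi(1)[of 0] psi(2) cst by simp

text \<open>With \<epsilon> \<le> 1/4 the factors 1 + \<epsilon> and 1 / (1 - \<epsilon>) are at
  most the 5/4 used here and the 4/3 of \<open>near_lower\<close>.\<close>

lemma near_upper:
  assumes "p \<in> P" "y \<in> ball 0 \<rho>" "y' \<in> ball 0 \<rho>"
  shows "norm (Q p (\<psi> y) - Q p (\<psi> y')) \<le> 5/4 * norm (y - y')"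
proof -
  have "norm (Q p (\<psi> y) - Q p (\<psi> y')) \<le> norm (Q p (\<psi> y) - Q p (\<psi> y') - (y - y')) + norm (y - y')"
    using norm_triangle_ineq[of "Q p (\<psi> y) - Q p (\<psi> y') - (y - y')" "y - y'"] by simp
  also have "\<dots> \<le> \<epsilon> * norm (y - y') + norm (y - y')" using near[OF assms] by simp
  also have "\<dots> \<le> 1/4 * norm (y - y') + norm (y - y')"
    using cst by (intro add_mono mult_right_mono) auto
  finally show ?thesis by simp
qed

lemma near_lower:
  assumes "p \<in> P" "y \<in> ball 0 \<rho>" "y' \<in> ball 0 \<rho>"
  shows "norm (y - y') \<le> 4/3 * norm (Q p (\<psi> y) - Q p (\<psi> y'))"
proof -
  have "norm (y - y') \<le> norm (Q p (\<psi> y) - Q p (\<psi> y') - (y - y')) + norm (Q p (\<psi> y) - Q p (\<psi> y'))"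
    using norm_triangle_ineq4[of "Q p (\<psi> y) - Q p (\<psi> y')" "Q p (\<psi> y) - Q p (\<psi> y') - (y - y')"] by simp
  also have "norm (Q p (\<psi> y) - Q p (\<psi> y') - (y - y')) \<le> \<epsilon> * norm (y - y')" by (rule near[OF assms])
  also have "\<epsilon> * norm (y - y') \<le> 1/4 * norm (y - y')"
    using cst by (intro mult_right_mono) auto
  finally show ?thesis by simp
qed

lemma norm_y_le:
  assumes "p \<in> P" "y \<in> ball 0 \<rho>"
  shows "norm y \<le> 4/3 * norm (Q p (\<psi> y))"
  using near_lower[OF assms, of 0] cst assms psi(2) by simp

text \<open>Banach's fixed point theorem for y |-> y - Q p (\<psi> y) + q, a contraction with factor
  1/4. The ball of radius 4/3 |q| is mapped into itself since 1/4 * 4/3 + 1 = 4/3, and it lies in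
  the patch because |q| < 3/4 \<rho>.\<close>

lemma patch_surj:
  assumes p: "p \<in> P" and q: "norm q < 3/4 * \<rho>"
  obtains y where "y \<in> ball 0 \<rho>" "Q p (\<psi> y) = q" "norm y \<le> 4/3 * norm q"
proof -
  let ?S = "cball 0 (4/3 * norm q) :: (real^'n) set"
  let ?f = "\<lambda>y. y - Q p (\<psi> y) + q"
  have sub: "y \<in> ball 0 \<rho>" if "y \<in> ?S" for y
    using that q by auto
  have "\<exists>!y\<in>?S. ?f y = y"
  proof (rule Banach_fix)
    show "complete ?S" "?S \<noteq> {}" by (auto intro: compact_imp_complete)
    show "0 \<le> (1/4 :: real)" "1/4 < (1::real)" by auto
    show "?f ` ?S \<subseteq> ?S"
    proof clarify
      fix y :: "real^'n" assume "y \<in> ?S"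
      then have y: "norm y \<le> 4/3 * norm q" "y \<in> ball 0 \<rho>" using sub by auto
      have "norm (y - Q p (\<psi> y)) \<le> \<epsilon> * norm y"
        using near[OF p y(2), of 0] cst psi(2) p by (simp add: norm_minus_commute)
      also have "\<dots> \<le> 1/4 * (4/3 * norm q)" using cst y by (intro mult_mono) auto
      finally have "norm (?f y) \<le> 4/3 * norm q"
        using norm_triangle_ineq[of "y - Q p (\<psi> y)" q] by simp
      then show "?f y \<in> ?S" by simp
    qed
    show "dist (?f x) (?f y) \<le> 1/4 * dist x y" if "x \<in> ?S" "y \<in> ?S" for x y
    proof -
      have "norm (Q p (\<psi> x) - Q p (\<psi> y) - (x - y)) \<le> \<epsilon> * norm (x - y)"
        using near[OF p sub sub] that by blast
      also have "\<dots> \<le> 1/4 * norm (x - y)" using cst by (intro mult_right_mono) auto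
      finally show ?thesis
        by (simp add: dist_norm norm_minus_commute algebra_simps)
    qed
  qed
  then obtain y where y: "y \<in> ?S" "?f y = y" by auto
  then show ?thesis using that[of y] sub by auto
qed

lemma segment_ex:
  assumes "p \<in> P" "w0 \<in> W" "w1 \<in> W" "t \<in> {0..1}"
  obtains w where "w \<in> W" "Q p w = (1 - t) *\<^sub>R Q p w0 + t *\<^sub>R Q p w1"
proof -
  have "(1 - t) *\<^sub>R Q p w0 + t *\<^sub>R Q p w1 \<in> Q p ` W"
    using assms by (intro convexD[OF Qconv]) auto
  then show ?thesis using that by auto
qed

text \<open>Maximum principle along a c-segment: started at the end with the larger value, the
  positive part in \<open>qq\<close> vanishes. If that end is w1, the segment is traversed backwards
  with parameter 1 - t.\<close>

lemma loeper:
  assumes "p \<in> P" "p0 \<in> P" "w0 \<in> W" "w1 \<in> W" "w \<in> W" "t \<in> {0..1}"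
    and Qw: "Q p0 w = (1 - t) *\<^sub>R Q p0 w0 + t *\<^sub>R Q p0 w1"
  shows "b p w - b p0 w \<le> max (b p w0 - b p0 w0) (b p w1 - b p0 w1)"
proof (cases "b p w1 - b p0 w1 \<le> b p w0 - b p0 w0")
  case True
  then have "max 0 (b p w1 - b p0 w1 - (b p w0 - b p0 w0)) = 0" by simp
  then show ?thesis using qq[OF assms] True by simp
next
  case False
  have "b p w - b p0 w - (b p w1 - b p0 w1) \<le> M0 * (1 - t) * max 0 (b p w0 - b p0 w0 - (b p w1 - b p0 w1))"
    by (rule qq) (use assms in \<open>auto simp: algebra_simps\<close>)
  moreover have "max 0 (b p w0 - b p0 w0 - (b p w1 - b p0 w1)) = 0" using False by simp
  ultimately show ?thesis using False by simp
qed

lemma mvt_b: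
  assumes "p \<in> P" "p0 \<in> P" "w \<in> W" "w' \<in> W"
  obtains p' where "p' \<in> closed_segment p0 p" "p' \<in> P"
    "b p w - b p w' - (b p0 w - b p0 w') = (Q p' w - Q p' w') \<bullet> (p - p0)"
proof -
  let ?l = "\<lambda>s::real. p0 + s *\<^sub>R (p - p0)"
  have seg: "?l s \<in> closed_segment p0 p" if "0 \<le> s" "s \<le> 1" for s
    using that unfolding closed_segment_def by (auto simp: algebra_simps intro!: exI[of _ s])
  have lP: "?l s \<in> P" if "0 \<le> s" "s \<le> 1" for s
    using seg[OF that] closed_segment_subset[OF assms(2,1) P(2)] by auto
  have "\<exists>s\<in>{0..1}. (b (?l 1) w - b (?l 1) w') - (b (?l 0) w - b (?l 0) w') =
     (\<lambda>h. Q (?l s) w \<bullet> (h *\<^sub>R (p - p0)) - Q (?l s) w' \<bullet> (h *\<^sub>R (p - p0))) (1 - 0)"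
  proof (rule mvt_very_simple)
    fix s :: real assume s: "0 \<le> s" "s \<le> 1"
    have l: "(?l has_derivative (\<lambda>h. h *\<^sub>R (p - p0))) (at s within {0..1})"
      by (auto intro!: derivative_eq_intros)
    have d: "((\<lambda>s. b (?l s) w) has_derivative (\<lambda>h. Q (?l s) w \<bullet> (h *\<^sub>R (p - p0)))) (at s within {0..1})" if "w \<in> W" for w
      using diff_chain_within[OF l has_derivative_at_withinI[OF der[OF lP[OF s] that]]] by (simp add: o_def)
    show "((\<lambda>s. b (?l s) w - b (?l s) w') has_derivative
       (\<lambda>h. Q (?l s) w \<bullet> (h *\<^sub>R (p - p0)) - Q (?l s) w' \<bullet> (h *\<^sub>R (p - p0)))) (at s within {0..1})"
      by (intro has_derivative_diff d assms)
  qed simp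
  then obtain s where "s \<in> {0..1}" "b p w - b p w' - (b p0 w - b p0 w') = (Q (?l s) w - Q (?l s) w') \<bullet> (p - p0)"
    by (auto simp: inner_diff_left)
  then show ?thesis using that seg lP by force
qed

text \<open>The mean value theorem in p turns this second difference into a difference of gradients,
  which is Lipschitz in y.\<close>

lemma b_lipschitz:
  assumes "p \<in> P" "p0 \<in> P" "y \<in> ball 0 \<rho>" "y' \<in> ball 0 \<rho>"
  shows "\<bar>b p (\<psi> y) - b p0 (\<psi> y) - (b p (\<psi> y') - b p0 (\<psi> y'))\<bar> \<le> 5/4 * norm (y - y') * norm (p - p0)"
proof -
  obtain p' where p': "p' \<in> P"
    "b p (\<psi> y) - b p (\<psi> y') - (b p0 (\<psi> y) - b p0 (\<psi> y')) = (Q p' (\<psi> y) - Q p' (\<psi> y')) \<bullet> (p - p0)"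
    using mvt_b[OF assms(1,2) psi(1)[OF assms(3)] psi(1)[OF assms(4)]] by metis
  have "\<bar>(Q p' (\<psi> y) - Q p' (\<psi> y')) \<bullet> (p - p0)\<bar> \<le> norm (Q p' (\<psi> y) - Q p' (\<psi> y')) * norm (p - p0)"
    by (rule Cauchy_Schwarz_ineq2)
  also have "\<dots> \<le> 5/4 * norm (y - y') * norm (p - p0)"
    by (intro mult_right_mono near_upper p' assms) auto
  finally show ?thesis using p'(2) by argo
qed

text \<open>If the difference were nonpositive at \<psi> y, \<open>qq\<close> started at xb, where
  it is 0, would keep it nonpositive along the whole segment. Near xb, however, it equals s (q . (p
  - p0)) up to an error of order s^2, by the mean value theorem and \<open>quad\<close>.\<close>

lemma slope_pos:
  assumes p: "p \<in> P" "p0 \<in> P" and y: "y \<in> ball 0 \<rho>" and pos: "Q p0 (\<psi> y) \<bullet> (p - p0) > 0"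
  shows "b p (\<psi> y) - b p0 (\<psi> y) > 0"
proof (rule ccontr)
  assume neg: "\<not> ?thesis"
  define q where "q = Q p0 (\<psi> y)"
  define C where "C = 4 * \<Lambda> * (norm q)\<^sup>2 * norm (p - p0)"
  have q0: "q \<noteq> 0" using pos by (auto simp: q_def)
  have C: "C \<ge> 0" using cst by (simp add: C_def)
  have *: "q \<bullet> (p - p0) \<le> s * C" if s: "0 < s" "s \<le> 1" "s * norm q < 3/4 * \<rho>" for s
  proof -
    obtain z where z: "z \<in> ball 0 \<rho>" "Q p0 (\<psi> z) = s *\<^sub>R q" "norm z \<le> 4/3 * norm (s *\<^sub>R q)"
      using patch_surj[OF p(2), of "s *\<^sub>R q"] s by auto
    have "b p (\<psi> z) - b p0 (\<psi> z) - (b p xb - b p0 xb) \<le>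
        M0 * s * max 0 (b p (\<psi> y) - b p0 (\<psi> y) - (b p xb - b p0 xb))"
      by (rule qq) (use p z y s psi in \<open>auto simp: q_def\<close>)
    then have le0: "b p (\<psi> z) - b p0 (\<psi> z) \<le> 0"
      using neg b0 p by simp
    obtain p' where p': "p' \<in> P"
      "b p (\<psi> z) - b p xb - (b p0 (\<psi> z) - b p0 xb) = (Q p' (\<psi> z) - Q p' xb) \<bullet> (p - p0)"
      using mvt_b[OF p psi(1)[OF z(1)] xb_in] by metis
    then have "Q p' (\<psi> z) \<bullet> (p - p0) \<le> 0" using le0 b0 p by simp
    \<comment> \<open>Both gradients at \<psi> z differ from z by at most \<Lambda> |z|^2, and |z|
      \<le> 4/3 s |q|; the numerical factor is 2 * 16/9 \<le> 4.\<close>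
    moreover have "norm (Q p' (\<psi> z) - s *\<^sub>R q) \<le> 4 * \<Lambda> * s\<^sup>2 * (norm q)\<^sup>2"
    proof -
      have "norm (Q p' (\<psi> z) - s *\<^sub>R q) \<le> norm (Q p' (\<psi> z) - z) + norm (Q p0 (\<psi> z) - z)"
        using norm_triangle_ineq4[of "Q p' (\<psi> z) - z" "Q p0 (\<psi> z) - z"] z(2) by simp
      also have "\<dots> \<le> \<Lambda> * (norm z)\<^sup>2 + \<Lambda> * (norm z)\<^sup>2"
        by (intro add_mono quad p' p z)
      also have "\<dots> = 2 * \<Lambda> * (norm z)\<^sup>2" by simp
      also have "\<dots> \<le> 2 * \<Lambda> * (4/3 * norm (s *\<^sub>R q))\<^sup>2"
        using cst z by (intro mult_left_mono power_mono) auto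
      also have "\<dots> = 32/9 * (\<Lambda> * s\<^sup>2 * (norm q)\<^sup>2)"
        using s by (simp add: power_mult_distrib power2_eq_square)
      also have "\<dots> \<le> 4 * (\<Lambda> * s\<^sup>2 * (norm q)\<^sup>2)"
        using cst by (intro mult_right_mono) auto
      finally show ?thesis by simp
    qed
    moreover have "s *\<^sub>R q \<bullet> (p - p0) - Q p' (\<psi> z) \<bullet> (p - p0) \<le> norm (Q p' (\<psi> z) - s *\<^sub>R q) * norm (p - p0)"
      using Cauchy_Schwarz_ineq2[of "Q p' (\<psi> z) - s *\<^sub>R q" "p - p0"] by (simp add: inner_diff_left)
    ultimately have "s * (q \<bullet> (p - p0)) \<le> 4 * \<Lambda> * s\<^sup>2 * (norm q)\<^sup>2 * norm (p - p0)"
      using mult_right_mono[of "norm (Q p' (\<psi> z) - s *\<^sub>R q)" "4 * \<Lambda> * s\<^sup>2 * (norm q)\<^sup>2" "norm (p - p0)"]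
      by (simp del: scaleR_conv_of_real)
    then have "s * (q \<bullet> (p - p0)) \<le> s * (s * C)"
      by (simp add: C_def power2_eq_square algebra_simps)
    then show ?thesis using s by simp
  qed
  have posq: "q \<bullet> (p - p0) > 0" using pos by (simp add: q_def)
  \<comment> \<open>Small enough for s q to stay within reach of the patch and for the quadratic
    error s C to remain below q . (p - p0); C + 1 avoids a division by 0.\<close>
  define s where "s = min 1 (min (\<rho> / (2 * norm q)) ((q \<bullet> (p - p0)) / (2 * (C + 1))))"
  have s0: "0 < s" using cst q0 posq C by (simp add: s_def)
  have "s * norm q \<le> \<rho> / (2 * norm q) * norm q"
    unfolding s_def by (intro mult_right_mono) auto
  then have s1: "s * norm q < 3/4 * \<rho>" using q0 cst by simp
  have "q \<bullet> (p - p0) \<le> s * C" by (rule *) (use s0 s1 in \<open>auto simp: s_def\<close>)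
  also have "\<dots> \<le> (q \<bullet> (p - p0)) / (2 * (C + 1)) * C"
    using C by (intro mult_right_mono) (auto simp: s_def)
  also have "\<dots> = (q \<bullet> (p - p0)) * (C / (2 * (C + 1)))" by simp
  also have "\<dots> < (q \<bullet> (p - p0)) * 1"
    using C posq by (intro mult_strict_left_mono) auto
  finally show False by simp
qed

text \<open>In a tilted direction v' the value is positive by \<open>slope_pos\<close>, and passing
  from the focus z to y costs at most 5/4 |y - z| |p0 - p1|. The tilt has size 2 d / |p0 - p1|, so
  the distance cancels and only T d is left, with the factor 5/4 * 4/3 * 2 = 10/3 \<le> 4.\<close>

lemma depth_lower:
  assumes p: "p0 \<in> P" "p1 \<in> P" and y: "y \<in> ball 0 \<rho>" and v: "norm v = 1"
    and Qy: "Q p1 (\<psi> y) = T *\<^sub>R v" and T: "0 < T" "T \<le> \<rho> / 8" and d: "0 < v \<bullet> (p1 - p0)"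
  shows "- (4 * T * (v \<bullet> (p1 - p0))) \<le> b p0 (\<psi> y) - b p1 (\<psi> y)"
proof -
  define d where "d = v \<bullet> (p1 - p0)"
  define r where "r = norm (p0 - p1)"
  have d0: "d > 0" using d by (simp add: d_def)
  then have "p0 \<noteq> p1" by (auto simp: d_def)
  then have r0: "r > 0" by (simp add: r_def)
  have dr: "d \<le> r"
    using Cauchy_Schwarz_ineq2[of v "p1 - p0"] v by (simp add: d_def r_def norm_minus_commute)
  \<comment> \<open>Reflection of v in the hyperplane orthogonal to p0 - p1: the inner product with
    p0 - p1 changes from -d to d.\<close>
  define v' where "v' = v + (2 * d / r\<^sup>2) *\<^sub>R (p0 - p1)"
  have v'v: "norm (v' - v) = 2 * d / r"
    using d0 r0 by (simp add: v'_def r_def[symmetric] power2_eq_square)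
  have "norm v' \<le> 1 + 2 * d / r"
    using norm_triangle_ineq[of v "v' - v"] v v'v by simp
  also have "\<dots> \<le> 3" using dr r0 by (simp add: field_simps)
  finally have n3: "norm (T *\<^sub>R v') \<le> 3 * T" using T by simp
  have "v' \<bullet> (p0 - p1) = - d + (2 * d / r\<^sup>2) * ((p0 - p1) \<bullet> (p0 - p1))"
    unfolding v'_def inner_add_left inner_scaleR_left d_def by (simp add: inner_diff_right)
  also have "(p0 - p1) \<bullet> (p0 - p1) = r\<^sup>2" by (simp add: r_def dot_square_norm)
  also have "- d + (2 * d / r\<^sup>2) * r\<^sup>2 = d" using r0 by simp
  finally have v'd: "v' \<bullet> (p0 - p1) = d" .
  obtain z where z: "z \<in> ball 0 \<rho>" "Q p1 (\<psi> z) = T *\<^sub>R v'"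
  proof -
    have "norm (T *\<^sub>R v') < 3/4 * \<rho>" using n3 T cst by linarith
    from patch_surj[OF p(2) this] show ?thesis using that by blast
  qed
  have "b p0 (\<psi> z) - b p1 (\<psi> z) > 0"
    by (rule slope_pos[OF p z(1)]) (use z(2) v'd d0 T in simp)
  moreover have "\<bar>b p0 (\<psi> y) - b p1 (\<psi> y) - (b p0 (\<psi> z) - b p1 (\<psi> z))\<bar> \<le> 5/4 * norm (y - z) * norm (p0 - p1)"
    by (rule b_lipschitz[OF p y z(1)])
  moreover have "norm (y - z) \<le> 4/3 * (T * (2 * d / r))"
  proof -
    have "norm (T *\<^sub>R v - T *\<^sub>R v') = T * (2 * d / r)"
      using T v'v by (simp add: scaleR_diff_right[symmetric] norm_minus_commute)
    then show ?thesis using near_lower[OF p(2) y z(1)] Qy z(2) by simp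
  qed
  then have "5/4 * norm (y - z) * norm (p0 - p1) \<le> 5/4 * (4/3 * (T * (2 * d / r))) * r"
    unfolding r_def[symmetric] using r0 by (intro mult_right_mono mult_left_mono) auto
  moreover have "5/4 * (4/3 * (T * (2 * d / r))) * r = 10/3 * (T * d)" using r0 by simp
  moreover have "10/3 * (T * d) \<le> 4 * (T * d)" using T d0 by simp
  ultimately show ?thesis unfolding d_def[symmetric] by argo
qed

text \<open>Moving from \<open>w\<close> towards the centre along the segment for \<open>p\<close> decreases the value at \<open>p0\<close> by at most
  the factor \<open>2\<close> per step, each step shortening the segment by the factor \<open>1 - 1 / (2 * M0)\<close>.\<close>

lemma scale_down:
  assumes p: "p \<in> P" and w: "w \<in> W"
  shows "\<exists>w'\<in>W. Q p w' = ((1 - 1 / (2 * M0)) ^ k) *\<^sub>R Q p w \<and>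
    (\<forall>p0\<in>P. b p0 w - b p w \<le> 0 \<longrightarrow> b p0 w' - b p w' \<le> (b p0 w - b p w) / 2 ^ k)"
proof (induction k)
  case 0
  then show ?case using w by (auto intro!: bexI[of _ w])
next
  case (Suc k)
  then obtain w' where w': "w' \<in> W" "Q p w' = ((1 - 1 / (2 * M0)) ^ k) *\<^sub>R Q p w"
    and le: "\<And>p0. p0 \<in> P \<Longrightarrow> b p0 w - b p w \<le> 0 \<Longrightarrow> b p0 w' - b p w' \<le> (b p0 w - b p w) / 2 ^ k"
    by auto
  \<comment> \<open>Since M0 * ?t = 1/2 and the value at xb is 0, \<open>qq\<close> raises a
    nonpositive value by at most half of its modulus.\<close>
  let ?t = "1 / (2 * M0)"
  have t: "?t \<in> {0..1}" using cst by auto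
  obtain z where z: "z \<in> W" "Q p z = (1 - ?t) *\<^sub>R Q p w' + ?t *\<^sub>R Q p xb"
    using segment_ex[OF p w'(1) xb_in t] .
  have "b p0 z - b p z \<le> (b p0 w - b p w) / 2 ^ Suc k" if p0: "p0 \<in> P" "b p0 w - b p w \<le> 0" for p0
  proof -
    have f0: "b p0 w' - b p w' \<le> (b p0 w - b p w) / 2 ^ k" by (rule le[OF p0])
    have "(b p0 w - b p w) / 2 ^ k \<le> 0" using p0 by (simp add: divide_nonpos_pos)
    then have neg: "b p0 w' - b p w' \<le> 0" using f0 by linarith
    have "b p0 z - b p z - (b p0 w' - b p w') \<le> M0 * ?t * max 0 (b p0 xb - b p xb - (b p0 w' - b p w'))"
      by (rule qq[OF p0(1) p w'(1) xb_in z(1) t z(2)])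
    also have "\<dots> = - (b p0 w' - b p w') / 2" using neg b0 p p0 cst by simp
    finally show ?thesis using f0 by simp
  qed
  then show ?case using z w' p by (intro bexI[of _ z]) (auto simp: algebra_simps)
qed

end

section \<open>Supports of a convex section in prescribed normal directions\<close>

text \<open>\<open>supp\<close> provides a support of depth h for every point outside K without
  saying where its focus lies. The number k of contractions is large enough to bring any gradient,
  of norm at most D, within \<rho> / 8 and hence into the patch.\<close>

locale cost_section = cost_patch P W xb b Q \<psi> \<rho> \<epsilon> \<Lambda> M0 D
  for P :: "(real^'n::finite) set" and W :: "'k set" and xb :: 'k
    and b :: "real^'n \<Rightarrow> 'k \<Rightarrow> real" and Q :: "real^'n \<Rightarrow> 'k \<Rightarrow> real^'n"
    and \<psi> :: "real^'n \<Rightarrow> 'k" and \<rho> \<epsilon> \<Lambda> M0 D :: real +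
  fixes K :: "(real^'n) set" and p0 :: "real^'n" and h :: real and k :: nat
  assumes K: "K \<subseteq> P" "compact K" "convex K" and p0: "p0 \<in> interior K"
    and h: "0 < h" and k: "(1 - 1 / (2 * M0)) ^ k * D \<le> \<rho> / 8"
    and supp: "\<And>p. p \<in> P - K \<Longrightarrow> \<exists>w\<in>W. (\<forall>x\<in>K. b x w - b p w \<le> 0) \<and> b p0 w - b p w \<le> - h"
begin

lemma p0_in [simp]: "p0 \<in> K" "p0 \<in> P"
proof -
  show "p0 \<in> K" using p0 interior_subset by blast
  then show "p0 \<in> P" using K(1) by blast
qed

text \<open>Foci in the patch whose function b supports K at p1 with depth at least h / 2 ^ k at p0;
  the factor 2 ^ k is what k contractions by \<open>scale_down\<close> may lose.\<close>

definition good :: "real^'n \<Rightarrow> (real^'n) set" where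
  "good p1 = {y \<in> ball 0 \<rho>. norm (Q p1 (\<psi> y)) \<le> \<rho> / 8 \<and> (\<forall>x\<in>K. b x (\<psi> y) - b p1 (\<psi> y) \<le> 0) \<and>
     b p0 (\<psi> y) - b p1 (\<psi> y) \<le> - (h / 2 ^ k)}"

lemma b_cont: "w \<in> W \<Longrightarrow> continuous_on P (\<lambda>p. b p w)"
  by (rule has_derivative_continuous_on[OF has_derivative_at_withinI[OF der]])

text \<open>Joint continuity in p and y: the dependence on y is Lipschitz with a constant that stays
  bounded along the sequence p, so continuity in p for the limit focus is enough.\<close>

lemma limit_b:
  assumes p: "\<And>n. p n \<in> P" "p \<longlonglongrightarrow> q" "q \<in> P" and y: "\<And>n. y n \<in> ball 0 \<rho>" "y \<longlonglongrightarrow> z" "z \<in> ball 0 \<rho>"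
    and x: "x \<in> P"
  shows "(\<lambda>n. b x (\<psi> (y n)) - b (p n) (\<psi> (y n))) \<longlonglongrightarrow> b x (\<psi> z) - b q (\<psi> z)"
proof -
  have 1: "(\<lambda>n. b x (\<psi> z) - b (p n) (\<psi> z)) \<longlonglongrightarrow> b x (\<psi> z) - b q (\<psi> z)"
    using continuous_on_tendsto_compose[OF b_cont[OF psi(1)[OF y(3)]] p(2,3)] p(1)
    by (intro tendsto_intros) auto
  have 2: "(\<lambda>n. 5/4 * norm (y n - z) * norm (x - p n)) \<longlonglongrightarrow> 5/4 * norm (z - z) * norm (x - q)"
    by (intro tendsto_intros y p)
  have "(\<lambda>n. (b x (\<psi> (y n)) - b (p n) (\<psi> (y n))) - (b x (\<psi> z) - b (p n) (\<psi> z))) \<longlonglongrightarrow> 0"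
  proof (rule Lim_null_comparison)
    show "\<forall>\<^sub>F n in sequentially. norm ((b x (\<psi> (y n)) - b (p n) (\<psi> (y n))) - (b x (\<psi> z) - b (p n) (\<psi> z)))
      \<le> 5/4 * norm (y n - z) * norm (x - p n)"
      unfolding real_norm_def by (intro always_eventually allI b_lipschitz x p y)
    show "(\<lambda>n. 5/4 * norm (y n - z) * norm (x - p n)) \<longlonglongrightarrow> 0" using 2 by simp
  qed
  from tendsto_add[OF this 1] show ?thesis by simp
qed

lemma limit_Q:
  assumes p: "\<And>n. p n \<in> P" "p \<longlonglongrightarrow> q" "q \<in> P" and y: "\<And>n. y n \<in> ball 0 \<rho>" "y \<longlonglongrightarrow> z" "z \<in> ball 0 \<rho>"
  shows "(\<lambda>n. Q (p n) (\<psi> (y n))) \<longlonglongrightarrow> Q q (\<psi> z)"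
proof -
  have 1: "(\<lambda>n. Q (p n) (\<psi> z)) \<longlonglongrightarrow> Q q (\<psi> z)"
    using continuous_on_tendsto_compose[OF Qcont[OF y(3)] p(2,3)] p(1) by auto
  have 2: "(\<lambda>n. 5/4 * norm (y n - z)) \<longlonglongrightarrow> 5/4 * norm (z - z)"
    by (intro tendsto_intros y p)
  have "(\<lambda>n. Q (p n) (\<psi> (y n)) - Q (p n) (\<psi> z)) \<longlonglongrightarrow> 0"
  proof (rule Lim_null_comparison)
    show "\<forall>\<^sub>F n in sequentially. norm (Q (p n) (\<psi> (y n)) - Q (p n) (\<psi> z)) \<le> 5/4 * norm (y n - z)"
      by (intro always_eventually allI near_upper p y)
    show "(\<lambda>n. 5/4 * norm (y n - z)) \<longlonglongrightarrow> 0" using 2 by simp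
  qed
  from tendsto_add[OF this 1] show ?thesis by simp
qed

text \<open>A limit of the supports at points outside \<open>K\<close> approaching \<open>p1\<close> in the direction \<open>\<xi>\<close>.\<close>

lemma good_direction:
  assumes p1: "p1 \<in> K" and v: "\<And>x. x \<in> K \<Longrightarrow> v \<bullet> x \<le> v \<bullet> p1" and xi: "0 < \<xi> \<bullet> v"
  shows "\<exists>y\<in>good p1. 0 \<le> \<xi> \<bullet> Q p1 (\<psi> y)"
proof -
  have p1P: "p1 \<in> P" using p1 K by auto
  have xi0: "\<xi> \<noteq> 0" using xi by auto
  from P(1) p1P obtain r where r: "r > 0" "ball p1 r \<subseteq> P"
    by (meson open_contains_ball)
  \<comment> \<open>The points p n lie outside K because v . p n > v . p1, and s n is small enough
    to keep them in the ball of radius r around p1.\<close>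
  define s where "s n = r / (2 * norm \<xi> * real (Suc n))" for n
  define p where "p n = p1 + s n *\<^sub>R \<xi>" for n
  have s0: "s n > 0" for n using r xi0 by (simp add: s_def)
  have sl: "s \<longlonglongrightarrow> 0"
  proof -
    have "(\<lambda>n. (r / (2 * norm \<xi>)) * (1 / real (Suc n))) \<longlonglongrightarrow> (r / (2 * norm \<xi>)) * 0"
      by (intro tendsto_intros LIMSEQ_Suc[OF lim_1_over_n])
    then show ?thesis by (simp add: s_def[abs_def])
  qed
  have pl: "p \<longlonglongrightarrow> p1"
    unfolding p_def[abs_def] using tendsto_add[OF tendsto_const tendsto_scaleR[OF sl tendsto_const], of p1 \<xi>] by simp
  have pP: "p n \<in> P" for n
  proof -
    have "s n * norm \<xi> = r / (2 * real (Suc n))" using xi0 by (simp add: s_def)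
    also have "\<dots> < r / 1" using r by (intro divide_strict_left_mono) auto
    also have "r / 1 = r" by simp
    finally have "p n \<in> ball p1 r" using s0[of n] by (simp add: p_def dist_norm)
    then show ?thesis using r by auto
  qed
  have pK: "p n \<notin> K" for n
  proof
    assume "p n \<in> K"
    from v[OF this] have "s n * (\<xi> \<bullet> v) \<le> 0" by (simp add: p_def inner_add_right inner_commute)
    then show False using mult_pos_pos[OF s0[of n] xi] by simp
  qed
  have "\<exists>y. y \<in> ball 0 \<rho> \<and> norm (Q (p n) (\<psi> y)) \<le> \<rho> / 8 \<and> (\<forall>x\<in>K. b x (\<psi> y) - b (p n) (\<psi> y) \<le> 0) \<and>
     b p0 (\<psi> y) - b (p n) (\<psi> y) \<le> - (h / 2 ^ k) \<and> norm y \<le> \<rho> / 6" for n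
  proof -
    \<comment> \<open>The focus of a support at an outside point is contracted k times, which makes
      it a point of the patch and keeps the sign on K.\<close>
    obtain w where w: "w \<in> W" "\<And>x. x \<in> K \<Longrightarrow> b x w - b (p n) w \<le> 0" "b p0 w - b (p n) w \<le> - h"
      using supp[of "p n"] pP pK by auto
    obtain w' where w': "w' \<in> W" "Q (p n) w' = ((1 - 1 / (2 * M0)) ^ k) *\<^sub>R Q (p n) w"
      "\<And>x. x \<in> P \<Longrightarrow> b x w - b (p n) w \<le> 0 \<Longrightarrow> b x w' - b (p n) w' \<le> (b x w - b (p n) w) / 2 ^ k"
      using scale_down[OF pP w(1), of n k] by auto
    have c: "0 \<le> 1 - 1 / (2 * M0)" using cst by simp
    have "norm (Q (p n) w') = (1 - 1 / (2 * M0)) ^ k * norm (Q (p n) w)"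
      using c by (simp add: w'(2) abs_mult power_abs)
    also have "\<dots> \<le> (1 - 1 / (2 * M0)) ^ k * D"
      using c QD[OF pP w(1)] by (intro mult_left_mono) auto
    finally have nQ: "norm (Q (p n) w') \<le> \<rho> / 8" using k by simp
    obtain y where y: "y \<in> ball 0 \<rho>" "Q (p n) (\<psi> y) = Q (p n) w'" "norm y \<le> 4/3 * norm (Q (p n) w')"
      using patch_surj[OF pP, of "Q (p n) w'" n] nQ cst by auto
    have "\<psi> y = w'" using inj_onD[OF Qinj[OF pP] y(2) psi(1)[OF y(1)] w'(1)] .
    moreover have "b x w' - b (p n) w' \<le> 0" if "x \<in> K" for x
    proof -
      have "b x w' - b (p n) w' \<le> (b x w - b (p n) w) / 2 ^ k"
        using w'(3) that K w(2) by auto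
      also have "\<dots> \<le> 0" using w(2)[OF that] by (simp add: divide_nonpos_pos)
      finally show ?thesis .
    qed
    moreover have "b p0 w' - b (p n) w' \<le> - (h / 2 ^ k)"
    proof -
      have "b p0 w' - b (p n) w' \<le> (b p0 w - b (p n) w) / 2 ^ k"
        using w'(3) w(2) by auto
      also have "\<dots> \<le> - h / 2 ^ k" using w(3) by (intro divide_right_mono) auto
      finally show ?thesis by simp
    qed
    ultimately show ?thesis using y nQ by (intro exI[of _ y]) auto
  qed
  then obtain y where y: "\<And>n. y n \<in> ball 0 \<rho>" "\<And>n. norm (Q (p n) (\<psi> (y n))) \<le> \<rho> / 8"
     "\<And>n x. x\<in>K \<Longrightarrow> b x (\<psi> (y n)) - b (p n) (\<psi> (y n)) \<le> 0"
     "\<And>n. b p0 (\<psi> (y n)) - b (p n) (\<psi> (y n)) \<le> - (h / 2 ^ k)" "\<And>n. norm (y n) \<le> \<rho> / 6"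
    by metis
  obtain z \<sigma> where z: "z \<in> cball 0 (\<rho> / 6)" and sg: "strict_mono \<sigma>" "(y \<circ> \<sigma>) \<longlonglongrightarrow> z"
    using seq_compactE[OF compact_imp_seq_compact[OF compact_cball], of y 0 "\<rho> / 6"] y(5) by (auto simp: mem_cball_0)
  have zb: "z \<in> ball 0 \<rho>" using z cst by auto
  have pl': "(\<lambda>n. p (\<sigma> n)) \<longlonglongrightarrow> p1" using LIMSEQ_subseq_LIMSEQ[OF pl sg(1)] by (simp add: o_def)
  have yl': "(\<lambda>n. y (\<sigma> n)) \<longlonglongrightarrow> z" using sg(2) by (simp add: o_def)
  note lb = limit_b[of "\<lambda>n. p (\<sigma> n)", OF pP pl' p1P y(1) yl' zb]
  note lQ = limit_Q[of "\<lambda>n. p (\<sigma> n)", OF pP pl' p1P y(1) yl' zb]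
  have "b x (\<psi> z) - b p1 (\<psi> z) \<le> 0" if "x \<in> K" for x
    by (rule LIMSEQ_le_const2[OF lb]) (use that K y(3) in auto)
  moreover have "b p0 (\<psi> z) - b p1 (\<psi> z) \<le> - (h / 2 ^ k)"
    by (rule LIMSEQ_le_const2[OF lb]) (use y(4) in auto)
  moreover have "norm (Q p1 (\<psi> z)) \<le> \<rho> / 8"
    by (rule LIMSEQ_le_const2[OF tendsto_norm[OF lQ]]) (use y(2) in auto)
  ultimately have good: "z \<in> good p1" using zb by (simp add: good_def)
  \<comment> \<open>The function with focus y n supports K at p n, so it does not decrease from p1
    to p n; the mean value theorem gives a point in between where \<xi> . Q is nonnegative, and this
    point converges to p1.\<close>
  have "\<exists>q. q \<in> closed_segment p1 (p n) \<and> q \<in> P \<and> 0 \<le> \<xi> \<bullet> Q q (\<psi> (y n))" for n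
  proof -
    obtain q where q: "q \<in> closed_segment p1 (p n)" "q \<in> P"
      "b (p n) (\<psi> (y n)) - b (p n) xb - (b p1 (\<psi> (y n)) - b p1 xb) = (Q q (\<psi> (y n)) - Q q xb) \<bullet> (p n - p1)"
      using mvt_b[OF pP p1P psi(1)[OF y(1)] xb_in] by metis
    have "0 \<le> Q q (\<psi> (y n)) \<bullet> (p n - p1)"
      using q(2,3) y(3)[OF p1, of n] b0 pP p1P by simp
    then have "0 \<le> s n * (\<xi> \<bullet> Q q (\<psi> (y n)))" by (simp add: p_def inner_commute)
    then have "0 \<le> \<xi> \<bullet> Q q (\<psi> (y n))" using s0[of n] by (simp add: zero_le_mult_iff)
    then show ?thesis using q by blast
  qed
  then obtain q where q: "\<And>n. q n \<in> closed_segment p1 (p n)" "\<And>n. q n \<in> P" "\<And>n. 0 \<le> \<xi> \<bullet> Q (q n) (\<psi> (y n))"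
    by metis
  have "q \<longlonglongrightarrow> p1"
  proof (rule LIM_zero_cancel, rule Lim_null_comparison)
    show "\<forall>\<^sub>F n in sequentially. norm (q n - p1) \<le> norm (p n - p1)"
      using segment_bound(1)[OF q(1)] by (intro always_eventually allI) (simp add: norm_minus_commute)
    show "(\<lambda>n. norm (p n - p1)) \<longlonglongrightarrow> 0"
      using pl by (simp add: LIM_zero tendsto_norm_zero)
  qed
  then have ql': "(\<lambda>n. q (\<sigma> n)) \<longlonglongrightarrow> p1" using LIMSEQ_subseq_LIMSEQ[OF _ sg(1), of q p1] by (simp add: o_def)
  have "0 \<le> \<xi> \<bullet> Q p1 (\<psi> z)"
    by (rule LIMSEQ_le_const[OF tendsto_inner[OF tendsto_const limit_Q[of "\<lambda>n. q (\<sigma> n)", OF q(2) ql' p1P y(1) yl' zb]]])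
      (use q(3) in auto)
  then show ?thesis using good by blast
qed

text \<open>Both conditions in \<open>good\<close> are upper bounds for differences b x - b p1,
  which \<open>loeper\<close> preserves along segments in the image of \<open>Q p1\<close>.\<close>

lemma good_image_convex:
  assumes p1: "p1 \<in> K"
  shows "convex ((\<lambda>y. Q p1 (\<psi> y)) ` good p1)"
proof (rule convexI)
  fix q q' s t
  assume qq': "q \<in> (\<lambda>y. Q p1 (\<psi> y)) ` good p1" "q' \<in> (\<lambda>y. Q p1 (\<psi> y)) ` good p1" and st: "0 \<le> (s::real)" "0 \<le> t" "s + t = 1"
  have p1P: "p1 \<in> P" using p1 K by auto
  from qq' obtain y y' where y: "y \<in> good p1" "y' \<in> good p1" "q = Q p1 (\<psi> y)" "q' = Q p1 (\<psi> y')" by auto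
  have n: "norm (s *\<^sub>R q + t *\<^sub>R q') \<le> \<rho> / 8"
  proof -
    have "s *\<^sub>R q + t *\<^sub>R q' \<in> cball 0 (\<rho> / 8)"
      using y by (intro convexD[OF convex_cball] st) (auto simp: good_def)
    then show ?thesis by simp
  qed
  then have "norm (s *\<^sub>R q + t *\<^sub>R q') < 3/4 * \<rho>" using cst by linarith
  then obtain z where z: "z \<in> ball 0 \<rho>" "Q p1 (\<psi> z) = s *\<^sub>R q + t *\<^sub>R q'"
    by (rule patch_surj[OF p1P])
  have "1 - t = s" using st by simp
  then have Qz: "Q p1 (\<psi> z) = (1 - t) *\<^sub>R Q p1 (\<psi> y) + t *\<^sub>R Q p1 (\<psi> y')"
    using z(2) y(3,4) by simp
  have yb: "y \<in> ball 0 \<rho>" "y' \<in> ball 0 \<rho>" and tI: "t \<in> {0..1}"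
    using y(1,2) st unfolding good_def by auto
  have le: "b x (\<psi> z) - b p1 (\<psi> z) \<le> max (b x (\<psi> y) - b p1 (\<psi> y)) (b x (\<psi> y') - b p1 (\<psi> y'))" if "x \<in> P" for x
    by (rule loeper[OF that p1P psi(1)[OF yb(1)] psi(1)[OF yb(2)] psi(1)[OF z(1)] tI Qz])
  have "z \<in> good p1"
  proof -
    have "b x (\<psi> z) - b p1 (\<psi> z) \<le> 0" if "x \<in> K" for x
    proof -
      have "b x (\<psi> y) - b p1 (\<psi> y) \<le> 0" "b x (\<psi> y') - b p1 (\<psi> y') \<le> 0" "x \<in> P"
        using that K y(1,2) by (auto simp: good_def)
      then show ?thesis using le[of x] by simp
    qed
    moreover have "b p0 (\<psi> z) - b p1 (\<psi> z) \<le> - (h / 2 ^ k)"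
      using le[of p0] y by (auto simp: good_def)
    ultimately show ?thesis using z n by (simp add: good_def)
  qed
  then show "s *\<^sub>R q + t *\<^sub>R q' \<in> (\<lambda>y. Q p1 (\<psi> y)) ` good p1" using z by force
qed

text \<open>4/3 * \<rho> / 8 = \<rho> / 6. The foci thus stay in a closed ball inside the open
  patch, which is where compactness comes from.\<close>

lemma good_sub:
  assumes "p1 \<in> K" "y \<in> good p1"
  shows "norm y \<le> \<rho> / 6"
proof -
  have "p1 \<in> P" "y \<in> ball 0 \<rho>" "norm (Q p1 (\<psi> y)) \<le> \<rho> / 8"
    using assms K(1) by (auto simp: good_def)
  with norm_y_le[of p1 y] show ?thesis by linarith
qed

lemma good_image_compact:
  assumes p1: "p1 \<in> K"
  shows "compact ((\<lambda>y. Q p1 (\<psi> y)) ` good p1)"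
proof (rule compact_continuous_image)
  have p1P: "p1 \<in> P" using p1 K by auto
  have cQ: "continuous_on (ball 0 \<rho>) (\<lambda>y. Q p1 (\<psi> y))"
    by (rule lipschitz_on_continuous_on[of "5/4"], rule lipschitz_onI)
       (use near_upper[OF p1P] in \<open>auto simp: dist_norm\<close>)
  then show "continuous_on (good p1) (\<lambda>y. Q p1 (\<psi> y))"
    by (rule continuous_on_subset) (auto simp: good_def)
  have cb: "continuous_on (ball 0 \<rho>) (\<lambda>y. b x (\<psi> y) - b p1 (\<psi> y))" if "x \<in> P" for x
    by (rule lipschitz_on_continuous_on[of "5/4 * norm (x - p1)"], rule lipschitz_onI)
       (use b_lipschitz[OF that p1P] in \<open>auto simp: dist_norm mult_ac\<close>)
  let ?B = "cball 0 (\<rho> / 6) :: (real^'n) set"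
  have sub: "?B \<subseteq> ball 0 \<rho>" using cst by auto
  have eq: "good p1 = {y \<in> ?B. norm (Q p1 (\<psi> y)) \<le> \<rho> / 8} \<inter> (\<Inter>x\<in>K. {y \<in> ?B. b x (\<psi> y) - b p1 (\<psi> y) \<le> 0}) \<inter>
     {y \<in> ?B. b p0 (\<psi> y) - b p1 (\<psi> y) \<le> - (h / 2 ^ k)}"
    using good_sub[OF p1] sub p0_in(1) by (auto simp: good_def)
  have "closed (good p1)"
    unfolding eq
    by (intro closed_Int closed_INT ballI continuous_on_closed_Collect_le continuous_on_const continuous_on_norm
         continuous_on_subset[OF cQ sub] continuous_on_subset[OF cb sub]) (use K in auto)
  moreover have "bounded (good p1)"
    by (rule bounded_subset[OF bounded_cball[of 0 "\<rho> / 6"]]) (use good_sub[OF p1] in auto)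
  ultimately show "compact (good p1)" by (simp add: compact_eq_bounded_closed)
qed

text \<open>A support of \<open>K\<close> at \<open>p1\<close> whose focus lies exactly in the given normal direction; if it did not exist,
  a separating hyperplane would contradict \<open>good_direction\<close>.\<close>

lemma support_in_direction:
  assumes p1: "p1 \<in> K" and v: "\<And>x. x \<in> K \<Longrightarrow> v \<bullet> x \<le> v \<bullet> p1" and v1: "norm v = 1"
  obtains T y where "0 \<le> T" "y \<in> good p1" "Q p1 (\<psi> y) = T *\<^sub>R v"
proof -
  let ?G = "(\<lambda>y. Q p1 (\<psi> y)) ` good p1" and ?R = "(\<lambda>T. T *\<^sub>R v) ` {0..}"
  have "?R \<inter> ?G \<noteq> {}"
  proof
    assume disj: "?R \<inter> ?G = {}"
    have "convex ?R"
      by (intro convex_linear_image) (auto simp: linear_iff algebra_simps)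
    moreover have "closed ?R"
    proof -
      have "v \<noteq> 0" using v1 by auto
      then have "closed ((\<lambda>T. T *\<^sub>R v) ` {0::real..})"
        by (intro closed_injective_linear_image) (auto simp: linear_iff algebra_simps inj_def)
      then show ?thesis .
    qed
    moreover have "?G \<noteq> {}" using good_direction[OF p1 v, of v] v1 by (auto simp: dot_square_norm)
    ultimately obtain a c where ac: "\<And>T. 0 \<le> T \<Longrightarrow> a \<bullet> (T *\<^sub>R v) < c" "\<And>y. y \<in> good p1 \<Longrightarrow> c < a \<bullet> Q p1 (\<psi> y)"
      using separating_hyperplane_closed_compact[OF _ _ good_image_convex[OF p1] good_image_compact[OF p1] _ disj]
      by auto
    have c0: "c > 0" using ac(1)[of 0] by simp
    have av: "a \<bullet> v \<le> 0"
    proof (rule ccontr)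
      assume "\<not> a \<bullet> v \<le> 0"
      then have "a \<bullet> ((c / (a \<bullet> v)) *\<^sub>R v) = c" "0 \<le> c / (a \<bullet> v)" using c0 by auto
      then show False using ac(1)[of "c / (a \<bullet> v)"] by simp
    qed
    \<comment> \<open>Small enough that d (v . Q) \<le> c for every admissible focus. The direction
      d v - a still has positive product with v, so \<open>good_direction\<close> yields a focus
      with a . Q \<le> c, against the separation.\<close>
    define d where "d = c / \<rho>"
    have d0: "d > 0" using c0 cst by (simp add: d_def)
    have "0 < (d *\<^sub>R v - a) \<bullet> v"
      using d0 av v1 by (simp add: inner_diff_left dot_square_norm)
    from good_direction[OF p1 v this] obtain y where y: "y \<in> good p1" "0 \<le> (d *\<^sub>R v - a) \<bullet> Q p1 (\<psi> y)" by auto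
    have "v \<bullet> Q p1 (\<psi> y) \<le> norm (Q p1 (\<psi> y))"
      using Cauchy_Schwarz_ineq2[of v "Q p1 (\<psi> y)"] v1 by simp
    also have "\<dots> \<le> \<rho>" using y cst by (simp add: good_def)
    finally have "d * (v \<bullet> Q p1 (\<psi> y)) \<le> c" using d0 cst by (simp add: d_def field_simps)
    then show False using y ac(2)[OF y(1)] by (simp add: inner_diff_left)
  qed
  then obtain T y where "0 \<le> T" "y \<in> good p1" "Q p1 (\<psi> y) = T *\<^sub>R v" by force
  then show ?thesis using that by blast
qed

text \<open>In the application h = m x0 - u x0, and the condition says that the c-function with
  focus \<psi> y through (x0, u x0) stays at most m on the section. This is what puts the focus into
  the c-subdifferential.\<close>

definition E :: "(real^'n) set" where
  "E = {y \<in> ball 0 \<rho>. \<forall>x\<in>K. b x (\<psi> y) - b p0 (\<psi> y) \<le> h}"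

text \<open>The support found by \<open>support_in_direction\<close> may be deeper than h at p0 and
  then miss \<open>E\<close>. In that case the focus is moved towards xb along the ray of v until
  the depth is exactly h; \<open>loeper\<close> keeps the values on K nonpositive, and
  \<open>depth_lower\<close> converts depth into a lower bound for T.\<close>

lemma direction_in_E:
  assumes p1: "p1 \<in> K" and v: "\<And>x. x \<in> K \<Longrightarrow> v \<bullet> x \<le> v \<bullet> p1" and v1: "norm v = 1"
  obtains T y where "0 < T" "T \<le> \<rho> / 8" "y \<in> E" "Q p1 (\<psi> y) = T *\<^sub>R v" "h / 2 ^ k \<le> 4 * T * (v \<bullet> (p1 - p0))"
proof -
  have p1P: "p1 \<in> P" using p1 K by auto
  have dpos: "0 < v \<bullet> (p1 - p0)"
  proof -
    obtain r where r: "r > 0" "cball p0 r \<subseteq> K" using p0 by (meson mem_interior_cball)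
    have "p0 + r *\<^sub>R v \<in> K" using r v1 by (intro subsetD[OF r(2)]) (simp add: dist_norm)
    from v[OF this] show ?thesis using r v1 by (simp add: inner_add_right inner_diff_right dot_square_norm)
  qed
  obtain T y where T: "0 \<le> T" and y: "y \<in> good p1" "Q p1 (\<psi> y) = T *\<^sub>R v"
    by (rule support_in_direction[OF p1 v v1])
  have yb: "y \<in> ball 0 \<rho>" and Tle: "T \<le> \<rho> / 8" and
    f: "\<And>x. x \<in> K \<Longrightarrow> b x (\<psi> y) - b p1 (\<psi> y) \<le> 0" "b p0 (\<psi> y) - b p1 (\<psi> y) \<le> - (h / 2 ^ k)"
    using y T v1 by (auto simp: good_def)
  have hk: "0 < h / 2 ^ k" "h / 2 ^ k \<le> h" using h by (auto simp: field_simps)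
  have "T \<noteq> 0"
  proof
    assume "T = 0"
    then have "y = 0" using norm_y_le[OF p1P yb] y(2) by simp
    then show False using f(2) hk psi(2) b0 p1P by simp
  qed
  then have T0: "T > 0" using T by simp
  have inE: "z \<in> E" if "z \<in> ball 0 \<rho>" "\<And>x. x \<in> K \<Longrightarrow> b x (\<psi> z) - b p1 (\<psi> z) \<le> 0" "b p0 (\<psi> z) - b p1 (\<psi> z) \<ge> - h" for z
  proof -
    have "b x (\<psi> z) - b p0 (\<psi> z) \<le> h" if "x \<in> K" for x
      using \<open>b p0 (\<psi> z) - b p1 (\<psi> z) \<ge> - h\<close> \<open>\<And>x. x \<in> K \<Longrightarrow> b x (\<psi> z) - b p1 (\<psi> z) \<le> 0\<close>[OF that] by simp
    then show ?thesis using \<open>z \<in> ball 0 \<rho>\<close> by (simp add: E_def)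
  qed
  show ?thesis
  proof (cases "b p0 (\<psi> y) - b p1 (\<psi> y) \<ge> - h")
    case True
    have "h / 2 ^ k \<le> 4 * T * (v \<bullet> (p1 - p0))"
      using depth_lower[OF p0_in(2) p1P yb v1 y(2) T0 Tle dpos] f(2) by simp
    then show ?thesis using that[OF T0 Tle inE[OF yb f(1) True] y(2)] by simp
  next
    case False
    have ex: "\<exists>z. z \<in> ball 0 \<rho> \<and> Q p1 (\<psi> z) = (s * T) *\<^sub>R v" if "s \<in> {0..1}" for s
    proof -
      have "s * T \<le> 1 * T" using that T0 by (intro mult_right_mono) auto
      moreover have "norm ((s * T) *\<^sub>R v) = s * T" using that T0 v1 by simp
      ultimately have "norm ((s * T) *\<^sub>R v) < 3/4 * \<rho>" using Tle cst by linarith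
      then obtain z where "z \<in> ball 0 \<rho>" "Q p1 (\<psi> z) = (s * T) *\<^sub>R v"
        by (rule patch_surj[OF p1P])
      then show ?thesis by blast
    qed
    \<comment> \<open>Preimage of the ray under \<open>Q p1\<close>; by \<open>near_lower\<close> it
      is Lipschitz in s, so the depth depends continuously on s.\<close>
    define G where "G s = (SOME z. z \<in> ball 0 \<rho> \<and> Q p1 (\<psi> z) = (s * T) *\<^sub>R v)" for s
    have G: "G s \<in> ball 0 \<rho>" "Q p1 (\<psi> (G s)) = (s * T) *\<^sub>R v" if "s \<in> {0..1}" for s
      using someI_ex[OF ex[OF that]] unfolding G_def by auto
    have lip: "norm (G s - G t) \<le> 4/3 * T * \<bar>s - t\<bar>" if "s \<in> {0..1}" "t \<in> {0..1}" for s t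
    proof -
      have "norm (Q p1 (\<psi> (G s)) - Q p1 (\<psi> (G t))) = \<bar>s - t\<bar> * T"
        using G that v1 T0 by (simp add: scaleR_diff_left[symmetric] left_diff_distrib[symmetric] abs_mult)
      then show ?thesis using near_lower[OF p1P G(1)[OF that(1)] G(1)[OF that(2)]] by (simp add: mult_ac)
    qed
    let ?f = "\<lambda>s. b p0 (\<psi> (G s)) - b p1 (\<psi> (G s))"
    have contf: "continuous_on {0..1} ?f"
    proof (rule lipschitz_on_continuous_on, rule lipschitz_onI)
      fix s t :: real assume st: "s \<in> {0..1}" "t \<in> {0..1}"
      have "\<bar>?f s - ?f t\<bar> \<le> 5/4 * norm (G s - G t) * norm (p0 - p1)"
        by (rule b_lipschitz[OF p0_in(2) p1P G(1)[OF st(1)] G(1)[OF st(2)]])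
      also have "\<dots> \<le> 5/4 * (4/3 * T * \<bar>s - t\<bar>) * norm (p0 - p1)"
        by (intro mult_right_mono mult_left_mono lip st) auto
      finally show "dist (?f s) (?f t) \<le> (5/3 * T * norm (p0 - p1)) * dist s t"
        by (simp add: dist_real_def algebra_simps)
    qed (use T0 in auto)
    have "\<psi> (G 1) = \<psi> y"
      by (rule inj_onD[OF Qinj[OF p1P]]) (use G[of 1] y(2) yb psi in auto)
    then have f1: "?f 1 \<le> - h" using False by simp
    have f0: "- h \<le> ?f 0"
    proof -
      have "\<psi> (G 0) = xb"
        by (rule inj_onD[OF Qinj[OF p1P]]) (use G[of 0] p1P psi in auto)
      then show ?thesis using b0 p1P h by simp
    qed
    have "\<exists>s. 0 \<le> s \<and> s \<le> 1 \<and> ?f s = - h"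
      by (rule IVT2'[OF f1 f0 zero_le_one contf])
    then obtain s where s: "0 \<le> s" "s \<le> 1" "?f s = - h"
      by (elim exE conjE)
    have sI: "s \<in> {0..1}" using s by simp
    have "s \<noteq> 0"
    proof
      assume "s = 0"
      moreover have "\<psi> (G 0) = xb"
        by (rule inj_onD[OF Qinj[OF p1P]]) (use G[of 0] p1P psi in auto)
      ultimately show False using s(3) b0 p1P h by simp
    qed
    then have sT: "0 < s * T" using s T0 by simp
    have "s * T \<le> 1 * T" using s T0 by (intro mult_right_mono) auto
    then have sT8: "s * T \<le> \<rho> / 8" using Tle by simp
    have neg: "b x (\<psi> (G s)) - b p1 (\<psi> (G s)) \<le> 0" if "x \<in> K" for x
    proof -
      have xP: "x \<in> P" using that K by auto
      have "b x (\<psi> (G s)) - b p1 (\<psi> (G s)) \<le> max (b x xb - b p1 xb) (b x (\<psi> y) - b p1 (\<psi> y))"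
        by (rule loeper[OF xP p1P xb_in psi(1)[OF yb] psi(1)[OF G(1)[OF sI]] sI])
          (use G(2)[OF sI] y(2) p1P in simp)
      then show ?thesis using f(1)[OF that] b0 xP p1P by simp
    qed
    have "h / 2 ^ k \<le> 4 * (s * T) * (v \<bullet> (p1 - p0))"
      using depth_lower[OF p0_in(2) p1P G(1)[OF sI] v1 G(2)[OF sI] sT sT8 dpos] s(3) hk by simp
    then show ?thesis using that[OF sT sT8 inE[OF G(1)[OF sI] neg] G(2)[OF sI]] s(3) by simp
  qed
qed

end

section \<open>The convex set of foci and its volume\<close>

context cost_section
begin

text \<open>The cut at \<rho> / 4 keeps convex combinations of gradients within the radius 3/4
  \<rho> of \<open>patch_surj\<close>, so that each again comes from a focus in the patch.\<close>

definition E0 :: "(real^'n) set" where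
  "E0 = {y \<in> E. norm (Q p0 (\<psi> y)) \<le> \<rho> / 4}"

lemma E0_image_convex: "convex ((\<lambda>y. Q p0 (\<psi> y)) ` E0)"
proof (rule convexI)
  fix q q' s t
  assume qq': "q \<in> (\<lambda>y. Q p0 (\<psi> y)) ` E0" "q' \<in> (\<lambda>y. Q p0 (\<psi> y)) ` E0" and st: "0 \<le> (s::real)" "0 \<le> t" "s + t = 1"
  from qq' obtain y y' where y: "y \<in> E0" "y' \<in> E0" "q = Q p0 (\<psi> y)" "q' = Q p0 (\<psi> y')" by auto
  have n: "norm (s *\<^sub>R q + t *\<^sub>R q') \<le> \<rho> / 4"
  proof -
    have "s *\<^sub>R q + t *\<^sub>R q' \<in> cball 0 (\<rho> / 4)"
      using y by (intro convexD[OF convex_cball] st) (auto simp: E0_def)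
    then show ?thesis by simp
  qed
  then have "norm (s *\<^sub>R q + t *\<^sub>R q') < 3/4 * \<rho>" using cst by linarith
  then obtain z where z: "z \<in> ball 0 \<rho>" "Q p0 (\<psi> z) = s *\<^sub>R q + t *\<^sub>R q'"
    by (rule patch_surj[OF p0_in(2)])
  have "1 - t = s" using st by simp
  then have Qz: "Q p0 (\<psi> z) = (1 - t) *\<^sub>R Q p0 (\<psi> y) + t *\<^sub>R Q p0 (\<psi> y')"
    using z(2) y(3,4) by simp
  have yb: "y \<in> ball 0 \<rho>" "y' \<in> ball 0 \<rho>" and tI: "t \<in> {0..1}"
    using y(1,2) st unfolding E0_def E_def by auto
  have "b x (\<psi> z) - b p0 (\<psi> z) \<le> h" if x: "x \<in> K" for x
  proof -
    have "x \<in> P" using x K(1) by blast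
    from loeper[OF this p0_in(2) psi(1)[OF yb(1)] psi(1)[OF yb(2)] psi(1)[OF z(1)] tI Qz]
    have "b x (\<psi> z) - b p0 (\<psi> z) \<le> max (b x (\<psi> y) - b p0 (\<psi> y)) (b x (\<psi> y') - b p0 (\<psi> y'))" .
    moreover have "b x (\<psi> y) - b p0 (\<psi> y) \<le> h" "b x (\<psi> y') - b p0 (\<psi> y') \<le> h"
      using y(1,2) x unfolding E0_def E_def by blast+
    ultimately show ?thesis by linarith
  qed
  then have "z \<in> E0" using z n by (simp add: E0_def E_def)
  then show "s *\<^sub>R q + t *\<^sub>R q' \<in> (\<lambda>y. Q p0 (\<psi> y)) ` E0" using z(2) by (metis image_eqI)
qed

text \<open>Multiplying h / 2 ^ k \<le> 4 T_i d_i over the frame bounds h^n by the product of the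
  T_i, comparable with a volume of foci, and the product of the d_i. For i other than i0 the width
  bound replaces d_i by 2 \<open>hg i\<close>, and l times the product of these \<open>hg i\<close>
  is at most n^n |K|; the factor d for i0 is kept, as it is the distance to a supporting
  hyperplane.\<close>

lemma aleksandrov_core:
  assumes v1: "norm v = 1" and seg: "a \<in> K" "a + l *\<^sub>R v \<in> K" "0 < l"
    and p1: "p1 \<in> K" and top: "\<And>x. x \<in> K \<Longrightarrow> v \<bullet> x \<le> v \<bullet> p1"
    and \<delta>: "\<And>(e :: 'n \<Rightarrow> real^'n) g. \<lbrakk>\<And>i j. e i \<bullet> e j = (if i = j then 1 else 0); \<And>i. norm (g i) \<le> \<delta>\<rbrakk> \<Longrightarrow>
       1 / 2 \<le> \<bar>det (\<chi> i. e i + g i)\<bar>" and \<epsilon>\<delta>: "3 * \<epsilon> \<le> \<delta>"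
  obtains B and m :: real where "B \<subseteq> (\<lambda>y. Q p0 (\<psi> y)) ` E0" "compact B" "0 \<le> m" "emeasure lborel B = ennreal m"
    "h ^ CARD('n) * l \<le> (2 ^ k * 8) ^ CARD('n) * 2 * real CARD('n) ^ CARD('n) * real CARD('n) ^ CARD('n) *
       m * (v \<bullet> (p1 - p0)) * measure lborel K"
proof -
  have intK: "interior K \<noteq> {}" using p0 by auto
  obtain e and hg :: "'n \<Rightarrow> real" and i0 :: 'n where e0: "e i0 = v" and on: "\<And>i j. e i \<bullet> e j = (if i = j then 1 else 0)"
    and hg: "\<And>i. 0 < hg i" and wd: "\<And>i p q. i \<noteq> i0 \<Longrightarrow> p \<in> K \<Longrightarrow> q \<in> K \<Longrightarrow> \<bar>e i \<bullet> (p - q)\<bar> \<le> 2 * hg i"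
    and vol: "ennreal (l * (\<Prod>i\<in>UNIV - {i0}. hg i) / CARD('n) ^ CARD('n)) \<le> emeasure lborel K"
    by (rule greedy_frame[OF K(2,3) intK seg(1) v1 seg(2,3)]) blast
  define N where "N = real CARD('n) ^ CARD('n)"
  have N: "N > 0" by (simp add: N_def)
  have Kne: "K \<noteq> {}" using seg by auto
  have "\<exists>x\<in>K. \<forall>z\<in>K. e i \<bullet> z \<le> e i \<bullet> x" for i
    by (rule continuous_attains_sup[OF K(2) Kne]) (intro continuous_intros)
  then obtain T0 where T0: "\<And>i. T0 i \<in> K" "\<And>i z. z \<in> K \<Longrightarrow> e i \<bullet> z \<le> e i \<bullet> T0 i"
    by metis
  have e1: "norm (e i) = 1" for i using on[of i i] by (simp add: norm_eq_1)
  define d where "d i = e i \<bullet> (T0 i - p0)" for i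
  have "\<exists>T y. 0 < T \<and> T \<le> \<rho> / 8 \<and> y \<in> E \<and> Q (T0 i) (\<psi> y) = T *\<^sub>R e i \<and> h / 2 ^ k \<le> 4 * T * d i" for i
    unfolding d_def by (rule direction_in_E[OF T0(1) T0(2) e1, of i]) blast+
  then obtain T y where T: "\<And>i. 0 < T i" "\<And>i. T i \<le> \<rho> / 8" and yE: "\<And>i. y i \<in> E"
    and Qy: "\<And>i. Q (T0 i) (\<psi> (y i)) = T i *\<^sub>R e i" and hd: "\<And>i. h / 2 ^ k \<le> 4 * T i * d i"
    by metis
  have yb: "y i \<in> ball 0 \<rho>" for i using yE[of i] by (simp add: E_def)
  have TP: "T0 i \<in> P" for i using T0(1) K(1) by blast
  define w where "w i = Q p0 (\<psi> (y i))" for i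
  \<comment> \<open>The gradients at p0 and at \<open>T0 i\<close> belong to the same focus y i and
    are each within \<epsilon> |y i| of it; |y i| \<le> 4/3 T_i gives 8/3 \<epsilon> T_i.\<close>
  have wT: "norm (w i - T i *\<^sub>R e i) \<le> 3 * \<epsilon> * T i" for i
  proof -
    have nr: "norm (Q p (\<psi> (y i)) - y i) \<le> \<epsilon> * norm (y i)" if "p \<in> P" for p
      using near[OF that yb[of i], of 0] that psi(2) cst by simp
    have ny: "norm (y i) \<le> 4/3 * T i"
      using norm_y_le[OF TP yb, of i i] Qy[of i] e1[of i] T(1)[of i] by simp
    have "norm (w i - T i *\<^sub>R e i) \<le> norm (Q p0 (\<psi> (y i)) - y i) + norm (Q (T0 i) (\<psi> (y i)) - y i)"
      using norm_triangle_ineq4[of "Q p0 (\<psi> (y i)) - y i" "Q (T0 i) (\<psi> (y i)) - y i"] by (simp add: w_def Qy)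
    also have "\<dots> \<le> \<epsilon> * norm (y i) + \<epsilon> * norm (y i)" by (intro add_mono nr TP p0_in)
    also have "\<dots> = 2 * (\<epsilon> * norm (y i))" by simp
    also have "\<dots> \<le> 2 * (\<epsilon> * (4/3 * T i))" using cst by (intro mult_left_mono ny) auto
    also have "\<dots> = 8/3 * (\<epsilon> * T i)" by simp
    also have "\<dots> \<le> 3 * (\<epsilon> * T i)" using cst T(1)[of i] by (intro mult_right_mono) auto
    finally show ?thesis by simp
  qed
  define g where "g i = (1 / T i) *\<^sub>R (w i - T i *\<^sub>R e i)" for i
  have g: "norm (g i) \<le> \<delta>" for i
  proof -
    have "norm (g i) = norm (w i - T i *\<^sub>R e i) / T i" using T(1)[of i] by (simp add: g_def)
    also have "\<dots> \<le> 3 * \<epsilon> * T i / T i" using T(1)[of i] by (intro divide_right_mono wT) auto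
    also have "\<dots> = 3 * \<epsilon>" using T(1)[of i] by simp
    finally show ?thesis using \<epsilon>\<delta> by simp
  qed
  have wg: "w i = T i *s (e i + g i)" for i
    using T(1)[of i] by (simp add: g_def scalar_mult_eq_scaleR scaleR_add_right)
  have "det (\<chi> i. w i) = (\<Prod>i\<in>UNIV. T i) * det (\<chi> i. e i + g i)"
    unfolding wg by (rule det_rows_mul)
  moreover have Tp: "0 < (\<Prod>i\<in>UNIV. T i)" using T(1) by (intro prod_pos) auto
  moreover have dge: "1/2 \<le> \<bar>det (\<chi> i. e i + g i)\<bar>" by (rule \<delta>[OF on g])
  ultimately have detw: "(\<Prod>i\<in>UNIV. T i) \<le> 2 * \<bar>det (\<chi> i. w i)\<bar>"
    using mult_left_mono[OF dge, of "\<Prod>i\<in>UNIV. T i"] by (simp add: abs_mult)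
  then have det0: "det (\<chi> i. w i) \<noteq> 0" using Tp by auto
  \<comment> \<open>Parallelepiped of side 1 / n inside the simplex spanned by 0 and the w i;
    convexity of the image of \<open>E0\<close> absorbs it.\<close>
  define B where "B = (\<lambda>t. 0 + transpose (\<chi> i. w i) *v t) ` cbox 0 (vec (1 / CARD('n)))"
  define m where "m = \<bar>det (\<chi> i. w i)\<bar> / N"
  have Bm: "emeasure lborel B = ennreal m"
    unfolding B_def m_def N_def using emeasure_parallelepiped[OF det0, of 0] by simp
  have m0: "0 \<le> m" using N by (simp add: m_def)
  have Bc: "compact B" unfolding B_def
    by (intro compact_continuous_image continuous_intros linear_continuous_on matrix_vector_mul_bounded_linear compact_cbox)
  have BE: "B \<subseteq> (\<lambda>y. Q p0 (\<psi> y)) ` E0"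
    unfolding B_def
  proof (rule convex_contains_parallelepiped[OF E0_image_convex])
    have "0 \<in> E0" using cst h psi(2) b0 K(1) by (auto simp: E0_def E_def subset_iff)
    moreover have "Q p0 (\<psi> 0) = 0" using psi(2) by simp
    ultimately show "0 \<in> (\<lambda>y. Q p0 (\<psi> y)) ` E0" by (metis image_eqI)
    fix i
    \<comment> \<open>7/4 T_i \<le> 7/32 \<rho> \<le> \<rho> / 4, so the foci respect the cut in
      \<open>E0\<close>.\<close>
    have "norm (w i) \<le> norm (w i - T i *\<^sub>R e i) + norm (T i *\<^sub>R e i)"
      using norm_triangle_ineq[of "w i - T i *\<^sub>R e i" "T i *\<^sub>R e i"] by simp
    also have "\<dots> \<le> 3 * \<epsilon> * T i + T i" using wT[of i] e1[of i] T(1)[of i] by simp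
    also have "\<dots> \<le> 3/4 * T i + T i" using cst T(1)[of i] by simp
    also have "\<dots> \<le> \<rho> / 4" using T(2)[of i] cst by simp
    finally have "y i \<in> E0" using yE[of i] by (simp add: E0_def w_def)
    then show "0 + w i \<in> (\<lambda>y. Q p0 (\<psi> y)) ` E0" by (simp add: w_def)
  qed
  have d_le: "d i \<le> 2 * hg i" if "i \<noteq> i0" for i
    using wd[OF that T0(1)[of i] p0_in(1)] by (simp add: d_def)
  have d_pos: "0 < d i" for i
  proof -
    have "0 < h / 2 ^ k" using h by simp
    then have "0 < 4 * T i * d i" using hd[of i] by linarith
    then show ?thesis using T(1)[of i] by (simp add: zero_less_mult_iff)
  qed
  \<comment> \<open>\<open>T0 i0\<close> and p1 both maximise v over K.\<close>
  have di0: "d i0 = v \<bullet> (p1 - p0)"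
    using T0(2)[OF p1, of i0] top[OF T0(1)[of i0]] e0 by (simp add: d_def inner_diff_right)
  let ?n = "CARD('n)"
  have "(h / 2 ^ k) ^ ?n = (\<Prod>i\<in>(UNIV::'n set). h / 2 ^ k)" by simp
  also have "\<dots> \<le> (\<Prod>i\<in>UNIV. 4 * T i * d i)"
    by (rule prod_mono) (use hd h in auto)
  also have "\<dots> = 4 ^ ?n * (\<Prod>i\<in>UNIV. T i) * (\<Prod>i\<in>UNIV. d i)"
    by (simp add: prod.distrib)
  also have "(\<Prod>i\<in>UNIV. d i) = d i0 * (\<Prod>i\<in>UNIV - {i0}. d i)"
    by (rule prod.remove) auto
  also have "4 ^ ?n * (\<Prod>i\<in>UNIV. T i) * (d i0 * (\<Prod>i\<in>UNIV - {i0}. d i)) \<le>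
      4 ^ ?n * (\<Prod>i\<in>UNIV. T i) * (d i0 * (2 ^ ?n * (\<Prod>i\<in>UNIV - {i0}. hg i)))"
  proof (intro mult_left_mono)
    have "(\<Prod>i\<in>UNIV - {i0}. d i) \<le> (\<Prod>i\<in>UNIV - {i0}. 2 * hg i)"
      by (rule prod_mono) (use d_le d_pos in \<open>auto intro: less_imp_le\<close>)
    also have "\<dots> = 2 ^ card (UNIV - {i0}) * (\<Prod>i\<in>UNIV - {i0}. hg i)" by (simp add: prod.distrib)
    also have "\<dots> \<le> 2 ^ ?n * (\<Prod>i\<in>UNIV - {i0}. hg i)"
      using hg by (intro mult_right_mono power_increasing card_mono prod_nonneg) (auto intro: less_imp_le)
    finally show "(\<Prod>i\<in>UNIV - {i0}. d i) \<le> 2 ^ ?n * (\<Prod>i\<in>UNIV - {i0}. hg i)" .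
  qed (use d_pos[of i0] Tp in auto)
  finally have 1: "(h / 2 ^ k) ^ ?n \<le> 4 ^ ?n * (\<Prod>i\<in>UNIV. T i) * (d i0 * (2 ^ ?n * (\<Prod>i\<in>UNIV - {i0}. hg i)))" .
  have volK: "l * (\<Prod>i\<in>UNIV - {i0}. hg i) \<le> N * measure lborel K"
  proof -
    have "emeasure lborel K < \<infinity>" using emeasure_bounded_finite[of K] K(2) by (simp add: compact_imp_bounded)
    then have "emeasure lborel K = ennreal (measure lborel K)" by (simp add: emeasure_eq_ennreal_measure)
    then have "l * (\<Prod>i\<in>UNIV - {i0}. hg i) / N \<le> measure lborel K"
      using vol by (simp add: N_def ennreal_le_iff)
    then show ?thesis using N by (simp add: field_simps)
  qed
  have Tm: "(\<Prod>i\<in>UNIV. T i) \<le> 2 * N * m" using detw N by (simp add: m_def)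
  have "(h / 2 ^ k) ^ ?n * l \<le> 4 ^ ?n * (\<Prod>i\<in>UNIV. T i) * (d i0 * (2 ^ ?n * (\<Prod>i\<in>UNIV - {i0}. hg i))) * l"
    using seg(3) by (intro mult_right_mono 1) auto
  also have "\<dots> = (4 ^ ?n * 2 ^ ?n * d i0) * ((\<Prod>i\<in>UNIV. T i) * (l * (\<Prod>i\<in>UNIV - {i0}. hg i)))"
    by (simp only: mult_ac)
  also have "\<dots> \<le> (4 ^ ?n * 2 ^ ?n * d i0) * ((2 * N * m) * (N * measure lborel K))"
  proof (rule mult_left_mono)
    have "0 \<le> (\<Prod>i\<in>UNIV - {i0}. hg i)" using hg by (intro prod_nonneg) (auto intro: less_imp_le)
    then show "(\<Prod>i\<in>UNIV. T i) * (l * (\<Prod>i\<in>UNIV - {i0}. hg i)) \<le> (2 * N * m) * (N * measure lborel K)"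
      using seg(3) N m0 by (intro mult_mono Tm volK) auto
  qed (use d_pos[of i0] in simp)
  also have "(4::real) ^ ?n * 2 ^ ?n = 8 ^ ?n" by (simp add: power_mult_distrib[symmetric])
  finally have 2: "(h / 2 ^ k) ^ ?n * l \<le> 8 ^ ?n * d i0 * (2 * N * m * (N * measure lborel K))" .
  have "h ^ ?n * l = (2 ^ k) ^ ?n * ((h / 2 ^ k) ^ ?n * l)" by (simp add: power_divide)
  also have "\<dots> \<le> (2 ^ k) ^ ?n * (8 ^ ?n * d i0 * (2 * N * m * (N * measure lborel K)))"
    by (intro mult_left_mono 2) auto
  also have "\<dots> = (2 ^ k * 8) ^ ?n * 2 * N * N * m * d i0 * measure lborel K"
    by (simp add: power_mult_distrib mult_ac)
  finally have "h ^ ?n * l \<le> (2 ^ k * 8) ^ ?n * 2 * N * N * m * (v \<bullet> (p1 - p0)) * measure lborel K"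
    unfolding di0 .
  then show ?thesis using that[OF BE Bc m0 Bm] unfolding N_def by simp
qed

end

section \<open>Riemannian manifolds and their volume\<close>

lemma linear_axis_expand:
  fixes f :: "real^'n::finite \<Rightarrow> real"
  assumes "linear f"
  shows "f h = (\<Sum>i\<in>UNIV. f (axis i 1) * h $ i)"
proof -
  have e: "(\<Sum>i\<in>UNIV. h $ i *\<^sub>R axis i 1) = h"
    using basis_expansion[of h] by (simp only: scalar_mult_eq_scaleR)
  have "f h = f (\<Sum>i\<in>UNIV. h $ i *\<^sub>R axis i 1)"
    by (simp only: e)
  also have "\<dots> = (\<Sum>i\<in>UNIV. f (axis i 1) * h $ i)"
    using assms by (simp add: linear_sum linear_scale mult.commute)
  finally show ?thesis .
qed

lemma partial_eqI: "(f has_derivative f') (at y) \<Longrightarrow> partial i f y = f' (axis i 1)"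
  by (simp add: partial_def frechet_derivative_at[symmetric])

lemma has_derivative_partial:
  fixes f :: "real^'n::finite \<Rightarrow> real"
  assumes "f differentiable at y"
  shows "(f has_derivative (\<lambda>h. \<Sum>i\<in>UNIV. partial i f y * h $ i)) (at y)"
proof -
  have d: "(f has_derivative frechet_derivative f (at y)) (at y)"
    using assms by (simp add: frechet_derivative_works)
  have "frechet_derivative f (at y) = (\<lambda>h. \<Sum>i\<in>UNIV. partial i f y * h $ i)"
    unfolding partial_def by (rule ext, rule linear_axis_expand[OF has_derivative_linear[OF d]])
  with d show ?thesis by simp
qed

lemma has_derivative_vecI:
  fixes f :: "'a::euclidean_space \<Rightarrow> real^'n::finite"
  assumes "\<And>i. ((\<lambda>y. f y $ i) has_derivative (\<lambda>h. f' h $ i)) (at y within S)"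
  shows "(f has_derivative f') (at y within S)"
  unfolding has_derivative_componentwise_within[of f]
  using assms by (auto simp: Basis_vec_def inner_axis)

lemma has_derivative_vecD:
  fixes f :: "'a::real_normed_vector \<Rightarrow> real^'n::finite"
  assumes "(f has_derivative f') (at y within S)"
  shows "((\<lambda>y. f y $ i) has_derivative (\<lambda>h. f' h $ i)) (at y within S)"
  using bounded_linear.has_derivative[OF bounded_linear_vec_nth assms] .

lemma has_derivative_jacobian:
  fixes f :: "real^'m::finite \<Rightarrow> real^'n::finite"
  assumes "\<And>i. (\<lambda>y. f y $ i) differentiable at y"
  shows "(f has_derivative (*v) (jacobian f (at y))) (at y)"
    and "jacobian f (at y) $ i $ j = partial j (\<lambda>y. f y $ i) y"
proof -
  let ?f' = "\<lambda>h. \<chi> i. \<Sum>j\<in>UNIV. partial j (\<lambda>y. f y $ i) y * h $ j"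
  have "(f has_derivative ?f') (at y)"
    by (rule has_derivative_vecI) (simp add: has_derivative_partial assms)
  then have "f differentiable at y" by (auto simp: differentiable_def)
  then show d: "(f has_derivative (*v) (jacobian f (at y))) (at y)"
    by (simp add: jacobian_works)
  have "partial j (\<lambda>y. f y $ i) y = (jacobian f (at y) *v axis j 1) $ i"
    by (rule partial_eqI[OF has_derivative_vecD[OF d]])
  then show "jacobian f (at y) $ i $ j = partial j (\<lambda>y. f y $ i) y"
    by (simp add: matrix_vector_mul_component inner_axis row_def matrix_vector_mult_basis column_def)
qed

lemma jacobian_eqI:
  fixes f :: "real^'m::finite \<Rightarrow> real^'n::finite"
  assumes "(f has_derivative (*v) A) (at y)"
  shows "jacobian f (at y) = A"
  by (simp add: jacobian_def frechet_derivative_at[OF assms, symmetric] matrix_of_matrix_vector_mul)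

lemma inner_transpose: "v \<bullet> (transpose A *v w) = (A *v v) \<bullet> (w :: real^'n::finite)"
  by (metis dot_lmul_matrix inner_commute transpose_matrix_vector)

lemma smooth_onD:
  assumes "smooth_on V f"
  shows "y \<in> V \<Longrightarrow> f differentiable at y" "continuous_on V f" "smooth_on V (partial i f)"
proof -
  have *: "Ck_on (Suc k) V f" for k using assms by (simp add: smooth_on_def del: Ck_on.simps)
  show "y \<in> V \<Longrightarrow> f differentiable at y" using *[of 0] by simp
  show "continuous_on V f" using assms by (metis smooth_on_def Ck_on.simps(1))
  show "smooth_on V (partial i f)" using * by (simp add: smooth_on_def)
qed

section \<open>Transition maps, their Jacobians and the metric in charts\<close>

definition trans :: "('m, 'n::finite) chart \<Rightarrow> ('m, 'n) chart \<Rightarrow> real^'n \<Rightarrow> real^'n" where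
  "trans ct ct' y = snd ct' (chart_inv ct y)"

definition tjac :: "('m, 'n::finite) chart \<Rightarrow> ('m, 'n) chart \<Rightarrow> real^'n \<Rightarrow> real^'n^'n" where
  "tjac ct ct' y = jacobian (trans ct ct') (at y)"

locale rmanifold =
  fixes M :: "('m::{t2_space,second_countable_topology}, 'n::finite) rmfd"
  assumes riemannian: "riemannian_manifold M"
begin

lemma chart_at: "chart_at M x \<in> charts M" "x \<in> fst (chart_at M x)"
proof -
  have "\<exists>ct. ct \<in> charts M \<and> x \<in> fst ct"
    using riemannian unfolding riemannian_manifold_def by blast
  from someI_ex[OF this] show "chart_at M x \<in> charts M" "x \<in> fst (chart_at M x)"
    unfolding chart_at_def by auto
qed

lemma chart_open: "ct \<in> charts M \<Longrightarrow> open (fst ct)" "ct \<in> charts M \<Longrightarrow> open (snd ct ` fst ct)"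
  using riemannian unfolding riemannian_manifold_def by blast+

lemma chart_homeo: "ct \<in> charts M \<Longrightarrow> homeomorphism (fst ct) (snd ct ` fst ct) (snd ct) (chart_inv ct)"
  using riemannian unfolding riemannian_manifold_def by blast

lemma chart_inv1: "ct \<in> charts M \<Longrightarrow> x \<in> fst ct \<Longrightarrow> chart_inv ct (snd ct x) = x"
  using homeomorphism_apply1[OF chart_homeo] .

lemma chart_inv2: "ct \<in> charts M \<Longrightarrow> y \<in> snd ct ` fst ct \<Longrightarrow> snd ct (chart_inv ct y) = y"
  using homeomorphism_apply2[OF chart_homeo] .

lemma chart_inv_in:
  assumes "ct \<in> charts M" "y \<in> snd ct ` fst ct"
  shows "chart_inv ct y \<in> fst ct"
  using assms(2) chart_inv1[OF assms(1)] by auto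

lemma chart_cont: "ct \<in> charts M \<Longrightarrow> continuous_on (fst ct) (snd ct)"
  "ct \<in> charts M \<Longrightarrow> continuous_on (snd ct ` fst ct) (chart_inv ct)"
  using chart_homeo homeomorphism_def by blast+

lemma chart_inj: "ct \<in> charts M \<Longrightarrow> inj_on (snd ct) (fst ct)"
  using chart_inv1 by (metis inj_onI)

lemma chart_image_eq:
  assumes "ct \<in> charts M" "A \<subseteq> fst ct"
  shows "snd ct ` A = {y \<in> snd ct ` fst ct. chart_inv ct y \<in> A}"
proof (intro set_eqI iffI)
  fix y assume "y \<in> {y \<in> snd ct ` fst ct. chart_inv ct y \<in> A}"
  then have "y = snd ct (chart_inv ct y)" "chart_inv ct y \<in> A" using chart_inv2[OF assms(1)] by auto
  then show "y \<in> snd ct ` A" by (rule image_eqI)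
next
  fix y assume "y \<in> snd ct ` A"
  then show "y \<in> {y \<in> snd ct ` fst ct. chart_inv ct y \<in> A}"
    using assms(2) chart_inv1[OF assms(1)] by auto
qed

lemma chart_image_open:
  assumes ct: "ct \<in> charts M" and A: "open A"
  shows "open (snd ct ` (fst ct \<inter> A))"
proof -
  have "snd ct ` (fst ct \<inter> A) = snd ct ` fst ct \<inter> chart_inv ct -` A"
    using chart_image_eq[OF ct, of "fst ct \<inter> A"] chart_inv_in[OF ct] by blast
  then show ?thesis
    using continuous_on_open_vimage[OF chart_open(2)[OF ct], of "chart_inv ct"] chart_cont(2)[OF ct] A
    by (metis Int_commute)
qed

lemma chart_inv_image_open:
  assumes ct: "ct \<in> charts M" and A: "open A" "A \<subseteq> snd ct ` fst ct"
  shows "open (chart_inv ct ` A)"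
proof -
  have "chart_inv ct ` A = fst ct \<inter> snd ct -` A"
  proof (intro set_eqI iffI)
    fix x assume "x \<in> fst ct \<inter> snd ct -` A"
    then have "x = chart_inv ct (snd ct x)" "snd ct x \<in> A" using chart_inv1[OF ct] by auto
    then show "x \<in> chart_inv ct ` A" by (rule image_eqI)
  next
    fix x assume "x \<in> chart_inv ct ` A"
    then obtain y where y: "y \<in> A" "x = chart_inv ct y" by blast
    then have "y \<in> snd ct ` fst ct" using A(2) by blast
    then show "x \<in> fst ct \<inter> snd ct -` A"
      using y chart_inv_in[OF ct] chart_inv2[OF ct] by simp
  qed
  then show ?thesis
    using continuous_on_open_vimage[OF chart_open(1)[OF ct], of "snd ct"] chart_cont(1)[OF ct] A(1)
    by (metis Int_commute)
qed

lemma chart_image_borel: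
  assumes ct: "ct \<in> charts M" and A: "A \<in> sets borel" "A \<subseteq> fst ct"
  shows "snd ct ` A \<in> sets borel"
proof -
  have "chart_inv ct \<in> borel_measurable (restrict_space borel (snd ct ` fst ct))"
    using chart_cont(2)[OF ct] by (rule borel_measurable_continuous_on_restrict)
  from measurable_sets[OF this A(1)]
  have "chart_inv ct -` A \<inter> snd ct ` fst ct \<in> sets borel"
    using chart_open(2)[OF ct] by (simp add: space_restrict_space sets_restrict_space_iff)
  also have "chart_inv ct -` A \<inter> snd ct ` fst ct = snd ct ` A"
    unfolding chart_image_eq[OF ct A(2)] by auto
  finally show ?thesis .
qed

lemma overlap:
  assumes "ct \<in> charts M" "ct' \<in> charts M" "y \<in> snd ct ` (fst ct \<inter> fst ct')"
  shows "y \<in> snd ct ` fst ct" "chart_inv ct y \<in> fst ct" "chart_inv ct y \<in> fst ct'"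
    "trans ct ct' y \<in> snd ct' ` (fst ct' \<inter> fst ct)" "chart_inv ct' (trans ct ct' y) = chart_inv ct y"
    "snd ct (chart_inv ct y) = y"
proof -
  obtain x where x: "y = snd ct x" "x \<in> fst ct" "x \<in> fst ct'" using assms(3) by blast
  then have e: "chart_inv ct y = x" using chart_inv1[OF assms(1)] by simp
  show "y \<in> snd ct ` fst ct" "chart_inv ct y \<in> fst ct" "chart_inv ct y \<in> fst ct'"
    "trans ct ct' y \<in> snd ct' ` (fst ct' \<inter> fst ct)" "chart_inv ct' (trans ct ct' y) = chart_inv ct y"
    "snd ct (chart_inv ct y) = y"
    using x e chart_inv1[OF assms(2)] by (auto simp: trans_def)
qed

lemma overlap_open: "ct \<in> charts M \<Longrightarrow> ct' \<in> charts M \<Longrightarrow> open (snd ct ` (fst ct \<inter> fst ct'))"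
  by (intro chart_image_open chart_open)

lemma trans_smooth:
  assumes "ct \<in> charts M" "ct' \<in> charts M"
  shows "smooth_on (snd ct ` (fst ct \<inter> fst ct')) (\<lambda>y. trans ct ct' y $ i)"
  using riemannian assms unfolding riemannian_manifold_def trans_def by blast

lemma trans_deriv:
  assumes "ct \<in> charts M" "ct' \<in> charts M" "y \<in> snd ct ` (fst ct \<inter> fst ct')"
  shows "(trans ct ct' has_derivative (*v) (tjac ct ct' y)) (at y)"
    and "tjac ct ct' y $ i $ j = partial j (\<lambda>y. trans ct ct' y $ i) y"
  unfolding tjac_def
  using has_derivative_jacobian smooth_onD(1)[OF trans_smooth[OF assms(1,2)] assms(3)] by blast+

lemma tjac_entry_smooth:
  assumes "ct \<in> charts M" "ct' \<in> charts M" "y \<in> snd ct ` (fst ct \<inter> fst ct')"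
  shows "(\<lambda>y. tjac ct ct' y $ i $ j) differentiable at y"
    "partial l (\<lambda>y. tjac ct ct' y $ i $ j) y = partial l (partial j (\<lambda>y. trans ct ct' y $ i)) y"
proof -
  let ?O = "snd ct ` (fst ct \<inter> fst ct')"
  have d: "partial j (\<lambda>y. trans ct ct' y $ i) differentiable at y"
    using smooth_onD(1)[OF smooth_onD(3)[OF trans_smooth[OF assms(1,2)]] assms(3)] .
  then obtain D where D: "(partial j (\<lambda>y. trans ct ct' y $ i) has_derivative D) (at y)"
    by (auto simp: differentiable_def)
  have D': "((\<lambda>y. tjac ct ct' y $ i $ j) has_derivative D) (at y)"
    by (rule has_derivative_transform_within_open[OF D overlap_open[OF assms(1,2)] assms(3)])
       (simp add: trans_deriv(2)[OF assms(1,2)])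
  then show "(\<lambda>y. tjac ct ct' y $ i $ j) differentiable at y"
    by (auto simp: differentiable_def)
  show "partial l (\<lambda>y. tjac ct ct' y $ i $ j) y = partial l (partial j (\<lambda>y. trans ct ct' y $ i)) y"
    by (simp add: partial_eqI[OF D] partial_eqI[OF D'])
qed

lemma tjac_cont:
  assumes "ct \<in> charts M" "ct' \<in> charts M"
  shows "continuous_on (snd ct ` (fst ct \<inter> fst ct')) (tjac ct ct')"
proof -
  have "continuous_on (snd ct ` (fst ct \<inter> fst ct')) (\<lambda>y. \<chi> i j. partial j (\<lambda>y. trans ct ct' y $ i) y)"
    by (intro continuous_on_vec_lambda smooth_onD(2)[OF smooth_onD(3)[OF trans_smooth[OF assms]]])
  then show ?thesis
    by (rule continuous_on_eq) (simp add: vec_eq_iff trans_deriv(2)[OF assms])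
qed

lemma trans_cont:
  assumes "ct \<in> charts M" "ct' \<in> charts M"
  shows "continuous_on (snd ct ` (fst ct \<inter> fst ct')) (trans ct ct')"
  by (rule has_derivative_continuous_on[OF has_derivative_at_withinI[OF trans_deriv(1)[OF assms]]])

lemma tjac_compose:
  assumes k: "ct \<in> charts M" "ct' \<in> charts M" "ct'' \<in> charts M" and x: "x \<in> fst ct" "x \<in> fst ct'" "x \<in> fst ct''"
  shows "tjac ct ct'' (snd ct x) = tjac ct' ct'' (snd ct' x) ** tjac ct ct' (snd ct x)"
proof -
  let ?y = "snd ct x"
  have ty: "trans ct ct' ?y = snd ct' x" using chart_inv1[OF k(1) x(1)] by (simp add: trans_def)
  have 1: "(trans ct ct' has_derivative (*v) (tjac ct ct' ?y)) (at ?y)"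
    by (rule trans_deriv(1)[OF k(1,2)]) (use x in auto)
  have 2: "(trans ct' ct'' has_derivative (*v) (tjac ct' ct'' (snd ct' x))) (at (trans ct ct' ?y))"
    unfolding ty by (rule trans_deriv(1)[OF k(2,3)]) (use x in auto)
  have "(trans ct' ct'' \<circ> trans ct ct' has_derivative (*v) (tjac ct' ct'' (snd ct' x)) \<circ> (*v) (tjac ct ct' ?y)) (at ?y)"
    by (rule diff_chain_at[OF 1 2])
  then have "(trans ct ct'' has_derivative (*v) (tjac ct' ct'' (snd ct' x)) \<circ> (*v) (tjac ct ct' ?y)) (at ?y)"
  proof (rule has_derivative_transform_within_open)
    show "open (snd ct ` (fst ct \<inter> (fst ct' \<inter> fst ct'')))"
      by (intro chart_image_open open_Int chart_open k)
    show "?y \<in> snd ct ` (fst ct \<inter> (fst ct' \<inter> fst ct''))" using x by blast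
    fix z assume "z \<in> snd ct ` (fst ct \<inter> (fst ct' \<inter> fst ct''))"
    then show "(trans ct' ct'' \<circ> trans ct ct') z = trans ct ct'' z"
      using chart_inv1[OF k(1)] chart_inv1[OF k(2)] by (auto simp: trans_def)
  qed
  moreover have "(*v) (tjac ct' ct'' (snd ct' x)) \<circ> (*v) (tjac ct ct' ?y) = (*v) (tjac ct' ct'' (snd ct' x) ** tjac ct ct' ?y)"
    by (auto simp: matrix_vector_mul_assoc)
  ultimately show ?thesis
    using jacobian_eqI by (auto simp: tjac_def)
qed

lemma tjac_same:
  assumes k: "ct \<in> charts M" and x: "x \<in> fst ct"
  shows "tjac ct ct (snd ct x) = mat 1"
proof -
  have "((\<lambda>z. z) has_derivative (*v) (mat 1)) (at (snd ct x))"
    by (simp add: matrix_vector_mul_lid[abs_def])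
  then have "(trans ct ct has_derivative (*v) (mat 1)) (at (snd ct x))"
    by (rule has_derivative_transform_within_open[OF _ chart_open(2)[OF k]])
      (use x chart_inv2[OF k] in \<open>auto simp: trans_def\<close>)
  then show ?thesis by (simp add: tjac_def jacobian_eqI)
qed

lemma tjac_inverse:
  assumes "ct \<in> charts M" "ct' \<in> charts M" "x \<in> fst ct" "x \<in> fst ct'"
  shows "tjac ct' ct (snd ct' x) ** tjac ct ct' (snd ct x) = mat 1"
  using tjac_compose[OF assms(1,2,1) assms(3,4,3)] tjac_same[OF assms(1,3)] by simp

lemma tjac_det:
  assumes "ct \<in> charts M" "ct' \<in> charts M" "x \<in> fst ct" "x \<in> fst ct'"
  shows "det (tjac ct ct' (snd ct x)) \<noteq> 0"
  using arg_cong[OF tjac_inverse[OF assms], of det] by (auto simp: det_mul)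

lemma gram_in_eq: "gram_in M ct x = transpose (tjac ct (chart_at M x) (snd ct x)) ** gram M x ** tjac ct (chart_at M x) (snd ct x)"
proof -
  have "snd (chart_at M x) \<circ> chart_inv ct = trans ct (chart_at M x)"
    by (auto simp: trans_def)
  then show ?thesis by (simp add: gram_in_def Let_def tjac_def)
qed

text \<open>\<open>gram_in\<close> refers to the chart chosen at each point, a choice that may jump
  from point to point; the cocycle identity for Jacobians eliminates it.\<close>

lemma gram_in_trans:
  assumes "ct \<in> charts M" "ct' \<in> charts M" "x \<in> fst ct" "x \<in> fst ct'"
  shows "gram_in M ct x = transpose (tjac ct ct' (snd ct x)) ** gram_in M ct' x ** tjac ct ct' (snd ct x)"
  unfolding gram_in_eq tjac_compose[OF assms(1,2) chart_at(1) assms(3,4) chart_at(2)]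
  by (simp add: matrix_transpose_mul matrix_mul_assoc)

lemma gram_in_chart_at: "gram_in M (chart_at M x) x = gram M x"
  by (simp add: gram_in_eq tjac_same[OF chart_at] transpose_mat matrix_mul_lid matrix_mul_rid)

lemma gram_pos: "v \<noteq> 0 \<Longrightarrow> v \<bullet> (gram M x *v v) > 0" and gram_sym: "transpose (gram M x) = gram M x"
  using riemannian unfolding riemannian_manifold_def by blast+

lemma gram_in_pos:
  assumes "ct \<in> charts M" "x \<in> fst ct" "v \<noteq> 0"
  shows "v \<bullet> (gram_in M ct x *v v) > 0"
proof -
  let ?J = "tjac ct (chart_at M x) (snd ct x)"
  have "?J *v v \<noteq> 0"
  proof
    assume "?J *v v = 0"
    then have "(tjac (chart_at M x) ct (snd (chart_at M x) x) ** ?J) *v v = 0"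
      by (simp add: matrix_vector_mul_assoc[symmetric])
    then show False using assms(3) by (simp add: tjac_inverse[OF assms(1) chart_at(1) assms(2) chart_at(2)])
  qed
  from gram_pos[OF this, of x] show ?thesis
    by (simp add: gram_in_eq matrix_vector_mul_assoc[symmetric] inner_transpose del: transpose_matrix_vector)
qed

lemma gram_in_sym: "transpose (gram_in M ct x) = gram_in M ct x"
  by (simp add: gram_in_eq matrix_transpose_mul gram_sym matrix_mul_assoc)

lemma gram_in_smooth:
  "ct \<in> charts M \<Longrightarrow> smooth_on (snd ct ` fst ct) (\<lambda>y. gram_in M ct (chart_inv ct y) $ i $ j)"
  using riemannian unfolding riemannian_manifold_def by blast

lemma gram_in_cont:
  assumes "ct \<in> charts M"
  shows "continuous_on (snd ct ` fst ct) (\<lambda>y. gram_in M ct (chart_inv ct y))"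
proof -
  have "continuous_on (snd ct ` fst ct) (\<lambda>y. \<chi> i j. gram_in M ct (chart_inv ct y) $ i $ j)"
    by (intro continuous_on_vec_lambda smooth_onD(2)[OF gram_in_smooth[OF assms]])
  then show ?thesis by simp
qed

end

section \<open>Positive definite matrices\<close>

lemma continuous_on_det:
  fixes F :: "'a::topological_space \<Rightarrow> real^'n::finite^'n"
  assumes "continuous_on S F"
  shows "continuous_on S (\<lambda>y. det (F y))"
proof -
  have "continuous_on UNIV (det :: real^'n^'n \<Rightarrow> real)"
    unfolding det_def by (intro continuous_intros)
  from continuous_on_compose2[OF this assms] show ?thesis by simp
qed

lemma disjoint_family_Int:
  assumes "disjoint_family A"
  shows "disjoint_family (\<lambda>i. B \<inter> A i)" "disjoint_family (\<lambda>i. A i \<inter> B)"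
  using assms unfolding disjoint_family_on_def by blast+

text \<open>Gram-Schmidt for the form G: the new vector is Euclidean orthogonal to all G f_i, exists
  by counting dimensions, and is normalised by its G-length.\<close>

lemma gram_orthonormal_aux:
  fixes G :: "real^'n::finite^'n"
  assumes pos: "\<And>v. v \<noteq> 0 \<Longrightarrow> v \<bullet> (G *v v) > 0" and sym: "transpose G = G" and J: "finite (J :: 'n set)"
  shows "\<exists>f. \<forall>i\<in>J. \<forall>j\<in>J. f i \<bullet> (G *v f j) = (if i = j then 1 else 0)"
  using J
proof (induction J)
  case (insert k J)
  then obtain f where f: "\<And>i j. i \<in> J \<Longrightarrow> j \<in> J \<Longrightarrow> f i \<bullet> (G *v f j) = (if i = j then 1 else 0)" by auto
  let ?S = "(\<lambda>i. G *v f i) ` J"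
  have "card ?S < CARD('n)"
  proof -
    have "card ?S \<le> card J" by (rule card_image_le[OF insert.hyps(1)])
    also have "\<dots> < card (insert k J)" using insert.hyps by simp
    also have "\<dots> \<le> CARD('n)" by (rule card_mono) auto
    finally show ?thesis .
  qed
  then have "dim (span ?S) < DIM(real^'n)"
    using dim_le_card[of ?S ?S] insert.hyps(1) by (simp add: span_superset)
  then have "span ?S \<noteq> UNIV" by (metis dim_UNIV less_irrefl)
  then have "span ?S \<subset> UNIV" by blast
  then obtain w where w: "w \<noteq> 0" "\<And>x. x \<in> span ?S \<Longrightarrow> orthogonal w x"
    using orthogonal_to_subspace_exists_gen[of ?S UNIV] by (auto simp: span_UNIV)
  have wf: "w \<bullet> (G *v f i) = 0" if "i \<in> J" for i
    using w(2)[of "G *v f i"] that by (auto simp: orthogonal_def intro: span_base)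
  have fw: "f i \<bullet> (G *v w) = 0" if "i \<in> J" for i
    using wf[OF that] inner_transpose[of "f i" G w]
    by (simp add: sym inner_commute del: transpose_matrix_vector)
  define r where "r = sqrt (w \<bullet> (G *v w))"
  have r: "r > 0" "r * r = w \<bullet> (G *v w)" using pos[OF w(1)] by (simp_all add: r_def)
  have ww: "((1/r) *\<^sub>R w) \<bullet> (G *v ((1/r) *\<^sub>R w)) = 1"
  proof -
    have "((1/r) *\<^sub>R w) \<bullet> (G *v ((1/r) *\<^sub>R w)) = (w \<bullet> (G *v w)) / (r * r)"
      by (simp add: matrix_vector_mult_scaleR)
    then show ?thesis using r(1) by (simp flip: r(2))
  qed
  define g where "g = f(k := (1/r) *\<^sub>R w)"
  have gk: "g k = (1/r) *\<^sub>R w" and gJ: "\<And>i. i \<in> J \<Longrightarrow> g i = f i" using insert.hyps by (auto simp: g_def)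
  have "g i \<bullet> (G *v g j) = (if i = j then 1 else 0)" if "i \<in> insert k J" "j \<in> insert k J" for i j
  proof (cases "i = k")
    case i: True
    show ?thesis
    proof (cases "j = k")
      case True
      then show ?thesis using i ww gk by simp
    next
      case False
      then have "j \<in> J" using that by simp
      then show ?thesis using i False wf[of j] gk gJ[of j] by simp
    qed
  next
    case i: False
    then have iJ: "i \<in> J" using that by simp
    show ?thesis
    proof (cases "j = k")
      case True
      then show ?thesis using i iJ fw[of i] gk gJ[of i] by (simp add: matrix_vector_mult_scaleR)
    next
      case False
      then have "j \<in> J" using that by simp
      then show ?thesis using iJ f gJ by simp
    qed
  qed
  then show ?case by blast
qed simp

text \<open>If the rows of F are orthonormal for G, then F G F^T = 1, so G is the inverse of F times
  its transpose, and that transpose is the factor.\<close>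

lemma posdef_factor:
  fixes G :: "real^'n::finite^'n"
  assumes pos: "\<And>v. v \<noteq> 0 \<Longrightarrow> v \<bullet> (G *v v) > 0" and sym: "transpose G = G"
  obtains A where "G = transpose A ** A" "det A \<noteq> 0"
proof -
  have "\<exists>f. \<forall>i\<in>(UNIV::'n set). \<forall>j\<in>UNIV. f i \<bullet> (G *v f j) = (if i = j then 1 else 0)"
    by (rule gram_orthonormal_aux[OF pos sym]) auto
  then obtain f where "\<forall>i\<in>(UNIV::'n set). \<forall>j\<in>UNIV. f i \<bullet> (G *v f j) = (if i = j then 1 else 0)"
    by (rule exE)
  then have f: "\<And>i j. f i \<bullet> (G *v f j) = (if i = j then 1 else 0)" by blast
  define F where "F = (\<chi> i. f i)"
  have FGF: "F ** (G ** transpose F) = mat 1"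
  proof -
    have "(F ** (G ** transpose F)) $ i $ j = f i \<bullet> (G *v f j)" for i j
    proof -
      define X where "X = G ** transpose F"
      have X: "X $ k $ j = (G *v f j) $ k" for k
        by (simp add: X_def matrix_matrix_mult_def matrix_vector_mult_def F_def transpose_def)
      have "(F ** X) $ i $ j = (\<Sum>k\<in>UNIV. F $ i $ k * X $ k $ j)"
        by (simp add: matrix_matrix_mult_def)
      also have "\<dots> = f i \<bullet> (G *v f j)"
        by (simp add: X inner_vec_def F_def)
      finally show ?thesis by (simp add: X_def)
    qed
    then show ?thesis by (simp add: vec_eq_iff f mat_def)
  qed
  then have inv: "(G ** transpose F) ** F = mat 1" by (simp add: matrix_left_right_inverse)
  have det: "det F \<noteq> 0" using arg_cong[OF FGF, of det] by (auto simp: det_mul)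
  then obtain A' where A': "A' ** F = mat 1" "F ** A' = mat 1"
    using invertible_det_nz[of F] unfolding invertible_def by blast
  have GF: "G ** transpose F = A'"
  proof -
    have "G ** transpose F = (G ** transpose F) ** (F ** A')" by (simp add: A')
    also have "\<dots> = A'" using inv by (simp add: matrix_mul_assoc)
    finally show ?thesis .
  qed
  have "transpose F ** transpose A' = mat 1" using arg_cong[OF A'(1), of transpose] by (simp add: matrix_transpose_mul transpose_mat)
  then have "G = (G ** transpose F) ** transpose A'" by (simp add: matrix_mul_assoc[symmetric])
  also have "\<dots> = A' ** transpose A'" by (simp add: GF)
  finally have "G = transpose (transpose A') ** transpose A'" by simp
  moreover have "det (transpose A') \<noteq> 0" using arg_cong[OF A'(1), of det] by (auto simp: det_mul)
  ultimately show ?thesis by (rule that)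
qed

lemma posdef_det_pos:
  fixes G :: "real^'n::finite^'n"
  assumes "\<And>v. v \<noteq> 0 \<Longrightarrow> v \<bullet> (G *v v) > 0" "transpose G = G"
  shows "det G > 0"
proof -
  obtain A where "G = transpose A ** A" "det A \<noteq> 0" by (rule posdef_factor[OF assms])
  then have "det G = (det A)\<^sup>2" by (simp add: det_mul det_transpose power2_eq_square)
  then show ?thesis using \<open>det A \<noteq> 0\<close> by simp
qed

section \<open>The Riemannian volume measure\<close>

context rmanifold
begin

definition wt :: "('m, 'n) chart \<Rightarrow> real^'n \<Rightarrow> real" where
  "wt ct y = sqrt (det (gram_in M ct (chart_inv ct y)))"

definition nu :: "('m, 'n) chart \<Rightarrow> 'm set \<Rightarrow> ennreal" where
  "nu ct B = (\<integral>\<^sup>+ y. ennreal (wt ct y) * indicator (snd ct ` B) y \<partial>lborel)"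

lemma gram_in_det_pos: "ct \<in> charts M \<Longrightarrow> x \<in> fst ct \<Longrightarrow> det (gram_in M ct x) > 0"
  by (rule posdef_det_pos) (auto intro: gram_in_pos gram_in_sym)

lemma wt_pos: "ct \<in> charts M \<Longrightarrow> y \<in> snd ct ` fst ct \<Longrightarrow> 0 < wt ct y"
  by (simp add: wt_def gram_in_det_pos chart_inv_in)

lemma wt_cont: "ct \<in> charts M \<Longrightarrow> continuous_on (snd ct ` fst ct) (wt ct)"
  unfolding wt_def by (intro continuous_on_real_sqrt continuous_on_det gram_in_cont)

lemma borel_cont_indicator:
  fixes f :: "real^'n \<Rightarrow> real"
  assumes "continuous_on V f" "open V" "A \<in> sets borel" "A \<subseteq> V"
  shows "(\<lambda>x. indicator A x * f x) \<in> borel_measurable borel"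
proof -
  have "f \<in> borel_measurable (restrict_space borel V)"
    by (rule borel_measurable_continuous_on_restrict[OF assms(1)])
  then have "(\<lambda>x. indicator V x *\<^sub>R f x) \<in> borel_measurable borel"
    using assms(2) by (subst (asm) borel_measurable_restrict_space_iff) auto
  then have "(\<lambda>x. indicator A x * (indicator V x *\<^sub>R f x)) \<in> borel_measurable borel"
    using assms(3) by measurable
  moreover have "(\<lambda>x. indicator A x * (indicator V x *\<^sub>R f x)) = (\<lambda>x. indicator A x * f x)"
    using assms(4) by (auto simp: indicator_def fun_eq_iff)
  ultimately show ?thesis by (simp only:)
qed

lemma wt_borel:
  assumes "ct \<in> charts M" "B \<in> sets borel" "B \<subseteq> fst ct"
  shows "(\<lambda>y. indicator (snd ct ` B) y * wt ct y) \<in> borel_measurable borel"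
  using assms by (intro borel_cont_indicator[OF wt_cont chart_open(2)] chart_image_borel) auto

lemma wt_borel':
  assumes "ct \<in> charts M" "B \<in> sets borel" "B \<subseteq> fst ct"
  shows "(\<lambda>y. ennreal (wt ct y) * indicator (snd ct ` B) y) \<in> borel_measurable borel"
proof -
  have "(\<lambda>y. ennreal (indicator (snd ct ` B) y * wt ct y)) \<in> borel_measurable borel"
    using wt_borel[OF assms] by measurable
  moreover have "ennreal (indicator (snd ct ` B) y * wt ct y) = ennreal (wt ct y) * indicator (snd ct ` B) y" for y
    by (auto simp: indicator_def)
  ultimately show ?thesis by simp
qed

text \<open>Under a change of chart sqrt (det g) acquires the factor |det J|, which is also the
  factor of the volume element.\<close>

lemma nu_eq:
  assumes k: "ct \<in> charts M" "ct' \<in> charts M" and B: "B \<in> sets borel" "B \<subseteq> fst ct" "B \<subseteq> fst ct'"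
  shows "nu ct' B = nu ct B"
proof -
  let ?S = "snd ct ` B" and ?T = "trans ct ct'"
  \<comment> \<open>Set to 0 off the chart image, so that it is nonnegative everywhere.\<close>
  define g where "g z = (if z \<in> snd ct' ` fst ct' then wt ct' z else 0)" for z
  have g0: "0 \<le> g z" for z using wt_pos[OF k(2)] by (auto simp: g_def less_imp_le)
  have img: "?T ` ?S = snd ct' ` B"
  proof -
    have "?T (snd ct x) = snd ct' x" if "x \<in> B" for x
      using chart_inv1[OF k(1)] B(2) that by (auto simp: trans_def)
    then show ?thesis by (auto simp: image_iff)
  qed
  have sub: "?S \<subseteq> snd ct ` (fst ct \<inter> fst ct')" using B by blast
  have Sb: "?S \<in> sets borel" by (rule chart_image_borel[OF k(1) B(1,2)])
  have wteq: "\<bar>det (tjac ct ct' y)\<bar> * g (?T y) = wt ct y" if y: "y \<in> ?S" for y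
  proof -
    obtain x where x: "x \<in> B" "y = snd ct x" using y by blast
    have xk: "x \<in> fst ct" "x \<in> fst ct'" using x B by auto
    have Ty: "?T y = snd ct' x" using chart_inv1[OF k(1) xk(1)] x by (simp add: trans_def)
    have "wt ct y = sqrt (det (gram_in M ct x))" using chart_inv1[OF k(1) xk(1)] x by (simp add: wt_def)
    also have "\<dots> = sqrt ((det (tjac ct ct' y))\<^sup>2 * det (gram_in M ct' x))"
      unfolding gram_in_trans[OF k xk] x(2) by (simp add: det_mul det_transpose power2_eq_square mult_ac)
    also have "\<dots> = \<bar>det (tjac ct ct' y)\<bar> * sqrt (det (gram_in M ct' x))"
      by (simp add: real_sqrt_mult)
    also have "sqrt (det (gram_in M ct' x)) = g (?T y)"
      using chart_inv1[OF k(2) xk(2)] xk by (simp add: g_def wt_def Ty)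
    finally show ?thesis by simp
  qed
  have "(\<integral>\<^sup>+z. ennreal (g z) * indicator (?T ` ?S) z \<partial>lborel) =
    (\<integral>\<^sup>+y. ennreal (\<bar>det (matrix ((*v) (tjac ct ct' y)))\<bar> * g (?T y)) * indicator ?S y \<partial>lborel)"
  proof (rule nn_integral_change_of_variables[OF Sb])
    show "(?T has_derivative (*v) (tjac ct ct' y)) (at y within ?S)" if "y \<in> ?S" for y
      using trans_deriv(1)[OF k] sub that by (blast intro: has_derivative_at_withinI)
    show "inj_on ?T ?S"
    proof (rule inj_onI)
      fix y y' assume yy: "y \<in> ?S" "y' \<in> ?S" "?T y = ?T y'"
      then have "y \<in> snd ct ` (fst ct \<inter> fst ct')" "y' \<in> snd ct ` (fst ct \<inter> fst ct')" using sub by auto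
      with yy(3) show "y = y'" using overlap(5,6)[OF k] by metis
    qed
    show "0 \<le> g z" for z by (rule g0)
    have "(\<lambda>y. indicator (snd ct' ` B) y * g y) = (\<lambda>y. indicator (snd ct' ` B) y * wt ct' y)"
      using B(3) by (auto simp: indicator_def g_def fun_eq_iff)
    then show "(\<lambda>z. indicator (?T ` ?S) z * g z) \<in> borel_measurable borel"
      unfolding img using wt_borel[OF k(2) B(1,3)] by simp
    have "(\<lambda>y. indicator ?S y * (\<bar>det (matrix ((*v) (tjac ct ct' y)))\<bar> * g (?T y))) = (\<lambda>y. indicator ?S y * wt ct y)"
      using wteq by (auto simp: indicator_def matrix_of_matrix_vector_mul fun_eq_iff)
    then show "(\<lambda>y. indicator ?S y * (\<bar>det (matrix ((*v) (tjac ct ct' y)))\<bar> * g (?T y))) \<in> borel_measurable borel"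
      using wt_borel[OF k(1) B(1,2)] by simp
  qed
  moreover have "(\<integral>\<^sup>+z. ennreal (g z) * indicator (?T ` ?S) z \<partial>lborel) = nu ct' B"
    unfolding nu_def img using B(3) by (intro nn_integral_cong) (auto simp: indicator_def g_def)
  moreover have "(\<integral>\<^sup>+y. ennreal (\<bar>det (matrix ((*v) (tjac ct ct' y)))\<bar> * g (?T y)) * indicator ?S y \<partial>lborel) = nu ct B"
    unfolding nu_def using wteq by (intro nn_integral_cong) (auto simp: indicator_def matrix_of_matrix_vector_mul)
  ultimately show ?thesis by simp
qed

lemma nu_suminf:
  assumes k: "ct \<in> charts M" and A: "\<And>i. A i \<in> sets borel" "\<And>i. A i \<subseteq> fst ct" "disjoint_family A"
  shows "nu ct (\<Union>i::nat. A i) = (\<Sum>i. nu ct (A i))"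
proof -
  have dis: "disjoint_family (\<lambda>i. snd ct ` A i)"
    using A(2,3) chart_inj[OF k] unfolding disjoint_family_on_def
    by (metis image_empty inj_on_image_Int)
  have "indicator (snd ct ` (\<Union>i. A i)) y = (\<Sum>i. indicator (snd ct ` A i) y :: ennreal)" for y
    unfolding image_UN by (rule suminf_indicator[OF dis, symmetric])
  then have "nu ct (\<Union>i. A i) = (\<integral>\<^sup>+ y. (\<Sum>i. ennreal (wt ct y) * indicator (snd ct ` A i) y) \<partial>lborel)"
    unfolding nu_def by simp
  also have "\<dots> = (\<Sum>i. nu ct (A i))"
    unfolding nu_def using wt_borel'[OF k A(1,2)] by (intro nn_integral_suminf) simp
  finally show ?thesis .
qed

text \<open>The chart domains have a countable subcover by Lindelof's theorem, and
  \<open>disjointed\<close> makes it a Borel partition on which measures are built and compared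
  piece by piece.\<close>

lemma chart_partition:
  obtains cts :: "nat \<Rightarrow> ('m, 'n) chart" and D :: "nat \<Rightarrow> 'm set" where "\<And>i. cts i \<in> charts M"
    "\<And>i. D i \<in> sets borel" "\<And>i. D i \<subseteq> fst (cts i)" "disjoint_family D" "\<And>B. (\<Union>i. B \<inter> D i) = B"
proof -
  obtain F where F: "F \<subseteq> fst ` charts M" "countable F" "\<Union>F = \<Union>(fst ` charts M)"
  proof (rule Lindelof[of "fst ` charts M"])
    show "open S" if "S \<in> fst ` charts M" for S using that chart_open(1) by blast
  qed blast
  have U: "\<Union>F = UNIV" unfolding F(3) using chart_at by blast
  then have "F \<noteq> {}" by auto
  then have r: "range (from_nat_into F) = F" using F(2) by (rule range_from_nat_into)
  have "\<exists>ct. ct \<in> charts M \<and> fst ct = from_nat_into F i" for i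
  proof -
    have "from_nat_into F i \<in> fst ` charts M" using F(1) r by blast
    then show ?thesis by force
  qed
  then obtain cts where k: "\<And>i. cts i \<in> charts M" "\<And>i. fst (cts i) = from_nat_into F i" by metis
  define D where "D = disjointed (\<lambda>i. fst (cts i))"
  have "(\<Union>i. fst (cts i)) = UNIV" unfolding k(2) r using U by simp
  then have UD: "(\<Union>i. D i) = UNIV" by (simp add: D_def UN_disjointed_eq)
  have "range (\<lambda>i. fst (cts i)) \<subseteq> sets borel" using borel_open[OF chart_open(1)[OF k(1)]] by blast
  then have "range D \<subseteq> sets borel" unfolding D_def by (rule sets.range_disjointed_sets)
  then have "D i \<in> sets borel" for i by blast
  moreover have "D i \<subseteq> fst (cts i)" for i unfolding D_def by (rule disjointed_subset)
  moreover have "disjoint_family D" unfolding D_def by (rule disjoint_family_disjointed)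
  moreover have "(\<Union>i. B \<inter> D i) = B" for B using UD by blast
  ultimately show ?thesis using that[of cts D] k(1) by blast
qed

definition chart_measure :: "'m measure \<Rightarrow> bool" where
  "chart_measure \<mu> \<longleftrightarrow> sets \<mu> = sets borel \<and> (\<forall>ct\<in>charts M. \<forall>B\<in>sets borel. B \<subseteq> fst ct \<longrightarrow> emeasure \<mu> B = nu ct B)"

text \<open>The chart densities are summed over a partition. By \<open>nu_eq\<close> each piece may
  be computed in any other chart containing it, so the sum has the prescribed values in all
  charts.\<close>

lemma chart_measure_ex: "\<exists>\<mu>. chart_measure \<mu>"
proof -
  obtain cts :: "nat \<Rightarrow> ('m, 'n) chart" and D :: "nat \<Rightarrow> 'm set" where k: "\<And>i. cts i \<in> charts M"
    and D: "\<And>i. D i \<in> sets borel" "\<And>i. D i \<subseteq> fst (cts i)" "disjoint_family D" and BD: "\<And>B. (\<Union>i. B \<inter> D i) = B"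
    by (rule chart_partition) blast
  define m where "m B = (\<integral>\<^sup>+i. nu (cts i) (B \<inter> D i) \<partial>count_space UNIV)" for B
  define \<mu> where "\<mu> = measure_of UNIV (sets borel) m"
  have ca: "countably_additive (sets borel) m"
  proof (rule countably_additiveI)
    fix A :: "nat \<Rightarrow> 'm set" assume A: "range A \<subseteq> sets borel" "disjoint_family A"
    have "nu (cts i) ((\<Union>j. A j) \<inter> D i) = (\<Sum>j. nu (cts i) (A j \<inter> D i))" for i
    proof -
      have "nu (cts i) (\<Union>j. A j \<inter> D i) = (\<Sum>j. nu (cts i) (A j \<inter> D i))"
        using A(1) D(1,2)[of i] by (intro nu_suminf[OF k] disjoint_family_Int A(2)) auto
      moreover have "(\<Union>j. A j \<inter> D i) = (\<Union>j. A j) \<inter> D i" by blast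
      ultimately show ?thesis by simp
    qed
    then have "m (\<Union>j. A j) = (\<integral>\<^sup>+i. (\<Sum>j. nu (cts i) (A j \<inter> D i)) \<partial>count_space UNIV)"
      unfolding m_def by (simp only:)
    also have "\<dots> = (\<Sum>j. m (A j))"
      unfolding m_def by (rule nn_integral_suminf) simp
    finally show "(\<Sum>j. m (A j)) = m (\<Union>j. A j)" by (rule sym)
  qed
  have s: "sets \<mu> = sets borel" unfolding \<mu>_def by (metis sets.sets_measure_of_eq space_borel)
  have em: "emeasure \<mu> B = m B" if "B \<in> sets borel" for B
    unfolding \<mu>_def
  proof (rule emeasure_measure_of_sigma)
    show "sigma_algebra UNIV (sets (borel :: 'm measure))"
      using sets.sigma_algebra_axioms[of borel] by simp
    show "positive (sets borel) m" by (simp add: positive_def m_def nu_def)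
  qed (use ca that in auto)
  have "emeasure \<mu> B = nu ct B" if "ct \<in> charts M" "B \<in> sets borel" "B \<subseteq> fst ct" for ct B
  proof -
    have "emeasure \<mu> B = (\<integral>\<^sup>+i. nu ct (B \<inter> D i) \<partial>count_space UNIV)"
      unfolding em[OF that(2)] m_def
      using that D(1,2) by (intro nn_integral_cong nu_eq k) auto
    also have "\<dots> = (\<Sum>i. nu ct (B \<inter> D i))" by (rule nn_integral_count_space_nat)
    also have "\<dots> = nu ct (\<Union>i. B \<inter> D i)"
      using that D(1,2) by (intro nu_suminf[symmetric] disjoint_family_Int D(3)) auto
    also have "(\<Union>i. B \<inter> D i) = B" by (rule BD)
    finally show ?thesis .
  qed
  then show ?thesis using s by (auto simp: chart_measure_def)
qed

text \<open>A Borel set is the disjoint union of its pieces in the partition, and on each piece the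
  chart formula fixes the value.\<close>

lemma chart_measure_unique:
  assumes "chart_measure \<mu>" "chart_measure \<mu>'"
  shows "\<mu> = \<mu>'"
proof (rule measure_eqI)
  show "sets \<mu> = sets \<mu>'" using assms by (simp add: chart_measure_def)
  obtain cts :: "nat \<Rightarrow> ('m, 'n) chart" and D :: "nat \<Rightarrow> 'm set" where k: "\<And>i. cts i \<in> charts M"
    and D: "\<And>i. D i \<in> sets borel" "\<And>i. D i \<subseteq> fst (cts i)" "disjoint_family D" and BD: "\<And>B. (\<Union>i. B \<inter> D i) = B"
    by (rule chart_partition) blast
  have *: "emeasure \<mu> B = (\<Sum>i. nu (cts i) (B \<inter> D i))" if "chart_measure \<mu>" "B \<in> sets borel" for \<mu> B
  proof -
    have sm: "sets \<mu> = sets borel" using that by (simp add: chart_measure_def)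
    have "emeasure \<mu> B = emeasure \<mu> (\<Union>i. B \<inter> D i)" unfolding BD ..
    also have "\<dots> = (\<Sum>i. emeasure \<mu> (B \<inter> D i))"
      using D(1) that sm by (intro suminf_emeasure[symmetric] disjoint_family_Int D(3)) auto
    also have "\<dots> = (\<Sum>i. nu (cts i) (B \<inter> D i))"
    proof (rule suminf_cong)
      fix i
      have "B \<inter> D i \<in> sets borel" "B \<inter> D i \<subseteq> fst (cts i)" using D(1,2)[of i] that(2) by auto
      then show "emeasure \<mu> (B \<inter> D i) = nu (cts i) (B \<inter> D i)"
        using that(1) k[of i] unfolding chart_measure_def by blast
    qed
    finally show ?thesis .
  qed
  show "emeasure \<mu> B = emeasure \<mu>' B" if "B \<in> sets \<mu>" for B
  proof -
    have "B \<in> sets borel" using that assms(1) by (simp add: chart_measure_def)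
    from *[OF assms(1) this] *[OF assms(2) this] show ?thesis by simp
  qed
qed

text \<open>Existence and uniqueness give the definite description in \<open>riem_vol\<close> its
  meaning.\<close>

lemma riem_vol_completion:
  obtains \<mu> where "chart_measure \<mu>" "riem_vol M = completion \<mu>"
proof -
  obtain \<mu> where \<mu>: "chart_measure \<mu>" using chart_measure_ex by blast
  have "(THE \<mu>. chart_measure \<mu>) = \<mu>"
    using \<mu> chart_measure_unique[OF _ \<mu>] by (rule the_equality)
  moreover have "riem_vol M = completion (THE \<mu>. chart_measure \<mu>)"
    unfolding riem_vol_def chart_measure_def nu_def wt_def ..
  ultimately show ?thesis using that[OF \<mu>] by simp
qed

lemma riem_vol_sets: "B \<in> sets borel \<Longrightarrow> B \<in> sets (riem_vol M)"
  by (rule riem_vol_completion) (auto simp: chart_measure_def)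

lemma riem_vol_chart:
  assumes "ct \<in> charts M" "B \<in> sets borel" "B \<subseteq> fst ct"
  shows "emeasure (riem_vol M) B = nu ct B"
  by (rule riem_vol_completion) (use assms in \<open>auto simp: chart_measure_def\<close>)

text \<open>The density is bounded on closed coordinate balls, so every point has an open
  neighbourhood of finite volume, and finitely many of them cover.\<close>

lemma riem_vol_compact_finite:
  assumes S: "compact S"
  shows "emeasure (riem_vol M) S < \<infinity>"
proof -
  have "\<exists>U. open U \<and> x \<in> U \<and> emeasure (riem_vol M) U < \<infinity>" for x
  proof -
    let ?k = "chart_at M x" and ?y = "snd (chart_at M x) x"
    note k = chart_at[of x]
    have "?y \<in> snd ?k ` fst ?k" using k by auto
    then obtain r where r: "r > 0" "cball ?y r \<subseteq> snd ?k ` fst ?k"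
      using chart_open(2)[OF k(1)] open_contains_cball by blast
    have sub: "ball ?y r \<subseteq> snd ?k ` fst ?k" using r(2) ball_subset_cball by blast
    let ?U = "chart_inv ?k ` ball ?y r"
    have oU: "open ?U" by (rule chart_inv_image_open[OF k(1) open_ball sub])
    have xU: "x \<in> ?U" using r(1) chart_inv1[OF k] by (metis centre_in_ball image_eqI)
    have Uk: "?U \<subseteq> fst ?k" using chart_inv_in[OF k(1)] sub by auto
    have img: "snd ?k ` ?U = ball ?y r"
    proof -
      have "snd ?k (chart_inv ?k z) = z" if "z \<in> ball ?y r" for z
        using that sub chart_inv2[OF k(1)] by blast
      then have "(\<lambda>z. snd ?k (chart_inv ?k z)) ` ball ?y r = (\<lambda>z. z) ` ball ?y r"
        by (intro image_cong refl) auto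
      then show ?thesis by (simp add: image_image)
    qed
    have "continuous_on (cball ?y r) (wt ?k)"
      by (rule continuous_on_subset[OF wt_cont[OF k(1)] r(2)])
    then have "bounded (wt ?k ` cball ?y r)" by (intro compact_imp_bounded compact_continuous_image compact_cball)
    then obtain C where "\<forall>z\<in>wt ?k ` cball ?y r. norm z \<le> C" unfolding bounded_iff by (rule exE)
    then have C: "\<And>z. z \<in> cball ?y r \<Longrightarrow> norm (wt ?k z) \<le> C" by blast
    have "emeasure (riem_vol M) ?U = nu ?k ?U"
      by (rule riem_vol_chart[OF k(1) borel_open[OF oU] Uk])
    also have "\<dots> \<le> (\<integral>\<^sup>+ y. ennreal C * indicator (ball ?y r) y \<partial>lborel)"
      unfolding nu_def img
    proof (rule nn_integral_mono)
      fix z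
      show "ennreal (wt ?k z) * indicator (ball ?y r) z \<le> ennreal C * indicator (ball ?y r) z"
      proof (cases "z \<in> ball ?y r")
        case True
        then have "wt ?k z \<le> C" using C[of z] by auto
        then show ?thesis using True by (simp add: ennreal_leI)
      qed simp
    qed
    also have "\<dots> = ennreal C * emeasure lborel (ball ?y r)" by (simp add: nn_integral_cmult_indicator)
    also have "\<dots> < \<infinity>"
      using emeasure_bounded_finite[OF bounded_ball, of ?y r] by (simp add: ennreal_mult_less_top)
    finally show ?thesis using oU xU by blast
  qed
  then obtain U where U: "\<And>x. open (U x)" "\<And>x. x \<in> U x" "\<And>x. emeasure (riem_vol M) (U x) < \<infinity>" by metis
  obtain F where F: "F \<subseteq> S" "finite F" "S \<subseteq> (\<Union>x\<in>F. U x)"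
    using compactE_image[OF S, of S U] U by blast
  have "emeasure (riem_vol M) S \<le> emeasure (riem_vol M) (\<Union>x\<in>F. U x)"
    using F U by (intro emeasure_mono riem_vol_sets borel_open) auto
  also have "\<dots> \<le> (\<Sum>x\<in>F. emeasure (riem_vol M) (U x))"
    using F U by (intro emeasure_subadditive_finite) (auto intro!: riem_vol_sets borel_open)
  also have "\<dots> < \<infinity>" using F(2) U(3) by simp
  finally show ?thesis .
qed

text \<open>\<open>le\<close> compares the Jacobian with the Riemannian density in every chart;
  change of variables gives the estimate on each piece of a chart partition, and the pieces are
  summed.\<close>

lemma emeasure_image_le:
  fixes f :: "'m \<Rightarrow> real^'n"
  assumes \<Omega>: "open \<Omega>" and inj: "inj_on f \<Omega>"
    and der: "\<And>ct y. ct \<in> charts M \<Longrightarrow> y \<in> snd ct ` (fst ct \<inter> \<Omega>) \<Longrightarrow> ((\<lambda>y. f (chart_inv ct y)) has_derivative (*v) (F ct y)) (at y)"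
    and cont: "\<And>ct. ct \<in> charts M \<Longrightarrow> continuous_on (snd ct ` (fst ct \<inter> \<Omega>)) (F ct)"
    and le: "\<And>ct y. ct \<in> charts M \<Longrightarrow> y \<in> snd ct ` (fst ct \<inter> \<Omega>) \<Longrightarrow> \<bar>det (F ct y)\<bar> \<le> C * wt ct y"
    and fb: "\<And>B. B \<in> sets borel \<Longrightarrow> B \<subseteq> \<Omega> \<Longrightarrow> f ` B \<in> sets borel" and C: "0 \<le> C"
    and B: "B \<in> sets borel" "B \<subseteq> \<Omega>"
  shows "emeasure lborel (f ` B) \<le> ennreal C * emeasure (riem_vol M) B"
proof -
  have loc: "emeasure lborel (f ` A) \<le> ennreal C * emeasure (riem_vol M) A"
    if k: "ct \<in> charts M" and A: "A \<in> sets borel" "A \<subseteq> \<Omega>" "A \<subseteq> fst ct" for ct A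
  proof -
    let ?f = "\<lambda>y. f (chart_inv ct y)" and ?S = "snd ct ` A" and ?O = "snd ct ` (fst ct \<inter> \<Omega>)"
    have sub: "?S \<subseteq> ?O" using A by blast
    have Sb: "?S \<in> sets borel" by (rule chart_image_borel[OF k A(1,3)])
    have inv: "chart_inv ct (snd ct x) = x" if "x \<in> A" for x using chart_inv1[OF k] A(3) that by blast
    have img: "?f ` ?S = f ` A" using inv by (auto simp: image_image)
    have "(\<integral>\<^sup>+z. ennreal 1 * indicator (?f ` ?S) z \<partial>lborel) =
      (\<integral>\<^sup>+y. ennreal (\<bar>det (matrix ((*v) (F ct y)))\<bar> * 1) * indicator ?S y \<partial>lborel)"
    proof (rule nn_integral_change_of_variables[OF Sb])
      show "(?f has_derivative (*v) (F ct y)) (at y within ?S)" if "y \<in> ?S" for y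
        using der[OF k] sub that by (blast intro: has_derivative_at_withinI)
      show "inj_on ?f ?S"
        using inj A(2) inv by (auto simp: inj_on_def subset_iff)
      show "(\<lambda>z. indicator (?f ` ?S) z * (1::real)) \<in> borel_measurable borel"
        unfolding img mult_1_right by (rule borel_measurable_indicator) (use fb[OF A(1,2)] in simp)
      have "continuous_on ?O (\<lambda>y. \<bar>det (F ct y)\<bar>)"
        by (intro continuous_on_rabs continuous_on_det cont k)
      then show "(\<lambda>y. indicator ?S y * (\<bar>det (matrix ((*v) (F ct y)))\<bar> * 1)) \<in> borel_measurable borel"
        using borel_cont_indicator[OF _ chart_image_open[OF k \<Omega>] Sb sub] by (simp add: matrix_of_matrix_vector_mul)
    qed simp
    then have "emeasure lborel (f ` A) = (\<integral>\<^sup>+y. ennreal \<bar>det (F ct y)\<bar> * indicator ?S y \<partial>lborel)"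
      unfolding img using fb[OF A(1,2)] by (simp add: matrix_of_matrix_vector_mul)
    also have "\<dots> \<le> (\<integral>\<^sup>+y. ennreal C * (ennreal (wt ct y) * indicator ?S y) \<partial>lborel)"
    proof (rule nn_integral_mono)
      fix y
      show "ennreal \<bar>det (F ct y)\<bar> * indicator ?S y \<le> ennreal C * (ennreal (wt ct y) * indicator ?S y)"
      proof (cases "y \<in> ?S")
        case True
        then have "\<bar>det (F ct y)\<bar> \<le> C * wt ct y" using le[OF k] sub by blast
        then have "ennreal \<bar>det (F ct y)\<bar> \<le> ennreal C * ennreal (wt ct y)"
          using C by (subst ennreal_mult'[symmetric]) (auto intro: ennreal_leI)
        then show ?thesis using True by simp
      qed simp
    qed
    also have "\<dots> = ennreal C * nu ct A"
      unfolding nu_def using wt_borel'[OF k A(1,3)] by (intro nn_integral_cmult) simp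
    also have "\<dots> = ennreal C * emeasure (riem_vol M) A" using riem_vol_chart[OF k A(1,3)] by simp
    finally show ?thesis .
  qed
  obtain cts :: "nat \<Rightarrow> ('m, 'n) chart" and D :: "nat \<Rightarrow> 'm set" where k: "\<And>i. cts i \<in> charts M"
    and D: "\<And>i. D i \<in> sets borel" "\<And>i. D i \<subseteq> fst (cts i)" "disjoint_family D" and BD: "\<And>B. (\<Union>i. B \<inter> D i) = B"
    by (rule chart_partition) blast
  have "emeasure lborel (f ` B) = emeasure lborel (\<Union>i. f ` (B \<inter> D i))" unfolding image_UN[symmetric] BD ..
  also have "\<dots> \<le> (\<Sum>i. emeasure lborel (f ` (B \<inter> D i)))"
  proof (rule emeasure_subadditive_countably)
    have "f ` (B \<inter> D i) \<in> sets borel" for i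
      by (rule fb) (use B D(1)[of i] in auto)
    then show "range (\<lambda>i. f ` (B \<inter> D i)) \<subseteq> sets lborel" by auto
  qed
  also have "\<dots> \<le> (\<Sum>i. ennreal C * emeasure (riem_vol M) (B \<inter> D i))"
    using B D(1,2) by (intro suminf_le loc[OF k]) auto
  also have "\<dots> = ennreal C * (\<Sum>i. emeasure (riem_vol M) (B \<inter> D i))" by simp
  also have "(\<Sum>i. emeasure (riem_vol M) (B \<inter> D i)) = emeasure (riem_vol M) (\<Union>i. B \<inter> D i)"
    using B D(1) by (intro suminf_emeasure disjoint_family_Int D(3)) (auto intro!: riem_vol_sets)
  finally show ?thesis unfolding BD .
qed

end

section \<open>Symmetry of mixed derivatives, Christoffel symbols and covariant Hessians\<close>

text \<open>Schwarz's theorem in a form that involves only the two mixed second derivatives, since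
  pure ones are not assumed of the cost. The second difference over a square of side a is a^2 times
  either mixed derivative at some point of the square; continuity at the origin finishes as a tends
  to 0.\<close>

lemma mixed_derivatives_eq:
  fixes f ft fs fst fts :: "real \<Rightarrow> real \<Rightarrow> real"
  assumes r: "r > 0"
    and 1: "\<And>s t. \<bar>s\<bar> < r \<Longrightarrow> \<bar>t\<bar> < r \<Longrightarrow> ((\<lambda>t. f s t) has_real_derivative ft s t) (at t)"
    and 2: "\<And>s t. \<bar>s\<bar> < r \<Longrightarrow> \<bar>t\<bar> < r \<Longrightarrow> ((\<lambda>s. ft s t) has_real_derivative fst s t) (at s)"
    and 3: "\<And>s t. \<bar>s\<bar> < r \<Longrightarrow> \<bar>t\<bar> < r \<Longrightarrow> ((\<lambda>s. f s t) has_real_derivative fs s t) (at s)"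
    and 4: "\<And>s t. \<bar>s\<bar> < r \<Longrightarrow> \<bar>t\<bar> < r \<Longrightarrow> ((\<lambda>t. fs s t) has_real_derivative fts s t) (at t)"
    and c1: "isCont (\<lambda>(s, t). fst s t) (0, 0)" and c2: "isCont (\<lambda>(s, t). fts s t) (0, 0)"
  shows "fst 0 0 = fts 0 0"
proof -
  have ex1: "\<exists>\<sigma> \<tau>. 0 < \<sigma> \<and> \<sigma> < a \<and> 0 < \<tau> \<and> \<tau> < a \<and> f a a - f 0 a - (f a 0 - f 0 0) = a * a * fst \<sigma> \<tau>"
    if a: "0 < a" "a < r" and
      1: "\<And>s t. \<bar>s\<bar> < r \<Longrightarrow> \<bar>t\<bar> < r \<Longrightarrow> ((\<lambda>t. f s t) has_real_derivative ft s t) (at t)" and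
      2: "\<And>s t. \<bar>s\<bar> < r \<Longrightarrow> \<bar>t\<bar> < r \<Longrightarrow> ((\<lambda>s. ft s t) has_real_derivative fst s t) (at s)"
    for a and f ft fst :: "real \<Rightarrow> real \<Rightarrow> real"
  proof -
    have "\<exists>\<tau>>0. \<tau> < a \<and> (f a a - f 0 a) - (f a 0 - f 0 0) = (a - 0) * (ft a \<tau> - ft 0 \<tau>)"
      by (rule MVT2) (use a 1 in \<open>auto intro!: DERIV_diff\<close>)
    then obtain \<tau> where \<tau>: "0 < \<tau>" "\<tau> < a" "(f a a - f 0 a) - (f a 0 - f 0 0) = a * (ft a \<tau> - ft 0 \<tau>)" by auto
    have "\<exists>\<sigma>>0. \<sigma> < a \<and> ft a \<tau> - ft 0 \<tau> = (a - 0) * fst \<sigma> \<tau>"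
      by (rule MVT2) (use a \<tau> 2 in auto)
    then show ?thesis using \<tau> by auto
  qed
  have ex: "\<exists>\<sigma> \<tau> \<sigma>' \<tau>'. 0 < \<sigma> \<and> \<sigma> < a \<and> 0 < \<tau> \<and> \<tau> < a \<and> 0 < \<sigma>' \<and> \<sigma>' < a \<and> 0 < \<tau>' \<and> \<tau>' < a \<and> fst \<sigma> \<tau> = fts \<sigma>' \<tau>'"
    if a: "0 < a" "a < r" for a
  proof -
    obtain \<sigma> \<tau> where 1: "0 < \<sigma>" "\<sigma> < a" "0 < \<tau>" "\<tau> < a" "f a a - f 0 a - (f a 0 - f 0 0) = a * a * fst \<sigma> \<tau>"
      using ex1[OF a 1 2] by blast
    have "\<exists>\<tau>' \<sigma>'. 0 < \<tau>' \<and> \<tau>' < a \<and> 0 < \<sigma>' \<and> \<sigma>' < a \<and> f a a - f a 0 - (f 0 a - f 0 0) = a * a * fts \<sigma>' \<tau>'"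
      by (rule ex1[OF a, where f = "\<lambda>t s. f s t" and ft = "\<lambda>t s. fs s t" and fst = "\<lambda>t s. fts s t"]) (use 3 4 in auto)
    then obtain \<sigma>' \<tau>' where 2: "0 < \<sigma>'" "\<sigma>' < a" "0 < \<tau>'" "\<tau>' < a" "f a a - f a 0 - (f 0 a - f 0 0) = a * a * fts \<sigma>' \<tau>'" by blast
    have "a * a * fst \<sigma> \<tau> = a * a * fts \<sigma>' \<tau>'" using 1(5) 2(5) by linarith
    moreover have "a * a \<noteq> 0" using a by simp
    ultimately have "fst \<sigma> \<tau> = fts \<sigma>' \<tau>'" by (metis mult_left_cancel)
    then show ?thesis using 1 2 by blast
  qed
  define A where "A n = r * (1 / real (Suc (Suc n)))" for n :: nat
  have A: "0 < A n" "A n < r" for n using r by (auto simp: A_def field_simps add_pos_nonneg)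
  have "A \<longlonglongrightarrow> r * 0"
    unfolding A_def by (intro tendsto_intros LIMSEQ_Suc[OF LIMSEQ_Suc[OF lim_1_over_n]])
  then have Al: "A \<longlonglongrightarrow> 0" by simp
  from ex[OF A] obtain \<sigma> \<tau> \<sigma>' \<tau>' where b: "\<And>n. 0 < \<sigma> n" "\<And>n. \<sigma> n < A n" "\<And>n. 0 < \<tau> n" "\<And>n. \<tau> n < A n"
    "\<And>n. 0 < \<sigma>' n" "\<And>n. \<sigma>' n < A n" "\<And>n. 0 < \<tau>' n" "\<And>n. \<tau>' n < A n" and eq: "\<And>n. fst (\<sigma> n) (\<tau> n) = fts (\<sigma>' n) (\<tau>' n)"
    by metis
  have sq: "s \<longlonglongrightarrow> 0" if "\<And>n. 0 < s n" "\<And>n. s n < A n" for s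
    by (rule tendsto_sandwich[OF _ _ tendsto_const Al]) (use that in \<open>auto intro!: always_eventually less_imp_le\<close>)
  have "(\<lambda>n. (\<sigma> n, \<tau> n)) \<longlonglongrightarrow> (0, 0)" "(\<lambda>n. (\<sigma>' n, \<tau>' n)) \<longlonglongrightarrow> (0, 0)"
    by (intro tendsto_Pair sq b)+
  then have L: "(\<lambda>n. fst (\<sigma> n) (\<tau> n)) \<longlonglongrightarrow> fst 0 0" "(\<lambda>n. fts (\<sigma>' n) (\<tau>' n)) \<longlonglongrightarrow> fts 0 0"
    using isCont_tendsto_compose[OF c1, of "\<lambda>n. (\<sigma> n, \<tau> n)"] isCont_tendsto_compose[OF c2, of "\<lambda>n. (\<sigma>' n, \<tau>' n)"] by auto
  show ?thesis by (rule LIMSEQ_unique[OF L(1)]) (simp only: eq L(2))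
qed

lemma partial_line:
  fixes \<phi> :: "real^'n::finite \<Rightarrow> real"
  assumes "\<phi> differentiable at (y + t *\<^sub>R axis i 1)"
  shows "((\<lambda>t. \<phi> (y + t *\<^sub>R axis i 1)) has_real_derivative partial i \<phi> (y + t *\<^sub>R axis i 1)) (at t)"
proof -
  obtain D where D: "(\<phi> has_derivative D) (at (y + t *\<^sub>R axis i 1))" using assms by (auto simp: differentiable_def)
  have l: "((\<lambda>t. y + t *\<^sub>R axis i 1) has_derivative (\<lambda>h. h *\<^sub>R axis i 1)) (at t)"
    by (auto intro!: derivative_eq_intros)
  have "((\<lambda>t. \<phi> (y + t *\<^sub>R axis i 1)) has_derivative (\<lambda>h. D (h *\<^sub>R axis i 1))) (at t)"
    using diff_chain_at[OF l D] by (simp add: o_def)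
  moreover have "D (h *\<^sub>R axis i 1) = h * partial i \<phi> (y + t *\<^sub>R axis i 1)" for h
    using linear_scale[OF has_derivative_linear[OF D]] partial_eqI[OF D] by simp
  ultimately show ?thesis by (simp add: has_field_derivative_def mult.commute[of _ "partial i \<phi> _"] mult_commute_abs)
qed

lemma partial_partial_commute:
  fixes \<phi> :: "real^'n::finite \<Rightarrow> real"
  assumes V: "open V" "y \<in> V" and s: "smooth_on V \<phi>"
  shows "partial i (partial j \<phi>) y = partial j (partial i \<phi>) y"
proof -
  obtain r where r: "r > 0" "ball y r \<subseteq> V" using V open_contains_ball by metis
  have inV: "y + s *\<^sub>R axis i 1 + t *\<^sub>R axis j 1 \<in> V" if "\<bar>s\<bar> < r/2" "\<bar>t\<bar> < r/2" for s t and i j :: 'n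
  proof -
    have "norm (s *\<^sub>R axis i 1 + t *\<^sub>R axis j 1 :: real^'n) \<le> \<bar>s\<bar> + \<bar>t\<bar>"
      using norm_triangle_ineq[of "s *\<^sub>R axis i 1" "t *\<^sub>R axis j 1 :: real^'n"] by simp
    also have "\<dots> < r" using that by linarith
    finally show ?thesis using r(2) by (auto simp: dist_norm subset_iff algebra_simps norm_minus_commute)
  qed
  note d = smooth_onD(1)[OF s] and d1 = smooth_onD(1)[OF smooth_onD(3)[OF s]]
  let ?p = "\<lambda>s t. y + s *\<^sub>R axis i 1 + t *\<^sub>R axis j 1"
  have sw: "?p s t = y + t *\<^sub>R axis j 1 + s *\<^sub>R axis i 1" for s t by simp
  have cont: "isCont (\<lambda>(s, t). partial a (partial b \<phi>) (?p s t)) (0, 0)" for a b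
  proof -
    have "isCont (partial a (partial b \<phi>)) y"
      using smooth_onD(2)[OF smooth_onD(3)[OF smooth_onD(3)[OF s]]] V by (simp add: continuous_on_eq_continuous_at)
    then have B: "isCont (partial a (partial b \<phi>)) (y + Product_Type.fst (0::real, 0::real) *\<^sub>R axis i 1 + snd (0::real, 0::real) *\<^sub>R axis j 1)"
      by simp
    have A: "isCont (\<lambda>x::real \<times> real. y + Product_Type.fst x *\<^sub>R axis i 1 + snd x *\<^sub>R axis j 1) (0, 0)"
      by (intro continuous_intros)
    from isCont_o2[OF A B]
    show ?thesis by (simp add: case_prod_unfold)
  qed
  have "partial i (partial j \<phi>) (?p 0 0) = partial j (partial i \<phi>) (?p 0 0)"
  proof (rule mixed_derivatives_eq[where r = "r/2" and f = "\<lambda>s t. \<phi> (?p s t)" and ft = "\<lambda>s t. partial j \<phi> (?p s t)"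
        and fs = "\<lambda>s t. partial i \<phi> (?p s t)" and fst = "\<lambda>s t. partial i (partial j \<phi>) (?p s t)"
        and fts = "\<lambda>s t. partial j (partial i \<phi>) (?p s t)"])
    show "isCont (\<lambda>(s, t). partial i (partial j \<phi>) (?p s t)) (0, 0)" "isCont (\<lambda>(s, t). partial j (partial i \<phi>) (?p s t)) (0, 0)"
      by (rule cont)+
    show "r / 2 > 0" using r by simp
    fix s t :: real assume st: "\<bar>s\<bar> < r/2" "\<bar>t\<bar> < r/2"
    show "((\<lambda>t. \<phi> (?p s t)) has_real_derivative partial j \<phi> (?p s t)) (at t)"
      by (rule partial_line[OF d[OF inV[OF st]]])
    show "((\<lambda>t. partial i \<phi> (?p s t)) has_real_derivative partial j (partial i \<phi>) (?p s t)) (at t)"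
      by (rule partial_line[OF d1[OF inV[OF st]]])
    show "((\<lambda>s. \<phi> (?p s t)) has_real_derivative partial i \<phi> (?p s t)) (at s)"
      unfolding sw by (rule partial_line[OF d[OF inV[OF st(2,1)]]])
    show "((\<lambda>s. partial j \<phi> (?p s t)) has_real_derivative partial i (partial j \<phi>) (?p s t)) (at s)"
      unfolding sw by (rule partial_line[OF d1[OF inV[OF st(2,1)]]])
  qed
  then show ?thesis by simp
qed

lemma partial_cong_open:
  assumes "open V" "y \<in> V" "\<And>z. z \<in> V \<Longrightarrow> f z = g z"
  shows "partial i f y = partial i g y"
proof -
  have "(f has_derivative D) (at y) \<longleftrightarrow> (g has_derivative D) (at y)" for D
  proof
    assume "(f has_derivative D) (at y)"
    then show "(g has_derivative D) (at y)"
      by (rule has_derivative_transform_within_open[OF _ assms(1,2)]) (rule assms(3))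
  next
    assume "(g has_derivative D) (at y)"
    then show "(f has_derivative D) (at y)"
      by (rule has_derivative_transform_within_open[OF _ assms(1,2)]) (rule assms(3)[symmetric])
  qed
  then show ?thesis by (simp add: partial_def frechet_derivative_def)
qed

lemma matrix_inv_props:
  fixes A :: "real^'n::finite^'n"
  assumes "det A \<noteq> 0"
  shows "A ** matrix_inv A = mat 1" "matrix_inv A ** A = mat 1"
proof -
  have "\<exists>B. A ** B = mat 1 \<and> B ** A = mat 1"
    using assms by (simp add: invertible_det_nz[symmetric] invertible_def)
  from someI_ex[OF this] show "A ** matrix_inv A = mat 1" "matrix_inv A ** A = mat 1"
    unfolding matrix_inv_def by auto
qed

definition mderiv :: "(real^'n::finite \<Rightarrow> real^'m::finite^'k::finite) \<Rightarrow> real^'n \<Rightarrow> real^'n \<Rightarrow> real^'m^'k" where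
  "mderiv F y v = (\<chi> a b. \<Sum>i\<in>UNIV. partial i (\<lambda>y. F y $ a $ b) y * v $ i)"

lemma has_derivative_vec_componentI:
  fixes f :: "'a::euclidean_space \<Rightarrow> 'b::euclidean_space^'n::finite"
  assumes "\<And>i. ((\<lambda>y. f y $ i) has_derivative (\<lambda>h. f' h $ i)) (at y within S)"
  shows "(f has_derivative f') (at y within S)"
  unfolding has_derivative_componentwise_within[of f]
proof
  fix b :: "'b^'n" assume "b \<in> Basis"
  then obtain i u where b: "b = axis i u" by (auto simp: Basis_vec_def)
  show "((\<lambda>x. f x \<bullet> b) has_derivative (\<lambda>x. f' x \<bullet> b)) (at y within S)"
    unfolding b inner_axis by (rule has_derivative_inner_left[OF assms])
qed

lemma matrix_add_rdist: "(A + B) ** C = A ** C + B ** (C :: real^'l::finite^'m::finite)"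
  by (simp add: vec_eq_iff matrix_matrix_mult_def sum.distrib distrib_right)

lemma inner_transpose_left: "(transpose A *v x) \<bullet> w = x \<bullet> (A *v (w :: real^'n::finite))"
  by (metis inner_commute inner_transpose)

lemma has_derivative_mderiv:
  assumes "\<And>a b. (\<lambda>y. F y $ a $ b) differentiable at y"
  shows "(F has_derivative mderiv F y) (at y)"
proof (rule has_derivative_vec_componentI, rule has_derivative_vec_componentI)
  fix a b
  show "((\<lambda>y. F y $ a $ b) has_derivative (\<lambda>h. mderiv F y h $ a $ b)) (at y)"
    using has_derivative_partial[OF assms[of a b]] by (simp add: mderiv_def)
qed

lemma has_derivative_unique_at:
  "(f has_derivative f') (at x) \<Longrightarrow> (f has_derivative f'') (at x) \<Longrightarrow> f' = f''"
  by (rule has_derivative_unique)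

lemma matrix_mult_scaleR_left: "(c *\<^sub>R A) ** B = c *\<^sub>R (A ** (B :: real^'l::finite^'m::finite))"
  by (simp add: vec_eq_iff matrix_matrix_mult_def sum_distrib_left mult.assoc)

lemma matrix_mult_scaleR_right: "A ** (c *\<^sub>R B) = c *\<^sub>R (A ** (B :: real^'l::finite^'m::finite))"
  by (simp add: vec_eq_iff matrix_matrix_mult_def sum_distrib_left mult.left_commute)

lemma bounded_bilinear_matrix_vector: "bounded_bilinear ((*v) :: real^'m::finite^'k::finite \<Rightarrow> _)"
proof (rule bilinear_conv_bounded_bilinear[THEN iffD1], unfold bilinear_def, intro conjI allI linearI)
  fix A A' :: "real^'m^'k" and x y :: "real^'m" and c :: real
  show "A *v (x + y) = A *v x + A *v y" by (rule matrix_vector_right_distrib)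
  show "A *v (c *\<^sub>R x) = c *\<^sub>R (A *v x)" by (rule matrix_vector_mult_scaleR)
  show "(A + A') *v x = A *v x + A' *v x" by (rule matrix_vector_mult_add_rdistrib)
  show "(c *\<^sub>R A) *v x = c *\<^sub>R (A *v x)" by (rule scaleR_matrix_vector_assoc[symmetric])
qed

lemma bounded_bilinear_matrix_matrix: "bounded_bilinear ((**) :: real^'m::finite^'k::finite \<Rightarrow> real^'l::finite^'m \<Rightarrow> _)"
proof (rule bilinear_conv_bounded_bilinear[THEN iffD1], unfold bilinear_def, intro conjI allI linearI)
  fix A A' :: "real^'m^'k" and B B' :: "real^'l^'m" and c :: real
  show "A ** (B + B') = A ** B + A ** B'" by (rule matrix_add_ldistrib)
  show "A ** (c *\<^sub>R B) = c *\<^sub>R (A ** B)" by (rule matrix_mult_scaleR_right)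
  show "(A + A') ** B = A ** B + A' ** B" by (rule matrix_add_rdist)
  show "(c *\<^sub>R A) ** B = c *\<^sub>R (A ** B)" by (rule matrix_mult_scaleR_left)
qed

lemma bounded_linear_transpose: "bounded_linear (transpose :: real^'m::finite^'k::finite \<Rightarrow> _)"
  by (rule linear_conv_bounded_linear[THEN iffD1]) (auto simp: linear_iff vec_eq_iff transpose_def)

lemmas has_derivative_matvec = bounded_bilinear.FDERIV[OF bounded_bilinear_matrix_vector]
lemmas has_derivative_matmul = bounded_bilinear.FDERIV[OF bounded_bilinear_matrix_matrix]
lemmas has_derivative_transpose = bounded_linear.has_derivative[OF bounded_linear_transpose]

context rmanifold
begin

abbreviation Gm :: "('m, 'n) chart \<Rightarrow> real^'n \<Rightarrow> real^'n^'n" where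
  "Gm ct y \<equiv> gram_in M ct (chart_inv ct y)"

definition Gam :: "('m, 'n) chart \<Rightarrow> real^'n \<Rightarrow> real^'n \<Rightarrow> real^'n \<Rightarrow> real^'n" where
  "Gam ct y v w = (\<chi> l. \<Sum>i\<in>UNIV. \<Sum>j\<in>UNIV. christoffel M ct y l i j * v $ i * w $ j)"

lemma Gm_deriv:
  "ct \<in> charts M \<Longrightarrow> y \<in> snd ct ` fst ct \<Longrightarrow> (Gm ct has_derivative mderiv (Gm ct) y) (at y)"
  by (rule has_derivative_mderiv) (rule smooth_onD(1)[OF gram_in_smooth])

lemma gram_in_inverse:
  assumes "ct \<in> charts M" "x \<in> fst ct"
  shows "gram_in M ct x ** matrix_inv (gram_in M ct x) = mat 1" "matrix_inv (gram_in M ct x) ** gram_in M ct x = mat 1"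
proof -
  have "det (gram_in M ct x) \<noteq> 0" using gram_in_det_pos[OF assms] by linarith
  from matrix_inv_props[OF this]
  show "gram_in M ct x ** matrix_inv (gram_in M ct x) = mat 1" "matrix_inv (gram_in M ct x) ** gram_in M ct x = mat 1" .
qed

text \<open>The Christoffel formula multiplied by 2 G, that is, the Koszul formula in coordinates.
  No inverse matrix occurs in it, which makes the transformation law and estimates
  accessible.\<close>

lemma Gam_koszul:
  assumes "ct \<in> charts M" "y \<in> snd ct ` fst ct"
  shows "2 * (u \<bullet> (Gm ct y *v Gam ct y v w)) =
     u \<bullet> (mderiv (Gm ct) y v *v w) + u \<bullet> (mderiv (Gm ct) y w *v v) - v \<bullet> (mderiv (Gm ct) y u *v w)"
proof -
  let ?G = "Gm ct"
  define I where "I = matrix_inv (Gm ct y)"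
  define d where "d i j m = partial i (\<lambda>y. ?G y $ j $ m) y" for i j m
  have "?G y $ a $ b = ?G y $ b $ a" for y a b
    using gram_in_sym[of ct "chart_inv ct y"] by (metis transpose_def vec_lambda_beta)
  then have sym: "d i a b = d i b a" for i a b by (simp add: d_def)
  define X where "X m = (\<Sum>i\<in>UNIV. \<Sum>j\<in>UNIV. (d i j m + d j i m - d m i j) * v $ i * w $ j)" for m
  have chr: "christoffel M ct y l i j = 1/2 * (\<Sum>m\<in>UNIV. I $ l $ m * (d i j m + d j i m - d m i j))" for l i j
    by (simp add: christoffel_def Let_def d_def I_def)
  have "2 *\<^sub>R Gam ct y v w = I *v (\<chi> m. X m)"
  proof -
    have "2 * (\<Sum>i\<in>UNIV. \<Sum>j\<in>UNIV. christoffel M ct y l i j * v $ i * w $ j) = (\<Sum>m\<in>UNIV. I $ l $ m * X m)" for l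
    proof -
      have "2 * (\<Sum>i\<in>UNIV. \<Sum>j\<in>UNIV. christoffel M ct y l i j * v $ i * w $ j) =
        (\<Sum>i\<in>UNIV. \<Sum>j\<in>UNIV. \<Sum>m\<in>UNIV. I $ l $ m * ((d i j m + d j i m - d m i j) * v $ i * w $ j))"
        unfolding chr sum_distrib_left by (intro sum.cong refl) (simp add: sum_distrib_left sum_distrib_right mult.assoc)
      also have "\<dots> = (\<Sum>i\<in>UNIV. \<Sum>m\<in>UNIV. \<Sum>j\<in>UNIV. I $ l $ m * ((d i j m + d j i m - d m i j) * v $ i * w $ j))"
        by (rule sum.cong[OF refl], rule sum.swap)
      also have "\<dots> = (\<Sum>m\<in>UNIV. \<Sum>i\<in>UNIV. \<Sum>j\<in>UNIV. I $ l $ m * ((d i j m + d j i m - d m i j) * v $ i * w $ j))"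
        by (rule sum.swap)
      finally show ?thesis by (simp only: X_def sum_distrib_left)
    qed
    then show ?thesis by (simp add: vec_eq_iff Gam_def matrix_vector_mult_def)
  qed
  then have "?G y *v (2 *\<^sub>R Gam ct y v w) = (?G y ** I) *v (\<chi> m. X m)" by (simp add: matrix_vector_mul_assoc)
  then have "2 *\<^sub>R (?G y *v Gam ct y v w) = (\<chi> m. X m)"
    using gram_in_inverse(1)[OF assms(1) chart_inv_in[OF assms]] by (simp add: matrix_vector_mult_scaleR I_def)
  then have "2 * (u \<bullet> (?G y *v Gam ct y v w)) = u \<bullet> (\<chi> m. X m)" by (metis inner_scaleR_right)
  also have "\<dots> = (\<Sum>m\<in>UNIV. u $ m * (\<Sum>i\<in>UNIV. \<Sum>j\<in>UNIV. d i j m * v $ i * w $ j))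
     + (\<Sum>m\<in>UNIV. u $ m * (\<Sum>i\<in>UNIV. \<Sum>j\<in>UNIV. d j i m * v $ i * w $ j))
     - (\<Sum>m\<in>UNIV. u $ m * (\<Sum>i\<in>UNIV. \<Sum>j\<in>UNIV. d m i j * v $ i * w $ j))"
  proof -
    have "X m = (\<Sum>i\<in>UNIV. \<Sum>j\<in>UNIV. d i j m * v $ i * w $ j) + (\<Sum>i\<in>UNIV. \<Sum>j\<in>UNIV. d j i m * v $ i * w $ j)
       - (\<Sum>i\<in>UNIV. \<Sum>j\<in>UNIV. d m i j * v $ i * w $ j)" for m
      by (simp only: X_def left_diff_distrib distrib_right sum.distrib sum_subtractf)
    then show ?thesis
      by (simp add: inner_vec_def distrib_left right_diff_distrib sum.distrib sum_subtractf)
  qed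
  also have "(\<Sum>m\<in>UNIV. u $ m * (\<Sum>i\<in>UNIV. \<Sum>j\<in>UNIV. d i j m * v $ i * w $ j)) = u \<bullet> (mderiv ?G y v *v w)"
  proof -
    have "(\<Sum>i\<in>UNIV. \<Sum>j\<in>UNIV. d i j m * v $ i * w $ j) = (\<Sum>j\<in>UNIV. (\<Sum>i\<in>UNIV. d i m j * v $ i) * w $ j)" for m
      unfolding sum_distrib_right by (subst sum.swap) (intro sum.cong refl, subst sym, simp)
    then show ?thesis by (simp add: inner_vec_def matrix_vector_mult_def mderiv_def d_def)
  qed
  also have "(\<Sum>m\<in>UNIV. u $ m * (\<Sum>i\<in>UNIV. \<Sum>j\<in>UNIV. d j i m * v $ i * w $ j)) = u \<bullet> (mderiv ?G y w *v v)"
  proof -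
    have "(\<Sum>i\<in>UNIV. \<Sum>j\<in>UNIV. d j i m * v $ i * w $ j) = (\<Sum>i\<in>UNIV. (\<Sum>j\<in>UNIV. d j m i * w $ j) * v $ i)" for m
      unfolding sum_distrib_right by (intro sum.cong refl, subst sym) simp
    then show ?thesis by (simp add: inner_vec_def matrix_vector_mult_def mderiv_def d_def)
  qed
  also have "(\<Sum>m\<in>UNIV. u $ m * (\<Sum>i\<in>UNIV. \<Sum>j\<in>UNIV. d m i j * v $ i * w $ j)) = v \<bullet> (mderiv ?G y u *v w)"
  proof -
    have "(\<Sum>m\<in>UNIV. u $ m * (\<Sum>i\<in>UNIV. \<Sum>j\<in>UNIV. d m i j * v $ i * w $ j))
      = (\<Sum>i\<in>UNIV. \<Sum>m\<in>UNIV. \<Sum>j\<in>UNIV. u $ m * (d m i j * v $ i * w $ j))"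
      unfolding sum_distrib_left by (rule sum.swap)
    also have "\<dots> = (\<Sum>i\<in>UNIV. \<Sum>j\<in>UNIV. \<Sum>m\<in>UNIV. u $ m * (d m i j * v $ i * w $ j))"
      by (rule sum.cong[OF refl], rule sum.swap)
    also have "\<dots> = (\<Sum>i\<in>UNIV. v $ i * (\<Sum>j\<in>UNIV. (\<Sum>m\<in>UNIV. d m i j * u $ m) * w $ j))"
      unfolding sum_distrib_left sum_distrib_right by (intro sum.cong refl) simp
    finally show ?thesis by (simp add: inner_vec_def matrix_vector_mult_def mderiv_def d_def)
  qed
  finally show ?thesis .
qed

lemma tjac_deriv:
  assumes "ct \<in> charts M" "ct' \<in> charts M" "y \<in> snd ct ` (fst ct \<inter> fst ct')"
  shows "(tjac ct ct' has_derivative mderiv (tjac ct ct') y) (at y)"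
  by (rule has_derivative_mderiv) (rule tjac_entry_smooth(1)[OF assms])

lemma tjac_deriv_sym:
  assumes "ct \<in> charts M" "ct' \<in> charts M" "y \<in> snd ct ` (fst ct \<inter> fst ct')"
  shows "mderiv (tjac ct ct') y v *v w = mderiv (tjac ct ct') y w *v v"
proof -
  have "partial i (\<lambda>y. tjac ct ct' y $ a $ j) y = partial j (\<lambda>y. tjac ct ct' y $ a $ i) y" for a i j
    unfolding tjac_entry_smooth(2)[OF assms]
    by (rule partial_partial_commute[OF overlap_open[OF assms(1,2)] assms(3) trans_smooth[OF assms(1,2)]])
  note sy = this
  have "(mderiv (tjac ct ct') y v *v w) $ a = (mderiv (tjac ct ct') y w *v v) $ a" for a
  proof -
    let ?P = "\<lambda>i j. partial i (\<lambda>y. tjac ct ct' y $ a $ j) y"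
    have "(mderiv (tjac ct ct') y v *v w) $ a = (\<Sum>j\<in>UNIV. \<Sum>i\<in>UNIV. ?P i j * v $ i * w $ j)"
      by (simp add: matrix_vector_mult_def mderiv_def sum_distrib_right)
    also have "\<dots> = (\<Sum>i\<in>UNIV. \<Sum>j\<in>UNIV. ?P i j * v $ i * w $ j)" by (rule sum.swap)
    also have "\<dots> = (\<Sum>i\<in>UNIV. \<Sum>j\<in>UNIV. ?P j i * w $ j * v $ i)"
      by (intro sum.cong refl) (subst sy, simp)
    also have "\<dots> = (mderiv (tjac ct ct') y w *v v) $ a"
      by (simp add: matrix_vector_mult_def mderiv_def sum_distrib_right)
    finally show ?thesis .
  qed
  then show ?thesis by (simp add: vec_eq_iff)
qed

lemma Gm_deriv_trans:
  assumes k: "ct \<in> charts M" "ct' \<in> charts M" and y: "y \<in> snd ct ` (fst ct \<inter> fst ct')"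
  shows "mderiv (Gm ct) y v = transpose (mderiv (tjac ct ct') y v) ** Gm ct' (trans ct ct' y) ** tjac ct ct' y
     + transpose (tjac ct ct' y) ** mderiv (Gm ct') (trans ct ct' y) (tjac ct ct' y *v v) ** tjac ct ct' y
     + transpose (tjac ct ct' y) ** Gm ct' (trans ct ct' y) ** mderiv (tjac ct ct') y v"
proof -
  let ?J = "tjac ct ct'" and ?T = "trans ct ct'"
  note ov = overlap[OF k y]
  have T: "(?T has_derivative (*v) (?J y)) (at y)" by (rule trans_deriv(1)[OF k y])
  have "?T y \<in> snd ct' ` fst ct'" using ov(4) by auto
  from diff_chain_at[OF T Gm_deriv[OF k(2) this]]
  have GT: "((\<lambda>y. Gm ct' (?T y)) has_derivative (\<lambda>h. mderiv (Gm ct') (?T y) (?J y *v h))) (at y)" by (simp add: o_def)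
  note J = tjac_deriv[OF k y]
  have 1: "((\<lambda>y. transpose (?J y) ** Gm ct' (?T y) ** ?J y) has_derivative
    (\<lambda>h. (transpose (?J y) ** Gm ct' (?T y)) ** mderiv ?J y h +
       (transpose (?J y) ** mderiv (Gm ct') (?T y) (?J y *v h) + transpose (mderiv ?J y h) ** Gm ct' (?T y)) ** ?J y)) (at y)"
    by (intro has_derivative_matmul has_derivative_transpose J GT)
  have 2: "(Gm ct has_derivative
    (\<lambda>h. (transpose (?J y) ** Gm ct' (?T y)) ** mderiv ?J y h +
       (transpose (?J y) ** mderiv (Gm ct') (?T y) (?J y *v h) + transpose (mderiv ?J y h) ** Gm ct' (?T y)) ** ?J y)) (at y)"
  proof (rule has_derivative_transform_within_open[OF 1 overlap_open[OF k] y])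
    fix z assume z: "z \<in> snd ct ` (fst ct \<inter> fst ct')"
    note oz = overlap[OF k z]
    show "transpose (?J z) ** Gm ct' (?T z) ** ?J z = Gm ct z"
      using gram_in_trans[OF k oz(2,3)] by (simp add: oz(5,6))
  qed
  have "mderiv (Gm ct) y = (\<lambda>h. (transpose (?J y) ** Gm ct' (?T y)) ** mderiv ?J y h +
       (transpose (?J y) ** mderiv (Gm ct') (?T y) (?J y *v h) + transpose (mderiv ?J y h) ** Gm ct' (?T y)) ** ?J y)"
    by (rule has_derivative_unique_at[OF Gm_deriv[OF k(1) ov(1)] 2])
  then show ?thesis
    by (simp add: matrix_add_rdist matrix_add_ldistrib add_ac)
qed

text \<open>Inserting the derivative of the transformed metric into \<open>Gam_koszul\<close> gives
  the same formula in the other chart plus terms with the derivative of the Jacobian. By symmetry of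
  second derivatives these collapse to twice one term, the inhomogeneous part of the law.\<close>

lemma Gam_trans:
  assumes k: "ct \<in> charts M" "ct' \<in> charts M" and y: "y \<in> snd ct ` (fst ct \<inter> fst ct')"
  shows "tjac ct ct' y *v Gam ct y v w =
    Gam ct' (trans ct ct' y) (tjac ct ct' y *v v) (tjac ct ct' y *v w) + mderiv (tjac ct ct') y v *v w"
proof -
  let ?J = "tjac ct ct' y" and ?T = "trans ct ct' y" and ?DJ = "mderiv (tjac ct ct') y"
  let ?G = "Gm ct' ?T" and ?DG = "mderiv (Gm ct') ?T"
  note ov = overlap[OF k y]
  have Ty: "?T \<in> snd ct' ` fst ct'" using ov(4) by auto
  have G1: "Gm ct y = transpose ?J ** ?G ** ?J"
    using gram_in_trans[OF k ov(2,3)] by (simp add: ov(5,6))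
  have Gsym: "a \<bullet> (?G *v b) = b \<bullet> (?G *v a)" for a b
    using inner_transpose[of a ?G b] by (simp add: gram_in_sym inner_commute del: transpose_matrix_vector)
  have D: "a \<bullet> (mderiv (Gm ct) y c *v b) = (?DJ c *v a) \<bullet> (?G *v (?J *v b)) + (?J *v a) \<bullet> (?DG (?J *v c) *v (?J *v b))
      + (?J *v a) \<bullet> (?G *v (?DJ c *v b))" for a b c
    unfolding Gm_deriv_trans[OF k y]
    by (simp add: matrix_vector_mult_add_rdistrib matrix_vector_mul_assoc[symmetric] inner_add_right inner_transpose
        del: transpose_matrix_vector)
  have eq: "(?J *v u) \<bullet> (?G *v (?J *v Gam ct y v w)) = (?J *v u) \<bullet> (?G *v (Gam ct' ?T (?J *v v) (?J *v w) + ?DJ v *v w))" for u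
  proof -
    have "2 * ((?J *v u) \<bullet> (?G *v (?J *v Gam ct y v w))) = 2 * (u \<bullet> (Gm ct y *v Gam ct y v w))"
      unfolding G1 by (simp add: matrix_vector_mul_assoc[symmetric] inner_transpose del: transpose_matrix_vector)
    also have "\<dots> = u \<bullet> (mderiv (Gm ct) y v *v w) + u \<bullet> (mderiv (Gm ct) y w *v v) - v \<bullet> (mderiv (Gm ct) y u *v w)"
      by (rule Gam_koszul[OF k(1) ov(1)])
    also have "\<dots> = ((?J *v u) \<bullet> (?DG (?J *v v) *v (?J *v w)) + (?J *v u) \<bullet> (?DG (?J *v w) *v (?J *v v))
       - (?J *v v) \<bullet> (?DG (?J *v u) *v (?J *v w))) + 2 * ((?J *v u) \<bullet> (?G *v (?DJ v *v w)))"
      unfolding D tjac_deriv_sym[OF k y, of w v] tjac_deriv_sym[OF k y, of v u] tjac_deriv_sym[OF k y, of w u]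
      using Gsym[of "?DJ u *v v" "?J *v w"] Gsym[of "?J *v v" "?DJ u *v w"] by simp
    also have "\<dots> = 2 * ((?J *v u) \<bullet> (?G *v Gam ct' ?T (?J *v v) (?J *v w))) + 2 * ((?J *v u) \<bullet> (?G *v (?DJ v *v w)))"
      using Gam_koszul[OF k(2) Ty, of "?J *v u" "?J *v v" "?J *v w"] by simp
    finally show ?thesis by (simp add: matrix_vector_right_distrib inner_add_right)
  qed
  let ?d = "?J *v Gam ct y v w - (Gam ct' ?T (?J *v v) (?J *v w) + ?DJ v *v w)"
  let ?x = "chart_inv ct y"
  have inv: "?J ** tjac ct' ct ?T = mat 1"
    using tjac_inverse[OF k(2,1) ov(3,2)] ov(5,6) by (simp add: trans_def)
  \<comment> \<open>The Jacobian is surjective, so u can be chosen with image ?d; positive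
    definiteness then forces ?d = 0.\<close>
  have "(?J *v u) \<bullet> (?G *v ?d) = 0" for u
    using eq[of u] by (simp add: matrix_vector_mult_diff_distrib inner_diff_right)
  from this[of "tjac ct' ct ?T *v ?d"] have "?d \<bullet> (?G *v ?d) = 0"
    by (simp add: matrix_vector_mul_assoc inv)
  then have "?d = 0" using gram_in_pos[OF k(2) chart_inv_in[OF k(2) Ty], of ?d] by (metis less_irrefl)
  then show ?thesis by simp
qed

definition grad :: "(real^'n \<Rightarrow> real) \<Rightarrow> real^'n \<Rightarrow> real^'n" where
  "grad \<phi> y = (\<chi> i. partial i \<phi> y)"

definition hess :: "(real^'n \<Rightarrow> real) \<Rightarrow> real^'n \<Rightarrow> real^'n^'n" where
  "hess \<phi> y = (\<chi> j i. partial i (partial j \<phi>) y)"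

definition covhess :: "('m, 'n) chart \<Rightarrow> (real^'n \<Rightarrow> real) \<Rightarrow> real^'n \<Rightarrow> real^'n \<Rightarrow> real^'n \<Rightarrow> real" where
  "covhess ct \<phi> y v w = (hess \<phi> y *v v) \<bullet> w - grad \<phi> y \<bullet> Gam ct y v w"

lemma grad_deriv:
  assumes "\<phi> differentiable at y"
  shows "(\<phi> has_derivative (\<lambda>h. grad \<phi> y \<bullet> h)) (at y)"
  using has_derivative_partial[OF assms] by (simp add: grad_def inner_vec_def)

lemma hess_deriv:
  assumes "\<And>j. partial j \<phi> differentiable at y"
  shows "(grad \<phi> has_derivative (*v) (hess \<phi> y)) (at y)"
proof (rule has_derivative_vecI)
  fix j
  show "((\<lambda>y. grad \<phi> y $ j) has_derivative (\<lambda>h. (hess \<phi> y *v h) $ j)) (at y)"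
    using has_derivative_partial[OF assms[of j]] by (simp add: grad_def hess_def matrix_vector_mult_def)
qed

lemma grad_trans:
  assumes "ct \<in> charts M" "ct' \<in> charts M" "y \<in> snd ct ` (fst ct \<inter> fst ct')"
    and "\<phi> differentiable at (trans ct ct' y)"
  shows "((\<lambda>y. \<phi> (trans ct ct' y)) has_derivative (\<lambda>h. (transpose (tjac ct ct' y) *v grad \<phi> (trans ct ct' y)) \<bullet> h)) (at y)"
    "grad (\<lambda>y. \<phi> (trans ct ct' y)) y = transpose (tjac ct ct' y) *v grad \<phi> (trans ct ct' y)"
proof -
  have "((\<lambda>y. \<phi> (trans ct ct' y)) has_derivative (\<lambda>h. grad \<phi> (trans ct ct' y) \<bullet> (tjac ct ct' y *v h))) (at y)"
    using diff_chain_at[OF trans_deriv(1)[OF assms(1-3)] grad_deriv[OF assms(4)]] by (simp add: o_def)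
  also have "(\<lambda>h. grad \<phi> (trans ct ct' y) \<bullet> (tjac ct ct' y *v h)) = (\<lambda>h. (transpose (tjac ct ct' y) *v grad \<phi> (trans ct ct' y)) \<bullet> h)"
    by (rule ext) (metis inner_commute inner_transpose)
  finally show d: "((\<lambda>y. \<phi> (trans ct ct' y)) has_derivative (\<lambda>h. (transpose (tjac ct ct' y) *v grad \<phi> (trans ct ct' y)) \<bullet> h)) (at y)" .
  show "grad (\<lambda>y. \<phi> (trans ct ct' y)) y = transpose (tjac ct ct' y) *v grad \<phi> (trans ct ct' y)"
    unfolding vec_eq_iff grad_def[of "\<lambda>y. \<phi> (trans ct ct' y)"] using partial_eqI[OF d] by (simp add: inner_axis)
qed

text \<open>The second derivative of the transition map enters through the ordinary Hessian and
  through the Christoffel term with opposite signs, so it cancels and a tensor remains. The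
  regularity asked of \<phi> is that of a first derivative of the cost.\<close>

lemma covhess_trans:
  assumes k: "ct \<in> charts M" "ct' \<in> charts M" and y: "y \<in> snd ct ` (fst ct \<inter> fst ct')"
    and V: "open V" "trans ct ct' y \<in> V" and d1: "\<And>z. z \<in> V \<Longrightarrow> \<phi> differentiable at z"
    and d2: "\<And>z j. z \<in> V \<Longrightarrow> partial j \<phi> differentiable at z"
  shows "covhess ct (\<lambda>y. \<phi> (trans ct ct' y)) y v w =
     covhess ct' \<phi> (trans ct ct' y) (tjac ct ct' y *v v) (tjac ct ct' y *v w)"
proof -
  let ?J = "tjac ct ct'" and ?T = "trans ct ct'" and ?f = "\<lambda>y. \<phi> (trans ct ct' y)"
  let ?O = "snd ct ` (fst ct \<inter> fst ct') \<inter> ?T -` V"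
  have oO: "open ?O"
    using continuous_on_open_vimage[OF overlap_open[OF k], of ?T] trans_cont[OF k] V(1) by (metis Int_commute)
  have yO: "y \<in> ?O" using y V by auto
  have gr: "grad ?f z = transpose (?J z) *v grad \<phi> (?T z)" if "z \<in> ?O" for z
    by (rule grad_trans(2)[OF k]) (use that d1 in auto)
  have GT: "((\<lambda>y. grad \<phi> (?T y)) has_derivative (\<lambda>h. hess \<phi> (?T y) *v (?J y *v h))) (at y)"
    using diff_chain_at[OF trans_deriv(1)[OF k y] hess_deriv[OF d2[OF V(2)]]] by (simp add: o_def)
  have 1: "((\<lambda>y. transpose (?J y) *v grad \<phi> (?T y)) has_derivative
    (\<lambda>h. transpose (?J y) *v (hess \<phi> (?T y) *v (?J y *v h)) + transpose (mderiv ?J y h) *v grad \<phi> (?T y))) (at y)"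
    by (intro has_derivative_matvec has_derivative_transpose tjac_deriv[OF k y] GT)
  have 2: "(grad ?f has_derivative
    (\<lambda>h. transpose (?J y) *v (hess \<phi> (?T y) *v (?J y *v h)) + transpose (mderiv ?J y h) *v grad \<phi> (?T y))) (at y)"
    by (rule has_derivative_transform_within_open[OF 1 oO yO]) (simp add: gr)
  have pj: "(partial j ?f has_derivative (\<lambda>h. (transpose (?J y) *v (hess \<phi> (?T y) *v (?J y *v h)) + transpose (mderiv ?J y h) *v grad \<phi> (?T y)) $ j)) (at y)" for j
    using has_derivative_vecD[OF 2, of j] by (simp add: grad_def)
  then have "\<And>j. partial j ?f differentiable at y" by (auto simp: differentiable_def)
  from has_derivative_unique_at[OF hess_deriv[OF this] 2]
  have H: "hess ?f y *v v = transpose (?J y) *v (hess \<phi> (?T y) *v (?J y *v v)) + transpose (mderiv ?J y v) *v grad \<phi> (?T y)"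
    by (rule fun_cong)
  have "(hess ?f y *v v) \<bullet> w = (hess \<phi> (?T y) *v (?J y *v v)) \<bullet> (?J y *v w) + grad \<phi> (?T y) \<bullet> (mderiv ?J y v *v w)"
    unfolding H by (simp add: inner_add_left inner_transpose_left del: transpose_matrix_vector)
  moreover have "grad ?f y \<bullet> Gam ct y v w = grad \<phi> (?T y) \<bullet> (?J y *v Gam ct y v w)"
    unfolding gr[OF yO] by (metis inner_commute inner_transpose)
  ultimately show ?thesis
    unfolding covhess_def Gam_trans[OF k y] by (simp add: inner_add_right)
qed

end

section \<open>Bounds for the derivatives of the cost\<close>

definition posdef :: "real^'n::finite^'n \<Rightarrow> bool" where
  "posdef G \<longleftrightarrow> transpose G = G \<and> (\<forall>v. v \<noteq> 0 \<longrightarrow> v \<bullet> (G *v v) > 0)"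

lemma norm_matvec_le: "norm (A *v v) \<le> norm A * norm (v :: real^'m::finite)" for A :: "real^'m^'k::finite"
proof -
  have "norm (A *v v) = L2_set (\<lambda>i. \<bar>(A *v v) $ i\<bar>) UNIV" by (simp add: norm_vec_def)
  also have "\<dots> \<le> L2_set (\<lambda>i. norm v * norm (A $ i)) UNIV"
  proof (rule L2_set_mono)
    fix i
    have "(A *v v) $ i = A $ i \<bullet> v" by (simp add: matrix_vector_mult_def inner_vec_def)
    then show "\<bar>(A *v v) $ i\<bar> \<le> norm v * norm (A $ i)"
      using Cauchy_Schwarz_ineq2[of "A $ i" v] by (simp add: mult.commute)
  qed simp
  also have "\<dots> = norm v * norm A" by (simp add: L2_set_right_distrib[symmetric] norm_vec_def[of A])
  finally show ?thesis by (simp add: mult.commute)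
qed

text \<open>A is any factor, not necessarily triangular. It maps the space with inner product G
  isometrically to Euclidean space, and the transpose of Ai does so for the dual inner
  product.\<close>

definition chol :: "real^'n::finite^'n \<Rightarrow> real^'n^'n \<Rightarrow> real^'n^'n \<Rightarrow> bool" where
  "chol G A Ai \<longleftrightarrow> G = transpose A ** A \<and> A ** Ai = mat 1 \<and> Ai ** A = mat 1 \<and> matrix_inv G = Ai ** transpose Ai \<and>
    (\<forall>v. nrm G v = norm (A *v v)) \<and> (\<forall>p. nrm (matrix_inv G) p = norm (transpose Ai *v p)) \<and> det G = (det A)\<^sup>2"

lemma cholD:
  assumes "chol G A Ai"
  shows "G = transpose A ** A" "A ** Ai = mat 1" "Ai ** A = mat 1" "matrix_inv G = Ai ** transpose Ai"
    "nrm G v = norm (A *v v)" "nrm (matrix_inv G) p = norm (transpose Ai *v p)" "det G = (det A)\<^sup>2"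
  using assms unfolding chol_def by - (elim conjE, (assumption | erule spec))+

lemma ex_nonzero_vec: "\<exists>v :: real^'n::finite. v \<noteq> 0"
  by (rule exI[of _ "axis undefined 1"]) (simp add: axis_eq_0_iff)

lemma posdef_cholesky:
  assumes "posdef G"
  obtains A Ai where "chol G A Ai"
proof -
  have "\<And>v. v \<noteq> 0 \<Longrightarrow> v \<bullet> (G *v v) > 0" "transpose G = G" using assms by (auto simp: posdef_def)
  then obtain A where A: "G = transpose A ** A" "det A \<noteq> 0" by (rule posdef_factor) blast
  obtain Ai where Ai: "A ** Ai = mat 1" "Ai ** A = mat 1"
    using A(2) by (auto simp: invertible_det_nz[symmetric] invertible_def)
  have AiT: "transpose Ai ** transpose A = mat 1" "transpose A ** transpose Ai = mat 1"
    using arg_cong[OF Ai(1), of transpose] arg_cong[OF Ai(2), of transpose] by (simp_all add: matrix_transpose_mul transpose_mat)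
  have GI: "G ** (Ai ** transpose Ai) = mat 1"
  proof -
    have "G ** (Ai ** transpose Ai) = transpose A ** (A ** Ai) ** transpose Ai" by (simp only: A matrix_mul_assoc)
    then show ?thesis by (simp add: Ai AiT)
  qed
  have "det G \<noteq> 0" using arg_cong[OF GI, of det] by (auto simp: det_mul)
  note B = matrix_inv_props[OF this]
  have inv: "matrix_inv G = Ai ** transpose Ai"
  proof -
    have "matrix_inv G = matrix_inv G ** (G ** (Ai ** transpose Ai))" by (simp add: GI)
    also have "\<dots> = Ai ** transpose Ai" by (simp add: matrix_mul_assoc B)
    finally show ?thesis .
  qed
  have 1: "nrm G v = norm (A *v v)" for v
    by (simp add: nrm_def ip_def A(1) matrix_vector_mul_assoc[symmetric] inner_transpose norm_eq_sqrt_inner del: transpose_matrix_vector)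
  have "p \<bullet> (matrix_inv G *v p) = (transpose Ai *v p) \<bullet> (transpose Ai *v p)" for p
    using inner_transpose[of p "transpose Ai" "transpose Ai *v p"]
    by (simp add: inv matrix_vector_mul_assoc[symmetric] del: transpose_matrix_vector)
  then have 2: "nrm (matrix_inv G) p = norm (transpose Ai *v p)" for p
    by (simp add: nrm_def ip_def norm_eq_sqrt_inner)
  have "det G = (det A)\<^sup>2" by (simp add: A(1) det_mul det_transpose power2_eq_square)
  then show ?thesis using that[of A Ai] A(1) Ai inv 1 2 unfolding chol_def by blast
qed

text \<open>The hypothesis is tested at the vector representing p, where p . w is the square of the
  dual norm of p and the norm of w is that dual norm itself.\<close>

lemma dual_bound:
  fixes G :: "real^'n::finite^'n"
  assumes G: "posdef G" and B: "\<And>w. p \<bullet> w \<le> B * nrm G w"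
  shows "nrm (matrix_inv G) p \<le> B"
proof -
  obtain A Ai where ch: "chol G A Ai" by (rule posdef_cholesky[OF G])
  note A = cholD(2,5,6)[OF ch]
  let ?t = "transpose Ai *v p"
  have AA: "A *v (Ai *v w) = w" for w by (simp add: matrix_vector_mul_assoc A(1))
  have "nrm G (Ai *v ?t) = norm ?t" by (simp only: A(2) AA)
  moreover have "p \<bullet> (Ai *v ?t) = (norm ?t)\<^sup>2"
    using inner_transpose_left[of Ai p "?t"] by (simp add: dot_square_norm del: transpose_matrix_vector)
  ultimately have "norm ?t * norm ?t \<le> B * norm ?t"
    using B[of "Ai *v ?t"] by (simp add: power2_eq_square)
  \<comment> \<open>If p has norm 0 the representing vector gives nothing; testing a nonzero w and
    -w shows 0 \<le> B.\<close>
  moreover have "0 \<le> B" if "norm ?t = 0"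
  proof -
    obtain w :: "real^'n" where "w \<noteq> 0" using ex_nonzero_vec by blast
    then have "w \<bullet> (G *v w) > 0" using G by (auto simp: posdef_def)
    then have n: "nrm G w > 0" "nrm G (- w) > 0" by (simp_all add: nrm_def ip_def linear_neg[OF matrix_vector_mul_linear])
    have "p \<bullet> w \<le> B * nrm G w" "- (p \<bullet> w) \<le> B * nrm G (- w)" using B[of w] B[of "- w"] by auto
    moreover have ne: "nrm G (- w) = nrm G w" by (simp add: nrm_def ip_def linear_neg[OF matrix_vector_mul_linear])
    ultimately have "0 \<le> B * nrm G w" unfolding ne by linarith
    then show ?thesis using n by (simp add: zero_le_mult_iff)
  qed
  ultimately show ?thesis unfolding A(3)
    by (cases "norm ?t = 0") (simp_all only: mult_le_cancel_right, use norm_ge_zero[of ?t] in linarith)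
qed

lemma dual_cauchy:
  assumes G: "posdef G"
  shows "\<bar>p \<bullet> w\<bar> \<le> nrm (matrix_inv G) p * nrm G w"
proof -
  obtain A Ai where ch: "chol G A Ai" by (rule posdef_cholesky[OF G])
  note A = cholD(3,5,6)[OF ch]
  have "p \<bullet> w = p \<bullet> (Ai *v (A *v w))" by (simp add: matrix_vector_mul_assoc A(1))
  also have "\<dots> = (transpose Ai *v p) \<bullet> (A *v w)" by (simp only: inner_transpose_left)
  finally show ?thesis unfolding A using Cauchy_Schwarz_ineq2[of "transpose Ai *v p" "A *v w"] by simp
qed

lemma nrm_zero [simp]: "nrm H 0 = 0"
  by (simp add: nrm_def ip_def)

lemma nrm_scaleR: "nrm H (a *\<^sub>R v) = \<bar>a\<bar> * nrm H v"
proof -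
  have "ip H (a *\<^sub>R v) (a *\<^sub>R v) = a\<^sup>2 * ip H v v"
    by (simp add: ip_def matrix_vector_mult_scaleR power2_eq_square)
  then show ?thesis by (simp add: nrm_def real_sqrt_mult)
qed

lemma nrm_pos: "posdef G \<Longrightarrow> v \<noteq> 0 \<Longrightarrow> 0 < nrm G v"
  by (simp add: nrm_def ip_def posdef_def)

lemma nrm_nonneg: "posdef G \<Longrightarrow> 0 \<le> nrm G v"
  using nrm_pos[of G v] by (cases "v = 0") auto

lemma posdef_inv:
  assumes "posdef G"
  shows "posdef (matrix_inv G)"
proof -
  obtain A Ai where ch: "chol G A Ai" by (rule posdef_cholesky[OF assms])
  note A = cholD(2,3,4,6)[OF ch]
  have "0 < p \<bullet> (matrix_inv G *v p)" if "p \<noteq> 0" for p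
  proof -
    have "transpose A *v (transpose Ai *v p) = p"
      using arg_cong[OF A(2), of transpose] by (simp add: matrix_vector_mul_assoc matrix_transpose_mul transpose_mat del: transpose_matrix_vector)
    then have "transpose Ai *v p \<noteq> 0" using that by (metis matrix_vector_mult_0_right)
    then have "0 < nrm (matrix_inv G) p" unfolding A(4) by (simp del: transpose_matrix_vector)
    then show ?thesis by (simp add: nrm_def ip_def)
  qed
  then show ?thesis by (simp add: posdef_def A(3) matrix_transpose_mul)
qed

lemma nrm_le_norm: "nrm H v \<le> sqrt (norm H) * norm v"
proof -
  have "v \<bullet> (H *v v) \<le> norm v * norm (H *v v)" by (rule norm_cauchy_schwarz)
  also have "\<dots> \<le> norm v * (norm H * norm v)" by (intro mult_left_mono norm_matvec_le) auto
  finally have "v \<bullet> (H *v v) \<le> norm H * (norm v)\<^sup>2" by (simp add: power2_eq_square mult_ac)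
  then have "sqrt (v \<bullet> (H *v v)) \<le> sqrt (norm H * (norm v)\<^sup>2)" by (rule real_sqrt_le_mono)
  then show ?thesis by (simp add: nrm_def ip_def real_sqrt_mult)
qed

lemma opnorm_le:
  assumes "\<And>p. nrm H p \<le> 1 \<Longrightarrow> nrm H' (A *v p) \<le> B"
  shows "opnorm H H' A \<le> B"
  unfolding opnorm_def
proof (rule cSup_least)
  show "{nrm H' (A *v p) |p. nrm H p \<le> 1} \<noteq> {}" by (auto intro!: exI[of _ 0])
qed (use assms in auto)

text \<open>The factorisation of H bounds its unit ball, so the supremum in \<open>opnorm\<close> is
  over a bounded set and is an upper bound; homogeneity does the rest.\<close>

lemma opnorm_bound:
  assumes H: "posdef H" and H': "posdef H'"
  shows "nrm H' (A *v p) \<le> opnorm H H' A * nrm H p" "0 \<le> opnorm H H' A"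
proof -
  obtain F Fi where ch: "chol H F Fi" by (rule posdef_cholesky[OF H])
  note F = cholD(2,3,5)[OF ch]
  have "nrm H' (A *v p) \<le> sqrt (norm H') * (norm (A ** Fi) * 1)" if "nrm H p \<le> 1" for p
  proof -
    have "A *v p = (A ** Fi) *v (F *v p)" by (simp add: matrix_vector_mul_assoc matrix_mul_assoc[symmetric] F)
    then have "norm (A *v p) \<le> norm (A ** Fi) * norm (F *v p)" by (simp add: norm_matvec_le)
    also have "\<dots> \<le> norm (A ** Fi) * 1" using that by (intro mult_left_mono) (auto simp: F)
    finally have "sqrt (norm H') * norm (A *v p) \<le> sqrt (norm H') * (norm (A ** Fi) * 1)" by (intro mult_left_mono) auto
    then show ?thesis using nrm_le_norm[of H' "A *v p"] by linarith
  qed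
  then have bdd: "bdd_above {nrm H' (A *v p) |p. nrm H p \<le> 1}" by (auto intro!: bdd_aboveI)
  have le: "nrm H' (A *v p) \<le> opnorm H H' A" if "nrm H p \<le> 1" for p
    unfolding opnorm_def using that by (intro cSup_upper bdd) auto
  show "0 \<le> opnorm H H' A" using le[of 0] by simp
  show "nrm H' (A *v p) \<le> opnorm H H' A * nrm H p"
  proof (cases "p = 0")
    case False
    then have n: "nrm H p > 0" using nrm_pos[OF H] by auto
    have "nrm H' (A *v ((1 / nrm H p) *\<^sub>R p)) \<le> opnorm H H' A"
      by (rule le) (use n in \<open>simp add: nrm_scaleR\<close>)
    then have "(1 / nrm H p) * nrm H' (A *v p) \<le> opnorm H H' A"
      using n by (simp add: matrix_vector_mult_scaleR nrm_scaleR)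
    then show ?thesis using n by (simp add: field_simps)
  qed simp
qed

lemma posdef_local_bounds:
  fixes G :: "'a::topological_space \<Rightarrow> real^'n::finite^'n"
  assumes cont: "continuous_on U G" and U: "open U" "x0 \<in> U" and pd: "posdef (G x0)"
  obtains N l L where "open N" "x0 \<in> N" "N \<subseteq> U" "0 < l" "0 < L"
    "\<And>x v. x \<in> N \<Longrightarrow> l * norm v \<le> nrm (G x) v" "\<And>x v. x \<in> N \<Longrightarrow> nrm (G x) v \<le> L * norm v"
proof -
  obtain A Ai where ch: "chol (G x0) A Ai" by (rule posdef_cholesky[OF pd])
  note A = cholD(3,5)[OF ch]
  have low: "norm v \<le> norm Ai * nrm (G x0) v" for v
  proof -
    have "norm v = norm (Ai *v (A *v v))" by (simp add: matrix_vector_mul_assoc A(1))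
    also have "\<dots> \<le> norm Ai * norm (A *v v)" by (rule norm_matvec_le)
    finally show ?thesis by (simp add: A(2))
  qed
  have a0: "norm Ai > 0"
  proof -
    obtain v :: "real^'n" where "v \<noteq> 0" using ex_nonzero_vec by blast
    then have "0 < norm v" by simp
    then have "0 < norm Ai * nrm (G x0) v" using low[of v] by linarith
    then have "norm Ai \<noteq> 0" by auto
    then show ?thesis by simp
  qed
  \<comment> \<open>Half of the lower bound 1 / |Ai|^2 for the quadratic form of G x0, so that
    nearby forms keep at least the other half.\<close>
  define e where "e = 1 / (2 * (norm Ai)\<^sup>2)"
  have e: "e > 0" using a0 by (simp add: e_def)
  have "\<exists>N. open N \<and> x0 \<in> N \<and> N \<subseteq> U \<and> (\<forall>x\<in>N. norm (G x - G x0) < e)"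
  proof -
    have "open (G -` ball (G x0) e \<inter> U)"
      using cont U(1) continuous_on_open_vimage[OF U(1), of G] by auto
    then show ?thesis using U(2) e
      by (intro exI[of _ "G -` ball (G x0) e \<inter> U"]) (auto simp: dist_norm norm_minus_commute)
  qed
  then obtain N where N: "open N" "x0 \<in> N" "N \<subseteq> U" "\<And>x. x \<in> N \<Longrightarrow> norm (G x - G x0) < e" by blast
  define L where "L = sqrt (norm (G x0) + e)"
  have L0: "L > 0" using e by (simp add: L_def add_nonneg_pos)
  have up: "nrm (G x) v \<le> L * norm v" if "x \<in> N" for x v
  proof -
    have "norm (G x) \<le> norm (G x0) + e" using N(4)[OF that] norm_triangle_ineq2[of "G x" "G x0"] by linarith
    then have "sqrt (norm (G x)) * norm v \<le> L * norm v" unfolding L_def by (intro mult_right_mono) auto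
    then show ?thesis using nrm_le_norm[of "G x" v] by linarith
  qed
  have lo: "1 / (2 * norm Ai) * norm v \<le> nrm (G x) v" if "x \<in> N" for x v
  proof -
    have "(norm v)\<^sup>2 \<le> (norm Ai * nrm (G x0) v)\<^sup>2" by (intro power_mono low) auto
    also have "\<dots> = (norm Ai)\<^sup>2 * (v \<bullet> (G x0 *v v))"
    proof -
      have "0 \<le> v \<bullet> (G x0 *v v)" using pd by (cases "v = 0") (auto simp: posdef_def less_imp_le)
      then show ?thesis by (simp add: power_mult_distrib nrm_def ip_def)
    qed
    finally have 1: "(norm v)\<^sup>2 / (norm Ai)\<^sup>2 \<le> v \<bullet> (G x0 *v v)" using a0 by (simp add: field_simps)
    have "\<bar>v \<bullet> ((G x - G x0) *v v)\<bar> \<le> norm v * norm ((G x - G x0) *v v)" by (rule Cauchy_Schwarz_ineq2)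
    also have "\<dots> \<le> norm v * (norm (G x - G x0) * norm v)" by (intro mult_left_mono norm_matvec_le) auto
    also have "\<dots> \<le> norm v * (e * norm v)" using N(4)[OF that] by (intro mult_left_mono mult_right_mono) auto
    also have "\<dots> = (norm v)\<^sup>2 / (2 * (norm Ai)\<^sup>2)" by (simp add: e_def power2_eq_square)
    finally have 2: "\<bar>v \<bullet> ((G x - G x0) *v v)\<bar> \<le> (norm v)\<^sup>2 / (2 * (norm Ai)\<^sup>2)" .
    have 3: "v \<bullet> (G x *v v) = v \<bullet> (G x0 *v v) + v \<bullet> ((G x - G x0) *v v)"
      by (simp add: matrix_vector_mult_diff_rdistrib inner_diff_right)
    have "(norm v)\<^sup>2 / (norm Ai)\<^sup>2 - (norm v)\<^sup>2 / (2 * (norm Ai)\<^sup>2) = (norm v)\<^sup>2 / (2 * (norm Ai)\<^sup>2)"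
      using a0 by (simp add: field_simps)
    then have "(norm v)\<^sup>2 / (2 * (norm Ai)\<^sup>2) \<le> v \<bullet> (G x *v v)" using 1 2 3 by linarith
    moreover have "(norm v)\<^sup>2 / (4 * (norm Ai)\<^sup>2) \<le> (norm v)\<^sup>2 / (2 * (norm Ai)\<^sup>2)"
      using a0 by (intro divide_left_mono) auto
    moreover have "(1 / (2 * norm Ai) * norm v)\<^sup>2 = (norm v)\<^sup>2 / (4 * (norm Ai)\<^sup>2)"
      by (simp add: power_mult_distrib power_divide)
    ultimately have "(1 / (2 * norm Ai) * norm v)\<^sup>2 \<le> v \<bullet> (G x *v v)" by linarith
    then show ?thesis unfolding nrm_def ip_def using a0 by (intro real_le_rsqrt) auto
  qed
  show ?thesis
    by (rule that[OF N(1-3) _ L0 lo up]) (use a0 in auto)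
qed

text \<open>By a finite subcover and monotonicity in the constant; the sum of the absolute values of
  the local constants dominates each of them. Abstract in R, because the properties in question are
  formulated in charts that change from point to point.\<close>

lemma compact_local_bound:
  fixes K :: "'a::topological_space set" and K' :: "'b::topological_space set"
  assumes K: "compact K" "compact K'"
    and loc: "\<And>x x'. x \<in> K \<Longrightarrow> x' \<in> K' \<Longrightarrow> \<exists>N N' (B::real). open N \<and> open N' \<and> x \<in> N \<and> x' \<in> N' \<and> (\<forall>y\<in>N. \<forall>y'\<in>N'. R B y y')"
    and mono: "\<And>B B' y y'. R B y y' \<Longrightarrow> B \<le> B' \<Longrightarrow> R B' y y'"
  obtains B where "0 \<le> B" "\<And>x x'. x \<in> K \<Longrightarrow> x' \<in> K' \<Longrightarrow> R B x x'"
proof -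
  have "\<exists>W B. open W \<and> z \<in> W \<and> (\<forall>w\<in>W. R B (fst w) (snd w))" if "z \<in> K \<times> K'" for z
  proof -
    obtain N N' B where "open N" "open N'" "fst z \<in> N" "snd z \<in> N'" "\<forall>y\<in>N. \<forall>y'\<in>N'. R B y y'"
      using loc[of "fst z" "snd z"] \<open>z \<in> K \<times> K'\<close> by auto
    then show ?thesis by (intro exI[of _ "N \<times> N'"] exI[of _ B]) (auto simp: open_Times mem_Times_iff)
  qed
  then obtain W B where W: "\<And>z. z \<in> K \<times> K' \<Longrightarrow> open (W z)" "\<And>z. z \<in> K \<times> K' \<Longrightarrow> z \<in> W z"
     "\<And>z w. z \<in> K \<times> K' \<Longrightarrow> w \<in> W z \<Longrightarrow> R (B z) (fst w) (snd w)" by metis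
  have "compact (K \<times> K')" by (rule compact_Times[OF K])
  then obtain F where F: "F \<subseteq> K \<times> K'" "finite F" "K \<times> K' \<subseteq> (\<Union>z\<in>F. W z)"
  proof (rule compactE_image)
    show "open (W z)" if "z \<in> K \<times> K'" for z using W(1) that .
    show "K \<times> K' \<subseteq> (\<Union>z\<in>K \<times> K'. W z)" using W(2) by (intro subsetI UN_I)
  qed
  define B0 where "B0 = (\<Sum>z\<in>F. \<bar>B z\<bar>)"
  have "R B0 x x'" if "x \<in> K" "x' \<in> K'" for x x'
  proof -
    have "(x, x') \<in> (\<Union>z\<in>F. W z)" using F(3) that by (meson SigmaI subsetD)
    then obtain z where z: "z \<in> F" "(x, x') \<in> W z" by (rule UN_E)
    have "z \<in> K \<times> K'" using z(1) F(1) by (rule subsetD[rotated])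
    from W(3)[OF this z(2)] have "R (B z) x x'" by simp
    moreover have "B z \<le> B0"
    proof -
      have "\<bar>B z\<bar> \<le> B0" unfolding B0_def by (rule member_le_sum) (use z F in auto)
      then show ?thesis by linarith
    qed
    ultimately show ?thesis by (rule mono)
  qed
  moreover have "0 \<le> B0" by (simp add: B0_def sum_nonneg)
  ultimately show ?thesis using that by blast
qed

lemma trilinear_bound:
  fixes F :: "'n::finite \<Rightarrow> 'n \<Rightarrow> 'n \<Rightarrow> real"
  assumes "\<And>k j i. \<bar>F k j i\<bar> \<le> B"
  shows "\<bar>\<Sum>k\<in>UNIV. \<Sum>j\<in>UNIV. \<Sum>i\<in>UNIV. F k j i * v $ i * w $ j * u $ k\<bar>
     \<le> real CARD('n) ^ 3 * B * norm v * norm w * norm u"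
proof -
  have B: "0 \<le> B" using order_trans[OF abs_ge_zero assms] .
  have t: "\<bar>F k j i * v $ i * w $ j * u $ k\<bar> \<le> B * norm v * norm w * norm u" for k j i
    unfolding abs_mult by (intro mult_mono assms component_le_norm_cart mult_nonneg_nonneg B) auto
  have "\<bar>\<Sum>k\<in>UNIV. \<Sum>j\<in>UNIV. \<Sum>i\<in>UNIV. F k j i * v $ i * w $ j * u $ k\<bar>
     \<le> (\<Sum>k\<in>(UNIV::'n set). \<Sum>j\<in>(UNIV::'n set). \<Sum>i\<in>(UNIV::'n set). B * norm v * norm w * norm u)"
    by (intro order_trans[OF sum_abs] sum_mono t)
  then show ?thesis by (simp add: power3_eq_cube mult_ac)
qed

lemma continuous_on_prod_nbhd:
  assumes "continuous_on (A \<times> A') g" "a \<in> A" "a' \<in> A'" "open B" "g (a, a') \<in> B"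
  obtains N N' where "open N" "open N'" "a \<in> N" "a' \<in> N'" "\<And>x x'. x \<in> N \<Longrightarrow> x' \<in> N' \<Longrightarrow> x \<in> A \<Longrightarrow> x' \<in> A' \<Longrightarrow> g (x, x') \<in> B"
proof -
  have "\<exists>W. open W \<and> (a, a') \<in> W \<and> (\<forall>y\<in>A \<times> A'. y \<in> W \<longrightarrow> g y \<in> B)"
    using assms(1)[unfolded continuous_on_topological, rule_format, of "(a, a')" B] assms(2-5) by auto
  then obtain W where W: "open W" "(a, a') \<in> W" "\<And>y. y \<in> A \<times> A' \<Longrightarrow> y \<in> W \<Longrightarrow> g y \<in> B" by blast
  obtain N N' where N: "open N" "open N'" "(a, a') \<in> N \<times> N'" "N \<times> N' \<subseteq> W"
    by (rule open_prod_elim[OF W(1,2)])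
  show ?thesis
  proof (rule that[OF N(1,2)])
    show "g (x, x') \<in> B" if "x \<in> N" "x' \<in> N'" "x \<in> A" "x' \<in> A'" for x x'
      using that N(4) by (intro W(3)) auto
  qed (use N(3) in auto)
qed

lemma open_closure_limpt:
  fixes S :: "'a::perfect_space set"
  assumes "open S" "x \<in> closure S"
  shows "at x within S \<noteq> bot"
proof -
  have "x islimpt S"
  proof (cases "x \<in> S")
    case True
    then show ?thesis using assms(1) interior_limit_point[of x S] by (simp add: interior_open)
  next
    case False
    then show ?thesis using assms(2) by (simp add: closure_def)
  qed
  then show ?thesis by (simp add: trivial_limit_within)
qed

context rmanifold
begin

lemma posdef_gram_in: "ct \<in> charts M \<Longrightarrow> x \<in> fst ct \<Longrightarrow> posdef (gram_in M ct x)"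
  by (simp add: posdef_def gram_in_pos gram_in_sym)

lemma posdef_gram: "posdef (gram M x)"
  by (simp add: posdef_def gram_pos gram_sym)

lemma nrm_trans:
  assumes "ct \<in> charts M" "ct' \<in> charts M" "x \<in> fst ct" "x \<in> fst ct'"
  shows "nrm (gram_in M ct x) v = nrm (gram_in M ct' x) (tjac ct ct' (snd ct x) *v v)"
  by (simp only: gram_in_trans[OF assms] nrm_def ip_def matrix_vector_mul_assoc[symmetric] inner_transpose)

lemma gram_local_bounds:
  assumes k: "ct \<in> charts M" and x0: "x0 \<in> fst ct"
  obtains N l L where "open N" "x0 \<in> N" "N \<subseteq> fst ct" "0 < l" "0 < L"
    "\<And>x v. x \<in> N \<Longrightarrow> l * norm v \<le> nrm (gram_in M ct x) v" "\<And>x v. x \<in> N \<Longrightarrow> nrm (gram_in M ct x) v \<le> L * norm v"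
proof -
  have "continuous_on (fst ct) (\<lambda>x. gram_in M ct (chart_inv ct (snd ct x)))"
    by (rule continuous_on_compose2[OF gram_in_cont[OF k] chart_cont(1)[OF k]]) auto
  then have c: "continuous_on (fst ct) (gram_in M ct)"
    by (rule continuous_on_eq) (simp add: chart_inv1[OF k])
  show ?thesis by (rule posdef_local_bounds[OF c chart_open(1)[OF k] x0 posdef_gram_in[OF k x0]]) (rule that)
qed

text \<open>In \<open>Gam_koszul\<close> with u the Christoffel vector itself the left side is at
  least 2 l^2 times its squared norm, while the right side is linear in that norm; the inverse
  metric never has to be estimated.\<close>

lemma Gam_local_bound:
  assumes k: "ct \<in> charts M" and x0: "x0 \<in> fst ct"
  obtains N C where "open N" "x0 \<in> N" "N \<subseteq> fst ct" "0 \<le> C"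
    "\<And>x v w. x \<in> N \<Longrightarrow> norm (Gam ct (snd ct x) v w) \<le> C * norm v * norm w"
proof -
  obtain N l L where N: "open N" "x0 \<in> N" "N \<subseteq> fst ct" "0 < l" "0 < L"
    and lo: "\<And>x v. x \<in> N \<Longrightarrow> l * norm v \<le> nrm (gram_in M ct x) v" and "\<And>x v. x \<in> N \<Longrightarrow> nrm (gram_in M ct x) v \<le> L * norm v"
    by (rule gram_local_bounds[OF k x0], rule that)
  define p where "p x = (\<chi> t. partial (snd (snd t)) (\<lambda>y. Gm ct y $ fst t $ fst (snd t)) (snd ct x))" for x
  have "continuous_on (fst ct) p"
    unfolding p_def
  proof (intro continuous_on_vec_lambda)
    fix t :: "'n \<times> 'n \<times> 'n"
    show "continuous_on (fst ct) (\<lambda>x. partial (snd (snd t)) (\<lambda>y. Gm ct y $ fst t $ fst (snd t)) (snd ct x))"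
      by (rule continuous_on_compose2[OF smooth_onD(2)[OF smooth_onD(3)[OF gram_in_smooth[OF k]]] chart_cont(1)[OF k]]) auto
  qed
  from this[unfolded continuous_on_topological, rule_format, OF x0, of "ball (p x0) 1"]
  obtain W where W: "open W" "x0 \<in> W" "\<And>x. x \<in> fst ct \<Longrightarrow> x \<in> W \<Longrightarrow> p x \<in> ball (p x0) 1" by auto
  define B where "B = norm (p x0) + 1"
  have B0: "0 \<le> B" by (simp add: B_def)
  have pb: "\<bar>partial i (\<lambda>y. Gm ct y $ a $ b) (snd ct x)\<bar> \<le> B" if "x \<in> N \<inter> W" for x i a b
  proof -
    have "norm (p x) \<le> B" using W(3)[of x] that N(3) norm_triangle_ineq2[of "p x" "p x0"]
      by (auto simp: B_def dist_norm norm_minus_commute)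
    then show ?thesis using component_le_norm_cart[of "p x" "(a, b, i)"] by (simp add: p_def)
  qed
  let ?n = "real CARD('n) ^ 3"
  have mb: "\<bar>u \<bullet> (mderiv (Gm ct) (snd ct x) v *v w)\<bar> \<le> ?n * B * norm v * norm w * norm u" if "x \<in> N \<inter> W" for x u v w
  proof -
    have "u \<bullet> (mderiv (Gm ct) (snd ct x) v *v w) = (\<Sum>k\<in>UNIV. \<Sum>j\<in>UNIV. \<Sum>i\<in>UNIV. partial i (\<lambda>y. Gm ct y $ k $ j) (snd ct x) * v $ i * w $ j * u $ k)"
      by (simp add: inner_vec_def matrix_vector_mult_def mderiv_def sum_distrib_left sum_distrib_right mult_ac)
    then show ?thesis using trilinear_bound[of "\<lambda>k j i. partial i (\<lambda>y. Gm ct y $ k $ j) (snd ct x)", OF pb[OF that]] by simp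
  qed
  define C where "C = 3 * ?n * B / (2 * l\<^sup>2)"
  have gb: "norm (Gam ct (snd ct x) v w) \<le> C * norm v * norm w" if x: "x \<in> N \<inter> W" for x v w
  proof -
    let ?g = "Gam ct (snd ct x) v w"
    have xk: "x \<in> fst ct" "snd ct x \<in> snd ct ` fst ct" using x N(3) by auto
    have ci: "chart_inv ct (snd ct x) = x" by (rule chart_inv1[OF k xk(1)])
    have "2 * (?g \<bullet> (Gm ct (snd ct x) *v ?g)) \<le> 3 * (?n * B * norm v * norm w * norm ?g)"
      unfolding Gam_koszul[OF k xk(2)]
      using mb[OF x, of ?g v w] mb[OF x, of ?g w v] mb[OF x, of v ?g w]
      by (simp add: mult_ac abs_le_iff)
    moreover have "?g \<bullet> (Gm ct (snd ct x) *v ?g) \<ge> (l * norm ?g)\<^sup>2"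
    proof -
      have "(l * norm ?g)\<^sup>2 \<le> (nrm (gram_in M ct x) ?g)\<^sup>2"
        using lo[of x ?g] x N(4) by (intro power_mono) auto
      also have "\<dots> = ?g \<bullet> (gram_in M ct x *v ?g)"
        using gram_in_pos[OF k xk(1), of ?g] by (cases "?g = 0") (auto simp: nrm_def ip_def less_imp_le)
      finally show ?thesis by (simp add: ci)
    qed
    ultimately have "2 * l\<^sup>2 * norm ?g * norm ?g \<le> (3 * ?n * B * norm v * norm w) * norm ?g"
      by (simp add: power_mult_distrib power2_eq_square mult_ac)
    then have "2 * l\<^sup>2 * norm ?g \<le> 3 * ?n * B * norm v * norm w" if "norm ?g > 0"
      using that by (simp only: mult_le_cancel_right_pos)
    moreover have "0 \<le> 3 * ?n * B * norm v * norm w" using B0 by simp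
    ultimately have "2 * l\<^sup>2 * norm ?g \<le> 3 * ?n * B * norm v * norm w"
      by (cases "?g = 0") auto
    then show ?thesis using N(4) by (simp add: C_def field_simps)
  qed
  show ?thesis
    by (rule that[of "N \<inter> W" C]) (use N W gb B0 in \<open>auto simp: C_def\<close>)
qed

lemma grad_cong:
  assumes "open V" "y \<in> V" "\<And>z. z \<in> V \<Longrightarrow> f z = g z"
  shows "grad f y = grad g y" "covhess ct f y v w = covhess ct g y v w"
proof -
  have 1: "partial i f z = partial i g z" if "z \<in> V" for i z by (rule partial_cong_open[OF assms(1) that assms(3)])
  have 2: "partial i (partial j f) y = partial i (partial j g) y" for i j
    by (rule partial_cong_open[OF assms(1,2)]) (rule 1)
  show "grad f y = grad g y" by (simp add: grad_def 1[OF assms(2)])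
  then show "covhess ct f y v w = covhess ct g y v w" by (simp add: covhess_def hess_def 2)
qed

end

section \<open>Mixed derivatives of the cost as tensors\<close>

text \<open>One half of the symmetric situation: order 1 in the second and order up to 2 in the
  first variable. It is instantiated for c and, with the manifolds exchanged, for
  \<open>flip c\<close>.\<close>

locale half_cost = A: rmanifold M + B: rmanifold M'
  for M :: "('m::{t2_space,second_countable_topology}, 'n::finite) rmfd"
    and M' :: "('k::{t2_space,second_countable_topology}, 'n) rmfd" +
  fixes \<Omega> :: "'m set" and \<Omega>' :: "'k set" and c :: "'m \<Rightarrow> 'k \<Rightarrow> real"
  assumes doms: "open \<Omega>" "open \<Omega>'" "compact (closure \<Omega>)" "compact (closure \<Omega>')" "\<Omega> \<noteq> {}" "\<Omega>' \<noteq> {}"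
    and C3: "C3_half M M' \<Omega> \<Omega>' c"
begin

abbreviation "Dom ct \<equiv> snd ct ` (fst ct \<inter> \<Omega>)"
abbreviation "Dom' ct \<equiv> snd ct ` (fst ct \<inter> \<Omega>')"

abbreviation "DD \<equiv> DDbar M M' \<Omega> \<Omega>' c"
abbreviation "HN \<equiv> C3_half_norm M M' \<Omega> \<Omega>' c"

definition q where "q ct ct' y z = (\<chi> k. pd2 k (loc ct ct' c) y z)"
definition Hm where "Hm ct ct' y z = (\<chi> k i. pd1 i (pd2 k (loc ct ct' c)) y z)"
definition H3 where "H3 ct ct' y z k j i = pd1 i (pd1 j (pd2 k (loc ct ct' c))) y z"
text \<open>Pairing with a fixed coordinate vector w makes the covector a scalar function of y, so
  that its second derivatives in y are covered by \<open>covhess\<close>.\<close>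

definition sc where "sc ct ct' z w y = q ct ct' y z \<bullet> w"

lemma C3D:
  assumes "ct \<in> charts M" "ct' \<in> charts M'" "y \<in> Dom ct" "z \<in> Dom' ct'"
  shows "(\<lambda>z. loc ct ct' c y z) differentiable at z" "(\<lambda>y. pd2 k (loc ct ct' c) y z) differentiable at y"
    "(\<lambda>y. pd1 j (pd2 k (loc ct ct' c)) y z) differentiable at y"
proof -
  note * = C3[unfolded C3_half_def, rule_format, OF assms(1,2), THEN conjunct1, THEN bspec, OF assms(3), THEN bspec, OF assms(4)]
  show "(\<lambda>z. loc ct ct' c y z) differentiable at z" by (rule *[THEN conjunct1])
  show "(\<lambda>y. pd2 k (loc ct ct' c) y z) differentiable at y" by (rule *[THEN conjunct2, THEN conjunct1])
  show "(\<lambda>y. pd1 j (pd2 k (loc ct ct' c)) y z) differentiable at y" by (rule *[THEN conjunct2, THEN conjunct2])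
qed

lemma C3E:
  assumes "ct \<in> charts M" "ct' \<in> charts M'"
  shows "extends_cont ct ct' \<Omega> \<Omega>' (pd2 k (loc ct ct' c))"
    "extends_cont ct ct' \<Omega> \<Omega>' (pd1 j (pd2 k (loc ct ct' c)))" "extends_cont ct ct' \<Omega> \<Omega>' (pd1 i (pd1 j (pd2 k (loc ct ct' c))))"
proof -
  note * = C3[unfolded C3_half_def, rule_format, OF assms(1,2), THEN conjunct2]
  show "extends_cont ct ct' \<Omega> \<Omega>' (pd2 k (loc ct ct' c))" by (rule *[THEN conjunct1])
  show "extends_cont ct ct' \<Omega> \<Omega>' (pd1 j (pd2 k (loc ct ct' c)))" by (rule *[THEN conjunct2, THEN conjunct1])
  show "extends_cont ct ct' \<Omega> \<Omega>' (pd1 i (pd1 j (pd2 k (loc ct ct' c))))" by (rule *[THEN conjunct2, THEN conjunct2])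
qed

lemma Dom_open: "ct \<in> charts M \<Longrightarrow> open (Dom ct)" "ct' \<in> charts M' \<Longrightarrow> open (Dom' ct')"
  by (auto intro: A.chart_image_open B.chart_image_open doms)

lemma q_grad: "q ct ct' y z = B.grad (\<lambda>z. loc ct ct' c y z) z"
  by (simp add: q_def B.grad_def pd2_def)

lemma loc_deriv:
  assumes "ct \<in> charts M" "ct' \<in> charts M'" "y \<in> Dom ct" "z \<in> Dom' ct'"
  shows "((\<lambda>z. loc ct ct' c y z) has_derivative (\<lambda>h. q ct ct' y z \<bullet> h)) (at z)"
  unfolding q_grad by (rule B.grad_deriv[OF C3D(1)[OF assms]])

lemma q_deriv:
  assumes "ct \<in> charts M" "ct' \<in> charts M'" "y \<in> Dom ct" "z \<in> Dom' ct'"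
  shows "((\<lambda>y. q ct ct' y z) has_derivative (*v) (Hm ct ct' y z)) (at y)"
proof (rule has_derivative_vecI)
  fix k
  show "((\<lambda>y. q ct ct' y z $ k) has_derivative (\<lambda>h. (Hm ct ct' y z *v h) $ k)) (at y)"
    using has_derivative_partial[OF C3D(2)[OF assms, of k]] by (simp add: q_def Hm_def pd1_def matrix_vector_mult_def)
qed

lemma sc_deriv:
  assumes "ct \<in> charts M" "ct' \<in> charts M'" "y \<in> Dom ct" "z \<in> Dom' ct'"
  shows "(sc ct ct' z w has_derivative (\<lambda>h. (Hm ct ct' y z *v h) \<bullet> w)) (at y)"
  using has_derivative_inner_left[OF q_deriv[OF assms], of w] by (simp add: sc_def[abs_def])

lemma sc_differentiable:
  assumes "ct \<in> charts M" "ct' \<in> charts M'" "y \<in> Dom ct" "z \<in> Dom' ct'"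
  shows "sc ct ct' z w differentiable at y"
  unfolding differentiable_def by (rule exI) (rule sc_deriv[OF assms])

lemma sc_grad:
  assumes "ct \<in> charts M" "ct' \<in> charts M'" "y \<in> Dom ct" "z \<in> Dom' ct'"
  shows "A.grad (sc ct ct' z w) y \<bullet> v = (Hm ct ct' y z *v v) \<bullet> w"
  by (rule fun_cong[OF has_derivative_unique_at[OF A.grad_deriv[OF sc_differentiable[OF assms]] sc_deriv[OF assms]]])

lemma Hm_deriv:
  assumes "ct \<in> charts M" "ct' \<in> charts M'" "y \<in> Dom ct" "z \<in> Dom' ct'"
  shows "((\<lambda>y. Hm ct ct' y z $ k $ j) has_derivative (\<lambda>h. \<Sum>i\<in>UNIV. H3 ct ct' y z k j i * h $ i)) (at y)"
  using has_derivative_partial[OF C3D(3)[OF assms, of j k]] by (simp add: Hm_def H3_def pd1_def)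

lemma sc_partial:
  assumes "ct \<in> charts M" "ct' \<in> charts M'" "y \<in> Dom ct" "z \<in> Dom' ct'"
  shows "partial j (sc ct ct' z w) y = (\<Sum>k\<in>UNIV. Hm ct ct' y z $ k $ j * w $ k)"
proof -
  have "(Hm ct ct' y z *v axis j 1) \<bullet> w = (\<Sum>k\<in>UNIV. Hm ct ct' y z $ k $ j * w $ k)"
    by (simp add: inner_vec_def matrix_vector_mult_basis column_def)
  then show ?thesis using partial_eqI[OF sc_deriv[OF assms]] by simp
qed

lemma sc_partial_deriv:
  assumes "ct \<in> charts M" "ct' \<in> charts M'" "y \<in> Dom ct" "z \<in> Dom' ct'"
  shows "(partial j (sc ct ct' z w) has_derivative (\<lambda>h. \<Sum>k\<in>UNIV. (\<Sum>i\<in>UNIV. H3 ct ct' y z k j i * h $ i) * w $ k)) (at y)"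
proof (rule has_derivative_transform_within_open[OF _ Dom_open(1)[OF assms(1)] assms(3)])
  show "((\<lambda>y. \<Sum>k\<in>UNIV. Hm ct ct' y z $ k $ j * w $ k) has_derivative (\<lambda>h. \<Sum>k\<in>UNIV. (\<Sum>i\<in>UNIV. H3 ct ct' y z k j i * h $ i) * w $ k)) (at y)"
    by (intro has_derivative_sum has_derivative_mult_left Hm_deriv assms)
qed (use sc_partial[OF assms(1,2) _ assms(4)] in auto)

lemma sc_hess:
  assumes "ct \<in> charts M" "ct' \<in> charts M'" "y \<in> Dom ct" "z \<in> Dom' ct'"
  shows "(A.hess (sc ct ct' z u) y *v v) \<bullet> w = (\<Sum>k\<in>UNIV. \<Sum>j\<in>UNIV. \<Sum>i\<in>UNIV. H3 ct ct' y z k j i * v $ i * w $ j * u $ k)"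
    (is "?l = ?r")
proof -
  have h: "A.hess (sc ct ct' z u) y $ j $ i = (\<Sum>k\<in>UNIV. H3 ct ct' y z k j i * u $ k)" for j i
    unfolding A.hess_def using partial_eqI[OF sc_partial_deriv[OF assms]]
    by (simp add: axis_def if_distrib sum.delta cong: if_cong)
  have "?l = (\<Sum>j\<in>UNIV. \<Sum>i\<in>UNIV. \<Sum>k\<in>UNIV. H3 ct ct' y z k j i * v $ i * w $ j * u $ k)"
    by (simp add: inner_vec_def matrix_vector_mult_def h sum_distrib_right sum_distrib_left mult_ac)
  also have "\<dots> = (\<Sum>j\<in>UNIV. \<Sum>k\<in>UNIV. \<Sum>i\<in>UNIV. H3 ct ct' y z k j i * v $ i * w $ j * u $ k)"
    by (intro sum.cong refl sum.swap)
  also have "\<dots> = ?r" by (rule sum.swap)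
  finally show ?thesis .
qed

lemma sc_trans:
  assumes k: "ct \<in> charts M" "ct1 \<in> charts M" "ct' \<in> charts M'" "ct1' \<in> charts M'"
    and x: "x \<in> \<Omega>" "x \<in> fst ct" "x \<in> fst ct1" and x': "x' \<in> \<Omega>'" "x' \<in> fst ct'" "x' \<in> fst ct1'"
  shows "sc ct ct' (snd ct' x') w (snd ct x) = sc ct1 ct1' (snd ct1' x') (tjac ct' ct1' (snd ct' x') *v w) (trans ct ct1 (snd ct x))"
proof -
  let ?z = "snd ct' x'" and ?O = "snd ct' ` (fst ct' \<inter> fst ct1')"
  have t: "trans ct ct1 (snd ct x) = snd ct1 x" "trans ct' ct1' ?z = snd ct1' x'"
    using x x' by (simp_all add: trans_def A.chart_inv1[OF k(1)] B.chart_inv1[OF k(3)])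
  have z: "?z \<in> ?O" using x' by auto
  have "q ct ct' (snd ct x) ?z = B.grad (\<lambda>z. loc ct1 ct1' c (snd ct1 x) (trans ct' ct1' z)) ?z"
    unfolding q_grad
  proof (rule B.grad_cong(1)[OF B.overlap_open[OF k(3,4)] z])
    fix z assume "z \<in> ?O"
    then show "loc ct ct' c (snd ct x) z = loc ct1 ct1' c (snd ct1 x) (trans ct' ct1' z)"
      unfolding loc_def using x by (simp only: B.overlap(5)[OF k(3,4)] A.chart_inv1[OF k(1)] A.chart_inv1[OF k(2)])
  qed
  also have "\<dots> = transpose (tjac ct' ct1' ?z) *v B.grad (\<lambda>z. loc ct1 ct1' c (snd ct1 x) z) (trans ct' ct1' ?z)"
    by (rule B.grad_trans(2)[OF k(3,4) z]) (unfold t, rule C3D(1)[OF k(2,4)], use x x' in auto)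
  finally show ?thesis unfolding sc_def t by (simp only: q_grad inner_transpose_left)
qed

text \<open>Tensoriality of the three derivatives: \<open>sc_trans\<close> expresses the scalar
  function in another pair of charts by composition with the transition map, and its value, gradient
  and covariant Hessian transform accordingly.\<close>

lemma
  assumes k: "ct \<in> charts M" "ct1 \<in> charts M" "ct' \<in> charts M'" "ct1' \<in> charts M'"
    and x: "x \<in> \<Omega>" "x \<in> fst ct" "x \<in> fst ct1" and x': "x' \<in> \<Omega>'" "x' \<in> fst ct'" "x' \<in> fst ct1'"
  shows q_trans: "q ct ct' (snd ct x) (snd ct' x') \<bullet> w = q ct1 ct1' (snd ct1 x) (snd ct1' x') \<bullet> (tjac ct' ct1' (snd ct' x') *v w)"
    and Hm_trans: "(Hm ct ct' (snd ct x) (snd ct' x') *v v) \<bullet> w =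
       (Hm ct1 ct1' (snd ct1 x) (snd ct1' x') *v (tjac ct ct1 (snd ct x) *v v)) \<bullet> (tjac ct' ct1' (snd ct' x') *v w)"
    and cov_trans: "A.covhess ct (sc ct ct' (snd ct' x') w) (snd ct x) v v' =
       A.covhess ct1 (sc ct1 ct1' (snd ct1' x') (tjac ct' ct1' (snd ct' x') *v w)) (snd ct1 x)
          (tjac ct ct1 (snd ct x) *v v) (tjac ct ct1 (snd ct x) *v v')"
proof -
  let ?y = "snd ct x" and ?O = "snd ct ` (fst ct \<inter> (fst ct1 \<inter> \<Omega>))"
  let ?g = "sc ct1 ct1' (snd ct1' x') (tjac ct' ct1' (snd ct' x') *v w)"
  have t: "trans ct ct1 ?y = snd ct1 x" using x by (simp add: trans_def A.chart_inv1[OF k(1)])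
  have O: "open ?O" "?y \<in> ?O" using x by (auto intro!: A.chart_image_open[OF k(1)] open_Int doms A.chart_open[OF k(2)])
  have ov: "?y \<in> snd ct ` (fst ct \<inter> fst ct1)" using x by auto
  have D: "?y \<in> Dom ct" "snd ct1 x \<in> Dom ct1" "snd ct' x' \<in> Dom' ct'" "snd ct1' x' \<in> Dom' ct1'" using x x' by auto
  have eq: "sc ct ct' (snd ct' x') w z = ?g (trans ct ct1 z)" if "z \<in> ?O" for z
    using that sc_trans[OF k _ _ _ x'] by auto
  show "q ct ct' ?y (snd ct' x') \<bullet> w = q ct1 ct1' (snd ct1 x) (snd ct1' x') \<bullet> (tjac ct' ct1' (snd ct' x') *v w)"
    using eq[OF O(2)] unfolding t sc_def .
  have "A.grad (sc ct ct' (snd ct' x') w) ?y = A.grad (\<lambda>z. ?g (trans ct ct1 z)) ?y"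
    by (rule A.grad_cong(1)[OF O eq])
  also have "\<dots> = transpose (tjac ct ct1 ?y) *v A.grad ?g (trans ct ct1 ?y)"
    by (rule A.grad_trans(2)[OF k(1,2) ov]) (unfold t, rule sc_differentiable[OF k(2,4) D(2,4)])
  finally have "A.grad (sc ct ct' (snd ct' x') w) ?y \<bullet> v = A.grad ?g (snd ct1 x) \<bullet> (tjac ct ct1 ?y *v v)"
    by (simp only: inner_transpose_left t)
  then show "(Hm ct ct' (snd ct x) (snd ct' x') *v v) \<bullet> w =
       (Hm ct1 ct1' (snd ct1 x) (snd ct1' x') *v (tjac ct ct1 (snd ct x) *v v)) \<bullet> (tjac ct' ct1' (snd ct' x') *v w)"
    by (simp only: sc_grad[OF k(1,3) D(1,3)] sc_grad[OF k(2,4) D(2,4)])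
  have "A.covhess ct (sc ct ct' (snd ct' x') w) ?y v v' = A.covhess ct (\<lambda>z. ?g (trans ct ct1 z)) ?y v v'"
    by (rule A.grad_cong(2)[OF O eq])
  also have "\<dots> = A.covhess ct1 ?g (trans ct ct1 ?y) (tjac ct ct1 ?y *v v) (tjac ct ct1 ?y *v v')"
  proof (rule A.covhess_trans[OF k(1,2) ov Dom_open(1)[OF k(2)]])
    show "trans ct ct1 ?y \<in> Dom ct1" unfolding t by (rule D)
    fix z assume z: "z \<in> Dom ct1"
    show "?g differentiable at z" by (rule sc_differentiable[OF k(2,4) z D(4)])
    show "partial j ?g differentiable at z" for j
      unfolding differentiable_def by (rule exI) (rule sc_partial_deriv[OF k(2,4) z D(4)])
  qed
  finally show "A.covhess ct (sc ct ct' (snd ct' x') w) ?y v v' = A.covhess ct1 ?g (snd ct1 x)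
          (tjac ct ct1 ?y *v v) (tjac ct ct1 ?y *v v')" unfolding t .
qed

lemma covhess_sc:
  assumes "ct \<in> charts M" "ct' \<in> charts M'" "y \<in> Dom ct" "z \<in> Dom' ct'"
  shows "A.covhess ct (sc ct ct' z u) y v w =
    (\<Sum>k\<in>UNIV. \<Sum>j\<in>UNIV. \<Sum>i\<in>UNIV. H3 ct ct' y z k j i * v $ i * w $ j * u $ k) - (Hm ct ct' y z *v A.Gam ct y v w) \<bullet> u"
  unfolding A.covhess_def sc_hess[OF assms] sc_grad[OF assms] ..

text \<open>Required in all charts around the points at once. By tensoriality one pair of charts
  suffices (\<open>form_boundI\<close>), so bounds near points of the closure, each in its own
  charts, can be combined by compactness.\<close>

definition form_bound :: "real \<Rightarrow> 'm \<Rightarrow> 'k \<Rightarrow> bool" where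
  "form_bound N x x' \<longleftrightarrow> (\<forall>ct\<in>charts M. \<forall>ct'\<in>charts M'. x \<in> fst ct \<longrightarrow> x' \<in> fst ct' \<longrightarrow>
     (\<forall>v w u. \<bar>q ct ct' (snd ct x) (snd ct' x') \<bullet> u\<bar> \<le> N * nrm (gram_in M' ct' x') u \<and>
       \<bar>(Hm ct ct' (snd ct x) (snd ct' x') *v v) \<bullet> u\<bar> \<le> N * nrm (gram_in M ct x) v * nrm (gram_in M' ct' x') u \<and>
       \<bar>A.covhess ct (sc ct ct' (snd ct' x') u) (snd ct x) v w\<bar> \<le>
          N * nrm (gram_in M ct x) v * nrm (gram_in M ct x) w * nrm (gram_in M' ct' x') u))"

lemma form_boundI:
  assumes k: "ct \<in> charts M" "ct' \<in> charts M'" and x: "x \<in> \<Omega>" "x \<in> fst ct" and x': "x' \<in> \<Omega>'" "x' \<in> fst ct'"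
    and 1: "\<And>u. \<bar>q ct ct' (snd ct x) (snd ct' x') \<bullet> u\<bar> \<le> N * nrm (gram_in M' ct' x') u"
    and 2: "\<And>v u. \<bar>(Hm ct ct' (snd ct x) (snd ct' x') *v v) \<bullet> u\<bar> \<le> N * nrm (gram_in M ct x) v * nrm (gram_in M' ct' x') u"
    and 3: "\<And>v w u. \<bar>A.covhess ct (sc ct ct' (snd ct' x') u) (snd ct x) v w\<bar> \<le>
          N * nrm (gram_in M ct x) v * nrm (gram_in M ct x) w * nrm (gram_in M' ct' x') u"
  shows "form_bound N x x'"
  unfolding form_bound_def
proof (intro ballI impI allI)
  fix ct1 ct1' v w u assume k1: "ct1 \<in> charts M" "ct1' \<in> charts M'" "x \<in> fst ct1" "x' \<in> fst ct1'"
  note tr = k1(1) k(1) k1(2) k(2) x(1) k1(3) x(2) x'(1) k1(4) x'(2)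
  note n = A.nrm_trans[OF k1(1) k(1) k1(3) x(2)] B.nrm_trans[OF k1(2) k(2) k1(4) x'(2)]
  show "\<bar>q ct1 ct1' (snd ct1 x) (snd ct1' x') \<bullet> u\<bar> \<le> N * nrm (gram_in M' ct1' x') u \<and>
       \<bar>(Hm ct1 ct1' (snd ct1 x) (snd ct1' x') *v v) \<bullet> u\<bar> \<le> N * nrm (gram_in M ct1 x) v * nrm (gram_in M' ct1' x') u \<and>
       \<bar>A.covhess ct1 (sc ct1 ct1' (snd ct1' x') u) (snd ct1 x) v w\<bar> \<le>
          N * nrm (gram_in M ct1 x) v * nrm (gram_in M ct1 x) w * nrm (gram_in M' ct1' x') u"
    unfolding q_trans[OF tr] Hm_trans[OF tr] cov_trans[OF tr] n using 1 2 3 by blast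
qed

end

lemma mult_mono3:
  fixes a b c :: real
  assumes "a \<le> a'" "b \<le> b'" "c \<le> c'" "0 \<le> a" "0 \<le> b" "0 \<le> c"
  shows "a * b * c \<le> a' * b' * c'"
  by (intro mult_mono assms mult_nonneg_nonneg) (use assms in auto)

lemma matvec_inner_sum: "(A *v v) \<bullet> u = (\<Sum>k\<in>UNIV. \<Sum>i\<in>UNIV. A $ k $ i * v $ i * u $ k)"
  for A :: "real^'n::finite^'n"
  by (simp add: inner_vec_def matrix_vector_mult_def sum_distrib_right)

lemma norm_vec_le_bound:
  fixes p :: "real^'n::finite"
  assumes "\<And>k. \<bar>p $ k\<bar> \<le> B"
  shows "norm p \<le> real CARD('n) * B"
proof -
  have "norm p \<le> (\<Sum>k\<in>UNIV. \<bar>p $ k\<bar>)" by (rule norm_le_l1_cart)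
  also have "\<dots> \<le> (\<Sum>k\<in>(UNIV::'n set). B)" by (intro sum_mono assms)
  finally show ?thesis by simp
qed

lemma norm_matvec_le_bound:
  fixes A :: "real^'n::finite^'n"
  assumes "\<And>k i. \<bar>A $ k $ i\<bar> \<le> B"
  shows "norm (A *v v) \<le> real CARD('n) ^ 2 * B * norm v"
proof -
  have "\<bar>(A *v v) $ k\<bar> \<le> real CARD('n) * B * norm v" for k
  proof -
    have "\<bar>A $ k $ i * v $ i\<bar> \<le> B * norm v" for i
      unfolding abs_mult using assms[of k i] by (intro mult_mono component_le_norm_cart) auto
    then have "(\<Sum>i\<in>UNIV. \<bar>A $ k $ i * v $ i\<bar>) \<le> (\<Sum>i\<in>(UNIV::'n set). B * norm v)" by (intro sum_mono)
    then have "(\<Sum>i\<in>UNIV. \<bar>A $ k $ i * v $ i\<bar>) \<le> real CARD('n) * B * norm v" by simp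
    moreover have "(A *v v) $ k = (\<Sum>i\<in>UNIV. A $ k $ i * v $ i)" by (simp add: matrix_vector_mult_def)
    ultimately show ?thesis using sum_abs[of "\<lambda>i. A $ k $ i * v $ i" UNIV] by linarith
  qed
  from norm_vec_le_bound[of "A *v v", OF this] show ?thesis by (simp add: power2_eq_square mult_ac)
qed

context half_cost
begin

lemma snd_cont: "ct \<in> charts M \<Longrightarrow> continuous_on (fst ct \<inter> X) (snd ct)" "ct' \<in> charts M' \<Longrightarrow> continuous_on (fst ct' \<inter> Y) (snd ct')"
  by (auto intro: continuous_on_subset[OF A.chart_cont(1)] continuous_on_subset[OF B.chart_cont(1)])

lemma chart_pair_cont:
  assumes k: "ct \<in> charts M" "ct' \<in> charts M'"
    and G: "continuous_on (snd ct ` (fst ct \<inter> X) \<times> snd ct' ` (fst ct' \<inter> Y)) G"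
  shows "continuous_on ((fst ct \<inter> X) \<times> (fst ct' \<inter> Y)) (\<lambda>w. G (snd ct (fst w), snd ct' (snd w)))"
proof (rule continuous_on_compose2[OF G], intro continuous_on_Pair)
  let ?S = "(fst ct \<inter> X) \<times> (fst ct' \<inter> Y)"
  show "continuous_on ?S (\<lambda>w. snd ct (fst w))"
    by (rule continuous_on_compose2[OF snd_cont(1)[OF k(1), of X] continuous_on_fst[OF continuous_on_id]])
      (rule image_subsetI, erule SigmaE, simp)
  show "continuous_on ?S (\<lambda>w. snd ct' (snd w))"
    by (rule continuous_on_compose2[OF snd_cont(2)[OF k(2), of Y] continuous_on_snd[OF continuous_on_id]])
      (rule image_subsetI, erule SigmaE, simp)
qed (rule image_subsetI, erule SigmaE, simp only: fst_conv snd_conv, intro SigmaI imageI)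

text \<open>The finite family is gathered into one vector valued extension, continuous up to the
  closure; near the given point its values are within 1 of the value there.\<close>

lemma extends_cont_bound:
  fixes F :: "'i::finite \<Rightarrow> real^'n \<Rightarrow> real^'n \<Rightarrow> real"
  assumes k: "ct \<in> charts M" "ct' \<in> charts M'" and x: "x0 \<in> fst ct" "x0 \<in> closure \<Omega>" and x': "x0' \<in> fst ct'" "x0' \<in> closure \<Omega>'"
    and F: "\<And>i. extends_cont ct ct' \<Omega> \<Omega>' (F i)"
  obtains N N' B where "open N" "open N'" "x0 \<in> N" "x0' \<in> N'" "0 \<le> B"
    "\<And>x x' i. x \<in> N \<Longrightarrow> x' \<in> N' \<Longrightarrow> x \<in> \<Omega> \<inter> fst ct \<Longrightarrow> x' \<in> \<Omega>' \<inter> fst ct' \<Longrightarrow> \<bar>F i (snd ct x) (snd ct' x')\<bar> \<le> B"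
proof -
  let ?S = "snd ct ` (fst ct \<inter> closure \<Omega>) \<times> snd ct' ` (fst ct' \<inter> closure \<Omega>')"
  have "\<exists>G. continuous_on ?S G \<and> (\<forall>y \<in> Dom ct. \<forall>z \<in> Dom' ct'. G (y, z) = F i y z)" for i
    using F[of i] unfolding extends_cont_def .
  then have "\<exists>G. \<forall>i. continuous_on ?S (G i) \<and> (\<forall>y \<in> Dom ct. \<forall>z \<in> Dom' ct'. G i (y, z) = F i y z)" by (intro choice allI)
  then obtain G where G: "\<And>i. continuous_on ?S (G i)" "\<And>i y z. y \<in> Dom ct \<Longrightarrow> z \<in> Dom' ct' \<Longrightarrow> G i (y, z) = F i y z"
  proof (elim exE)
    fix G assume *: "\<forall>i. continuous_on ?S (G i) \<and> (\<forall>y \<in> Dom ct. \<forall>z \<in> Dom' ct'. G i (y, z) = F i y z)"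
    show thesis
    proof (rule that)
      show "continuous_on ?S (G i)" for i by (rule conjunct1[OF spec[OF *]])
      show "G i (y, z) = F i y z" if "y \<in> Dom ct" "z \<in> Dom' ct'" for i y z
        by (rule conjunct2[OF spec[OF *], THEN bspec, OF that(1), THEN bspec, OF that(2)])
    qed
  qed
  define g where "g w = (\<chi> i. G i (snd ct (fst w), snd ct' (snd w)))" for w
  have cg: "continuous_on ((fst ct \<inter> closure \<Omega>) \<times> (fst ct' \<inter> closure \<Omega>')) g"
    unfolding g_def by (intro continuous_on_vec_lambda chart_pair_cont[OF k] G)
  have mem: "x0 \<in> fst ct \<inter> closure \<Omega>" "x0' \<in> fst ct' \<inter> closure \<Omega>'" using x x' by auto
  obtain N N' where N: "open N" "open N'" "x0 \<in> N" "x0' \<in> N'" and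
    gb: "\<And>x x'. x \<in> N \<Longrightarrow> x' \<in> N' \<Longrightarrow> x \<in> fst ct \<inter> closure \<Omega> \<Longrightarrow> x' \<in> fst ct' \<inter> closure \<Omega>' \<Longrightarrow> g (x, x') \<in> ball (g (x0, x0')) 1"
    by (rule continuous_on_prod_nbhd[OF cg mem, of "ball (g (x0, x0')) 1"]) (simp, simp, rule that)
  define B where "B = norm (g (x0, x0')) + 1"
  show ?thesis
  proof (rule that[OF N, of B])
    fix x x' i assume a: "x \<in> N" "x' \<in> N'" "x \<in> \<Omega> \<inter> fst ct" "x' \<in> \<Omega>' \<inter> fst ct'"
    have m: "x \<in> fst ct \<inter> closure \<Omega>" "x' \<in> fst ct' \<inter> closure \<Omega>'" using a closure_subset by blast+
    have "norm (g (x, x')) \<le> B"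
      using gb[OF a(1,2) m] norm_triangle_ineq2[of "g (x, x')" "g (x0, x0')"] norm_minus_commute[of "g (x0, x0')" "g (x, x')"]
      unfolding B_def mem_ball dist_norm by linarith
    moreover have "g (x, x') $ i = F i (snd ct x) (snd ct' x')"
    proof -
      have "snd ct x \<in> Dom ct" "snd ct' x' \<in> Dom' ct'" using a(3,4) by simp_all
      from G(2)[OF this] show ?thesis by (simp add: g_def)
    qed
    ultimately show "\<bar>F i (snd ct x) (snd ct' x')\<bar> \<le> B" using component_le_norm_cart[of "g (x, x')" i] by simp
  qed (simp add: B_def)
qed

lemma form_bound_mono:
  assumes "form_bound N x x'" "N \<le> N'"
  shows "form_bound N' x x'"
  unfolding form_bound_def
proof (intro ballI impI allI)
  fix ct ct' v w u assume k: "ct \<in> charts M" "ct' \<in> charts M'" "x \<in> fst ct" "x' \<in> fst ct'"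
  note n = nrm_nonneg[OF A.posdef_gram_in[OF k(1,3)]] nrm_nonneg[OF B.posdef_gram_in[OF k(2,4)]]
  note f = assms(1)[unfolded form_bound_def, rule_format, OF k, of u v w]
  show "\<bar>q ct ct' (snd ct x) (snd ct' x') \<bullet> u\<bar> \<le> N' * nrm (gram_in M' ct' x') u \<and>
       \<bar>(Hm ct ct' (snd ct x) (snd ct' x') *v v) \<bullet> u\<bar> \<le> N' * nrm (gram_in M ct x) v * nrm (gram_in M' ct' x') u \<and>
       \<bar>A.covhess ct (sc ct ct' (snd ct' x') u) (snd ct x) v w\<bar> \<le>
          N' * nrm (gram_in M ct x) v * nrm (gram_in M ct x) w * nrm (gram_in M' ct' x') u"
    using f by (intro conjI; elim conjE) (erule order_trans; intro mult_right_mono n assms(2))+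
qed

lemma form_bound_local:
  assumes x0: "x0 \<in> closure \<Omega>" and x0': "x0' \<in> closure \<Omega>'"
  shows "\<exists>N N' B. open N \<and> open N' \<and> x0 \<in> N \<and> x0' \<in> N' \<and> (\<forall>x\<in>N. \<forall>x'\<in>N'. x \<in> \<Omega> \<longrightarrow> x' \<in> \<Omega>' \<longrightarrow> form_bound B x x')"
proof -
  define ct where "ct = chart_at M x0"
  define ct' where "ct' = chart_at M' x0'"
  have k: "ct \<in> charts M" "ct' \<in> charts M'" and xk: "x0 \<in> fst ct" "x0' \<in> fst ct'"
    by (simp_all add: ct_def ct'_def A.chart_at B.chart_at)
  let ?f = "loc ct ct' c"
  note eb = extends_cont_bound[OF k xk(1) x0 xk(2) x0']
  obtain N1 N1' B1 where N1: "open N1" "open N1'" "x0 \<in> N1" "x0' \<in> N1'" "0 \<le> B1"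
    and b1: "\<And>x x' i. x \<in> N1 \<Longrightarrow> x' \<in> N1' \<Longrightarrow> x \<in> \<Omega> \<inter> fst ct \<Longrightarrow> x' \<in> \<Omega>' \<inter> fst ct' \<Longrightarrow> \<bar>pd2 i ?f (snd ct x) (snd ct' x')\<bar> \<le> B1"
    by (rule eb[of "\<lambda>i. pd2 i ?f"]) (rule C3E(1)[OF k], rule that)
  obtain N2 N2' B2 where N2: "open N2" "open N2'" "x0 \<in> N2" "x0' \<in> N2'" "0 \<le> B2"
    and b2: "\<And>x x' i. x \<in> N2 \<Longrightarrow> x' \<in> N2' \<Longrightarrow> x \<in> \<Omega> \<inter> fst ct \<Longrightarrow> x' \<in> \<Omega>' \<inter> fst ct' \<Longrightarrow>
      \<bar>pd1 (snd i) (pd2 (fst i) ?f) (snd ct x) (snd ct' x')\<bar> \<le> B2"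
    by (rule eb[of "\<lambda>i. pd1 (snd i) (pd2 (fst i) ?f)"]) (rule C3E(2)[OF k], rule that)
  obtain N3 N3' B3 where N3: "open N3" "open N3'" "x0 \<in> N3" "x0' \<in> N3'" "0 \<le> B3"
    and b3: "\<And>x x' i. x \<in> N3 \<Longrightarrow> x' \<in> N3' \<Longrightarrow> x \<in> \<Omega> \<inter> fst ct \<Longrightarrow> x' \<in> \<Omega>' \<inter> fst ct' \<Longrightarrow>
      \<bar>pd1 (snd (snd i)) (pd1 (fst (snd i)) (pd2 (fst i) ?f)) (snd ct x) (snd ct' x')\<bar> \<le> B3"
    by (rule eb[of "\<lambda>i. pd1 (snd (snd i)) (pd1 (fst (snd i)) (pd2 (fst i) ?f))"]) (rule C3E(3)[OF k], rule that)
  obtain N4 C where N4: "open N4" "x0 \<in> N4" "N4 \<subseteq> fst ct" "0 \<le> C"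
    and gam: "\<And>x v w. x \<in> N4 \<Longrightarrow> norm (A.Gam ct (snd ct x) v w) \<le> C * norm v * norm w"
    by (rule A.Gam_local_bound[OF k(1) xk(1)], rule that)
  obtain N5 l L where N5: "open N5" "x0 \<in> N5" "N5 \<subseteq> fst ct" "0 < l" "0 < L"
    and lo: "\<And>x v. x \<in> N5 \<Longrightarrow> l * norm v \<le> nrm (gram_in M ct x) v" and "\<And>x v. x \<in> N5 \<Longrightarrow> nrm (gram_in M ct x) v \<le> L * norm v"
    by (rule A.gram_local_bounds[OF k(1) xk(1)], rule that)
  obtain N6 l' L' where N6: "open N6" "x0' \<in> N6" "N6 \<subseteq> fst ct'" "0 < l'" "0 < L'"
    and lo': "\<And>x v. x \<in> N6 \<Longrightarrow> l' * norm v \<le> nrm (gram_in M' ct' x) v" and "\<And>x v. x \<in> N6 \<Longrightarrow> nrm (gram_in M' ct' x) v \<le> L' * norm v"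
    by (rule B.gram_local_bounds[OF k(2) xk(2)], rule that)
  let ?n = "real CARD('n)"
  \<comment> \<open>The summands bound the first, the mixed second and the covariant third
    derivative; in the last one C accounts for the Christoffel term.\<close>
  define E where "E = ?n * B1 / l' + ?n ^ 2 * B2 / (l * l') + (?n ^ 3 * B3 + ?n ^ 2 * B2 * C) / (l * l * l')"
  let ?N = "N1 \<inter> N2 \<inter> N3 \<inter> N4 \<inter> N5" and ?N' = "N1' \<inter> N2' \<inter> N3' \<inter> N6"
  have "form_bound E x x'" if x: "x \<in> ?N" "x \<in> \<Omega>" and x': "x' \<in> ?N'" "x' \<in> \<Omega>'" for x x'
  proof -
    have xf: "x \<in> fst ct" "x' \<in> fst ct'" using x x' N5(3) N6(3) by auto
    then have D: "snd ct x \<in> Dom ct" "snd ct' x' \<in> Dom' ct'" using x x' by auto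
    have dm: "x \<in> \<Omega> \<inter> fst ct" "x' \<in> \<Omega>' \<inter> fst ct'" using x x' xf by auto
    let ?y = "snd ct x" and ?z = "snd ct' x'" and ?G = "nrm (gram_in M ct x)" and ?G' = "nrm (gram_in M' ct' x')"
    have c1: "\<bar>q ct ct' ?y ?z $ i\<bar> \<le> B1" for i using b1[OF _ _ dm, of i] x x' by (simp add: q_def)
    have c2: "\<bar>Hm ct ct' ?y ?z $ i $ j\<bar> \<le> B2" for i j using b2[OF _ _ dm, of "(i, j)"] x x' by (simp add: Hm_def)
    have c3: "\<bar>H3 ct ct' ?y ?z i j m\<bar> \<le> B3" for i j m using b3[OF _ _ dm, of "(i, j, m)"] x x' by (simp add: H3_def)
    have l1: "norm v \<le> ?G v / l" for v using lo[of x v] x N5(4) by (simp add: field_simps)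
    have l2: "norm v \<le> ?G' v / l'" for v using lo'[of x' v] x' N6(4) by (simp add: field_simps)
    have n0: "0 \<le> ?G v" "0 \<le> ?G' v" for v
      using nrm_nonneg[OF A.posdef_gram_in[OF k(1) xf(1)]] nrm_nonneg[OF B.posdef_gram_in[OF k(2) xf(2)]] by auto
    have E: "?n * B1 / l' \<le> E" "?n ^ 2 * B2 / (l * l') \<le> E" "(?n ^ 3 * B3 + ?n ^ 2 * B2 * C) / (l * l * l') \<le> E"
      unfolding E_def using N1(5) N2(5) N3(5) N4(4) N5(4) N6(4) by simp_all
    show ?thesis
    proof (rule form_boundI[OF k x(2) xf(1) x'(2) xf(2)])
      fix v w u
      have "\<bar>q ct ct' ?y ?z \<bullet> u\<bar> \<le> norm (q ct ct' ?y ?z) * norm u" by (rule Cauchy_Schwarz_ineq2)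
      also have "\<dots> \<le> (?n * B1) * (?G' u / l')"
        by (rule mult_mono[OF norm_vec_le_bound[OF c1] l2]) (use N1(5) in auto)
      also have "\<dots> = ?n * B1 / l' * ?G' u" by simp
      also have "\<dots> \<le> E * ?G' u" by (intro mult_right_mono E n0)
      finally show "\<bar>q ct ct' ?y ?z \<bullet> u\<bar> \<le> E * ?G' u" .
      have h: "\<bar>(Hm ct ct' ?y ?z *v v) \<bullet> u\<bar> \<le> ?n ^ 2 * B2 * norm v * norm u" for v u
        using order_trans[OF Cauchy_Schwarz_ineq2[of "Hm ct ct' ?y ?z *v v" u] mult_right_mono[OF norm_matvec_le_bound[OF c2] norm_ge_zero]] .
      have "?n ^ 2 * B2 * norm v * norm u \<le> ?n ^ 2 * B2 * (?G v / l) * (?G' u / l')"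
        by (intro mult_mono3 l1 l2) (use N2(5) in auto)
      also have "\<dots> = ?n ^ 2 * B2 / (l * l') * ?G v * ?G' u" by simp
      also have "\<dots> \<le> E * ?G v * ?G' u" by (intro mult_right_mono E n0)
      finally show "\<bar>(Hm ct ct' ?y ?z *v v) \<bullet> u\<bar> \<le> E * ?G v * ?G' u" using h[of v u] by linarith
      have "\<bar>A.covhess ct (sc ct ct' ?z u) ?y v w\<bar> \<le> ?n ^ 3 * B3 * norm v * norm w * norm u + ?n ^ 2 * B2 * norm (A.Gam ct ?y v w) * norm u"
        unfolding covhess_sc[OF k D] using trilinear_bound[of "H3 ct ct' ?y ?z" B3 v w u, OF c3] h[of "A.Gam ct ?y v w" u] by linarith
      also have "\<dots> \<le> ?n ^ 3 * B3 * norm v * norm w * norm u + ?n ^ 2 * B2 * (C * norm v * norm w) * norm u"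
        by (intro add_left_mono mult_right_mono mult_left_mono gam) (use x N2(5) in auto)
      also have "\<dots> = (?n ^ 3 * B3 + ?n ^ 2 * B2 * C) * norm v * (norm w * norm u)" by (simp add: algebra_simps)
      also have "\<dots> \<le> (?n ^ 3 * B3 + ?n ^ 2 * B2 * C) * (?G v / l) * ((?G w / l) * (?G' u / l'))"
        by (intro mult_mono3 mult_mono l1 l2) (use N2(5) N3(5) N4(4) n0 N5(4) in auto)
      also have "\<dots> = (?n ^ 3 * B3 + ?n ^ 2 * B2 * C) / (l * l * l') * ?G v * ?G w * ?G' u" by simp
      also have "\<dots> \<le> E * ?G v * ?G w * ?G' u" by (intro mult_right_mono E n0)
      finally show "\<bar>A.covhess ct (sc ct ct' ?z u) ?y v w\<bar> \<le> E * ?G v * ?G w * ?G' u" .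
    qed
  qed
  then show ?thesis using N1 N2 N3 N4 N5 N6
    by (intro exI[of _ ?N] exI[of _ ?N'] exI[of _ E]) (auto intro!: open_Int)
qed

lemma form_bound_global:
  obtains B where "0 \<le> B" "\<And>x x'. x \<in> \<Omega> \<Longrightarrow> x' \<in> \<Omega>' \<Longrightarrow> form_bound B x x'"
proof -
  let ?R = "\<lambda>B x x'. x \<in> \<Omega> \<longrightarrow> x' \<in> \<Omega>' \<longrightarrow> form_bound B x x'"
  have mono: "?R B' x x'" if "?R B x x'" "B \<le> B'" for B B' x x'
    using that form_bound_mono[of B x x' B'] by blast
  obtain B where B: "0 \<le> B" "\<And>x x'. x \<in> closure \<Omega> \<Longrightarrow> x' \<in> closure \<Omega>' \<Longrightarrow> ?R B x x'"
    by (rule compact_local_bound[OF doms(3,4), of ?R, OF form_bound_local mono], assumption+, rule that)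
  show ?thesis
  proof (rule that[OF B(1)])
    fix x x' assume "x \<in> \<Omega>" "x' \<in> \<Omega>'"
    then show "form_bound B x x'" using B(2)[of x x'] subsetD[OF closure_subset, of x \<Omega>] subsetD[OF closure_subset, of x' \<Omega>'] by simp
  qed
qed

lemma Hm_extension:
  assumes k: "ct \<in> charts M" "ct' \<in> charts M'"
  obtains G where "continuous_on (snd ct ` (fst ct \<inter> closure \<Omega>) \<times> snd ct' ` (fst ct' \<inter> closure \<Omega>')) G"
    "\<And>y z. y \<in> Dom ct \<Longrightarrow> z \<in> Dom' ct' \<Longrightarrow> G (y, z) = Hm ct ct' y z"
proof -
  let ?S = "snd ct ` (fst ct \<inter> closure \<Omega>) \<times> snd ct' ` (fst ct' \<inter> closure \<Omega>')"
  let ?P = "\<lambda>t G. continuous_on ?S G \<and> (\<forall>y \<in> Dom ct. \<forall>z \<in> Dom' ct'. G (y, z) = pd1 (snd t) (pd2 (fst t) (loc ct ct' c)) y z)"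
  have "\<exists>G. ?P t G" for t :: "'n \<times> 'n"
    using C3E(2)[OF k, of "snd t" "fst t"] unfolding extends_cont_def .
  then have "\<exists>G. \<forall>t. ?P t (G t)" by (intro choice allI)
  then obtain G where "\<forall>t. ?P t (G t)" by (rule exE)
  then have G: "\<And>t. ?P t (G t)" by (rule spec)
  show ?thesis
  proof (rule that[of "\<lambda>p. \<chi> k i. G (k, i) p"])
    show "continuous_on ?S (\<lambda>p. \<chi> k i. G (k, i) p)"
      by (intro continuous_on_vec_lambda conjunct1[OF G])
    fix y z assume yz: "y \<in> Dom ct" "z \<in> Dom' ct'"
    show "(\<chi> k i. G (k, i) (y, z)) = Hm ct ct' y z"
      by (simp add: Hm_def vec_eq_iff conjunct2[OF G, THEN bspec, OF yz(1), THEN bspec, OF yz(2)])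
  qed
qed

end

lemma matrix_eqI_inner:
  fixes A B :: "real^'n::finite^'n"
  assumes "\<And>v w. (A *v v) \<bullet> w = (B *v v) \<bullet> w"
  shows "A = B"
proof -
  have "A *v v = B *v v" for v using assms[of v] by (metis inner_commute vector_eq_ldot)
  then show ?thesis by (simp add: matrix_eq)
qed

lemma continuous_on_matmul:
  fixes f :: "_ \<Rightarrow> real^'n::finite^'n" and g :: "_ \<Rightarrow> real^'n^'n"
  assumes "continuous_on S f" "continuous_on S g"
  shows "continuous_on S (\<lambda>x. f x ** g x)"
  by (rule bounded_bilinear.continuous_on[OF bounded_bilinear_matrix_matrix assms])

lemma (in rmanifold) chart_image_closure:
  assumes k: "ct \<in> charts M" and x: "x \<in> fst ct" "x \<in> closure X"
  shows "snd ct x \<in> closure (snd ct ` (fst ct \<inter> X))"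
proof (rule ccontr)
  let ?D = "snd ct ` (fst ct \<inter> X)"
  assume a: "snd ct x \<notin> closure ?D"
  let ?V = "snd ct ` fst ct - closure ?D"
  have op: "open (chart_inv ct ` ?V)" by (rule chart_inv_image_open[OF k]) (auto intro: open_Diff chart_open(2)[OF k])
  have "x \<in> chart_inv ct ` ?V" using a x by (intro image_eqI[of _ _ "snd ct x"]) (simp_all add: chart_inv1[OF k])
  then obtain y where y: "y \<in> ?V" "chart_inv ct y \<in> X"
    using open_Int_closure_eq_empty[OF op, of X] x(2) by blast
  have yf: "y \<in> snd ct ` fst ct" using y(1) by blast
  have "chart_inv ct y \<in> fst ct \<inter> X" using chart_inv_in[OF k yf] y(2) by simp
  from imageI[OF this, of "snd ct"] have "y \<in> ?D" unfolding chart_inv2[OF k yf] .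
  then show False using y(1) subsetD[OF closure_subset, of y ?D] by simp
qed

lemma matrix_vector_mult_minus: "(- A) *v v = - (A *v v)" for A :: "real^'n::finite^'n"
  by (simp add: matrix_vector_mult_def vec_eq_iff sum_negf)

lemma det_minus_nz: "det A \<noteq> 0 \<Longrightarrow> det (- A) \<noteq> 0" for A :: "real^'n::finite^'n"
proof -
  assume A: "det A \<noteq> 0"
  have m: "matrix_inv A ** A = mat 1" by (rule matrix_inv_props(2)[OF A])
  have "(- matrix_inv A) ** (- A) = mat 1"
    using m by (simp add: matrix_matrix_mult_def)
  from arg_cong[OF this, of det] show "det (- A) \<noteq> 0" by (auto simp: det_mul)
qed

lemma (in rmanifold) tjac_cancel:
  assumes "ct \<in> charts M" "ct' \<in> charts M" "x \<in> fst ct" "x \<in> fst ct'"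
  shows "tjac ct' ct (snd ct' x) *v (tjac ct ct' (snd ct x) *v v) = v"
  by (simp only: matrix_vector_mul_assoc tjac_inverse[OF assms] matrix_vector_mul_lid)

section \<open>The mixed derivative up to the boundary, the half norm and the inverse\<close>

context half_cost
begin

text \<open>\<open>DDbar\<close> is a limit taken in the charts chosen at its two arguments, and
  these may jump. Here it is expressed through one continuous extension in fixed charts and
  Jacobians of transition maps, which gives control of its dependence on the points up to the
  boundary.\<close>

lemma DDbar_form:
  assumes k: "ct \<in> charts M" "ct' \<in> charts M'" and x: "x \<in> fst ct" "x \<in> closure \<Omega>" and x': "x' \<in> fst ct'" "x' \<in> closure \<Omega>'"
    and G: "continuous_on (snd ct ` (fst ct \<inter> closure \<Omega>) \<times> snd ct' ` (fst ct' \<inter> closure \<Omega>')) G"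
    "\<And>y z. y \<in> Dom ct \<Longrightarrow> z \<in> Dom' ct' \<Longrightarrow> G (y, z) = Hm ct ct' y z"
  shows "DD x x' = transpose (tjac (chart_at M' x') ct' (snd (chart_at M' x') x')) **
    G (snd ct x, snd ct' x') ** tjac (chart_at M x) ct (snd (chart_at M x) x)"
proof -
  define cta where "cta = chart_at M x"
  define cta' where "cta' = chart_at M' x'"
  have ka: "cta \<in> charts M" "cta' \<in> charts M'" and xa: "x \<in> fst cta" "x' \<in> fst cta'"
    by (simp_all add: cta_def cta'_def A.chart_at B.chart_at)
  define F where "F p = transpose (tjac cta' ct' (snd p)) ** G (trans cta ct (fst p), trans cta' ct' (snd p)) ** tjac cta ct (fst p)" for p
  let ?U = "snd cta ` (fst cta \<inter> fst ct)" and ?U' = "snd cta' ` (fst cta' \<inter> fst ct')"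
  let ?S1 = "snd cta ` (fst cta \<inter> fst ct \<inter> closure \<Omega>)" and ?S2 = "snd cta' ` (fst cta' \<inter> fst ct' \<inter> closure \<Omega>')"
  have fs: "fst p \<in> ?S1" "snd p \<in> ?S2" if "p \<in> ?S1 \<times> ?S2" for p using that by (simp_all add: mem_Times_iff)
  have sub: "?S1 \<subseteq> ?U" "?S2 \<subseteq> ?U'" by auto
  have t1: "trans cta ct y \<in> snd ct ` (fst ct \<inter> X)" if "y \<in> snd cta ` (fst cta \<inter> fst ct \<inter> X)" for y X
    using that by (auto simp: trans_def A.chart_inv1[OF ka(1)])
  have t2: "trans cta' ct' y \<in> snd ct' ` (fst ct' \<inter> X)" if "y \<in> snd cta' ` (fst cta' \<inter> fst ct' \<inter> X)" for y X
    using that by (auto simp: trans_def B.chart_inv1[OF ka(2)])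
  have cf: "continuous_on (?S1 \<times> ?S2) (\<lambda>p. f (fst p))" if "continuous_on ?U f" for f :: "real^'n \<Rightarrow> 'z::topological_space"
    by (rule continuous_on_compose2[OF that continuous_on_fst[OF continuous_on_id]]) (rule image_subsetI, use fs(1) sub(1) in blast)
  have cs: "continuous_on (?S1 \<times> ?S2) (\<lambda>p. f (snd p))" if "continuous_on ?U' f" for f :: "real^'n \<Rightarrow> 'z::topological_space"
    by (rule continuous_on_compose2[OF that continuous_on_snd[OF continuous_on_id]]) (rule image_subsetI, use fs(2) sub(2) in blast)
  have cF: "continuous_on (?S1 \<times> ?S2) F"
    unfolding F_def
  proof (intro continuous_on_matmul)
    show "continuous_on (?S1 \<times> ?S2) (\<lambda>p. transpose (tjac cta' ct' (snd p)))"
      by (intro bounded_linear.continuous_on[OF bounded_linear_transpose] cs B.tjac_cont ka k)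
    show "continuous_on (?S1 \<times> ?S2) (\<lambda>p. tjac cta ct (fst p))" by (intro cf A.tjac_cont ka k)
    show "continuous_on (?S1 \<times> ?S2) (\<lambda>p. G (trans cta ct (fst p), trans cta' ct' (snd p)))"
    proof (rule continuous_on_compose2[OF G(1)])
      show "continuous_on (?S1 \<times> ?S2) (\<lambda>p. (trans cta ct (fst p), trans cta' ct' (snd p)))"
        by (intro continuous_on_Pair cf cs A.trans_cont B.trans_cont ka k)
      show "(\<lambda>p. (trans cta ct (fst p), trans cta' ct' (snd p))) ` (?S1 \<times> ?S2) \<subseteq>
          snd ct ` (fst ct \<inter> closure \<Omega>) \<times> snd ct' ` (fst ct' \<inter> closure \<Omega>')"
        by (rule image_subsetI, rule SigmaI) (rule t1[OF fs(1)], assumption, rule t2[OF fs(2)], assumption)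
    qed
  qed
  have pS: "(snd cta x, snd cta' x') \<in> ?S1 \<times> ?S2" using x x' xa by auto
  have HF: "Hm cta cta' (fst p) (snd p) = F p" if p: "p \<in> Dom cta \<times> Dom' cta'" "p \<in> ?U \<times> ?U'" for p
  proof (rule matrix_eqI_inner)
    fix v w
    obtain a where a: "fst p = snd cta a" "a \<in> \<Omega>" "a \<in> fst cta" using p(1) by (auto simp: mem_Times_iff)
    obtain a' where a': "snd p = snd cta' a'" "a' \<in> \<Omega>'" "a' \<in> fst cta'" using p(1) by (auto simp: mem_Times_iff)
    have "a \<in> fst ct" using p(2) a(1,3) inj_onD[OF A.chart_inj[OF ka(1)], of a] by (auto simp: mem_Times_iff)
    moreover have "a' \<in> fst ct'" using p(2) a'(1,3) inj_onD[OF B.chart_inj[OF ka(2)], of a'] by (auto simp: mem_Times_iff)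
    moreover note A.chart_inv1[OF ka(1) a(3)] B.chart_inv1[OF ka(2) a'(3)]
    ultimately have af: "a \<in> fst ct" "a' \<in> fst ct'" and t: "trans cta ct (fst p) = snd ct a" "trans cta' ct' (snd p) = snd ct' a'"
      by (simp_all add: trans_def a a')
    have g: "G (snd ct a, snd ct' a') = Hm ct ct' (snd ct a) (snd ct' a')"
      by (rule G(2)) (use af a a' in auto)
    show "(Hm cta cta' (fst p) (snd p) *v v) \<bullet> w = (F p *v v) \<bullet> w"
      unfolding F_def t g
      unfolding a(1) a'(1) Hm_trans[OF ka(1) k(1) ka(2) k(2) a(2,3) af(1) a'(2,3) af(2)]
      by (simp only: matrix_vector_mul_assoc[symmetric] inner_transpose_left)
  qed
  let ?W = "Dom cta \<times> Dom' cta'"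
  have lim: "((\<lambda>p. Hm cta cta' (fst p) (snd p)) \<longlongrightarrow> F (snd cta x, snd cta' x')) (at (snd cta x, snd cta' x') within ?W)"
  proof (rule topological_tendstoI)
    fix B assume B: "open B" "F (snd cta x, snd cta' x') \<in> B"
    obtain W where W: "open W" "(snd cta x, snd cta' x') \<in> W" "\<And>p. p \<in> ?S1 \<times> ?S2 \<Longrightarrow> p \<in> W \<Longrightarrow> F p \<in> B"
      using cF[unfolded continuous_on_topological, rule_format, OF pS B] by (elim exE conjE) (rule that, blast+)
    have oU: "open (?U \<times> ?U')" by (intro open_Times A.overlap_open B.overlap_open ka k)
    show "\<forall>\<^sub>F p in at (snd cta x, snd cta' x') within ?W. Hm cta cta' (fst p) (snd p) \<in> B"
      unfolding eventually_at_topological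
    proof (intro exI[of _ "W \<inter> (?U \<times> ?U')"] conjI ballI impI)
      show "open (W \<inter> (?U \<times> ?U'))" using W(1) oU by (rule open_Int)
      show "(snd cta x, snd cta' x') \<in> W \<inter> (?U \<times> ?U')" using W(2) x x' xa by auto
      fix p assume p: "p \<in> W \<inter> (?U \<times> ?U')" "p \<in> ?W"
      have "fst p \<in> ?S1"
      proof -
        obtain a where a: "fst p = snd cta a" "a \<in> \<Omega>" "a \<in> fst cta" using p(2) by (auto simp: mem_Times_iff)
        have "a \<in> fst ct" using p(1) a(1,3) inj_onD[OF A.chart_inj[OF ka(1)], of a] by (auto simp: mem_Times_iff)
        then show ?thesis using a subsetD[OF closure_subset a(2)] by blast
      qed
      moreover have "snd p \<in> ?S2"
      proof -
        obtain a where a: "snd p = snd cta' a" "a \<in> \<Omega>'" "a \<in> fst cta'" using p(2) by (auto simp: mem_Times_iff)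
        have "a \<in> fst ct'" using p(1) a(1,3) inj_onD[OF B.chart_inj[OF ka(2)], of a] by (auto simp: mem_Times_iff)
        then show ?thesis using a subsetD[OF closure_subset a(2)] by blast
      qed
      ultimately have "F p \<in> B" using W(3)[of p] p(1) by (simp add: mem_Times_iff)
      then show "Hm cta cta' (fst p) (snd p) \<in> B" using HF[of p] p by simp
    qed
  qed
  \<comment> \<open>The point lies in the closure of an open set, so the filter is nontrivial and
    \<open>Lim\<close> is the value of the extension.\<close>
  have nt: "at (snd cta x, snd cta' x') within ?W \<noteq> bot"
  proof (rule open_closure_limpt)
    show "open ?W" by (intro open_Times Dom_open ka)
    show "(snd cta x, snd cta' x') \<in> closure ?W"
      unfolding closure_Times by (intro SigmaI A.chart_image_closure B.chart_image_closure ka xa x x')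
  qed
  have "((\<lambda>(y, z). pd1 i (pd2 k (loc cta cta' c)) y z) \<longlongrightarrow> F (snd cta x, snd cta' x') $ k $ i) (at (snd cta x, snd cta' x') within ?W)" for k i
    using tendsto_vec_nth[OF tendsto_vec_nth[OF lim], of k i] by (simp add: Hm_def case_prod_unfold)
  from tendsto_Lim[OF nt this]
  have "DD x x' = F (snd cta x, snd cta' x')"
    unfolding DDbar_def Let_def cta_def[symmetric] cta'_def[symmetric] by (simp add: vec_eq_iff)
  moreover have "trans cta ct (snd cta x) = snd ct x" "trans cta' ct' (snd cta' x') = snd ct' x'"
    by (simp_all add: trans_def A.chart_inv1[OF ka(1) xa(1)] B.chart_inv1[OF ka(2) xa(2)])
  ultimately show ?thesis unfolding F_def by (simp add: cta_def cta'_def)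
qed

lemma DDbar_interior:
  assumes x: "x \<in> \<Omega>" "x' \<in> \<Omega>'"
  shows "DD x x' = Hm (chart_at M x) (chart_at M' x') (snd (chart_at M x) x) (snd (chart_at M' x') x')"
proof -
  note k = A.chart_at(1)[of x] B.chart_at(1)[of x'] and f = A.chart_at(2)[of x] B.chart_at(2)[of x']
  obtain G where G: "continuous_on (snd (chart_at M x) ` (fst (chart_at M x) \<inter> closure \<Omega>) \<times> snd (chart_at M' x') ` (fst (chart_at M' x') \<inter> closure \<Omega>')) G"
    "\<And>y z. y \<in> Dom (chart_at M x) \<Longrightarrow> z \<in> Dom' (chart_at M' x') \<Longrightarrow> G (y, z) = Hm (chart_at M x) (chart_at M' x') y z"
    by (rule Hm_extension[OF k], rule that)
  have c: "x \<in> closure \<Omega>" "x' \<in> closure \<Omega>'" using x closure_subset by blast+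
  have g: "G (snd (chart_at M x) x, snd (chart_at M' x') x') = Hm (chart_at M x) (chart_at M' x') (snd (chart_at M x) x) (snd (chart_at M' x') x')"
    by (rule G(2)) (use x f in auto)
  show ?thesis
    using DDbar_form[OF k f(1) c(1) f(2) c(2) G] unfolding A.tjac_same[OF k(1) f(1)] B.tjac_same[OF k(2) f(2)] g
    by (simp add: transpose_mat)
qed

lemma Dc_q:
  "Dc M' (flip c) x' x = q (chart_at M x) (chart_at M' x') (snd (chart_at M x) x) (snd (chart_at M' x') x')"
  by (simp add: Dc_def q_def pd2_def loc_def flip_def A.chart_inv1[OF A.chart_at])

lemma D2Dbar_covhess:
  assumes x: "x \<in> \<Omega>" "x' \<in> \<Omega>'"
  shows "D2Dbar M M' c x x' v w u = A.covhess (chart_at M x) (sc (chart_at M x) (chart_at M' x') (snd (chart_at M' x') x') u) (snd (chart_at M x) x) v w"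
proof -
  let ?ct = "chart_at M x" and ?ct' = "chart_at M' x'"
  let ?y = "snd ?ct x" and ?z = "snd ?ct' x'"
  have D: "?y \<in> Dom ?ct" "?z \<in> Dom' ?ct'" using x A.chart_at(2) B.chart_at(2) by blast+
  define h where "h k l = Hm ?ct ?ct' ?y ?z $ k $ l" for k l
  define ch where "ch l i j = christoffel M ?ct ?y l i j" for l i j
  define t where "t k j i = H3 ?ct ?ct' ?y ?z k j i" for k j i
  have "(Hm ?ct ?ct' ?y ?z *v A.Gam ?ct ?y v w) \<bullet> u = (\<Sum>k\<in>UNIV. \<Sum>l\<in>UNIV. h k l * (\<Sum>i\<in>UNIV. \<Sum>j\<in>UNIV. ch l i j * v $ i * w $ j) * u $ k)"
    by (simp add: matvec_inner_sum A.Gam_def h_def ch_def)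
  also have "\<dots> = (\<Sum>k\<in>UNIV. \<Sum>l\<in>UNIV. \<Sum>i\<in>UNIV. \<Sum>j\<in>UNIV. ch l i j * h k l * v $ i * w $ j * u $ k)"
    by (simp add: sum_distrib_left sum_distrib_right mult_ac)
  also have "\<dots> = (\<Sum>k\<in>UNIV. \<Sum>i\<in>UNIV. \<Sum>l\<in>UNIV. \<Sum>j\<in>UNIV. ch l i j * h k l * v $ i * w $ j * u $ k)"
    by (intro sum.cong refl sum.swap)
  also have "\<dots> = (\<Sum>k\<in>UNIV. \<Sum>i\<in>UNIV. \<Sum>j\<in>UNIV. \<Sum>l\<in>UNIV. ch l i j * h k l * v $ i * w $ j * u $ k)"
    by (intro sum.cong refl sum.swap)
  finally have 1: "(Hm ?ct ?ct' ?y ?z *v A.Gam ?ct ?y v w) \<bullet> u = (\<Sum>k\<in>UNIV. \<Sum>i\<in>UNIV. \<Sum>j\<in>UNIV. (\<Sum>l\<in>UNIV. ch l i j * h k l) * v $ i * w $ j * u $ k)"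
    by (simp add: sum_distrib_right)
  have 2: "(\<Sum>k\<in>UNIV. \<Sum>j\<in>UNIV. \<Sum>i\<in>UNIV. t k j i * v $ i * w $ j * u $ k) = (\<Sum>k\<in>UNIV. \<Sum>i\<in>UNIV. \<Sum>j\<in>UNIV. t k j i * v $ i * w $ j * u $ k)"
    by (intro sum.cong refl sum.swap)
  have "D2Dbar M M' c x x' v w u = (\<Sum>i\<in>UNIV. \<Sum>j\<in>UNIV. \<Sum>k\<in>UNIV. (t k j i - (\<Sum>l\<in>UNIV. ch l i j * h k l)) * v $ i * w $ j * u $ k)"
    unfolding D2Dbar_def Let_def t_def H3_def ch_def h_def Hm_def by simp
  also have "\<dots> = (\<Sum>i\<in>UNIV. \<Sum>k\<in>UNIV. \<Sum>j\<in>UNIV. (t k j i - (\<Sum>l\<in>UNIV. ch l i j * h k l)) * v $ i * w $ j * u $ k)"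
    by (intro sum.cong refl sum.swap)
  also have "\<dots> = (\<Sum>k\<in>UNIV. \<Sum>i\<in>UNIV. \<Sum>j\<in>UNIV. (t k j i - (\<Sum>l\<in>UNIV. ch l i j * h k l)) * v $ i * w $ j * u $ k)"
    by (rule sum.swap)
  finally show ?thesis
    unfolding covhess_sc[OF A.chart_at(1) B.chart_at(1) D] 1 t_def[symmetric] 2
    by (simp add: sum_subtractf left_diff_distrib)
qed

lemma D2Dbar_scale: "D2Dbar M M' c x x' (a *\<^sub>R v) (b *\<^sub>R w) (d *\<^sub>R u) = a * b * d * D2Dbar M M' c x x' v w u"
  unfolding D2Dbar_def Let_def vector_scaleR_component by (simp only: real_scaleR_def sum_distrib_left mult_ac)

text \<open>The suprema defining the half norm are finite because \<open>form_bound\<close> is a local property.\<close>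

lemma half_norm:
  shows half_norm_nonneg: "0 \<le> HN"
    and half_norm_bound: "x \<in> \<Omega> \<Longrightarrow> x' \<in> \<Omega>' \<Longrightarrow> form_bound (HN) x x'"
proof -
  \<comment> \<open>A bound of unspecified size; it makes the sets in the half norm bounded, so that
    their suprema are upper bounds and can replace it.\<close>
  obtain B where B: "0 \<le> B" "\<And>x x'. x \<in> \<Omega> \<Longrightarrow> x' \<in> \<Omega>' \<Longrightarrow> form_bound B x x'" by (rule form_bound_global, rule that)
  define f1 where "f1 p = nrm (cogram M' (snd p)) (Dc M' (flip c) (snd p) (fst p))" for p
  define f2 where "f2 p = opnorm (gram M (fst p)) (cogram M' (snd p)) (DD (fst p) (snd p))" for p
  define S3 where "S3 p = {\<bar>D2Dbar M M' c (fst p) (snd p) v w v'\<bar> | v w v'.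
        nrm (gram M (fst p)) v \<le> 1 \<and> nrm (gram M (fst p)) w \<le> 1 \<and> nrm (gram M' (snd p)) v' \<le> 1}" for p
  have N: "HN = (SUP p\<in>\<Omega> \<times> \<Omega>'. f1 p) + (SUP p\<in>\<Omega> \<times> \<Omega>'. f2 p) + (SUP p\<in>\<Omega> \<times> \<Omega>'. Sup (S3 p))"
    unfolding C3_half_norm_def f1_def f2_def S3_def case_prod_unfold ..
  have ex: "\<exists>p. p \<in> \<Omega> \<times> \<Omega>'" using doms by auto
  have fb: "\<bar>Dc M' (flip c) (snd p) (fst p) \<bullet> u\<bar> \<le> B * nrm (gram M' (snd p)) u"
     "\<bar>(DD (fst p) (snd p) *v v) \<bullet> u\<bar> \<le> B * nrm (gram M (fst p)) v * nrm (gram M' (snd p)) u"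
     "\<bar>D2Dbar M M' c (fst p) (snd p) v w u\<bar> \<le> B * nrm (gram M (fst p)) v * nrm (gram M (fst p)) w * nrm (gram M' (snd p)) u"
    if p: "p \<in> \<Omega> \<times> \<Omega>'" for p u v w
  proof -
    have p': "fst p \<in> \<Omega>" "snd p \<in> \<Omega>'" using p by (simp_all add: mem_Times_iff)
    note f = B(2)[OF p', unfolded form_bound_def, rule_format, OF A.chart_at(1) B.chart_at(1) A.chart_at(2) B.chart_at(2),
        unfolded A.gram_in_chart_at B.gram_in_chart_at, of u v w]
    show "\<bar>Dc M' (flip c) (snd p) (fst p) \<bullet> u\<bar> \<le> B * nrm (gram M' (snd p)) u"
      unfolding Dc_q using f by (elim conjE)
    show "\<bar>(DD (fst p) (snd p) *v v) \<bullet> u\<bar> \<le> B * nrm (gram M (fst p)) v * nrm (gram M' (snd p)) u"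
      unfolding DDbar_interior[OF p'] using f by (elim conjE)
    show "\<bar>D2Dbar M M' c (fst p) (snd p) v w u\<bar> \<le> B * nrm (gram M (fst p)) v * nrm (gram M (fst p)) w * nrm (gram M' (snd p)) u"
      unfolding D2Dbar_covhess[OF p'] using f by (elim conjE)
  qed
  have pd: "posdef (cogram M' x')" for x' unfolding cogram_def by (rule posdef_inv[OF B.posdef_gram])
  note nA = nrm_nonneg[OF A.posdef_gram] and nB = nrm_nonneg[OF B.posdef_gram]
  have b1: "f1 p \<le> B" and b2: "f2 p \<le> B" and b3: "\<And>t. t \<in> S3 p \<Longrightarrow> t \<le> B" if p: "p \<in> \<Omega> \<times> \<Omega>'" for p
  proof -
    show "f1 p \<le> B" unfolding f1_def cogram_def by (rule dual_bound[OF B.posdef_gram]) (rule abs_le_D1[OF fb(1)[OF p]])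
    show "f2 p \<le> B" unfolding f2_def
    proof (rule opnorm_le)
      fix v assume v: "nrm (gram M (fst p)) v \<le> 1"
      show "nrm (cogram M' (snd p)) (DD (fst p) (snd p) *v v) \<le> B"
        unfolding cogram_def
      proof (rule dual_bound[OF B.posdef_gram])
        fix u
        have "B * nrm (gram M (fst p)) v * nrm (gram M' (snd p)) u \<le> B * 1 * nrm (gram M' (snd p)) u"
          by (intro mult_right_mono mult_left_mono v B nB)
        then show "(DD (fst p) (snd p) *v v) \<bullet> u \<le> B * nrm (gram M' (snd p)) u"
          using abs_le_D1[OF fb(2)[OF p, of v u]] by linarith
      qed
    qed
    fix t assume "t \<in> S3 p"
    then obtain v w u where t: "t = \<bar>D2Dbar M M' c (fst p) (snd p) v w u\<bar>" "nrm (gram M (fst p)) v \<le> 1"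
      "nrm (gram M (fst p)) w \<le> 1" "nrm (gram M' (snd p)) u \<le> 1" unfolding S3_def by blast
    have "B * nrm (gram M (fst p)) v * nrm (gram M (fst p)) w * nrm (gram M' (snd p)) u \<le> B * 1 * 1 * 1"
      by (intro mult_mono t mult_nonneg_nonneg B nA nB) auto
    then show "t \<le> B" using fb(3)[OF p, of v w u] t(1) by linarith
  qed
  have S3ne: "0 \<in> S3 p" for p
    unfolding S3_def by (rule CollectI, intro exI[of _ 0]) (simp add: D2Dbar_def)
  have b3': "Sup (S3 p) \<le> B" if "p \<in> \<Omega> \<times> \<Omega>'" for p
  proof (rule cSup_least)
    show "S3 p \<noteq> {}" using S3ne[of p] by blast
  qed (rule b3[OF that])
  have S3le: "t \<le> Sup (S3 p)" if "p \<in> \<Omega> \<times> \<Omega>'" "t \<in> S3 p" for p t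
    by (rule cSup_upper[OF that(2)]) (rule bdd_aboveI, rule b3[OF that(1)])
  have u1: "f1 p \<le> (SUP p\<in>\<Omega> \<times> \<Omega>'. f1 p)" and u2: "f2 p \<le> (SUP p\<in>\<Omega> \<times> \<Omega>'. f2 p)" and u3: "Sup (S3 p) \<le> (SUP p\<in>\<Omega> \<times> \<Omega>'. Sup (S3 p))"
    if "p \<in> \<Omega> \<times> \<Omega>'" for p
    by (rule cSUP_upper[OF that], rule bdd_aboveI2, erule b1 b2 b3')+
  have p1: "0 \<le> f1 p" "0 \<le> f2 p" for p unfolding f1_def f2_def by (rule nrm_nonneg[OF pd] opnorm_bound(2)[OF A.posdef_gram pd])+
  have p3: "0 \<le> Sup (S3 p)" if "p \<in> \<Omega> \<times> \<Omega>'" for p by (rule S3le[OF that S3ne])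
  obtain p0 where p0: "p0 \<in> \<Omega> \<times> \<Omega>'" using ex by (rule exE)
  let ?s1 = "SUP p\<in>\<Omega> \<times> \<Omega>'. f1 p" and ?s2 = "SUP p\<in>\<Omega> \<times> \<Omega>'. f2 p" and ?s3 = "SUP p\<in>\<Omega> \<times> \<Omega>'. Sup (S3 p)"
  have s: "0 \<le> ?s1" "0 \<le> ?s2" "0 \<le> ?s3"
    using u1[OF p0] u2[OF p0] u3[OF p0] p1[of p0] p3[OF p0] by linarith+
  show "0 \<le> HN" unfolding N using s by linarith
  assume x: "x \<in> \<Omega>" and x': "x' \<in> \<Omega>'"
  have p: "(x, x') \<in> \<Omega> \<times> \<Omega>'" using x x' by simp
  let ?k = "chart_at M x" and ?k' = "chart_at M' x'" and ?N = "HN"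
  have sN: "?s1 \<le> ?N" "?s2 \<le> ?N" "?s3 \<le> ?N" unfolding N using s by linarith+
  show "form_bound ?N x x'"
  proof (rule form_boundI[OF A.chart_at(1) B.chart_at(1) x A.chart_at(2) x' B.chart_at(2)], unfold A.gram_in_chart_at B.gram_in_chart_at)
    fix u v w
    have "\<bar>Dc M' (flip c) x' x \<bullet> u\<bar> \<le> f1 (x, x') * nrm (gram M' x') u"
      using dual_cauchy[OF B.posdef_gram, of "Dc M' (flip c) x' x" u x'] by (simp add: f1_def cogram_def)
    also have "\<dots> \<le> ?N * nrm (gram M' x') u" using u1[OF p] sN(1) by (intro mult_right_mono nB) linarith
    finally show "\<bar>q ?k ?k' (snd ?k x) (snd ?k' x') \<bullet> u\<bar> \<le> ?N * nrm (gram M' x') u" unfolding Dc_q .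
    let ?H = "DD x x'"
    have "\<bar>(?H *v v) \<bullet> u\<bar> \<le> nrm (cogram M' x') (?H *v v) * nrm (gram M' x') u"
      unfolding cogram_def by (rule dual_cauchy[OF B.posdef_gram])
    also have "\<dots> \<le> (f2 (x, x') * nrm (gram M x) v) * nrm (gram M' x') u"
      unfolding f2_def fst_conv snd_conv by (intro mult_right_mono nB opnorm_bound(1)[OF A.posdef_gram pd])
    also have "\<dots> \<le> ?N * nrm (gram M x) v * nrm (gram M' x') u" using u2[OF p] sN(2) by (intro mult_right_mono nA nB) linarith
    finally show "\<bar>(Hm ?k ?k' (snd ?k x) (snd ?k' x') *v v) \<bullet> u\<bar> \<le> ?N * nrm (gram M x) v * nrm (gram M' x') u"
      unfolding DDbar_interior[OF x x'] .
    have "\<bar>D2Dbar M M' c x x' v w u\<bar> \<le> ?N * nrm (gram M x) v * nrm (gram M x) w * nrm (gram M' x') u"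
    proof -
      define a where "a = nrm (gram M x) v"
      define b where "b = nrm (gram M x) w"
      define d where "d = nrm (gram M' x') u"
      have abd0: "0 \<le> a" "0 \<le> b" "0 \<le> d" unfolding a_def b_def d_def by (rule nA nB)+
      \<comment> \<open>Homogeneity reduces to vectors of norm at most 1. If one of the norms is 0,
        so is the vector, and 1 / 0 = 0 keeps the identity true.\<close>
      have "D2Dbar M M' c x x' v w u = a * b * d * D2Dbar M M' c x x' ((1/a) *\<^sub>R v) ((1/b) *\<^sub>R w) ((1/d) *\<^sub>R u)"
      proof -
        have ev: "a *\<^sub>R ((1/a) *\<^sub>R v) = v" using nrm_pos[OF A.posdef_gram, of v x] by (cases "v = 0") (auto simp: a_def)
        have ew: "b *\<^sub>R ((1/b) *\<^sub>R w) = w" using nrm_pos[OF A.posdef_gram, of w x] by (cases "w = 0") (auto simp: b_def)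
        have eu: "d *\<^sub>R ((1/d) *\<^sub>R u) = u" using nrm_pos[OF B.posdef_gram, of u x'] by (cases "u = 0") (auto simp: d_def)
        show ?thesis using D2Dbar_scale[of x x' a "(1/a) *\<^sub>R v" b "(1/b) *\<^sub>R w" d "(1/d) *\<^sub>R u"] unfolding ev ew eu .
      qed
      moreover have "\<bar>D2Dbar M M' c x x' ((1/a) *\<^sub>R v) ((1/b) *\<^sub>R w) ((1/d) *\<^sub>R u)\<bar> \<le> ?N"
      proof -
        have n1: "nrm (gram M x) ((1/a) *\<^sub>R v) \<le> 1" "nrm (gram M x) ((1/b) *\<^sub>R w) \<le> 1" "nrm (gram M' x') ((1/d) *\<^sub>R u) \<le> 1"
          using abd0 by (simp_all only: nrm_scaleR a_def[symmetric] b_def[symmetric] d_def[symmetric]) (simp_all add: divide_le_eq_1)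
        have "\<bar>D2Dbar M M' c x x' ((1/a) *\<^sub>R v) ((1/b) *\<^sub>R w) ((1/d) *\<^sub>R u)\<bar> \<in> S3 (x, x')"
          unfolding S3_def fst_conv snd_conv by (rule CollectI, intro exI conjI, rule refl) (rule n1)+
        from S3le[OF p this] show ?thesis using u3[OF p] sN(3) by linarith
      qed
      ultimately have "\<bar>D2Dbar M M' c x x' v w u\<bar> = a * b * d * \<bar>D2Dbar M M' c x x' ((1/a) *\<^sub>R v) ((1/b) *\<^sub>R w) ((1/d) *\<^sub>R u)\<bar>"
        "a * b * d * \<bar>D2Dbar M M' c x x' ((1/a) *\<^sub>R v) ((1/b) *\<^sub>R w) ((1/d) *\<^sub>R u)\<bar> \<le> a * b * d * ?N"
        using abd0 by (auto simp: abs_mult intro!: mult_left_mono)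
      then show ?thesis unfolding a_def[symmetric] b_def[symmetric] d_def[symmetric] by (simp add: mult_ac)
    qed
    then show "\<bar>A.covhess ?k (sc ?k ?k' (snd ?k' x') u) (snd ?k x) v w\<bar> \<le> ?N * nrm (gram M x) v * nrm (gram M x) w * nrm (gram M' x') u"
      unfolding D2Dbar_covhess[OF x x'] .
  qed
qed

text \<open>A lower bound l0 |v| \<le> |g v| at the given point persists with l0 / 2 for nearby
  matrices. Read through the charts it bounds the inverse, also at boundary points since
  invertibility holds on the closures.\<close>

lemma inverse_local_bound:
  assumes inv: "\<And>x x'. x \<in> closure \<Omega> \<Longrightarrow> x' \<in> closure \<Omega>' \<Longrightarrow> invertible (DD x x')"
    and x0: "x0 \<in> closure \<Omega>" "x0' \<in> closure \<Omega>'"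
  shows "\<exists>N N' B. open N \<and> open N' \<and> x0 \<in> N \<and> x0' \<in> N' \<and> (\<forall>x\<in>N. \<forall>x'\<in>N'. x \<in> closure \<Omega> \<longrightarrow> x' \<in> closure \<Omega>' \<longrightarrow>
    opnorm (cogram M' x') (gram M x) (matrix_inv (- DD x x')) \<le> B)"
proof -
  define ct where "ct = chart_at M x0"
  define ct' where "ct' = chart_at M' x0'"
  have k: "ct \<in> charts M" "ct' \<in> charts M'" and xk: "x0 \<in> fst ct" "x0' \<in> fst ct'"
    by (simp_all add: ct_def ct'_def A.chart_at B.chart_at)
  obtain G where G: "continuous_on (snd ct ` (fst ct \<inter> closure \<Omega>) \<times> snd ct' ` (fst ct' \<inter> closure \<Omega>')) G"
    "\<And>y z. y \<in> Dom ct \<Longrightarrow> z \<in> Dom' ct' \<Longrightarrow> G (y, z) = Hm ct ct' y z"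
    by (rule Hm_extension[OF k], rule that)
  define g where "g w = G (snd ct (fst w), snd ct' (snd w))" for w
  let ?S = "(fst ct \<inter> closure \<Omega>) \<times> (fst ct' \<inter> closure \<Omega>')"
  have cg: "continuous_on ?S g" unfolding g_def by (rule chart_pair_cont[OF k G(1)])
  have DD: "DD x x' = transpose (tjac (chart_at M' x') ct' (snd (chart_at M' x') x')) ** g (x, x') ** tjac (chart_at M x) ct (snd (chart_at M x) x)"
    if "x \<in> fst ct" "x \<in> closure \<Omega>" "x' \<in> fst ct'" "x' \<in> closure \<Omega>'" for x x'
    unfolding g_def fst_conv snd_conv by (rule DDbar_form[OF k that G])
  have "DD x0 x0' = g (x0, x0')"
    using DD[OF xk(1) x0(1) xk(2) x0(2)]
    unfolding ct_def ct'_def A.tjac_same[OF A.chart_at] B.tjac_same[OF B.chart_at] by (simp add: transpose_mat)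
  then have "invertible (g (x0, x0'))" using inv[OF x0] by simp
  then obtain I where I: "I ** g (x0, x0') = mat 1" unfolding invertible_def by blast
  define l0 where "l0 = 1 / (norm I + 1)"
  have l0: "l0 > 0" unfolding l0_def by (rule divide_pos_pos) (auto intro: add_nonneg_pos)
  have lowg0: "l0 * norm v \<le> norm (g (x0, x0') *v v)" for v
  proof -
    have "norm v = norm (I *v (g (x0, x0') *v v))" by (simp add: matrix_vector_mul_assoc I)
    also have "\<dots> \<le> norm I * norm (g (x0, x0') *v v)" by (rule norm_matvec_le)
    also have "\<dots> \<le> (norm I + 1) * norm (g (x0, x0') *v v)" by (intro mult_right_mono) auto
    finally show ?thesis unfolding l0_def by (simp add: divide_le_eq add_nonneg_pos mult.commute)
  qed
  have mem: "x0 \<in> fst ct \<inter> closure \<Omega>" "x0' \<in> fst ct' \<inter> closure \<Omega>'" using x0 xk by auto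
  have bm: "g (x0, x0') \<in> ball (g (x0, x0')) (l0 / 2)" using l0 by simp
  obtain N1 N1' where N1: "open N1" "open N1'" "x0 \<in> N1" "x0' \<in> N1'" and
    gb: "\<And>x x'. x \<in> N1 \<Longrightarrow> x' \<in> N1' \<Longrightarrow> x \<in> fst ct \<inter> closure \<Omega> \<Longrightarrow> x' \<in> fst ct' \<inter> closure \<Omega>' \<Longrightarrow> g (x, x') \<in> ball (g (x0, x0')) (l0 / 2)"
    by (rule continuous_on_prod_nbhd[OF cg mem open_ball bm], rule that)
  obtain N5 l L where N5: "open N5" "x0 \<in> N5" "N5 \<subseteq> fst ct" "0 < l" "0 < L"
    and "\<And>x v. x \<in> N5 \<Longrightarrow> l * norm v \<le> nrm (gram_in M ct x) v" and up: "\<And>x v. x \<in> N5 \<Longrightarrow> nrm (gram_in M ct x) v \<le> L * norm v"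
    by (rule A.gram_local_bounds[OF k(1) xk(1)], rule that)
  obtain N6 l' L' where N6: "open N6" "x0' \<in> N6" "N6 \<subseteq> fst ct'" "0 < l'" "0 < L'"
    and "\<And>x v. x \<in> N6 \<Longrightarrow> l' * norm v \<le> nrm (gram_in M' ct' x) v" and up': "\<And>x v. x \<in> N6 \<Longrightarrow> nrm (gram_in M' ct' x) v \<le> L' * norm v"
    by (rule B.gram_local_bounds[OF k(2) xk(2)], rule that)
  have "opnorm (cogram M' x') (gram M x) (matrix_inv (- DD x x')) \<le> L * (2 / l0 * L')"
    if x: "x \<in> N1" "x \<in> N5" "x \<in> closure \<Omega>" and x': "x' \<in> N1'" "x' \<in> N6" "x' \<in> closure \<Omega>'" for x x'
  proof (rule opnorm_le)
    fix p assume p: "nrm (cogram M' x') p \<le> 1"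
    have f: "x \<in> fst ct" "x' \<in> fst ct'" using x x' N5(3) N6(3) by auto
    let ?D = "DD x x'"
    define v where "v = matrix_inv (- ?D) *v p"
    let ?a = "chart_at M x" and ?a' = "chart_at M' x'"
    let ?J = "tjac ?a ct (snd ?a x)" and ?J' = "tjac ?a' ct' (snd ?a' x')"
    have "det (- ?D) \<noteq> 0" by (rule det_minus_nz) (use inv[OF x(3) x'(3)] in \<open>simp add: invertible_det_nz\<close>)
    then have "(- ?D) *v v = p" unfolding v_def by (simp add: matrix_vector_mul_assoc matrix_inv_props)
    then have Dv: "?D *v v = - p" unfolding matrix_vector_mult_minus by (metis minus_minus)
    let ?g = "g (x, x') *v (?J *v v)"
    \<comment> \<open>Chosen so that ?J' maps it to ?g: pairing with w then produces |?g|^2, which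
      the dual norm of p controls.\<close>
    define w where "w = tjac ct' ?a' (snd ct' x') *v ?g"
    have Jw: "?J' *v w = ?g" unfolding w_def
      by (rule B.tjac_cancel[OF k(2) B.chart_at(1) f(2) B.chart_at(2)])
    have "(?D *v v) \<bullet> w = ?g \<bullet> (?J' *v w)"
      unfolding DD[OF f(1) x(3) f(2) x'(3)] by (simp only: matrix_vector_mul_assoc[symmetric] inner_transpose_left)
    then have "(norm ?g)\<^sup>2 = - (p \<bullet> w)" unfolding Jw Dv by (simp add: dot_square_norm)
    also have "\<dots> \<le> nrm (cogram M' x') p * nrm (gram M' x') w"
      using dual_cauchy[OF B.posdef_gram, of p w x'] unfolding cogram_def by linarith
    also have "\<dots> \<le> 1 * nrm (gram M' x') w" by (intro mult_right_mono p nrm_nonneg[OF B.posdef_gram])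
    also have "nrm (gram M' x') w = nrm (gram_in M' ct' x') ?g"
      using B.nrm_trans[OF B.chart_at(1) k(2) B.chart_at(2) f(2), of w] unfolding B.gram_in_chart_at Jw .
    also have "\<dots> \<le> L' * norm ?g" by (rule up'[OF x'(2)])
    finally have "norm ?g * norm ?g \<le> L' * norm ?g" by (simp add: power2_eq_square)
    then have g1: "norm ?g \<le> L'" using N6(5) by (cases "norm ?g = 0") (simp_all only: mult_le_cancel_right, use norm_ge_zero[of ?g] in linarith)+
    have "norm (g (x, x') - g (x0, x0')) \<le> l0 / 2"
      using gb[OF x(1) x'(1)] x x' f by (simp add: dist_norm norm_minus_commute)
    then have "norm ((g (x, x') - g (x0, x0')) *v (?J *v v)) \<le> l0 / 2 * norm (?J *v v)"
      by (intro order_trans[OF norm_matvec_le] mult_right_mono) auto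
    moreover have geq: "g (x0, x0') *v (?J *v v) = ?g - (g (x, x') - g (x0, x0')) *v (?J *v v)"
      by (simp add: matrix_vector_mult_diff_rdistrib)
    ultimately have "l0 * norm (?J *v v) \<le> norm ?g + l0 / 2 * norm (?J *v v)"
      using lowg0[of "?J *v v", unfolded geq] norm_triangle_ineq4[of ?g "(g (x, x') - g (x0, x0')) *v (?J *v v)"] by linarith
    then have "l0 / 2 * norm (?J *v v) \<le> L'" using g1 by linarith
    then have "norm (?J *v v) \<le> 2 / l0 * L'" using l0 by (simp add: field_simps)
    then have "L * norm (?J *v v) \<le> L * (2 / l0 * L')" using N5(5) by (intro mult_left_mono) auto
    moreover have "nrm (gram M x) v = nrm (gram_in M ct x) (?J *v v)"
      using A.nrm_trans[OF A.chart_at(1) k(1) A.chart_at(2) f(1), of v] unfolding A.gram_in_chart_at .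
    ultimately show "nrm (gram M x) (matrix_inv (- ?D) *v p) \<le> L * (2 / l0 * L')"
      using up[OF x(2), of "?J *v v"] unfolding v_def[symmetric] by linarith
  qed
  then show ?thesis using N1 N5 N6
    by (intro exI[of _ "N1 \<inter> N5"] exI[of _ "N1' \<inter> N6"] exI[of _ "L * (2 / l0 * L')"]) (auto intro!: open_Int)
qed

text \<open>Compactness makes the supremum K finite, hence an upper bound at interior points. The
  second conclusion states the bound on the inverse by testing against vectors u, in arbitrary
  charts.\<close>

lemma inverse_bound:
  assumes inv: "\<And>x x'. x \<in> closure \<Omega> \<Longrightarrow> x' \<in> closure \<Omega>' \<Longrightarrow> invertible (DD x x')"
    and K: "K = (SUP p\<in>closure \<Omega> \<times> closure \<Omega>'. opnorm (cogram M' (snd p)) (gram M (fst p)) (matrix_inv (- DD (fst p) (snd p))))"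
    and x: "x \<in> \<Omega>" "x' \<in> \<Omega>'"
  shows "0 \<le> K" and "ct \<in> charts M \<Longrightarrow> ct' \<in> charts M' \<Longrightarrow> x \<in> fst ct \<Longrightarrow> x' \<in> fst ct' \<Longrightarrow>
      (\<And>u. (Hm ct ct' (snd ct x) (snd ct' x') *v v) \<bullet> u \<le> B * nrm (gram_in M' ct' x') u) \<Longrightarrow> nrm (gram_in M ct x) v \<le> K * B"
proof -
  define f where "f x x' = opnorm (cogram M' x') (gram M x) (matrix_inv (- DD x x'))" for x x'
  let ?R = "\<lambda>B x x'. x \<in> closure \<Omega> \<longrightarrow> x' \<in> closure \<Omega>' \<longrightarrow> f x x' \<le> B"
  have loc: "\<exists>N N' B. open N \<and> open N' \<and> x0 \<in> N \<and> x0' \<in> N' \<and> (\<forall>x\<in>N. \<forall>x'\<in>N'. ?R B x x')" if "x0 \<in> closure \<Omega>" "x0' \<in> closure \<Omega>'" for x0 x0'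
    unfolding f_def by (rule inverse_local_bound[OF inv that])
  obtain b where b: "0 \<le> b" "\<And>x x'. x \<in> closure \<Omega> \<Longrightarrow> x' \<in> closure \<Omega>' \<Longrightarrow> ?R b x x'"
  proof (rule compact_local_bound[OF doms(3,4), of ?R, OF loc])
    show "?R B' x x'" if "?R B x x'" "B \<le> B'" for B B' x x' using that order_trans by blast
  qed (assumption+, rule that)
  have KE: "K = (SUP p\<in>closure \<Omega> \<times> closure \<Omega>'. f (fst p) (snd p))" unfolding K f_def ..
  have pd: "posdef (cogram M' x')" for x' unfolding cogram_def by (rule posdef_inv[OF B.posdef_gram])
  have cl: "x \<in> closure \<Omega>" "x' \<in> closure \<Omega>'" using x closure_subset by blast+
  have fK: "f x x' \<le> K"
  proof -
    have "bdd_above ((\<lambda>p. f (fst p) (snd p)) ` (closure \<Omega> \<times> closure \<Omega>'))"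
      by (rule bdd_aboveI2[of _ _ b]) (use b(2) in \<open>simp add: mem_Times_iff\<close>)
    moreover have "(x, x') \<in> closure \<Omega> \<times> closure \<Omega>'" using cl by simp
    ultimately show ?thesis unfolding KE using cSUP_upper[of "(x, x')" _ "\<lambda>p. f (fst p) (snd p)"] by simp
  qed
  have f0: "0 \<le> f x x'" unfolding f_def by (rule opnorm_bound(2)[OF pd A.posdef_gram])
  show "0 \<le> K" using fK f0 by linarith
  assume k: "ct \<in> charts M" "ct' \<in> charts M'" and xf: "x \<in> fst ct" "x' \<in> fst ct'"
    and B: "\<And>u. (Hm ct ct' (snd ct x) (snd ct' x') *v v) \<bullet> u \<le> B * nrm (gram_in M' ct' x') u"
  let ?a = "chart_at M x" and ?a' = "chart_at M' x'"
  let ?D = "DD x x'"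
  define w where "w = tjac ct ?a (snd ct x) *v v"
  have nw: "nrm (gram_in M ct x) v = nrm (gram M x) w"
    using A.nrm_trans[OF k(1) A.chart_at(1) xf(1) A.chart_at(2), of v] unfolding A.gram_in_chart_at w_def .
  have "(?D *v w) \<bullet> u \<le> B * nrm (gram M' x') u" for u
  proof -
    let ?u = "tjac ?a' ct' (snd ?a' x') *v u"
    have "(Hm ct ct' (snd ct x) (snd ct' x') *v v) \<bullet> ?u = (?D *v w) \<bullet> u"
      unfolding DDbar_interior[OF x] w_def
      unfolding Hm_trans[OF k(1) A.chart_at(1) k(2) B.chart_at(1) x(1) xf(1) A.chart_at(2) x(2) xf(2) B.chart_at(2)]
      by (simp only: B.tjac_cancel[OF B.chart_at(1) k(2) B.chart_at(2) xf(2)])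
    moreover have "nrm (gram M' x') u = nrm (gram_in M' ct' x') ?u"
      using B.nrm_trans[OF B.chart_at(1) k(2) B.chart_at(2) xf(2), of u] unfolding B.gram_in_chart_at .
    ultimately show ?thesis using B[of ?u] by simp
  qed
  then have p: "nrm (cogram M' x') (?D *v w) \<le> B" unfolding cogram_def by (rule dual_bound[OF B.posdef_gram])
  have "det (- ?D) \<noteq> 0" by (rule det_minus_nz) (use inv[OF cl] in \<open>simp add: invertible_det_nz\<close>)
  then have "matrix_inv (- ?D) *v ((- ?D) *v w) = w" by (simp add: matrix_vector_mul_assoc matrix_inv_props)
  then have "matrix_inv (- ?D) *v (- (?D *v w)) = w" by (simp only: matrix_vector_mult_minus)
  then have "nrm (gram M x) w \<le> f x x' * nrm (cogram M' x') (- (?D *v w))"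
    using opnorm_bound(1)[OF pd A.posdef_gram, of x "matrix_inv (- ?D)" "- (?D *v w)" x'] unfolding f_def by simp
  also have "nrm (cogram M' x') (- (?D *v w)) = nrm (cogram M' x') (?D *v w)"
    using nrm_scaleR[of "cogram M' x'" "-1" "?D *v w"] by simp
  also have "f x x' * nrm (cogram M' x') (?D *v w) \<le> K * B"
    by (rule mult_mono[OF fK p]) (use fK f0 nrm_nonneg[OF pd] in auto)
  finally show "nrm (gram_in M ct x) v \<le> K * B" unfolding nw .
qed

end

section \<open>Functions convex with respect to the cost\<close>

context rmanifold
begin

text \<open>Invariance of domain, chart by chart.\<close>

lemma inj_open_map:
  fixes f :: "'m \<Rightarrow> real^'n"
  assumes f: "continuous_on \<Omega> f" "inj_on f \<Omega>" and U: "open U" "U \<subseteq> \<Omega>"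
  shows "open (f ` U)"
proof -
  have "open ((\<lambda>y. f (chart_inv ct y)) ` (snd ct ` (fst ct \<inter> U)))" if k: "ct \<in> charts M" for ct
  proof (rule invariance_of_domain)
    let ?D = "snd ct ` (fst ct \<inter> U)"
    have inv: "chart_inv ct y \<in> fst ct \<inter> U \<and> snd ct (chart_inv ct y) = y" if y: "y \<in> ?D" for y
    proof -
      obtain x where "y = snd ct x" "x \<in> fst ct" "x \<in> U" using y by blast
      then show ?thesis by (simp add: chart_inv1[OF k])
    qed
    show "open ?D" by (rule chart_image_open[OF k U(1)])
    show "continuous_on ?D (\<lambda>y. f (chart_inv ct y))"
    proof (rule continuous_on_compose2[OF f(1)])
      show "continuous_on ?D (chart_inv ct)" by (rule continuous_on_subset[OF chart_cont(2)[OF k]]) blast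
      show "chart_inv ct ` ?D \<subseteq> \<Omega>" using inv U(2) by blast
    qed
    show "inj_on (\<lambda>y. f (chart_inv ct y)) ?D"
    proof (rule inj_onI)
      fix y z assume yz: "y \<in> ?D" "z \<in> ?D" "f (chart_inv ct y) = f (chart_inv ct z)"
      have "chart_inv ct y \<in> \<Omega>" "chart_inv ct z \<in> \<Omega>" using inv[OF yz(1)] inv[OF yz(2)] U(2) by blast+
      from inj_onD[OF f(2) yz(3) this] show "y = z" using inv[OF yz(1)] inv[OF yz(2)] by metis
    qed
  qed
  then have "open (\<Union>ct\<in>charts M. (\<lambda>y. f (chart_inv ct y)) ` (snd ct ` (fst ct \<inter> U)))" by (rule open_UN[OF ballI])
  also have "(\<Union>ct\<in>charts M. (\<lambda>y. f (chart_inv ct y)) ` (snd ct ` (fst ct \<inter> U))) = f ` U"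
  proof (intro set_eqI iffI)
    fix p assume "p \<in> (\<Union>ct\<in>charts M. (\<lambda>y. f (chart_inv ct y)) ` (snd ct ` (fst ct \<inter> U)))"
    then obtain ct x where "ct \<in> charts M" "p = f (chart_inv ct (snd ct x))" "x \<in> fst ct" "x \<in> U" by blast
    then show "p \<in> f ` U" by (simp add: chart_inv1)
  next
    fix p assume "p \<in> f ` U"
    then obtain x where x: "p = f x" "x \<in> U" by blast
    then show "p \<in> (\<Union>ct\<in>charts M. (\<lambda>y. f (chart_inv ct y)) ` (snd ct ` (fst ct \<inter> U)))"
      using chart_at[of x] chart_inv1[OF chart_at, of x] by (intro UN_I[of "chart_at M x"] image_eqI[of _ _ "snd (chart_at M x) x"]) auto
  qed
  finally show ?thesis .
qed

lemma inj_inverse_continuous: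
  fixes f :: "'m \<Rightarrow> real^'n"
  assumes f: "continuous_on \<Omega> f" "inj_on f \<Omega>" and \<Omega>: "open \<Omega>"
  shows "continuous_on (f ` \<Omega>) (the_inv_into \<Omega> f)"
proof -
  have o: "open (f ` \<Omega>)" by (rule inj_open_map[OF f \<Omega>]) simp
  have "open (the_inv_into \<Omega> f -` B \<inter> f ` \<Omega>)" if "open B" for B
  proof -
    have "the_inv_into \<Omega> f -` B \<inter> f ` \<Omega> = f ` (\<Omega> \<inter> B)"
      using the_inv_into_f_f[OF f(2)] by force
    then show ?thesis using inj_open_map[OF f, of "\<Omega> \<inter> B"] \<Omega> that by auto
  qed
  then show ?thesis using continuous_on_open_vimage[OF o] by blast
qed

text \<open>The condition on q says that the differential a of \<phi> is the pull-back of q under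
  the derivative L of f; so q is the gradient of \<phi> in the coordinates given by f.\<close>

lemma inverse_chain:
  fixes f :: "'m \<Rightarrow> real^'n"
  assumes f: "continuous_on \<Omega> f" "inj_on f \<Omega>" and \<Omega>: "open \<Omega>" and k: "ct \<in> charts M" and x: "x \<in> \<Omega>" "x \<in> fst ct"
    and L: "((\<lambda>y. f (chart_inv ct y)) has_derivative (*v) L) (at (snd ct x))" "det L \<noteq> 0"
    and \<phi>: "((\<lambda>y. \<phi> (chart_inv ct y)) has_derivative (\<lambda>h. a \<bullet> h)) (at (snd ct x))" and q: "\<And>h. q \<bullet> (L *v h) = a \<bullet> h"
  shows "((\<lambda>p. \<phi> (the_inv_into \<Omega> f p)) has_derivative (\<lambda>h. q \<bullet> h)) (at (f x))"
proof -
  let ?g = "\<lambda>p. snd ct (the_inv_into \<Omega> f p)" and ?T = "f ` (\<Omega> \<inter> fst ct)"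
  have oT: "open ?T" by (rule inj_open_map[OF f]) (auto intro: open_Int \<Omega> chart_open(1)[OF k])
  have inv: "the_inv_into \<Omega> f (f z) = z" if "z \<in> \<Omega>" for z by (rule the_inv_into_f_f[OF f(2) that])
  note Li = matrix_inv_props[OF L(2)]
  have g: "(?g has_derivative (*v) (matrix_inv L)) (at (f x))"
  proof (rule has_derivative_inverse_basic[where f = "\<lambda>y. f (chart_inv ct y)" and f' = "(*v) L" and T = ?T])
    show "((\<lambda>y. f (chart_inv ct y)) has_derivative (*v) L) (at (?g (f x)))" using L(1) inv[OF x(1)] by simp
    show "bounded_linear ((*v) (matrix_inv L))" by (rule matrix_vector_mul_bounded_linear)
    show "(*v) (matrix_inv L) \<circ> (*v) L = id" by (auto simp: matrix_vector_mul_assoc Li)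
    show "continuous (at (f x)) ?g"
    proof -
      have "continuous_on ?T ?g"
      proof (rule continuous_on_compose2[OF chart_cont(1)[OF k]])
        show "continuous_on ?T (the_inv_into \<Omega> f)" by (rule continuous_on_subset[OF inj_inverse_continuous[OF f \<Omega>]]) blast
        show "the_inv_into \<Omega> f ` ?T \<subseteq> fst ct" using inv by auto
      qed
      then show ?thesis using oT x by (auto simp: continuous_on_eq_continuous_at)
    qed
    show "open ?T" by (rule oT)
    show "f x \<in> ?T" using x by blast
    show "f (chart_inv ct (?g z)) = z" if "z \<in> ?T" for z using that inv chart_inv1[OF k] by auto
  qed
  have "((\<lambda>p. \<phi> (chart_inv ct (?g p))) has_derivative (\<lambda>h. a \<bullet> (matrix_inv L *v h))) (at (f x))"
    using diff_chain_at[OF g, of "\<lambda>y. \<phi> (chart_inv ct y)" "\<lambda>h. a \<bullet> h"] \<phi> inv[OF x(1)] by (simp add: o_def)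
  moreover have "a \<bullet> (matrix_inv L *v h) = q \<bullet> h" for h
    using q[of "matrix_inv L *v h"] by (simp add: matrix_vector_mul_assoc Li)
  ultimately have "((\<lambda>p. \<phi> (chart_inv ct (?g p))) has_derivative (\<lambda>h. q \<bullet> h)) (at (f x))" by simp
  then show ?thesis
  proof (rule has_derivative_transform_within_open[OF _ oT])
    show "f x \<in> ?T" using x by blast
    show "\<phi> (chart_inv ct (?g p)) = \<phi> (the_inv_into \<Omega> f p)" if "p \<in> ?T" for p
      using that inv chart_inv1[OF k] by auto
  qed
qed

end

context half_cost
begin

text \<open>The covector lives at x', so its components do not depend on the chart used around
  x.\<close>

lemma q_any:
  assumes "ct \<in> charts M" "x \<in> fst ct"
  shows "Dc M' (flip c) x' x = q ct (chart_at M' x') (snd ct x) (snd (chart_at M' x') x')"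
  unfolding Dc_q by (simp add: q_def pd2_def loc_def A.chart_inv1[OF A.chart_at] A.chart_inv1[OF assms])

lemma Dc_deriv:
  assumes k: "ct \<in> charts M" and y: "y \<in> Dom ct" and x': "x' \<in> \<Omega>'"
  shows "((\<lambda>y. Dc M' (flip c) x' (chart_inv ct y)) has_derivative (*v) (Hm ct (chart_at M' x') y (snd (chart_at M' x') x'))) (at y)"
proof (rule has_derivative_transform_within_open[OF _ Dom_open(1)[OF k] y])
  have "snd (chart_at M' x') x' \<in> Dom' (chart_at M' x')" using x' B.chart_at by blast
  then show "((\<lambda>y. q ct (chart_at M' x') y (snd (chart_at M' x') x')) has_derivative (*v) (Hm ct (chart_at M' x') y (snd (chart_at M' x') x'))) (at y)"
    by (rule q_deriv[OF k B.chart_at(1) y])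
  fix z assume "z \<in> Dom ct"
  then obtain a where a: "z = snd ct a" "a \<in> fst ct" by blast
  then show "q ct (chart_at M' x') z (snd (chart_at M' x') x') = Dc M' (flip c) x' (chart_inv ct z)"
    by (simp add: A.chart_inv1[OF k] q_any[OF k])
qed

lemma mom_cont:
  assumes x': "x' \<in> \<Omega>'"
  shows "continuous_on \<Omega> (mom M' (flip c) x')"
proof -
  have "continuous (at x) (mom M' (flip c) x')" if x: "x \<in> \<Omega>" for x
  proof -
    let ?k = "chart_at M x"
    have y: "snd ?k x \<in> Dom ?k" using x A.chart_at by blast
    have 1: "isCont (\<lambda>y. Dc M' (flip c) x' (chart_inv ?k y)) (snd ?k x)"
      by (rule has_derivative_continuous[OF Dc_deriv[OF A.chart_at(1) y x']])
    have 2: "isCont (snd ?k) x"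
      using A.chart_cont(1)[OF A.chart_at(1), of x] A.chart_open(1)[OF A.chart_at(1), of x] A.chart_at(2)[of x]
      by (simp add: continuous_on_eq_continuous_at)
    have "isCont (\<lambda>x. Dc M' (flip c) x' (chart_inv ?k (snd ?k x))) x" by (rule isCont_o2[OF 2 1])
    then have "isCont (\<lambda>x. - Dc M' (flip c) x' (chart_inv ?k (snd ?k x))) x" by (rule continuous_minus)
    moreover have ev: "\<forall>\<^sub>F z in nhds x. - Dc M' (flip c) x' (chart_inv ?k (snd ?k z)) = mom M' (flip c) x' z"
      using eventually_nhds_in_open[OF A.chart_open(1)[OF A.chart_at(1), of x] A.chart_at(2)]
      by eventually_elim (simp add: mom_def A.chart_inv1[OF A.chart_at(1)])
    ultimately show ?thesis by (intro iffD1[OF isCont_cong[OF ev]])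
  qed
  then show ?thesis by (simp add: continuous_at_imp_continuous_on)
qed

lemma Hm_cont:
  assumes k: "ct \<in> charts M" "ct' \<in> charts M'"
  shows "continuous_on (Dom ct \<times> Dom' ct') (\<lambda>p. Hm ct ct' (fst p) (snd p))"
proof -
  obtain G where G: "continuous_on (snd ct ` (fst ct \<inter> closure \<Omega>) \<times> snd ct' ` (fst ct' \<inter> closure \<Omega>')) G"
    "\<And>y z. y \<in> Dom ct \<Longrightarrow> z \<in> Dom' ct' \<Longrightarrow> G (y, z) = Hm ct ct' y z"
    by (rule Hm_extension[OF k], rule that)
  have "continuous_on (Dom ct \<times> Dom' ct') G"
    by (rule continuous_on_subset[OF G(1)]) (intro Sigma_mono image_mono Int_mono order_refl closure_subset)
  then show ?thesis
  proof (rule continuous_on_eq)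
    fix p assume "p \<in> Dom ct \<times> Dom' ct'"
    then show "G p = Hm ct ct' (fst p) (snd p)" using G(2)[of "fst p" "snd p"] by (simp add: mem_Times_iff)
  qed
qed

end

lemma flip_flip [simp]: "flip (flip c) = c"
  by (intro ext) (simp add: flip_def)

section \<open>Supports and continuity of c-convex functions\<close>

locale ot_cost = F: half_cost M M' \<Omega> \<Omega>' c + R: half_cost M' M \<Omega>' \<Omega> "flip c"
  for M :: "('m::{t2_space,second_countable_topology}, 'n::finite) rmfd"
    and M' :: "('k::{t2_space,second_countable_topology}, 'n) rmfd"
    and \<Omega> :: "'m set" and \<Omega>' :: "'k set" and c :: "'m \<Rightarrow> 'k \<Rightarrow> real" +
  fixes X' :: "'k set" and M0 :: real
  assumes M0: "1 \<le> M0" and ccont: "continuous_on (closure \<Omega> \<times> closure \<Omega>') (\<lambda>(x, x'). c x x')"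
    and tw: "twist M M' \<Omega> \<Omega>' c" and nd: "nondeg M M' \<Omega> \<Omega>' c"
    and dc: "dom_conv M M' \<Omega> \<Omega>' X' c" and qqc: "qqconv M M' \<Omega> \<Omega>' M0 c"
begin

abbreviation "subdiff \<equiv> c_subdiff \<Omega> \<Omega>' c"
abbreviation "pm \<equiv> mom M' (flip c)"
abbreviation "pm' \<equiv> mom M c"

lemma pm_inj: "x' \<in> \<Omega>' \<Longrightarrow> inj_on (pm x') \<Omega>" and pm'_inj: "x \<in> \<Omega> \<Longrightarrow> inj_on (pm' x) \<Omega>'"
  using tw unfolding twist_def by blast+

lemma pm'_convex: "x \<in> \<Omega> \<Longrightarrow> convex (pm' x ` \<Omega>')" and pm_convex: "x' \<in> \<Omega>' \<Longrightarrow> convex (pm x' ` \<Omega>)"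
  using dc unfolding dom_conv_def c_convex_wrt_def convex_alt by auto

lemma pm_cont: "x' \<in> \<Omega>' \<Longrightarrow> continuous_on \<Omega> (pm x')"
  by (rule F.mom_cont)

lemma pm'_cont: "x \<in> \<Omega> \<Longrightarrow> continuous_on \<Omega>' (pm' x)"
  using R.mom_cont by simp

text \<open>By (Twist) a point whose momentum is the convex combination is the point of the
  c-segment, so the c-exponential disappears from (QQConv); \<open>qq2\<close> is the version in the
  other variable.\<close>

lemma qq1:
  assumes x: "x \<in> \<Omega>" "x0 \<in> \<Omega>" and w: "w0 \<in> \<Omega>'" "w1 \<in> \<Omega>'" "w \<in> \<Omega>'" and t: "t \<in> {0..1}"
    and seg: "pm' x0 w = (1 - t) *\<^sub>R pm' x0 w0 + t *\<^sub>R pm' x0 w1"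
  shows "- c x w + c x w0 - (- c x0 w + c x0 w0) \<le> M0 * t * max 0 (- c x w1 + c x w0 - (- c x0 w1 + c x0 w0))"
proof -
  have "cseg M \<Omega>' c x0 w0 w1 t = w"
    unfolding cseg_def cexp_def seg[symmetric] by (rule the_inv_into_f_f[OF pm'_inj[OF x(2)] w(3)])
  then show ?thesis
    using qqc[unfolded qqconv_def Let_def, rule_format, OF x x(1) w(1) w(1) w(2) t t] by simp
qed

lemma qq2:
  assumes x: "x0 \<in> \<Omega>" "x1 \<in> \<Omega>" "xs \<in> \<Omega>" and w: "w \<in> \<Omega>'" "w0 \<in> \<Omega>'" and s: "s \<in> {0..1}"
    and seg: "pm w0 xs = (1 - s) *\<^sub>R pm w0 x0 + s *\<^sub>R pm w0 x1"
  shows "- c xs w + c x0 w - (- c xs w0 + c x0 w0) \<le> M0 * s * max 0 (- c x1 w + c x0 w - (- c x1 w0 + c x0 w0))"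
proof -
  have "cseg M' \<Omega> (flip c) w0 x0 x1 s = xs"
    unfolding cseg_def cexp_def seg[symmetric] by (rule the_inv_into_f_f[OF pm_inj[OF w(2)] x(3)])
  then show ?thesis
    using qqc[unfolded qqconv_def Let_def, rule_format, OF x(1) x(1) x(2) w w(1) s s] by simp
qed

lemma c_equicont:
  assumes "x \<in> \<Omega>" "0 < e"
  obtains N where "open N" "x \<in> N" "\<And>z w. z \<in> N \<Longrightarrow> z \<in> \<Omega> \<Longrightarrow> w \<in> \<Omega>' \<Longrightarrow> \<bar>c z w - c x w\<bar> \<le> e"
proof -
  have x: "x \<in> closure \<Omega>" using assms(1) closure_subset by blast
  obtain N where N: "x \<in> N" "open N" "\<forall>z\<in>N \<inter> closure \<Omega>. \<forall>w\<in>closure \<Omega>'. dist (case (z, w) of (x, x') \<Rightarrow> c x x') (case (x, w) of (x, x') \<Rightarrow> c x x') \<le> e"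
    by (rule continuous_on_prod_compactE[OF ccont F.doms(4) x assms(2)])
  show ?thesis
  proof (rule that[OF N(2,1)])
    fix z w assume "z \<in> N" "z \<in> \<Omega>" "w \<in> \<Omega>'"
    then have "z \<in> N \<inter> closure \<Omega>" "w \<in> closure \<Omega>'" using closure_subset by blast+
    from N(3)[rule_format, OF this] show "\<bar>c z w - c x w\<bar> \<le> e" by (simp add: dist_real_def)
  qed
qed

lemma support_obtains:
  assumes "c_convex_fun \<Omega> \<Omega>' c u" "x \<in> \<Omega>"
  obtains w where "w \<in> \<Omega>'" "\<And>z. z \<in> \<Omega> \<Longrightarrow> u x - c z w + c x w \<le> u z"
proof -
  obtain w m where w: "w \<in> \<Omega>'" "c_function \<Omega> c w m" "supporting \<Omega> u x m"
    using assms unfolding c_convex_fun_def by blast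
  obtain a where a: "\<And>z. z \<in> \<Omega> \<Longrightarrow> m z = - c z w + a" using w(2) unfolding c_function_def by blast
  show ?thesis
  proof (rule that[OF w(1)])
    fix z assume "z \<in> \<Omega>"
    then show "u x - c z w + c x w \<le> u z" using w(3) a[of z] a[OF assms(2)] unfolding supporting_def by auto
  qed
qed

text \<open>Near x all c-functions change by at most e / 2, uniformly in the focus by compactness of
  the closure of the target. The support at x bounds u z from below and the support at z bounds u x
  from below.\<close>

lemma c_convex_continuous:
  assumes u: "c_convex_fun \<Omega> \<Omega>' c u"
  shows "continuous_on \<Omega> u"
  unfolding continuous_on_def
proof
  fix x assume x: "x \<in> \<Omega>"
  show "(u \<longlongrightarrow> u x) (at x within \<Omega>)"
  proof (rule tendstoI)
    fix e :: real assume e: "0 < e"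
    then have "0 < e / 2" by simp
    from c_equicont[OF x this] obtain N where N: "open N" "x \<in> N" "\<And>z w. z \<in> N \<Longrightarrow> z \<in> \<Omega> \<Longrightarrow> w \<in> \<Omega>' \<Longrightarrow> \<bar>c z w - c x w\<bar> \<le> e / 2"
      by metis
    obtain w where w: "w \<in> \<Omega>'" "\<And>z. z \<in> \<Omega> \<Longrightarrow> u x - c z w + c x w \<le> u z" by (rule support_obtains[OF u x], rule that)
    have "dist (u z) (u x) < e" if z: "z \<in> N" "z \<in> \<Omega>" for z
    proof -
      obtain w' where w': "w' \<in> \<Omega>'" "\<And>y. y \<in> \<Omega> \<Longrightarrow> u z - c y w' + c z w' \<le> u y" by (rule support_obtains[OF u z(2)], rule that)
      have "c z w - c x w \<le> e / 2" "- (c z w' - c x w') \<le> e / 2"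
        using abs_le_D1[OF N(3)[OF z w(1)]] abs_le_D2[OF N(3)[OF z w'(1)]] by simp_all
      then have "u z - u x < e" "u x - u z < e" using w(2)[OF z(2)] w'(2)[OF x] e by linarith+
      then show ?thesis by (simp add: dist_real_def abs_less_iff)
    qed
    then show "\<forall>\<^sub>F z in at x within \<Omega>. dist (u z) (u x) < e"
      unfolding eventually_at_topological using N by blast
  qed
qed

lemma c_cont_x: "w \<in> \<Omega>' \<Longrightarrow> continuous_on \<Omega> (\<lambda>x. c x w)"
proof -
  assume w: "w \<in> \<Omega>'"
  have "continuous_on \<Omega> (\<lambda>x. case (x, w) of (x, x') \<Rightarrow> c x x')"
    by (rule continuous_on_compose2[OF ccont])
      (use subsetD[OF closure_subset w] closure_subset[of \<Omega>] in \<open>auto intro!: continuous_intros\<close>)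
  then show ?thesis by simp
qed

lemma subdiffI:
  assumes "x \<in> A" "w \<in> \<Omega>'" "\<And>z. z \<in> \<Omega> \<Longrightarrow> u x - c z w + c x w \<le> u z"
  shows "w \<in> subdiff u A"
proof -
  have "c_function \<Omega> c w (\<lambda>z. u x - c z w + c x w)" unfolding c_function_def by (rule exI[of _ "u x + c x w"]) simp
  moreover have "supporting \<Omega> u x (\<lambda>z. u x - c z w + c x w)" unfolding supporting_def using assms(3) by simp
  ultimately show ?thesis unfolding c_subdiff_def using assms(1,2) by blast
qed

lemma subdiffE:
  assumes "w \<in> subdiff u A" "A \<subseteq> \<Omega>"
  obtains x where "x \<in> A" "w \<in> \<Omega>'" "\<And>z. z \<in> \<Omega> \<Longrightarrow> u x - c z w + c x w \<le> u z"
proof -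
  obtain x m where x: "x \<in> A" "w \<in> \<Omega>'" "c_function \<Omega> c w m" "supporting \<Omega> u x m"
    using assms unfolding c_subdiff_def by blast
  obtain a where a: "\<And>z. z \<in> \<Omega> \<Longrightarrow> m z = - c z w + a" using x(3) unfolding c_function_def by blast
  show ?thesis
  proof (rule that[OF x(1,2)])
    fix z assume z: "z \<in> \<Omega>"
    have "x \<in> \<Omega>" using x(1) assms(2) by blast
    then show "u x - c z w + c x w \<le> u z" using x(4) a[OF z] a[of x] z unfolding supporting_def by auto
  qed
qed

text \<open>Quantitative quasiconvexity propagates negativity of \<open>u - m\<close> backwards along a \<open>c\<close>-segment
  ending at a contact point, so that a local support is a global one.\<close>

lemma local_support_global:
  assumes u: "c_convex_fun \<Omega> \<Omega>' c u" and w: "w \<in> \<Omega>'" and x1: "x1 \<in> \<Omega>" and U: "open U" "x1 \<in> U" "U \<subseteq> \<Omega>"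
    and loc: "\<And>x. x \<in> U \<Longrightarrow> u x1 - c x w + c x1 w \<le> u x" and z: "z \<in> \<Omega>"
  shows "u x1 - c z w + c x1 w \<le> u z"
proof (rule ccontr)
  assume neg: "\<not> ?thesis"
  define f where "f x = u x - (u x1 - c x w + c x1 w)" for x
  \<comment> \<open>M0 * t = 1/2, so each step along the segment loses at most half of a negative
    value and its sign survives.\<close>
  define t where "t = 1 / (2 * M0)"
  have t: "0 < t" "t \<le> 1/2" "M0 * t = 1/2" using M0 by (auto simp: t_def field_simps)
  \<comment> \<open>Points on the segment from z to x1 in momentum coordinates; every step covers
    the fraction t of the remaining way, so p k tends to the momentum of the contact point
    x1.\<close>
  define p where "p k = pm w x1 + (1 - t) ^ k *\<^sub>R (pm w z - pm w x1)" for k :: nat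
  have t1: "0 \<le> (1 - t) ^ k" "(1 - t) ^ k \<le> 1" for k using t by (auto intro: power_le_one)
  have pin: "p k \<in> pm w ` \<Omega>" for k
  proof -
    have "(1 - (1 - t) ^ k) *\<^sub>R pm w x1 + (1 - t) ^ k *\<^sub>R pm w z \<in> pm w ` \<Omega>"
      using pm_convex[OF w] t1[of k] x1 z unfolding convex_alt by blast
    then show ?thesis by (simp add: p_def algebra_simps)
  qed
  define a where "a k = the_inv_into \<Omega> (pm w) (p k)" for k
  have a: "a k \<in> \<Omega>" "pm w (a k) = p k" for k
    using the_inv_into_into[OF pm_inj[OF w] pin] f_the_inv_into_f[OF pm_inj[OF w] pin] by (auto simp: a_def)
  have fneg: "f (a k) < 0" for k
  proof (induction k)
    case 0
    have "a 0 = z" unfolding a_def p_def using the_inv_into_f_f[OF pm_inj[OF w] z] by simp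
    then show ?case using neg by (simp add: f_def)
  next
    case (Suc k)
    obtain w' where w': "w' \<in> \<Omega>'" "\<And>y. y \<in> \<Omega> \<Longrightarrow> u (a (Suc k)) - c y w' + c (a (Suc k)) w' \<le> u y"
      by (rule support_obtains[OF u a(1)[of "Suc k"]], rule that)
    have seg: "pm w (a (Suc k)) = (1 - t) *\<^sub>R pm w (a k) + t *\<^sub>R pm w x1"
      by (simp add: a(2) p_def algebra_simps)
    \<comment> \<open>The support of u at a (k + 1) minus the candidate: it lies below f, agrees
      with f at a (k + 1), and is a difference of c-functions to which (QQConv) applies.\<close>
    define g where "g y = u (a (Suc k)) - c y w' + c (a (Suc k)) w' - (u x1 - c y w + c x1 w)" for y
    have gf: "g y \<le> f y" if "y \<in> \<Omega>" for y using w'(2)[OF that] by (simp add: g_def f_def)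
    have "g (a (Suc k)) - g (a k) \<le> M0 * t * max 0 (g x1 - g (a k))"
    proof -
      have e1: "g (a (Suc k)) - g (a k) = - c (a (Suc k)) w' + c (a k) w' - (- c (a (Suc k)) w + c (a k) w)" by (simp add: g_def)
      have e2: "g x1 - g (a k) = - c x1 w' + c (a k) w' - (- c x1 w + c (a k) w)" by (simp add: g_def)
      show ?thesis unfolding e1 e2 by (rule qq2[OF a(1) x1 a(1) w'(1) w _ seg]) (use t in auto)
    qed
    moreover have "g x1 \<le> 0" using gf[OF x1] by (simp add: f_def)
    moreover have gk: "g (a k) < 0" using gf[OF a(1)[of k]] Suc.IH by linarith
    ultimately have "g (a (Suc k)) - g (a k) \<le> 1/2 * max 0 (g x1 - g (a k))" "max 0 (g x1 - g (a k)) \<le> - g (a k)"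
      unfolding t(3) by simp_all
    moreover have "d < 0" if "d - e \<le> 1/2 * T" "T \<le> - e" "e < 0" for d e T :: real using that by linarith
    ultimately have "g (a (Suc k)) < 0" using gk by blast
    then show ?case by (simp add: g_def f_def)
  qed
  have "open (pm w ` U)" by (rule F.A.inj_open_map[OF pm_cont[OF w] pm_inj[OF w] U(1,3)])
  moreover have "p \<longlonglongrightarrow> pm w x1"
  proof -
    have "(\<lambda>k. (1 - t) ^ k) \<longlonglongrightarrow> 0" by (rule LIMSEQ_realpow_zero) (use t in auto)
    then have "p \<longlonglongrightarrow> pm w x1 + 0 *\<^sub>R (pm w z - pm w x1)" unfolding p_def by (rule tendsto_add[OF tendsto_const tendsto_scaleR[OF _ tendsto_const]])
    then show ?thesis by simp
  qed
  ultimately have "\<forall>\<^sub>F k in sequentially. p k \<in> pm w ` U" using U(2) by (intro topological_tendstoD) auto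
  then obtain k where "p k \<in> pm w ` U" by (metis eventually_sequentially order_refl)
  then obtain y where y: "p k = pm w y" "y \<in> U" by blast
  have "y = a k" using inj_onD[OF pm_inj[OF w], of y "a k"] a[of k] y U(3) by auto
  then show False using fneg[of k] loc[OF y(2)] by (simp add: f_def)
qed

end

section \<open>Sections of a c-convex function\<close>

locale ot_section = ot_cost M M' \<Omega> \<Omega>' c X' M0
  for M :: "('m::{t2_space,second_countable_topology}, 'n::finite) rmfd"
    and M' :: "('k::{t2_space,second_countable_topology}, 'n) rmfd"
    and \<Omega> :: "'m set" and \<Omega>' :: "'k set" and c :: "'m \<Rightarrow> 'k \<Rightarrow> real" and X' :: "'k set" and M0 :: real +
  fixes u m :: "'m \<Rightarrow> real" and xb :: 'k and S :: "'m set" and x0 :: 'm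
  assumes u: "c_convex_fun \<Omega> \<Omega>' c u" and xb: "xb \<in> \<Omega>'" and m: "c_function \<Omega> c xb m"
    and S: "S = {x\<in>\<Omega>. u x \<le> m x}" and Sc: "compactly_contained S \<Omega>" and x0: "x0 \<in> interior S"
begin

lemma m_diff: "x \<in> \<Omega> \<Longrightarrow> y \<in> \<Omega> \<Longrightarrow> m x - m y = - c x xb + c y xb"
  using m unfolding c_function_def by auto

lemma u_cont: "continuous_on \<Omega> u" by (rule c_convex_continuous[OF u])

lemma m_cont: "continuous_on \<Omega> m"
proof -
  obtain a where a: "\<And>x. x \<in> \<Omega> \<Longrightarrow> m x = - c x xb + a" using m unfolding c_function_def by blast
  have "continuous_on \<Omega> (\<lambda>x. - c x xb + a)" by (intro continuous_intros c_cont_x xb)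
  then show ?thesis by (rule continuous_on_eq) (simp add: a)
qed

lemma S_sub: "S \<subseteq> \<Omega>" using S by blast

lemma S_compact: "compact S"
proof -
  have cl: "compact (closure S)" "closure S \<subseteq> \<Omega>" using Sc interior_subset unfolding compactly_contained_def by blast+
  have "closed (closure S \<inter> S)"
  proof -
    have "closedin (top_of_set (closure S)) {x \<in> closure S. u x - m x \<in> {..0}}"
      by (rule continuous_closedin_preimage[OF _ closed_atMost, simplified vimage_def Collect_conj_eq[symmetric] Int_def mem_Collect_eq])
        (intro continuous_on_diff continuous_on_subset[OF u_cont cl(2)] continuous_on_subset[OF m_cont cl(2)])
    moreover have "{x \<in> closure S. u x - m x \<in> {..0}} = closure S \<inter> S" using cl(2) S by auto
    ultimately show ?thesis using closedin_closed_trans[of "closure S" "closure S \<inter> S"] closed_closure by metis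
  qed
  then have "closed S" by (simp add: Int_absorb1 closure_subset)
  then show ?thesis using cl(1) by simp
qed

lemma x0_in: "x0 \<in> S" "x0 \<in> \<Omega>"
  using x0 interior_subset S_sub by blast+

text \<open>For z on the segment, the support of u at z minus m is a difference of c-functions and
  so is bounded at z by its larger end value. At the ends it is at most u - m \<le> 0, and at z it
  equals u - m.\<close>

lemma section_convex: "convex (pm xb ` S)"
  unfolding convex_alt
proof (intro ballI allI impI)
  fix p q :: "real^'n" and t :: real assume "p \<in> pm xb ` S" "q \<in> pm xb ` S" and t: "0 \<le> t \<and> t \<le> 1"
  then obtain x y where x: "p = pm xb x" "x \<in> S" and y: "q = pm xb y" "y \<in> S" by blast
  have xy: "x \<in> \<Omega>" "y \<in> \<Omega>" using x y S_sub by auto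
  have "(1 - t) *\<^sub>R p + t *\<^sub>R q \<in> pm xb ` \<Omega>"
    using pm_convex[OF xb] t x y xy unfolding convex_alt by blast
  then obtain z where z: "pm xb z = (1 - t) *\<^sub>R pm xb x + t *\<^sub>R pm xb y" "z \<in> \<Omega>" using x y by auto
  obtain w where w: "w \<in> \<Omega>'" "\<And>y. y \<in> \<Omega> \<Longrightarrow> u z - c y w + c z w \<le> u y" by (rule support_obtains[OF u z(2)], rule that)
  define g where "g y = u z - c y w + c z w - m y" for y
  have g0: "g x \<le> 0" "g y \<le> 0" using w(2)[OF xy(1)] w(2)[OF xy(2)] x(2) y(2) by (auto simp: g_def S)
  have step: "g z \<le> g a" if "g b \<le> g a" "a \<in> \<Omega>" "b \<in> \<Omega>" "s \<in> {0..1}" "pm xb z = (1 - s) *\<^sub>R pm xb a + s *\<^sub>R pm xb b" for a b s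
    using qq2[OF that(2,3) z(2) w(1) xb that(4,5)] m_diff[OF z(2) that(2)] m_diff[OF that(3,2)] that(1) by (simp add: g_def)
  have "g z \<le> max (g x) (g y)"
    using step[OF _ xy _ z(1)] step[OF _ xy(2,1), of "1 - t"] z(1) t by (cases "g y \<le> g x") (auto simp: add.commute)
  then have zS: "z \<in> S" using g0 z(2) by (simp add: g_def S)
  show "(1 - t) *\<^sub>R p + t *\<^sub>R q \<in> pm xb ` S" using z(1) zS x(1) y(1) by (intro image_eqI[of _ "pm xb" z]) simp_all
qed

text \<open>By \<open>le\<close> the c-function with focus w through (x0, u x0) is at most m on S.
  Lowering it until it touches u from below on S gives a contact point in the open set u < m, hence
  a local support, which \<open>local_support_global\<close> makes global.\<close>

lemma subdiff_contains:
  assumes h: "u x0 < m x0" and w: "w \<in> \<Omega>'"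
    and le: "\<And>x. x \<in> S \<Longrightarrow> (- c x w + c x xb) - (- c x0 w + c x0 xb) \<le> m x0 - u x0"
  shows "w \<in> subdiff u S"
proof -
  define f where "f x = u x - (u x0 - c x w + c x0 w)" for x
  have cf: "continuous_on S f"
    unfolding f_def by (intro continuous_intros continuous_on_subset[OF u_cont S_sub] continuous_on_subset[OF c_cont_x[OF w] S_sub])
  have "S \<noteq> {}" using x0_in by blast
  from continuous_attains_inf[OF S_compact this cf] obtain x2 where x2: "x2 \<in> S" "\<And>x. x \<in> S \<Longrightarrow> f x2 \<le> f x" by blast
  have fx0: "f x0 = 0" by (simp add: f_def)
  \<comment> \<open>If the minimum is not negative, x0 itself is a contact point. Otherwise u at x2
    is strictly below a function that is at most m there, so u < m in both cases.\<close>
  define x1 where "x1 = (if f x2 < 0 then x2 else x0)"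
  have x1: "x1 \<in> S" "\<And>x. x \<in> S \<Longrightarrow> f x1 \<le> f x" "u x1 < m x1"
  proof -
    show "x1 \<in> S" using x2(1) x0_in by (simp add: x1_def)
    show "f x1 \<le> f x" if "x \<in> S" for x using x2(2)[OF that] fx0 by (auto simp: x1_def)
    have "u x2 < m x2" if "f x2 < 0"
      using le[OF x2(1)] that m_diff[of x2 x0] x2(1) S_sub x0_in by (auto simp: f_def)
    then show "u x1 < m x1" using h by (simp add: x1_def)
  qed
  have x1': "x1 \<in> \<Omega>" using x1(1) S_sub by blast
  define U where "U = (\<lambda>x. u x - m x) -` {..<0} \<inter> \<Omega>"
  have "open U"
    unfolding U_def by (rule iffD1[OF continuous_on_open_vimage[OF F.doms(1)], rule_format, OF continuous_on_diff[OF u_cont m_cont] open_lessThan])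
  moreover have "x1 \<in> U" "U \<subseteq> \<Omega>" using x1(3) x1' by (auto simp: U_def)
  moreover have "u x1 - c x w + c x1 w \<le> u x" if "x \<in> U" for x
  proof -
    have "x \<in> S" using that by (auto simp: U_def S)
    from x1(2)[OF this] show ?thesis by (simp add: f_def)
  qed
  ultimately have "u x1 - c z w + c x1 w \<le> u z" if "z \<in> \<Omega>" for z
    by (intro local_support_global[OF u w x1' _ _ _ _ that])
  then show ?thesis by (rule subdiffI[OF x1(1) w])
qed

text \<open>The support of u at x exceeds m at x, where u > m, but is at most u \<le> m on S and at
  most u at x0. Comparing these values gives both inequalities.\<close>

lemma outside_support:
  assumes "x \<in> \<Omega>" "x \<notin> S"
  obtains w where "w \<in> \<Omega>'" "\<And>y. y \<in> S \<Longrightarrow> (- c y w + c y xb) - (- c x w + c x xb) \<le> 0"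
    "(- c x0 w + c x0 xb) - (- c x w + c x xb) \<le> - (m x0 - u x0)"
proof -
  obtain w where w: "w \<in> \<Omega>'" "\<And>y. y \<in> \<Omega> \<Longrightarrow> u x - c y w + c x w \<le> u y" by (rule support_obtains[OF u assms(1)], rule that)
  have ux: "m x < u x" using assms by (auto simp: S)
  show ?thesis
  proof (rule that[OF w(1)])
    fix y assume y: "y \<in> S"
    then have y': "y \<in> \<Omega>" "u y \<le> m y" by (auto simp: S)
    then show "(- c y w + c y xb) - (- c x w + c x xb) \<le> 0" using w(2)[OF y'(1)] m_diff[OF y'(1) assms(1)] ux by linarith
  next
    show "(- c x0 w + c x0 xb) - (- c x w + c x xb) \<le> - (m x0 - u x0)"
      using w(2)[OF x0_in(2)] m_diff[OF x0_in(2) assms(1)] ux by linarith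
  qed
qed

lemma subdiff_sub: "subdiff u S \<subseteq> \<Omega>'"
  unfolding c_subdiff_def by blast

text \<open>Its complement in \<Omega>' is open: if w belongs to no x in S, some z violates the
  support inequality strictly, and it still does so near (x, w); compactness of S leaves finitely
  many neighbourhoods to intersect.\<close>

lemma subdiff_borel: "subdiff u S \<in> sets borel"
proof -
  have "open (\<Omega>' - subdiff u S)"
  proof (subst open_subopen)
    show "\<forall>w\<in>\<Omega>' - subdiff u S. \<exists>T. open T \<and> w \<in> T \<and> T \<subseteq> \<Omega>' - subdiff u S"
    proof
      fix w assume w: "w \<in> \<Omega>' - subdiff u S"
      define d where "d p z = u (fst p) - c z (snd p) + c (fst p) (snd p) - u z" for p z
      have cont: "continuous_on (\<Omega> \<times> \<Omega>') (\<lambda>p. d p z)" if z: "z \<in> \<Omega>" for z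
      proof -
        have cz: "continuous_on (\<Omega> \<times> \<Omega>') (\<lambda>p. case (g p, snd p) of (x, x') \<Rightarrow> c x x')"
          if "continuous_on (\<Omega> \<times> \<Omega>') g" "\<And>p. p \<in> \<Omega> \<times> \<Omega>' \<Longrightarrow> g p \<in> \<Omega>" for g
          by (rule continuous_on_compose2[OF ccont continuous_on_Pair[OF that(1) continuous_on_snd[OF continuous_on_id]]])
            (use that(2) closure_subset[of \<Omega>] closure_subset[of \<Omega>'] in \<open>auto simp: subset_iff\<close>)
        have "continuous_on (\<Omega> \<times> \<Omega>') (\<lambda>p. u (fst p))"
          by (rule continuous_on_compose2[OF u_cont continuous_on_fst[OF continuous_on_id]]) auto
        then have "continuous_on (\<Omega> \<times> \<Omega>') (\<lambda>p. u (fst p) - (case (z, snd p) of (x, x') \<Rightarrow> c x x') + (case (fst p, snd p) of (x, x') \<Rightarrow> c x x') - u z)"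
          by (intro continuous_intros cz) (use z in auto)
        then show ?thesis by (simp add: d_def case_prod_unfold)
      qed
      define good where "good x N N' \<longleftrightarrow> open N \<and> open N' \<and> x \<in> N \<and> w \<in> N' \<and> (\<forall>y\<in>N. \<forall>w'\<in>N'. y \<in> \<Omega> \<longrightarrow> w' \<in> \<Omega>' \<longrightarrow> (\<exists>z\<in>\<Omega>. 0 < d (y, w') z))" for x N N'
      have "\<exists>NN. good x (fst NN) (snd NN)" if x: "x \<in> S" for x
      proof -
        obtain z where z: "z \<in> \<Omega>" "0 < d (x, w) z"
        proof -
          have "\<not> (\<forall>z\<in>\<Omega>. u x - c z w + c x w \<le> u z)" using subdiffI[OF x, of w u] w by blast
          then obtain z where "z \<in> \<Omega>" "u z < u x - c z w + c x w" by (auto simp: not_le)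
          then show thesis by (intro that[of z]) (simp_all add: d_def)
        qed
        have xw: "x \<in> \<Omega>" "w \<in> \<Omega>'" using x S_sub w by auto
        obtain N N' where "open N" "open N'" "x \<in> N" "w \<in> N'" "\<And>y w'. y \<in> N \<Longrightarrow> w' \<in> N' \<Longrightarrow> y \<in> \<Omega> \<Longrightarrow> w' \<in> \<Omega>' \<Longrightarrow> d (y, w') z \<in> {0<..}"
          by (rule continuous_on_prod_nbhd[OF cont[OF z(1)] xw, of "{0<..}"]) (simp, simp add: z(2), rule that)
        then show ?thesis using z(1) unfolding good_def by (intro exI[of _ "(N, N')"]) auto
      qed
      then have "\<exists>NN. \<forall>x\<in>S. good x (fst (NN x)) (snd (NN x))" by (intro bchoice ballI)
      then obtain NN where NN: "\<forall>x\<in>S. good x (fst (NN x)) (snd (NN x))" by (rule exE)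
      define N where "N x = fst (NN x)" for x
      define N' where "N' x = snd (NN x)" for x
      have gd: "good x (N x) (N' x)" if "x \<in> S" for x unfolding N_def N'_def using NN that by (rule bspec)
      have N: "open (N x)" "open (N' x)" "x \<in> N x" "w \<in> N' x" if "x \<in> S" for x
        by (rule gd[OF that, unfolded good_def, THEN conjunct1] gd[OF that, unfolded good_def, THEN conjunct2, THEN conjunct1]
          gd[OF that, unfolded good_def, THEN conjunct2, THEN conjunct2, THEN conjunct1]
          gd[OF that, unfolded good_def, THEN conjunct2, THEN conjunct2, THEN conjunct2, THEN conjunct1])+
      have N5: "\<exists>z\<in>\<Omega>. 0 < d (y, w') z" if "x \<in> S" "y \<in> N x" "w' \<in> N' x" "y \<in> \<Omega>" "w' \<in> \<Omega>'" for x y w'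
      proof -
        have "\<forall>y\<in>N x. \<forall>w'\<in>N' x. y \<in> \<Omega> \<longrightarrow> w' \<in> \<Omega>' \<longrightarrow> (\<exists>z\<in>\<Omega>. 0 < d (y, w') z)"
          by (rule gd[OF that(1), unfolded good_def, THEN conjunct2, THEN conjunct2, THEN conjunct2, THEN conjunct2])
        from this[rule_format, OF that(2-)] show ?thesis .
      qed
      obtain C where C: "C \<subseteq> S" "finite C" "S \<subseteq> (\<Union>x\<in>C. N x)"
      proof (rule compactE_image[OF S_compact])
        show "open (N x)" if "x \<in> S" for x using N(1) that .
        show "S \<subseteq> (\<Union>x\<in>S. N x)" using N(3) by blast
      qed
      let ?T = "(\<Inter>x\<in>C. N' x) \<inter> \<Omega>'"
      have "open ?T" using C N(2) F.doms(2) by (intro open_Int open_INT) auto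
      moreover have "w \<in> ?T" using C(1) N(4) w by auto
      moreover have "?T \<subseteq> \<Omega>' - subdiff u S"
      proof
        fix w' assume w': "w' \<in> ?T"
        have "w' \<notin> subdiff u S"
        proof
          assume w'S: "w' \<in> subdiff u S"
          obtain y where y: "y \<in> S" "w' \<in> \<Omega>'" "\<And>z. z \<in> \<Omega> \<Longrightarrow> u y - c z w' + c y w' \<le> u z"
            by (rule subdiffE[OF w'S S_sub], rule that)
          obtain x where x: "x \<in> C" "y \<in> N x" using C(3) y(1) by blast
          have "\<exists>z\<in>\<Omega>. 0 < d (y, w') z" by (rule N5[of x]) (use x C(1) w' y S_sub in auto)
          then obtain z where z: "z \<in> \<Omega>" "0 < d (y, w') z" by (rule bexE)
          show False using y(3)[OF z(1)] z(2) by (simp add: d_def)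
        qed
        then show "w' \<in> \<Omega>' - subdiff u S" using w' by blast
      qed
      ultimately show "\<exists>T. open T \<and> w \<in> T \<and> T \<subseteq> \<Omega>' - subdiff u S" by blast
    qed
  qed
  then have "\<Omega>' - (\<Omega>' - subdiff u S) \<in> sets borel" by (rule sets.Diff[OF borel_open[OF F.doms(2)] borel_open])
  moreover have "\<Omega>' - (\<Omega>' - subdiff u S) = subdiff u S" using subdiff_sub by blast
  ultimately show ?thesis by (simp only:)
qed

end

section \<open>Coordinates adapted to a section\<close>

text \<open>Leibniz formula with entries bounded by B; the factorial is crude but depends on n
  only.\<close>

lemma det_le_fact:
  fixes A :: "real^'n::finite^'n"
  assumes A: "\<And>v. norm (A *v v) \<le> B * norm v" and B: "0 \<le> B"
  shows "\<bar>det A\<bar> \<le> fact CARD('n) * B ^ CARD('n)"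
proof -
  have e: "\<bar>A $ i $ j\<bar> \<le> B" for i j
  proof -
    have "\<bar>A $ i $ j\<bar> = \<bar>(A *v axis j 1) $ i\<bar>" by (simp add: matrix_vector_mult_basis column_def)
    also have "\<dots> \<le> norm (A *v axis j 1)" by (rule component_le_norm_cart)
    also have "\<dots> \<le> B * norm (axis j 1 :: real^'n)" by (rule A)
    finally show ?thesis by simp
  qed
  have "\<bar>det A\<bar> \<le> (\<Sum>p\<in>{p. p permutes (UNIV::'n set)}. \<bar>of_int (sign p) * (\<Prod>i\<in>UNIV. A $ i $ p i)\<bar>)"
    unfolding det_def by (rule sum_abs)
  also have "\<dots> \<le> (\<Sum>p\<in>{p. p permutes (UNIV::'n set)}. B ^ CARD('n))"
  proof (rule sum_mono)
    fix p :: "'n \<Rightarrow> 'n"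
    have "\<bar>of_int (sign p) * (\<Prod>i\<in>UNIV. A $ i $ p i)\<bar> = (\<Prod>i\<in>UNIV. \<bar>A $ i $ p i\<bar>)"
      by (simp add: abs_mult sign_def abs_prod)
    also have "\<dots> \<le> (\<Prod>i\<in>(UNIV::'n set). B)" by (intro prod_mono) (simp add: e)
    finally show "\<bar>of_int (sign p) * (\<Prod>i\<in>UNIV. A $ i $ p i)\<bar> \<le> B ^ CARD('n)" by simp
  qed
  also have "\<dots> = fact CARD('n) * B ^ CARD('n)" by (simp add: card_permutations[OF refl])
  finally show ?thesis .
qed

section \<open>Charts with uniform geometry over a compact set\<close>

context rmanifold
begin

text \<open>One constant B serves as reciprocal radius of a coordinate ball, for the comparison of
  the metric with the Euclidean norm and for the Christoffel symbols; the condition weakens as B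
  grows, as \<open>compact_local_bound\<close> requires.\<close>

definition uniform_at :: "'m set \<Rightarrow> real \<Rightarrow> 'm \<Rightarrow> ('m, 'n) chart \<Rightarrow> bool" where
  "uniform_at X B x ct \<longleftrightarrow> ct \<in> charts M \<and> x \<in> fst ct \<and> ball (snd ct x) (1 / B) \<subseteq> snd ct ` (fst ct \<inter> X) \<and>
    (\<forall>z\<in>ball (snd ct x) (1 / B). \<forall>v w. norm v \<le> B * nrm (Gm ct z) v \<and> nrm (Gm ct z) v \<le> B * norm v \<and>
       norm (Gam ct z v w) \<le> B * norm v * norm w)"

lemma uniform_charts:
  assumes K: "compact K" "K \<subseteq> X" and X: "open X"
  obtains B where "1 \<le> B" "\<And>x. x \<in> K \<Longrightarrow> \<exists>ct. uniform_at X B x ct"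
proof -
  let ?R = "\<lambda>B x (y :: 'm). 0 < B \<and> (\<exists>ct. uniform_at X B x ct)"
  have mono: "?R B' x y" if R: "?R B x y" and BB: "B \<le> B'" for B B' x y
  proof -
    obtain ct where k: "uniform_at X B x ct" using R by blast
    have B: "0 < B" "0 < B'" using R BB by auto
    have sub: "ball (snd ct x) (1 / B') \<subseteq> ball (snd ct x) (1 / B)"
      by (rule subset_ball) (use B BB in \<open>simp add: frac_le\<close>)
    have "uniform_at X B' x ct"
      unfolding uniform_at_def
    proof (intro conjI ballI allI)
      show "ct \<in> charts M" "x \<in> fst ct" using k unfolding uniform_at_def by simp_all
      show "ball (snd ct x) (1 / B') \<subseteq> snd ct ` (fst ct \<inter> X)" using k sub unfolding uniform_at_def by (meson subset_trans)
      then have sub': "ball (snd ct x) (1 / B') \<subseteq> snd ct ` fst ct" by blast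
      fix z v w assume z: "z \<in> ball (snd ct x) (1 / B')"
      then have z': "z \<in> ball (snd ct x) (1 / B)" using sub by blast
      have kk: "ct \<in> charts M" using k unfolding uniform_at_def by simp
      have n: "0 \<le> nrm (Gm ct z) v" by (rule nrm_nonneg[OF posdef_gram_in[OF kk chart_inv_in[OF kk]]]) (use z sub' in blast)
      have *: "norm v \<le> B * nrm (Gm ct z) v \<and> nrm (Gm ct z) v \<le> B * norm v \<and> norm (Gam ct z v w) \<le> B * norm v * norm w"
        using k z' unfolding uniform_at_def by simp
      show "norm v \<le> B' * nrm (Gm ct z) v" using * mult_right_mono[OF BB n] by linarith
      show "nrm (Gm ct z) v \<le> B' * norm v" using * mult_right_mono[OF BB norm_ge_zero[of v]] by linarith
      show "norm (Gam ct z v w) \<le> B' * norm v * norm w"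
        using * mult_right_mono[OF mult_right_mono[OF BB norm_ge_zero[of v]] norm_ge_zero[of w]] by linarith
    qed
    then show ?thesis using B by blast
  qed
  have loc: "\<exists>N N' B. open N \<and> open N' \<and> x0 \<in> N \<and> y0 \<in> N' \<and> (\<forall>x\<in>N. \<forall>y\<in>N'. ?R B x y)" if x0: "x0 \<in> K" for x0 and y0 :: 'm
  proof -
    let ?k = "chart_at M x0"
    note k = chart_at[of x0]
    obtain N5 l L where N5: "open N5" "x0 \<in> N5" "N5 \<subseteq> fst ?k" "0 < l" "0 < L"
      and lo: "\<And>x v. x \<in> N5 \<Longrightarrow> l * norm v \<le> nrm (gram_in M ?k x) v" and up: "\<And>x v. x \<in> N5 \<Longrightarrow> nrm (gram_in M ?k x) v \<le> L * norm v"
      by (rule gram_local_bounds[OF k], rule that)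
    obtain N4 C where N4: "open N4" "x0 \<in> N4" "N4 \<subseteq> fst ?k" "0 \<le> C"
      and gam: "\<And>x v w. x \<in> N4 \<Longrightarrow> norm (Gam ?k (snd ?k x) v w) \<le> C * norm v * norm w"
      by (rule Gam_local_bound[OF k], rule that)
    let ?O = "N5 \<inter> N4 \<inter> X"
    have "open (snd ?k ` (fst ?k \<inter> ?O))" by (rule chart_image_open[OF k(1)]) (intro open_Int N5 N4 X)
    moreover have "snd ?k x0 \<in> snd ?k ` (fst ?k \<inter> ?O)" using k N5 N4 x0 K by blast
    ultimately obtain r where r: "0 < r" "ball (snd ?k x0) r \<subseteq> snd ?k ` (fst ?k \<inter> ?O)"
      by (meson open_contains_ball)
    \<comment> \<open>The term 2 / r makes 1 / B \<le> r / 2, so balls of radius 1 / B around points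
      within r / 2 of the centre stay in the ball of radius r.\<close>
    define B where "B = 2 / r + 1 / l + L + C"
    have B0: "0 < B" using r(1) N5 N4 by (auto simp: B_def intro!: add_pos_nonneg)
    have B1: "2 / r \<le> B" "1 / l \<le> B" "L \<le> B" "C \<le> B" using r(1) N5 N4 by (auto simp: B_def)
    have Br: "1 / B \<le> r / 2"
    proof -
      have "1 / B \<le> 1 / (2 / r)" using B1(1) r(1) B0 by (intro divide_left_mono) auto
      then show ?thesis by simp
    qed
    let ?N = "chart_inv ?k ` ball (snd ?k x0) (r / 2)"
    have bs: "ball (snd ?k x0) (r / 2) \<subseteq> snd ?k ` fst ?k"
    proof -
      have "ball (snd ?k x0) (r / 2) \<subseteq> ball (snd ?k x0) r" by (rule subset_ball) (use r in auto)
      then show ?thesis using r(2) by blast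
    qed
    have "?R B x y" if xN: "x \<in> ?N" for x and y :: 'm
    proof -
      obtain z where z: "x = chart_inv ?k z" "z \<in> ball (snd ?k x0) (r / 2)" using xN by (rule imageE)
      have zi: "z \<in> snd ?k ` fst ?k" using z bs by blast
      have sx: "snd ?k x = z" unfolding z(1) by (rule chart_inv2[OF k(1) zi])
      have xf: "x \<in> fst ?k" unfolding z(1) by (rule chart_inv_in[OF k(1) zi])
      have sub: "ball (snd ?k x) (1 / B) \<subseteq> snd ?k ` (fst ?k \<inter> ?O)"
      proof -
        have "ball z (1 / B) \<subseteq> ball (snd ?k x0) r"
        proof
          fix a assume "a \<in> ball z (1 / B)"
          then have "dist z a < r / 2" "dist (snd ?k x0) z < r / 2" using Br z(2) by auto
          then show "a \<in> ball (snd ?k x0) r" using dist_triangle[of "snd ?k x0" a z] by simp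
        qed
        then show ?thesis unfolding sx using r(2) by blast
      qed
      have "uniform_at X B x ?k"
        unfolding uniform_at_def
      proof (intro conjI ballI allI)
        show "?k \<in> charts M" "x \<in> fst ?k" by (rule k xf)+
        show "ball (snd ?k x) (1 / B) \<subseteq> snd ?k ` (fst ?k \<inter> X)" using sub by blast
        fix a v w assume "a \<in> ball (snd ?k x) (1 / B)"
        then obtain b where b: "a = snd ?k b" "b \<in> fst ?k" "b \<in> N5" "b \<in> N4" using sub by blast
        have ci: "chart_inv ?k a = b" unfolding b(1) by (rule chart_inv1[OF k(1) b(2)])
        have n: "0 \<le> nrm (Gm ?k a) v" unfolding ci by (rule nrm_nonneg[OF posdef_gram_in[OF k(1) b(2)]])
        have "norm v \<le> 1 / l * nrm (Gm ?k a) v" using lo[OF b(3), of v] N5(4) by (simp add: ci field_simps)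
        then show "norm v \<le> B * nrm (Gm ?k a) v" using mult_right_mono[OF B1(2) n] by linarith
        show "nrm (Gm ?k a) v \<le> B * norm v"
          using up[OF b(3), of v] mult_right_mono[OF B1(3) norm_ge_zero[of v]] unfolding ci by linarith
        show "norm (Gam ?k a v w) \<le> B * norm v * norm w"
          using gam[OF b(4), of v w] mult_right_mono[OF mult_right_mono[OF B1(4) norm_ge_zero[of v]] norm_ge_zero[of w]] unfolding b(1) by linarith
      qed
      then show ?thesis using B0 by blast
    qed
    moreover have "open ?N" by (rule chart_inv_image_open[OF k(1) open_ball bs])
    moreover have "x0 \<in> ?N" using r(1) chart_inv1[OF k] by (intro image_eqI[of _ _ "snd ?k x0"]) auto
    ultimately show ?thesis by (intro exI[of _ ?N] exI[of _ UNIV] exI[of _ B] conjI ballI) simp_all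
  qed
  show thesis
  proof (cases "K = {}")
    case True
    then show ?thesis using that[of 1] by simp
  next
    case False
    obtain B where B: "0 \<le> B" "\<And>x y. x \<in> K \<Longrightarrow> y \<in> K \<Longrightarrow> ?R B x y"
      by (rule compact_local_bound[OF K(1) K(1), of ?R, OF loc mono], assumption+, rule that)
    show ?thesis
    proof (rule that[of "max 1 B"])
      fix x assume x: "x \<in> K"
      have "?R (max 1 B) x x" by (rule mono[OF B(2)[OF x x]]) simp
      then show "\<exists>ct. uniform_at X (max 1 B) x ct" by blast
    qed simp
  qed
qed

end

section \<open>Symmetry of the mixed derivative and normalised coordinates at the base point\<close>

context ot_cost
begin

text \<open>The two orders of differentiation come from separate assumptions on c;
  \<open>mixed_derivatives_eq\<close>, on the plane spanned by one axis of each variable, identifies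
  them.\<close>

lemma Hm_sym:
  assumes k: "ct \<in> charts M" "ct' \<in> charts M'" and y: "y \<in> F.Dom ct" and z: "z \<in> F.Dom' ct'"
  shows "R.Hm ct' ct z y = transpose (F.Hm ct ct' y z)"
proof -
  let ?f = "loc ct ct' c" and ?g = "loc ct' ct (flip c)"
  have fg: "?g z y = ?f y z" for y z by (simp add: loc_def flip_def)
  obtain r1 where r1: "r1 > 0" "ball y r1 \<subseteq> F.Dom ct" using F.Dom_open(1)[OF k(1)] y open_contains_ball by meson
  obtain r2 where r2: "r2 > 0" "ball z r2 \<subseteq> F.Dom' ct'" using F.Dom_open(2)[OF k(2)] z open_contains_ball by meson
  define r where "r = min r1 r2"
  have r: "r > 0" using r1 r2 by (simp add: r_def)
  have "pd1 i (pd2 j ?f) y z = pd1 j (pd2 i ?g) z y" for i j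
  proof -
    let ?y = "\<lambda>s. y + s *\<^sub>R axis i 1" and ?z = "\<lambda>t. z + t *\<^sub>R axis j 1"
    have iny: "?y s \<in> F.Dom ct" if "\<bar>s\<bar> < r" for s using that r1(2) by (auto simp: dist_norm subset_iff r_def)
    have inz: "?z s \<in> F.Dom' ct'" if "\<bar>s\<bar> < r" for s using that r2(2) by (auto simp: dist_norm subset_iff r_def)
    have "pd1 i (pd2 j ?f) (?y 0) (?z 0) = pd1 j (pd2 i ?g) (?z 0) (?y 0)"
    proof (rule mixed_derivatives_eq[where r = r and f = "\<lambda>s t. ?f (?y s) (?z t)" and ft = "\<lambda>s t. pd2 j ?f (?y s) (?z t)"
          and fs = "\<lambda>s t. pd2 i ?g (?z t) (?y s)" and fst = "\<lambda>s t. pd1 i (pd2 j ?f) (?y s) (?z t)"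
          and fts = "\<lambda>s t. pd1 j (pd2 i ?g) (?z t) (?y s)"])
      show "r > 0" by (rule r)
      have A: "isCont (\<lambda>x::real \<times> real. (?y (Product_Type.fst x), ?z (snd x))) (0, 0)" by (intro continuous_intros)
      have "isCont (\<lambda>p. F.Hm ct ct' (Product_Type.fst p) (snd p)) (y, z)"
        by (rule bspec[OF iffD1[OF continuous_on_eq_continuous_at[OF open_Times[OF F.Dom_open(1)[OF k(1)] F.Dom_open(2)[OF k(2)]]] F.Hm_cont[OF k]]])
          (rule SigmaI[OF y z])
      then have "isCont (\<lambda>p. F.Hm ct ct' (Product_Type.fst p) (snd p)) (?y (Product_Type.fst (0::real, 0::real)), ?z (snd (0::real, 0::real)))" by simp
      from isCont_o2[OF A this] have "isCont (\<lambda>x. F.Hm ct ct' (?y (Product_Type.fst x)) (?z (snd x)) $ j $ i) (0, 0)"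
        by (intro continuous_intros) simp
      then show "isCont (\<lambda>(s, t). pd1 i (pd2 j ?f) (?y s) (?z t)) (0, 0)" by (simp add: F.Hm_def case_prod_unfold)
      have A': "isCont (\<lambda>x::real \<times> real. (?z (snd x), ?y (Product_Type.fst x))) (0, 0)" by (intro continuous_intros)
      have "isCont (\<lambda>p. R.Hm ct' ct (Product_Type.fst p) (snd p)) (z, y)"
        by (rule bspec[OF iffD1[OF continuous_on_eq_continuous_at[OF open_Times[OF F.Dom_open(2)[OF k(2)] F.Dom_open(1)[OF k(1)]]] R.Hm_cont[OF k(2,1)]]])
          (rule SigmaI[OF z y])
      then have "isCont (\<lambda>p. R.Hm ct' ct (Product_Type.fst p) (snd p)) (?z (snd (0::real, 0::real)), ?y (Product_Type.fst (0::real, 0::real)))" by simp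
      from isCont_o2[OF A' this] have "isCont (\<lambda>x. R.Hm ct' ct (?z (snd x)) (?y (Product_Type.fst x)) $ i $ j) (0, 0)"
        by (intro continuous_intros) simp
      then show "isCont (\<lambda>(s, t). pd1 j (pd2 i ?g) (?z t) (?y s)) (0, 0)" by (simp add: R.Hm_def case_prod_unfold)
      fix s t :: real assume s: "\<bar>s\<bar> < r" and t: "\<bar>t\<bar> < r"
      show "((\<lambda>t. ?f (?y s) (?z t)) has_real_derivative pd2 j ?f (?y s) (?z t)) (at t)"
        unfolding pd2_def by (rule partial_line[OF F.C3D(1)[OF k iny[OF s] inz[OF t]]])
      show "((\<lambda>s. pd2 j ?f (?y s) (?z t)) has_real_derivative pd1 i (pd2 j ?f) (?y s) (?z t)) (at s)"
        unfolding pd1_def by (rule partial_line[OF F.C3D(2)[OF k iny[OF s] inz[OF t]]])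
      show "((\<lambda>s. ?f (?y s) (?z t)) has_real_derivative pd2 i ?g (?z t) (?y s)) (at s)"
        unfolding pd2_def fg[symmetric] by (rule partial_line[OF R.C3D(1)[OF k(2,1) inz[OF t] iny[OF s]]])
      show "((\<lambda>t. pd2 i ?g (?z t) (?y s)) has_real_derivative pd1 j (pd2 i ?g) (?z t) (?y s)) (at t)"
        unfolding pd1_def by (rule partial_line[OF R.C3D(2)[OF k(2,1) inz[OF t] iny[OF s]]])
    qed
    then show ?thesis by simp
  qed
  then show ?thesis by (simp add: R.Hm_def F.Hm_def vec_eq_iff transpose_def)
qed

end

text \<open>Orthonormal coordinates on \<open>T\<^sub>x M'\<close> and its dual at the base point \<open>xb\<close>, and a chart in
  which the geometry near \<open>xb\<close> is controlled by \<open>B\<close>.\<close>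

locale ot_coord = ot_cost M M' \<Omega> \<Omega>' c X' M0
  for M :: "('m::{t2_space,second_countable_topology}, 'n::finite) rmfd"
    and M' :: "('k::{t2_space,second_countable_topology}, 'n) rmfd"
    and \<Omega> :: "'m set" and \<Omega>' :: "'k set" and c :: "'m \<Rightarrow> 'k \<Rightarrow> real" and X' :: "'k set" and M0 :: real +
  fixes xb :: 'k and A0 Ai :: "real^'n^'n" and ct' :: "('k, 'n) chart" and B N K3 :: real
  assumes xb: "xb \<in> \<Omega>'" and ch: "chol (gram M' xb) A0 Ai" and B: "1 \<le> B" and uni: "F.B.uniform_at \<Omega>' B xb ct'"
    and N: "C3_half_norm M' M \<Omega>' \<Omega> (flip c) \<le> N" and NF: "C3_half_norm M M' \<Omega> \<Omega>' c \<le> N" and K3: "sup_norm M M' \<Omega> \<Omega>' c = K3"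
begin

definition "zb = snd ct' xb"
definition "kx x = chart_at M x"
definition "yx x = snd (chart_at M x) x"
definition "kb = chart_at M' xb"
definition "zc = snd kb xb"
text \<open>Carries orthonormal coordinates at xb to tangent vectors in the chart
  \<open>ct'\<close>, so that \<psi> has an isometry as its derivative at 0.\<close>

definition "Tm = tjac kb ct' zc ** Ai"
definition "\<psi> y = chart_inv ct' (zb + Tm *v y)"
definition "Dm x = R.Hm kb (kx x) zc (yx x)"
definition "qd x w = Dc M c x w"
text \<open>The covector difference is normalised by the inverse mixed derivative at xb; this makes
  the derivative of y |-> \<open>Qx x (\<psi> y)\<close> at 0 the identity for every x.\<close>

definition "Qx x w = A0 *v (matrix_inv (Dm x) *v (qd x w - qd x xb))"
text \<open>The momentum of x in orthonormal coordinates of the cotangent space at xb.\<close>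

definition "pt x = transpose Ai *v pm xb x"
definition "xi = the_inv_into \<Omega> pt"
definition "cb p w = - c (xi p) w + c (xi p) xb"

lemmas chD = cholD[OF ch]

lemma k': "ct' \<in> charts M'" "xb \<in> fst ct'" and ball_sub: "ball zb (1 / B) \<subseteq> F.Dom' ct'"
  and gB: "z \<in> ball zb (1 / B) \<Longrightarrow> norm v \<le> B * nrm (F.B.Gm ct' z) v" "z \<in> ball zb (1 / B) \<Longrightarrow> nrm (F.B.Gm ct' z) v \<le> B * norm v"
    "z \<in> ball zb (1 / B) \<Longrightarrow> norm (F.B.Gam ct' z v w) \<le> B * norm v * norm w"
  using uni unfolding F.B.uniform_at_def zb_def by simp_all

lemma kb: "kb \<in> charts M'" "xb \<in> fst kb" "zc \<in> F.Dom' kb"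
  using F.B.chart_at[of xb] xb by (auto simp: kb_def zc_def)

lemma kx: "kx x \<in> charts M" "x \<in> fst (kx x)" "x \<in> \<Omega> \<Longrightarrow> yx x \<in> F.Dom (kx x)" "yx x = snd (kx x) x"
  using F.A.chart_at[of x] by (auto simp: kx_def yx_def)

lemma A0i: "A0 *v (Ai *v v) = v" "Ai *v (A0 *v v) = v"
  by (simp_all add: matrix_vector_mul_assoc chD)

lemma Ait: "transpose A0 *v (transpose Ai *v p) = p" "transpose Ai *v (transpose A0 *v p) = p"
  by (simp_all add: matrix_vector_mul_assoc matrix_transpose_mul[symmetric] chD transpose_mat del: transpose_matrix_vector)

lemma DDinv:
  assumes "x' \<in> closure \<Omega>'" "x \<in> closure \<Omega>"
  shows "invertible (DDbar M' M \<Omega>' \<Omega> (flip c) x' x)"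
proof -
  have "invertible (- DDbar M' M \<Omega>' \<Omega> (flip c) x' x)" using nd assms unfolding nondeg_def mDbarD_def by simp
  then show ?thesis unfolding invertible_det_nz using det_minus_nz by fastforce
qed

lemma Dm_DD: "x \<in> \<Omega> \<Longrightarrow> DDbar M' M \<Omega>' \<Omega> (flip c) xb x = Dm x"
  unfolding Dm_def kb_def kx_def zc_def yx_def by (rule R.DDbar_interior[OF xb])

lemma Dm_det: "x \<in> \<Omega> \<Longrightarrow> det (Dm x) \<noteq> 0"
  using DDinv[of xb x] xb closure_subset[of \<Omega>] closure_subset[of \<Omega>'] Dm_DD[of x] by (auto simp: invertible_det_nz subset_iff)

lemma Dm_solve: "x \<in> \<Omega> \<Longrightarrow> Dm x *v (Ai *v Qx x w) = qd x w - qd x xb"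
  unfolding Qx_def A0i by (simp add: matrix_vector_mul_assoc matrix_inv_props[OF Dm_det])

text \<open>\<open>sup_norm\<close> bounds the inverse of the mixed derivative, and |A0 v| is the
  Riemannian length of v at xb. Testing against u avoids computing dual norms at each use.\<close>

lemma K3_bound:
  assumes x: "x \<in> \<Omega>" and le: "\<And>u. (Dm x *v v) \<bullet> u \<le> b * nrm (gram M x) u"
  shows "norm (A0 *v v) \<le> K3 * b"
proof -
  have "K3 = (SUP p\<in>closure \<Omega>' \<times> closure \<Omega>. opnorm (cogram M (snd p)) (gram M' (fst p)) (matrix_inv (- DDbar M' M \<Omega>' \<Omega> (flip c) (fst p) (snd p))))"
  proof -
    let ?f = "\<lambda>x x'. opnorm (cogram M x) (gram M' x') (matrix_inv (- DDbar M' M \<Omega>' \<Omega> (flip c) x' x))"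
    have "(\<lambda>p. ?f (snd p) (fst p)) ` (closure \<Omega>' \<times> closure \<Omega>) = (\<lambda>(x, x'). ?f x x') ` (closure \<Omega> \<times> closure \<Omega>')" by force
    then show ?thesis unfolding K3[symmetric] sup_norm_def Minv_def mDbarD_def by simp
  qed
  from R.inverse_bound(2)[OF DDinv this xb x kb(1) kx(1) kb(2) kx(2), of v b]
  have "nrm (gram_in M' kb xb) v \<le> K3 * b"
    using le unfolding Dm_def zc_def kx(4) by (simp add: kx_def F.A.gram_in_chart_at)
  then show ?thesis unfolding kb_def F.B.gram_in_chart_at chD(5) .
qed

lemma K3_nonneg: "0 \<le> K3"
proof -
  obtain x where x: "x \<in> \<Omega>" using F.doms by blast
  obtain v :: "real^'n" where v: "v \<noteq> 0" using ex_nonzero_vec by blast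
  have "\<exists>b\<ge>0. \<forall>u. (Dm x *v v) \<bullet> u \<le> b * nrm (gram M x) u"
    by (rule exI[of _ "nrm (matrix_inv (gram M x)) (Dm x *v v)"])
      (use dual_cauchy[OF F.A.posdef_gram] nrm_nonneg[OF posdef_inv[OF F.A.posdef_gram]] abs_le_D1 in blast)
  then obtain b where b: "b \<ge> 0" "\<And>u. (Dm x *v v) \<bullet> u \<le> b * nrm (gram M x) u" by blast
  have "A0 *v v \<noteq> 0" using v A0i(2)[of v] by (metis matrix_vector_mult_0_right)
  then have "0 < norm (A0 *v v)" by simp
  then have "0 < K3 * b" using K3_bound[OF x b(2)] by linarith
  then show ?thesis using b(1) by (simp add: zero_less_mult_iff)
qed

lemma N_nonneg: "0 \<le> N" using N R.half_norm_nonneg by linarith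

lemma Rform:
  assumes "x \<in> \<Omega>" "x' \<in> \<Omega>'"
  shows "R.form_bound N x' x" "F.form_bound N x x'"
  using R.form_bound_mono[OF R.half_norm_bound N] F.form_bound_mono[OF F.half_norm_bound NF] assms by blast+

lemma qd_q: "ct \<in> charts M' \<Longrightarrow> w \<in> fst ct \<Longrightarrow> qd x w = R.q ct (kx x) (snd ct w) (yx x)"
  unfolding qd_def kx_def yx_def using R.q_any[of ct w x] by simp

lemma qd_bound:
  assumes x: "x \<in> \<Omega>" and w: "w \<in> \<Omega>'"
  shows "\<bar>qd x w \<bullet> u\<bar> \<le> N * nrm (gram M x) u"
proof -
  let ?k = "chart_at M' w"
  note k = F.B.chart_at[of w]
  show ?thesis
    using Rform(1)[OF x w, unfolded R.form_bound_def, rule_format, OF k(1) kx(1) k(2) kx(2), of u]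
    unfolding qd_q[OF k] kx(4) by (simp add: kx_def F.A.gram_in_chart_at)
qed

lemma Q_bound:
  assumes x: "x \<in> \<Omega>" and w: "w \<in> \<Omega>'"
  shows "norm (Qx x w) \<le> K3 * (2 * N)"
proof -
  have "norm (A0 *v (Ai *v Qx x w)) \<le> K3 * (2 * N)"
  proof (rule K3_bound[OF x])
    fix u
    show "(Dm x *v (Ai *v Qx x w)) \<bullet> u \<le> 2 * N * nrm (gram M x) u"
      unfolding Dm_solve[OF x] using qd_bound[OF x w, of u] qd_bound[OF x xb, of u] by (simp add: inner_diff_left abs_le_iff)
  qed
  then show ?thesis by (simp add: A0i)
qed

lemma Tm_nrm: "nrm (gram_in M' ct' xb) (Tm *v y) = norm y"
proof -
  have "nrm (gram M' xb) (Ai *v y) = nrm (gram_in M' ct' xb) (tjac kb ct' zc *v (Ai *v y))"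
    using F.B.nrm_trans[OF kb(1) k'(1) kb(2) k'(2), of "Ai *v y"] unfolding zc_def[symmetric] by (simp add: kb_def F.B.gram_in_chart_at)
  then show ?thesis by (simp add: Tm_def matrix_vector_mul_assoc[symmetric] chD(5) A0i)
qed

lemma zb_ball: "zb \<in> ball zb (1 / B)" using B by simp

lemma Gm_zb: "F.B.Gm ct' zb = gram_in M' ct' xb"
  by (simp add: zb_def F.B.chart_inv1[OF k'])

lemma Tm_norm: "norm (Tm *v y) \<le> B * norm y"
  using gB(1)[OF zb_ball, of "Tm *v y"] unfolding Gm_zb Tm_nrm .

text \<open>|Tm y| \<le> B r \<le> 1 / (2 B).\<close>

lemma psi_ball:
  assumes "norm y \<le> r" "2 * B\<^sup>2 * r \<le> 1"
  shows "zb + Tm *v y \<in> ball zb (1 / B)"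
proof -
  have "2 * B * (B * norm y) \<le> 2 * B * (B * r)" using assms(1) B by (intro mult_left_mono) auto
  then have "2 * B * (B * norm y) \<le> 1" using assms(2) by (simp add: power2_eq_square)
  moreover have "2 * B * norm (Tm *v y) \<le> 2 * B * (B * norm y)" using B by (intro mult_left_mono Tm_norm) auto
  ultimately have "2 * (B * norm (Tm *v y)) \<le> 1" by linarith
  then have "B * norm (Tm *v y) < 1" by simp
  then show ?thesis using B by (simp add: dist_norm field_simps)
qed

lemma psi_in:
  assumes "norm y \<le> r" "2 * B\<^sup>2 * r \<le> 1"
  shows "\<psi> y \<in> \<Omega>'" "\<psi> y \<in> fst ct'" "snd ct' (\<psi> y) = zb + Tm *v y"
proof -
  obtain a where a: "zb + Tm *v y = snd ct' a" "a \<in> fst ct'" "a \<in> \<Omega>'" using psi_ball[OF assms] ball_sub by blast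
  have "\<psi> y = a" unfolding \<psi>_def a(1) by (rule F.B.chart_inv1[OF k'(1) a(2)])
  then show "\<psi> y \<in> \<Omega>'" "\<psi> y \<in> fst ct'" "snd ct' (\<psi> y) = zb + Tm *v y" using a by simp_all
qed

lemma psi_0: "\<psi> 0 = xb"
  by (simp add: \<psi>_def zb_def F.B.chart_inv1[OF k'])

text \<open>The ordinary Hessian in the chart is the covariant one plus a Christoffel term; each
  contributes N B^2.\<close>

lemma hess_bound:
  assumes x: "x \<in> \<Omega>" and z: "z \<in> ball zb (1 / B)"
  shows "\<bar>(F.B.hess (R.sc ct' (kx x) (yx x) u) z *v e) \<bullet> d\<bar> \<le> 2 * N * B\<^sup>2 * norm e * norm d * nrm (gram M x) u"
proof -
  have zD: "z \<in> F.Dom' ct'" using z ball_sub by blast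
  then obtain w where w: "z = snd ct' w" "w \<in> fst ct'" "w \<in> \<Omega>'" by blast
  have ci: "chart_inv ct' z = w" unfolding w(1) by (rule F.B.chart_inv1[OF k'(1) w(2)])
  let ?G = "nrm (F.B.Gm ct' z)" and ?g = "nrm (gram M x) u" and ?Gam = "F.B.Gam ct' z e d"
  have kk: "gram_in M (kx x) x = gram M x" by (simp add: kx_def F.A.gram_in_chart_at)
  note fb = Rform(1)[OF x w(3), unfolded R.form_bound_def, rule_format, OF k'(1) kx(1) w(2) kx(2), unfolded kk, folded kx(4) w(1)]
  have g0: "0 \<le> ?g" by (rule nrm_nonneg[OF F.A.posdef_gram])
  have G: "?G v \<le> B * norm v" for v using gB(2)[OF z] .
  have G0: "0 \<le> ?G v" for v unfolding ci by (rule nrm_nonneg[OF F.B.posdef_gram_in[OF k'(1) w(2)]])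
  have 1: "\<bar>F.B.covhess ct' (R.sc ct' (kx x) (yx x) u) z e d\<bar> \<le> N * (B * norm e) * (B * norm d) * ?g"
  proof -
    have "\<bar>F.B.covhess ct' (R.sc ct' (kx x) (yx x) u) z e d\<bar> \<le> N * ?G e * ?G d * ?g"
      using fb[of u e d] unfolding ci by blast
    also have "\<dots> \<le> N * (B * norm e) * (B * norm d) * ?g"
      by (intro mult_right_mono mult_mono G g0 G0 N_nonneg order_refl mult_nonneg_nonneg) (use B in auto)
    finally show ?thesis .
  qed
  have 2: "\<bar>(R.Hm ct' (kx x) z (yx x) *v ?Gam) \<bullet> u\<bar> \<le> N * (B * (B * norm e * norm d)) * ?g"
  proof -
    have "\<bar>(R.Hm ct' (kx x) z (yx x) *v ?Gam) \<bullet> u\<bar> \<le> N * ?G ?Gam * ?g"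
      using fb[of u ?Gam d] unfolding ci by blast
    also have "\<dots> \<le> N * (B * (B * norm e * norm d)) * ?g"
      by (intro mult_right_mono mult_left_mono order_trans[OF G] gB(3)[OF z] g0 N_nonneg) (use B in auto)
    finally show ?thesis .
  qed
  have "(F.B.hess (R.sc ct' (kx x) (yx x) u) z *v e) \<bullet> d =
     F.B.covhess ct' (R.sc ct' (kx x) (yx x) u) z e d + (R.Hm ct' (kx x) z (yx x) *v ?Gam) \<bullet> u"
    unfolding F.B.covhess_def R.sc_grad[OF k'(1) kx(1) zD kx(3)[OF x]] by simp
  then have "\<bar>(F.B.hess (R.sc ct' (kx x) (yx x) u) z *v e) \<bullet> d\<bar> \<le> N * (B * norm e) * (B * norm d) * ?g + N * (B * (B * norm e * norm d)) * ?g"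
    using 1 2 by linarith
  then show ?thesis by (simp add: power2_eq_square mult_ac)
qed

text \<open>Mean value theorem along the segment from zb to zb + e; the derivative is the Hessian of
  \<open>sc\<close> applied to e and d.\<close>

lemma Hm_variation:
  assumes x: "x \<in> \<Omega>" and z: "zb + e \<in> ball zb (1 / B)"
  shows "\<bar>(R.Hm ct' (kx x) (zb + e) (yx x) *v d) \<bullet> u - (R.Hm ct' (kx x) zb (yx x) *v d) \<bullet> u\<bar> \<le> 2 * N * B\<^sup>2 * norm e * norm d * nrm (gram M x) u"
proof -
  define g where "g s = (R.Hm ct' (kx x) (zb + s *\<^sub>R e) (yx x) *v d) \<bullet> u" for s :: real
  have inb: "zb + s *\<^sub>R e \<in> ball zb (1 / B)" if "0 \<le> s" "s \<le> 1" for s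
  proof -
    have "\<bar>s\<bar> * norm e \<le> 1 * norm e" using that by (intro mult_right_mono) auto
    then show ?thesis using z by (simp add: dist_norm)
  qed
  define g' where "g' s = (F.B.hess (R.sc ct' (kx x) (yx x) u) (zb + s *\<^sub>R e) *v e) \<bullet> d" for s :: real
  have der: "(g has_real_derivative g' s) (at s)" if s: "0 \<le> s" "s \<le> 1" for s
  proof -
    have zD: "zb + s *\<^sub>R e \<in> F.Dom' ct'" using inb[OF s] ball_sub by blast
    have ex: "(R.Hm ct' (kx x) z (yx x) *v d) \<bullet> u = (\<Sum>k\<in>UNIV. \<Sum>j\<in>UNIV. R.Hm ct' (kx x) z (yx x) $ k $ j * d $ j * u $ k)" for z
      by (rule matvec_inner_sum)
    have "((\<lambda>z. \<Sum>k\<in>UNIV. \<Sum>j\<in>UNIV. R.Hm ct' (kx x) z (yx x) $ k $ j * d $ j * u $ k) has_derivative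
       (\<lambda>h. \<Sum>k\<in>UNIV. \<Sum>j\<in>UNIV. (\<Sum>i\<in>UNIV. R.H3 ct' (kx x) (zb + s *\<^sub>R e) (yx x) k j i * h $ i) * d $ j * u $ k)) (at (zb + s *\<^sub>R e))"
      by (intro has_derivative_sum has_derivative_mult_left R.Hm_deriv[OF k'(1) kx(1) zD kx(3)[OF x]])
    then have D: "((\<lambda>z. (R.Hm ct' (kx x) z (yx x) *v d) \<bullet> u) has_derivative
       (\<lambda>h. \<Sum>k\<in>UNIV. \<Sum>j\<in>UNIV. (\<Sum>i\<in>UNIV. R.H3 ct' (kx x) (zb + s *\<^sub>R e) (yx x) k j i * h $ i) * d $ j * u $ k)) (at (zb + s *\<^sub>R e))"
      unfolding ex .
    have l: "((\<lambda>s. zb + s *\<^sub>R e) has_derivative (\<lambda>h. h *\<^sub>R e)) (at s)" by (auto intro!: derivative_eq_intros)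
    have "(g has_derivative (\<lambda>h. \<Sum>k\<in>UNIV. \<Sum>j\<in>UNIV. (\<Sum>i\<in>UNIV. R.H3 ct' (kx x) (zb + s *\<^sub>R e) (yx x) k j i * (h *\<^sub>R e) $ i) * d $ j * u $ k)) (at s)"
      using diff_chain_at[OF l D] by (simp add: o_def g_def[abs_def])
    also have "(\<lambda>h::real. \<Sum>k\<in>UNIV. \<Sum>j\<in>UNIV. (\<Sum>i\<in>UNIV. R.H3 ct' (kx x) (zb + s *\<^sub>R e) (yx x) k j i * (h *\<^sub>R e) $ i) * d $ j * u $ k) = (\<lambda>h. g' s * h)"
      unfolding g'_def R.sc_hess[OF k'(1) kx(1) zD kx(3)[OF x]] by (simp add: sum_distrib_left sum_distrib_right mult_ac)
    finally show ?thesis by (simp add: has_field_derivative_def)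
  qed
  have "\<exists>s>0. s < 1 \<and> g 1 - g 0 = (1 - 0) * g' s" by (rule MVT2) (simp, erule (1) der)
  then obtain s where s: "0 < s" "s < 1" "g 1 - g 0 = (1 - 0) * g' s" by (elim exE conjE)
  have "\<bar>g' s\<bar> \<le> 2 * N * B\<^sup>2 * norm e * norm d * nrm (gram M x) u"
    unfolding g'_def by (rule hess_bound[OF x inb]) (use s in auto)
  then show ?thesis using s(3) by (simp add: g_def)
qed

text \<open>By the mean value theorem the difference of the covectors is the mixed derivative at an
  intermediate point applied to Tm (y1 - y2), whereas y1 - y2 itself corresponds to the mixed
  derivative at zb. The gap is of order r: \<open>hess_bound\<close> contributes B^2, and each of
  the two vectors mapped by Tm one factor B.\<close>

lemma near_quad:
  assumes x: "x \<in> \<Omega>" and y: "norm y1 \<le> r" "norm y2 \<le> r" and r: "2 * B\<^sup>2 * r \<le> 1"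
  shows "norm (Qx x (\<psi> y1) - Qx x (\<psi> y2) - (y1 - y2)) \<le> 2 * K3 * N * B ^ 4 * r * norm (y1 - y2)"
proof -
  define d where "d = Tm *v (y1 - y2)"
  have key: "(Dm x *v (Ai *v (Qx x (\<psi> y1) - Qx x (\<psi> y2) - (y1 - y2)))) \<bullet> u \<le> 2 * N * B ^ 4 * r * norm (y1 - y2) * nrm (gram M x) u" for u
  proof -
    define \<phi> where "\<phi> t = R.sc ct' (kx x) (yx x) u (zb + Tm *v y2 + t *\<^sub>R d)" for t :: real
    define \<phi>' where "\<phi>' t = (R.Hm ct' (kx x) (zb + Tm *v y2 + t *\<^sub>R d) (yx x) *v d) \<bullet> u" for t :: real
    have yt: "zb + Tm *v y2 + t *\<^sub>R d = zb + Tm *v (y2 + t *\<^sub>R (y1 - y2))" for t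
      by (simp add: d_def matrix_vector_right_distrib matrix_vector_mult_scaleR)
    have yr: "norm (y2 + t *\<^sub>R (y1 - y2)) \<le> r" if "0 \<le> t" "t \<le> 1" for t
    proof -
      have "y2 + t *\<^sub>R (y1 - y2) = (1 - t) *\<^sub>R y2 + t *\<^sub>R y1" by (simp add: algebra_simps)
      moreover have "(1 - t) *\<^sub>R y2 + t *\<^sub>R y1 \<in> cball 0 r"
        by (rule convexD[OF convex_cball]) (use y that in auto)
      ultimately show ?thesis by simp
    qed
    have inb: "zb + Tm *v y2 + t *\<^sub>R d \<in> ball zb (1 / B)" if "0 \<le> t" "t \<le> 1" for t
      unfolding yt by (rule psi_ball[OF yr[OF that] r])
    have der: "(\<phi> has_real_derivative \<phi>' t) (at t)" if t: "0 \<le> t" "t \<le> 1" for t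
    proof -
      have zD: "zb + Tm *v y2 + t *\<^sub>R d \<in> F.Dom' ct'" using inb[OF t] ball_sub by blast
      have l: "((\<lambda>s. zb + Tm *v y2 + s *\<^sub>R d) has_derivative (\<lambda>h. h *\<^sub>R d)) (at t)" by (auto intro!: derivative_eq_intros)
      have "(\<phi> has_derivative (\<lambda>h. (R.Hm ct' (kx x) (zb + Tm *v y2 + t *\<^sub>R d) (yx x) *v (h *\<^sub>R d)) \<bullet> u)) (at t)"
        using diff_chain_at[OF l R.sc_deriv[OF k'(1) kx(1) zD kx(3)[OF x], of u]] by (simp add: o_def \<phi>_def[abs_def])
      then show ?thesis unfolding has_field_derivative_def \<phi>'_def
        by (rule has_derivative_eq_rhs) (rule ext, simp add: matrix_vector_mult_scaleR mult.commute)
    qed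
    have "\<exists>t>0. t < 1 \<and> \<phi> 1 - \<phi> 0 = (1 - 0) * \<phi>' t" by (rule MVT2) (simp, erule (1) der)
    then obtain t where t: "0 < t" "t < 1" "\<phi> 1 - \<phi> 0 = (1 - 0) * \<phi>' t" by (elim exE conjE)
    let ?e = "Tm *v (y2 + t *\<^sub>R (y1 - y2))"
    have q1: "\<phi> 1 = qd x (\<psi> y1) \<bullet> u" "\<phi> 0 = qd x (\<psi> y2) \<bullet> u"
      unfolding \<phi>_def yt R.sc_def qd_q[OF k'(1) psi_in(2)[OF y(1) r]] qd_q[OF k'(1) psi_in(2)[OF y(2) r]]
        psi_in(3)[OF y(1) r] psi_in(3)[OF y(2) r] by simp_all
    have hm: "(Dm x *v (Ai *v (y1 - y2))) \<bullet> u = (R.Hm ct' (kx x) zb (yx x) *v d) \<bullet> u"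
    proof -
      have "(Dm x *v (Ai *v (y1 - y2))) \<bullet> u = (R.Hm ct' (kx x) zb (yx x) *v (tjac kb ct' zc *v (Ai *v (y1 - y2)))) \<bullet> (tjac (kx x) (kx x) (yx x) *v u)"
        unfolding Dm_def zc_def zb_def kx(4) by (rule R.Hm_trans[OF kb(1) k'(1) kx(1) kx(1) xb kb(2) k'(2) x kx(2) kx(2)])
      moreover have "tjac (kx x) (kx x) (yx x) = mat 1" unfolding kx(4) by (rule F.A.tjac_same[OF kx(1,2)])
      ultimately show ?thesis by (simp add: d_def Tm_def matrix_vector_mul_assoc)
    qed
    have "(Dm x *v (Ai *v (Qx x (\<psi> y1) - Qx x (\<psi> y2) - (y1 - y2)))) \<bullet> u =
       (qd x (\<psi> y1) - qd x xb - (qd x (\<psi> y2) - qd x xb)) \<bullet> u - (Dm x *v (Ai *v (y1 - y2))) \<bullet> u"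
      by (simp only: matrix_vector_mult_diff_distrib Dm_solve[OF x] inner_diff_left)
    also have "\<dots> = \<phi> 1 - \<phi> 0 - (R.Hm ct' (kx x) zb (yx x) *v d) \<bullet> u"
      unfolding hm q1 by (simp add: inner_diff_left)
    also have "\<dots> = (R.Hm ct' (kx x) (zb + ?e) (yx x) *v d) \<bullet> u - (R.Hm ct' (kx x) zb (yx x) *v d) \<bullet> u"
      unfolding t(3) \<phi>'_def yt by simp
    also have "\<dots> \<le> 2 * N * B\<^sup>2 * norm ?e * norm d * nrm (gram M x) u"
      using Hm_variation[OF x, of ?e d u] inb[of t] t unfolding yt by (simp add: abs_le_iff)
    also have "\<dots> \<le> 2 * N * B\<^sup>2 * (B * r) * (B * norm (y1 - y2)) * nrm (gram M x) u"
    proof (intro mult_right_mono mult_mono mult_left_mono)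
      have "B * norm (y2 + t *\<^sub>R (y1 - y2)) \<le> B * r" using yr[of t] t B by (intro mult_left_mono) auto
      then show "norm ?e \<le> B * r" using Tm_norm[of "y2 + t *\<^sub>R (y1 - y2)"] by linarith
      show "norm d \<le> B * norm (y1 - y2)" unfolding d_def by (rule Tm_norm)
      show "0 \<le> nrm (gram M x) u" by (rule nrm_nonneg[OF F.A.posdef_gram])
      show "0 \<le> 2 * N * B\<^sup>2 * (B * r)" using N_nonneg B order_trans[OF norm_ge_zero y(1)] by simp
    qed (use N_nonneg in auto)
    also have "\<dots> = 2 * N * B ^ 4 * r * norm (y1 - y2) * nrm (gram M x) u" by (simp add: power2_eq_square power4_eq_xxxx)
    finally show ?thesis .
  qed
  have "norm (A0 *v (Ai *v (Qx x (\<psi> y1) - Qx x (\<psi> y2) - (y1 - y2)))) \<le> K3 * (2 * N * B ^ 4 * r * norm (y1 - y2))"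
    by (rule K3_bound[OF x key])
  then show ?thesis by (simp add: A0i mult_ac)
qed

lemma Q_xb: "Qx x xb = 0" by (simp add: Qx_def)

end

lemma continuous_on_minus_matmul:
  fixes G :: "'a::t2_space \<Rightarrow> real^'n::finite^'n"
  assumes "continuous_on S G"
  shows "continuous_on S (\<lambda>x. A ** G x)"
  by (rule bounded_linear.continuous_on[OF bounded_bilinear.bounded_linear_right[OF bounded_bilinear_matrix_matrix] assms])

context rmanifold
begin

lemma inj_image_borel:
  fixes f :: "'m \<Rightarrow> real^'n"
  assumes f: "continuous_on \<Omega> f" "inj_on f \<Omega>" and \<Omega>: "open \<Omega>" and B: "B \<in> sets borel" "B \<subseteq> \<Omega>"
  shows "f ` B \<in> sets borel"
proof -
  have o: "open (f ` \<Omega>)" by (rule inj_open_map[OF f \<Omega>]) simp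
  have "the_inv_into \<Omega> f \<in> borel_measurable (restrict_space borel (f ` \<Omega>))"
    by (rule borel_measurable_continuous_on_restrict[OF inj_inverse_continuous[OF f \<Omega>]])
  from measurable_sets[OF this B(1)]
  have "the_inv_into \<Omega> f -` B \<inter> f ` \<Omega> \<in> sets borel"
    using o by (simp add: space_restrict_space sets_restrict_space_iff)
  moreover have "the_inv_into \<Omega> f -` B \<inter> f ` \<Omega> = f ` B"
    using the_inv_into_f_f[OF f(2)] B(2) by force
  ultimately show ?thesis by simp
qed

text \<open>Composing with an orthonormal frame of the metric turns the hypothesis into a Euclidean
  operator bound; the frame has determinant 1 / \<open>wt\<close> up to sign.\<close>

lemma det_le_wt:
  assumes k: "ct \<in> charts M" and y: "y \<in> snd ct ` fst ct" and L: "\<And>v. norm (L *v v) \<le> b * nrm (gram_in M ct (chart_inv ct y)) v" and b: "0 \<le> b"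
  shows "\<bar>det L\<bar> \<le> fact CARD('n) * b ^ CARD('n) * wt ct y"
proof -
  let ?x = "chart_inv ct y"
  have x: "?x \<in> fst ct" by (rule chart_inv_in[OF k y])
  obtain A Ai where ch: "chol (gram_in M ct ?x) A Ai" by (rule posdef_cholesky[OF posdef_gram_in[OF k x]])
  note c = cholD[OF ch]
  have "norm ((L ** Ai) *v v) \<le> b * norm v" for v
  proof -
    have "A *v (Ai *v v) = v" by (simp add: matrix_vector_mul_assoc c)
    then show ?thesis using L[of "Ai *v v"] unfolding c(5) by (simp add: matrix_vector_mul_assoc)
  qed
  from det_le_fact[OF this b] have d: "\<bar>det (L ** Ai)\<bar> \<le> fact CARD('n) * b ^ CARD('n)" .
  have "L = (L ** Ai) ** A" by (simp add: matrix_mul_assoc[symmetric] c)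
  then have "det L = det (L ** Ai) * det A" by (metis det_mul)
  moreover have "wt ct y = \<bar>det A\<bar>" by (simp add: wt_def c(7))
  ultimately show ?thesis using mult_right_mono[OF d, of "\<bar>det A\<bar>"] by (simp add: abs_mult)
qed

end

context half_cost
begin

lemma Hm_cont1:
  assumes "ct \<in> charts M" "ct' \<in> charts M'" "z \<in> Dom' ct'"
  shows "continuous_on (Dom ct) (\<lambda>y. Hm ct ct' y z)"
proof -
  have "continuous_on (Dom ct) (\<lambda>y. Hm ct ct' (fst (y, z)) (snd (y, z)))"
    by (rule continuous_on_compose2[OF Hm_cont[OF assms(1,2)]]) (intro continuous_intros, use assms(3) in blast)
  then show ?thesis by simp
qed

lemma Hm_cont2:
  assumes "ct \<in> charts M" "ct' \<in> charts M'" "y \<in> Dom ct"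
  shows "continuous_on (Dom' ct') (\<lambda>z. Hm ct ct' y z)"
proof -
  have "continuous_on (Dom' ct') (\<lambda>z. Hm ct ct' (fst (y, z)) (snd (y, z)))"
    by (rule continuous_on_compose2[OF Hm_cont[OF assms(1,2)]]) (intro continuous_intros, use assms(3) in blast)
  then show ?thesis by simp
qed

lemma q_cont2:
  assumes k: "ct \<in> charts M" "ct' \<in> charts M'" and y: "y \<in> Dom ct"
  shows "continuous_on (Dom' ct') (\<lambda>z. q ct ct' y z)"
  unfolding q_def
proof (rule continuous_on_vec_lambda)
  fix i
  obtain G where G: "continuous_on (snd ct ` (fst ct \<inter> closure \<Omega>) \<times> snd ct' ` (fst ct' \<inter> closure \<Omega>')) G"
    "\<forall>y \<in> Dom ct. \<forall>z \<in> Dom' ct'. G (y, z) = pd2 i (loc ct ct' c) y z"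
    using C3E(1)[OF k, of i] unfolding extends_cont_def by (elim exE conjE)
  have "continuous_on (Dom' ct') (\<lambda>z. G (y, z))"
  proof (rule continuous_on_compose2[OF G(1)])
    show "continuous_on (Dom' ct') (\<lambda>z. (y, z))" by (intro continuous_intros)
    show "(\<lambda>z. (y, z)) ` Dom' ct' \<subseteq> snd ct ` (fst ct \<inter> closure \<Omega>) \<times> snd ct' ` (fst ct' \<inter> closure \<Omega>')"
      using y closure_subset[of \<Omega>] closure_subset[of \<Omega>'] by blast
  qed
  then show "continuous_on (Dom' ct') (\<lambda>z. pd2 i (loc ct ct' c) y z)"
    by (rule continuous_on_eq) (rule G(2)[rule_format, OF y])
qed

end

section \<open>The cost in normalised coordinates and comparison of volumes\<close>

context ot_coord
begin

definition "Lp ct y = - (transpose Ai ** F.Hm ct kb y zc)"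
definition "Lq x ct z = (A0 ** matrix_inv (Dm x)) ** R.Hm ct (kx x) z (yx x)"

lemma pt_deriv:
  assumes k: "ct \<in> charts M" and y: "y \<in> F.Dom ct"
  shows "((\<lambda>y. pt (chart_inv ct y)) has_derivative (*v) (Lp ct y)) (at y)"
proof -
  have "((\<lambda>y. transpose Ai *v (- Dc M' (flip c) xb (chart_inv ct y))) has_derivative (\<lambda>h. transpose Ai *v (- (F.Hm ct kb y zc *v h)))) (at y)"
    unfolding kb_def zc_def
    by (intro bounded_linear.has_derivative[OF matrix_vector_mul_bounded_linear] has_derivative_minus F.Dc_deriv[OF k y xb])
  moreover have "(\<lambda>h. transpose Ai *v (- (F.Hm ct kb y zc *v h))) = (*v) (Lp ct y)"
    by (rule ext) (simp only: Lp_def matrix_vector_mult_minus matrix_vector_mul_assoc[symmetric] linear_neg[OF matrix_vector_mul_linear])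
  ultimately show ?thesis by (simp add: pt_def mom_def del: transpose_matrix_vector)
qed

lemma Qx_deriv:
  assumes x: "x \<in> \<Omega>" and k: "ct \<in> charts M'" and z: "z \<in> F.Dom' ct"
  shows "((\<lambda>z. Qx x (chart_inv ct z)) has_derivative (*v) (Lq x ct z)) (at z)"
proof -
  have D: "((\<lambda>z. qd x (chart_inv ct z)) has_derivative (*v) (R.Hm ct (kx x) z (yx x))) (at z)"
    using R.Dc_deriv[OF k z x] by (simp add: qd_def kx_def yx_def)
  have "((\<lambda>z. (A0 ** matrix_inv (Dm x)) *v (qd x (chart_inv ct z) - qd x xb)) has_derivative (\<lambda>h. (A0 ** matrix_inv (Dm x)) *v (R.Hm ct (kx x) z (yx x) *v h - 0))) (at z)"
    by (intro bounded_linear.has_derivative[OF matrix_vector_mul_bounded_linear] has_derivative_diff D has_derivative_const)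
  moreover have "(\<lambda>h. (A0 ** matrix_inv (Dm x)) *v (R.Hm ct (kx x) z (yx x) *v h - 0)) = (*v) (Lq x ct z)"
    by (rule ext) (simp only: Lq_def matrix_vector_mul_assoc diff_0_right)
  ultimately show ?thesis by (simp only: Qx_def matrix_vector_mul_assoc)
qed

lemma pt_cont: "continuous_on \<Omega> pt"
  unfolding pt_def
  by (rule bounded_linear.continuous_on[OF matrix_vector_mul_bounded_linear pm_cont[OF xb]])

lemma pt_inj: "inj_on pt \<Omega>"
proof (rule inj_onI)
  fix x y assume xy: "x \<in> \<Omega>" "y \<in> \<Omega>" "pt x = pt y"
  have "pm xb x = pm xb y" using arg_cong[OF xy(3), of "\<lambda>p. transpose A0 *v p"] unfolding pt_def Ait .
  then show "x = y" by (rule inj_onD[OF pm_inj[OF xb] _ xy(1,2)])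
qed

lemma xi: "x \<in> \<Omega> \<Longrightarrow> xi (pt x) = x"
  unfolding xi_def by (rule the_inv_into_f_f[OF pt_inj])

lemma pt_image: "pt ` A = (\<lambda>p. transpose Ai *v p) ` (pm xb ` A)"
  by (simp add: image_image pt_def)

lemma pt_convex: "convex (pm xb ` A) \<Longrightarrow> convex (pt ` A)"
  unfolding pt_image by (rule convex_linear_image[OF matrix_vector_mul_linear])

lemma Qx_affine: "Qx x w = (A0 ** matrix_inv (Dm x)) *v (- pm' x w) + (A0 ** matrix_inv (Dm x)) *v pm' x xb"
  unfolding Qx_def qd_def mom_def matrix_vector_mul_assoc by (simp add: matrix_vector_mult_diff_distrib linear_neg[OF matrix_vector_mul_linear])

lemma Qx_cont: "x \<in> \<Omega> \<Longrightarrow> continuous_on \<Omega>' (Qx x)"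
  unfolding Qx_affine[abs_def]
  by (intro continuous_intros bounded_linear.continuous_on[OF matrix_vector_mul_bounded_linear] pm'_cont)

text \<open>For fixed x the passage from the momentum to \<open>Qx\<close> is affine and reversible,
  so convexity, injectivity and c-segments carry over.\<close>

lemma Qx_eq_pm':
  assumes x: "x \<in> \<Omega>"
  shows "pm' x w = pm' x xb - Dm x *v (Ai *v Qx x w)"
  unfolding Dm_solve[OF x] by (simp add: qd_def mom_def)

lemma Qx_inj: "x \<in> \<Omega> \<Longrightarrow> inj_on (Qx x) \<Omega>'"
proof (rule inj_onI)
  fix w w' assume x: "x \<in> \<Omega>" and w: "w \<in> \<Omega>'" "w' \<in> \<Omega>'" "Qx x w = Qx x w'"
  have "pm' x w = pm' x w'" using Qx_eq_pm'[OF x, of w] Qx_eq_pm'[OF x, of w'] w(3) by simp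
  then show "w = w'" by (rule inj_onD[OF pm'_inj[OF x] _ w(1,2)])
qed

lemma Qx_convex:
  assumes x: "x \<in> \<Omega>"
  shows "convex (Qx x ` \<Omega>')"
proof -
  let ?A = "A0 ** matrix_inv (Dm x)"
  have "Qx x ` \<Omega>' = (\<lambda>p. ?A *v pm' x xb + p) ` ((*v) ?A ` uminus ` (pm' x ` \<Omega>'))"
    unfolding image_image Qx_affine[abs_def] by (simp add: add.commute)
  then show ?thesis using pm'_convex[OF x]
    by (simp only: convex_translation_eq convex_linear_image[OF matrix_vector_mul_linear] convex_negations)
qed

text \<open>In passing from the chart chosen at x to a fixed one, both sides of
  \<open>Dm_solve\<close> are multiplied by the same transposed Jacobian. Continuity in x can thus
  be examined in a fixed chart.\<close>

lemma Rq_trans_eq: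
  assumes x: "x \<in> \<Omega>" and k: "ct \<in> charts M" "x \<in> fst ct"
  shows "R.Hm kb ct zc (snd ct x) = transpose (tjac ct (kx x) (snd ct x)) ** Dm x"
    and "w \<in> \<Omega>' \<Longrightarrow> R.q (chart_at M' w) ct (snd (chart_at M' w) w) (snd ct x) = transpose (tjac ct (kx x) (snd ct x)) *v qd x w"
proof -
  show "R.Hm kb ct zc (snd ct x) = transpose (tjac ct (kx x) (snd ct x)) ** Dm x"
  proof (rule matrix_eqI_inner)
    fix v u
    have "(R.Hm kb ct zc (snd ct x) *v v) \<bullet> u = (Dm x *v (tjac kb kb zc *v v)) \<bullet> (tjac ct (kx x) (snd ct x) *v u)"
      unfolding Dm_def zc_def kx(4) by (rule R.Hm_trans[OF kb(1) kb(1) k(1) kx(1) xb kb(2) kb(2) x k(2) kx(2)])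
    moreover have "tjac kb kb zc = mat 1" unfolding zc_def by (rule F.B.tjac_same[OF kb(1,2)])
    ultimately show "(R.Hm kb ct zc (snd ct x) *v v) \<bullet> u = ((transpose (tjac ct (kx x) (snd ct x)) ** Dm x) *v v) \<bullet> u"
      by (simp only: matrix_vector_mul_assoc[symmetric] inner_transpose_left matrix_vector_mul_lid)
  qed
  assume w: "w \<in> \<Omega>'"
  note kw = F.B.chart_at[of w]
  have "R.q (chart_at M' w) ct (snd (chart_at M' w) w) (snd ct x) \<bullet> u = (transpose (tjac ct (kx x) (snd ct x)) *v qd x w) \<bullet> u" for u
    unfolding qd_q[OF kw] inner_transpose_left kx(4) by (rule R.q_trans[OF kw(1) kw(1) k(1) kx(1) w kw(2) kw(2) x k(2) kx(2)])
  then show "R.q (chart_at M' w) ct (snd (chart_at M' w) w) (snd ct x) = transpose (tjac ct (kx x) (snd ct x)) *v qd x w"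
    by (metis inner_commute vector_eq_ldot)
qed

lemma Qx_cont_x:
  assumes w: "w \<in> \<Omega>'"
  shows "continuous_on \<Omega> (\<lambda>x. Qx x w)"
proof -
  have "isCont (\<lambda>x. Qx x w) x1" if x1: "x1 \<in> \<Omega>" for x1
  proof -
    define ct where "ct = chart_at M x1"
    have k: "ct \<in> charts M" "x1 \<in> fst ct" by (simp_all add: ct_def F.A.chart_at)
    let ?O = "fst ct \<inter> \<Omega>"
    have O: "open ?O" "x1 \<in> ?O" using F.A.chart_open(1)[OF k(1)] F.doms(1) k x1 by auto
    define Rm where "Rm x = R.Hm kb ct zc (snd ct x)" for x
    define a where "a x = R.q (chart_at M' w) ct (snd (chart_at M' w) w) (snd ct x) - R.q (chart_at M' xb) ct (snd (chart_at M' xb) xb) (snd ct x)" for x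
    have cs: "continuous_on ?O (snd ct)" by (rule F.snd_cont(1)[OF k(1)])
    have cR: "continuous_on ?O Rm"
      unfolding Rm_def
    proof (rule continuous_on_compose2[OF _ cs])
      show "continuous_on (F.Dom ct) (R.Hm kb ct zc)"
        by (rule R.Hm_cont2[OF kb(1) k(1) kb(3)])
    qed auto
    have ca: "continuous_on ?O a"
      unfolding a_def
      by (intro continuous_on_diff continuous_on_compose2[OF R.q_cont2 cs] F.B.chart_at k(1)) (use w xb F.B.chart_at in auto)
    have main: "det (Rm x) \<noteq> 0" "Rm x *v (Ai *v Qx x w) = a x" if x: "x \<in> ?O" for x
    proof -
      have x': "x \<in> \<Omega>" "x \<in> fst ct" using x by auto
      show "det (Rm x) \<noteq> 0"
        unfolding Rm_def Rq_trans_eq(1)[OF x'(1) k(1) x'(2)]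
        using F.A.tjac_det[OF k(1) kx(1) x'(2) kx(2)] Dm_det[OF x'(1)] by (simp add: det_mul det_transpose)
      show "Rm x *v (Ai *v Qx x w) = a x"
        unfolding Rm_def a_def Rq_trans_eq(1)[OF x'(1) k(1) x'(2)] Rq_trans_eq(2)[OF x'(1) k(1) x'(2) w] Rq_trans_eq(2)[OF x'(1) k(1) x'(2) xb]
        by (simp only: matrix_vector_mul_assoc[symmetric] Dm_solve[OF x'(1)] matrix_vector_mult_diff_distrib)
    qed
    \<comment> \<open>Cramer's rule writes the solution of the linear system through determinants,
      which shows its continuity.\<close>
    have "continuous_on ?O (\<lambda>x. A0 *v (\<chi> k. det (\<chi> i j. if j = k then a x $ i else Rm x $ i $ j) / det (Rm x)))"
    proof (intro bounded_linear.continuous_on[OF matrix_vector_mul_bounded_linear] continuous_on_vec_lambda continuous_on_divide continuous_on_det cR)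
      fix l i j :: 'n
      show "continuous_on ?O (\<lambda>x. if j = l then a x $ i else Rm x $ i $ j)"
        by (cases "j = l") (auto intro!: continuous_intros ca cR)
    qed (use main(1) in auto)
    then have "continuous_on ?O (\<lambda>x. Qx x w)"
    proof (rule continuous_on_eq)
      fix x assume x: "x \<in> ?O"
      have "Ai *v Qx x w = (\<chi> k. det (\<chi> i j. if j = k then a x $ i else Rm x $ i $ j) / det (Rm x))"
        using iffD1[OF cramer[OF main(1)[OF x]] main(2)[OF x]] .
      from arg_cong[OF this, of "\<lambda>v. A0 *v v"]
      show "A0 *v (\<chi> k. det (\<chi> i j. if j = k then a x $ i else Rm x $ i $ j) / det (Rm x)) = Qx x w" unfolding A0i by (rule sym)
    qed
    then show ?thesis using O by (simp add: continuous_on_eq_continuous_at)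
  qed
  then show ?thesis by (simp add: continuous_at_imp_continuous_on)
qed

text \<open>The gradient of -c(x, w) + c(x, xb) in a chart is -qd x w + qd x xb, and the derivative
  of \<open>pt\<close> is -Ai^T times the mixed derivative, by \<open>Hm_sym\<close> the transpose
  of Dm. So \<open>Dm_solve\<close> says exactly that \<open>Qx\<close> is the gradient with respect
  to p.\<close>

lemma cb_deriv:
  assumes x: "x \<in> \<Omega>" and w: "w \<in> \<Omega>'"
  shows "((\<lambda>p. cb p w) has_derivative (\<lambda>h. Qx x w \<bullet> h)) (at (pt x))"
  unfolding cb_def xi_def
proof (rule F.A.inverse_chain[where \<phi> = "\<lambda>x. - c x w + c x xb" and a = "- qd x w + qd x xb", OF pt_cont pt_inj F.doms(1) kx(1) x kx(2)])
  let ?L = "Lp (kx x) (snd (kx x) x)"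
  have y: "snd (kx x) x \<in> F.Dom (kx x)" using kx(3)[OF x] unfolding kx(4) .
  show "((\<lambda>y. pt (chart_inv (kx x) y)) has_derivative (*v) ?L) (at (snd (kx x) x))"
    by (rule pt_deriv[OF kx(1) y])
  have H: "transpose (F.Hm (kx x) kb (snd (kx x) x) zc) = Dm x"
    using Hm_sym[OF kx(1) kb(1) y kb(3)] unfolding Dm_def kx(4) by simp
  show "det ?L \<noteq> 0"
  proof -
    have "det (F.Hm (kx x) kb (snd (kx x) x) zc) \<noteq> 0" using Dm_det[OF x] unfolding H[symmetric] by (simp add: det_transpose)
    moreover have "det Ai \<noteq> 0" using arg_cong[OF chD(2), of det] by (auto simp: det_mul)
    ultimately show ?thesis unfolding Lp_def by (intro det_minus_nz) (simp add: det_mul det_transpose)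
  qed
  have g: "((\<lambda>y. c (chart_inv (kx x) y) w') has_derivative (\<lambda>h. qd x w' \<bullet> h)) (at (snd (kx x) x))" if w': "w' \<in> \<Omega>'" for w'
  proof -
    note kw = F.B.chart_at[of w']
    have zD: "snd (chart_at M' w') w' \<in> F.Dom' (chart_at M' w')" using kw w' by blast
    show ?thesis using R.loc_deriv[OF kw(1) kx(1) zD y] unfolding qd_q[OF kw] kx(4)
      by (simp add: loc_def flip_def F.B.chart_inv1[OF kw])
  qed
  have "((\<lambda>y. - c (chart_inv (kx x) y) w + c (chart_inv (kx x) y) xb) has_derivative (\<lambda>h. - (qd x w \<bullet> h) + qd x xb \<bullet> h)) (at (snd (kx x) x))"
    by (intro has_derivative_add has_derivative_minus g w xb)
  then show "((\<lambda>y. - c (chart_inv (kx x) y) w + c (chart_inv (kx x) y) xb) has_derivative (\<lambda>h. (- qd x w + qd x xb) \<bullet> h)) (at (snd (kx x) x))"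
    by (simp add: inner_diff_left)
  fix h
  have "Qx x w \<bullet> (?L *v h) = - (Qx x w \<bullet> (transpose Ai *v (F.Hm (kx x) kb (snd (kx x) x) zc *v h)))"
    by (simp only: Lp_def matrix_vector_mult_minus matrix_vector_mul_assoc[symmetric] inner_minus_right)
  also have "\<dots> = - ((Dm x *v (Ai *v Qx x w)) \<bullet> h)"
    unfolding H[symmetric] by (simp only: inner_transpose inner_transpose_left)
  also have "\<dots> = (- qd x w + qd x xb) \<bullet> h" unfolding Dm_solve[OF x] by (simp add: inner_diff_left)
  finally show "Qx x w \<bullet> (?L *v h) = (- qd x w + qd x xb) \<bullet> h" .
qed

lemma patch:
  assumes \<rho>: "0 < \<rho>" "2 * B\<^sup>2 * \<rho> \<le> 1" and \<epsilon>: "2 * K3 * N * B ^ 4 * \<rho> \<le> \<epsilon>" "\<epsilon> \<le> 1/4"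
  shows "cost_patch (pt ` \<Omega>) \<Omega>' xb cb (\<lambda>p. Qx (xi p)) \<psi> \<rho> \<epsilon> (2 * K3 * N * B ^ 4) M0 (K3 * (2 * N))"
proof
  have \<Lambda>: "0 \<le> 2 * K3 * N * B ^ 4" using K3_nonneg N_nonneg B by simp
  show "open (pt ` \<Omega>)" by (rule F.A.inj_open_map[OF pt_cont pt_inj F.doms(1)]) simp
  show "convex (pt ` \<Omega>)" by (rule pt_convex[OF pm_convex[OF xb]])
  show "0 < \<rho>" "\<epsilon> \<le> 1/4" "1 \<le> M0" "0 \<le> 2 * K3 * N * B ^ 4" by (rule \<rho> \<epsilon> M0 \<Lambda>)+
  show "0 \<le> \<epsilon>" using mult_nonneg_nonneg[OF \<Lambda>, of \<rho>] \<rho>(1) \<epsilon>(1) by linarith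
  have r: "norm y \<le> \<rho>" if "y \<in> ball 0 \<rho>" for y :: "real^'n" using that by simp
  show "\<psi> y \<in> \<Omega>'" if "y \<in> ball 0 \<rho>" for y by (rule psi_in(1)[OF r[OF that] \<rho>(2)])
  show "\<psi> 0 = xb" by (rule psi_0)
  fix p assume "p \<in> pt ` \<Omega>"
  then obtain x where x: "p = pt x" "x \<in> \<Omega>" by blast
  have xp: "xi p = x" unfolding x(1) by (rule xi[OF x(2)])
  show "cb p xb = 0" by (simp add: cb_def)
  show "((\<lambda>p. cb p w) has_derivative (\<lambda>h. Qx (xi p) w \<bullet> h)) (at p)" if "w \<in> \<Omega>'" for w
    unfolding xp unfolding x(1) by (rule cb_deriv[OF x(2) that])
  show "convex (Qx (xi p) ` \<Omega>')" unfolding xp by (rule Qx_convex[OF x(2)])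
  show "inj_on (Qx (xi p)) \<Omega>'" unfolding xp by (rule Qx_inj[OF x(2)])
  show "norm (Qx (xi p) w) \<le> K3 * (2 * N)" if "w \<in> \<Omega>'" for w unfolding xp by (rule Q_bound[OF x(2) that])
  show "norm (Qx (xi p) (\<psi> y) - Qx (xi p) (\<psi> y') - (y - y')) \<le> \<epsilon> * norm (y - y')" if "y \<in> ball 0 \<rho>" "y' \<in> ball 0 \<rho>" for y y'
    unfolding xp using near_quad[OF x(2) r[OF that(1)] r[OF that(2)] \<rho>(2)] mult_right_mono[OF \<epsilon>(1) norm_ge_zero[of "y - y'"]] by linarith
  \<comment> \<open>\<open>near_quad\<close> with r = |y| in place of r = \<rho>, which makes the
    bound quadratic.\<close>
  show "norm (Qx (xi p) (\<psi> y) - y) \<le> 2 * K3 * N * B ^ 4 * (norm y)\<^sup>2" if y: "y \<in> ball 0 \<rho>" for y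
  proof -
    have "2 * B\<^sup>2 * norm y \<le> 2 * B\<^sup>2 * \<rho>" using r[OF y] by (intro mult_left_mono) auto
    then have "2 * B\<^sup>2 * norm y \<le> 1" using \<rho>(2) by linarith
    from near_quad[OF x(2) order_refl _ this, of 0] show ?thesis
      unfolding xp psi_0 Q_xb by (simp add: power2_eq_square mult_ac)
  qed
  fix p0 w0 w1 w and t :: real
  assume p0: "p0 \<in> pt ` \<Omega>" and w: "w0 \<in> \<Omega>'" "w1 \<in> \<Omega>'" "w \<in> \<Omega>'" and t: "t \<in> {0..1}"
    and seg: "Qx (xi p0) w = (1 - t) *\<^sub>R Qx (xi p0) w0 + t *\<^sub>R Qx (xi p0) w1"
  obtain x0 where x0: "p0 = pt x0" "x0 \<in> \<Omega>" using p0 by blast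
  have x0p: "xi p0 = x0" unfolding x0(1) by (rule xi[OF x0(2)])
  have "pm' x0 w = (1 - t) *\<^sub>R pm' x0 w0 + t *\<^sub>R pm' x0 w1"
    unfolding Qx_eq_pm'[OF x0(2), of w] Qx_eq_pm'[OF x0(2), of w0] Qx_eq_pm'[OF x0(2), of w1] seg[unfolded x0p]
    by (simp add: matrix_vector_right_distrib matrix_vector_mult_scaleR algebra_simps)
  from qq1[OF x(2) x0(2) w t this]
  show "cb p w - cb p0 w - (cb p w0 - cb p0 w0) \<le> M0 * t * max 0 (cb p w1 - cb p0 w1 - (cb p w0 - cb p0 w0))"
    unfolding cb_def xp x0p by (simp add: algebra_simps)
next
  fix y :: "real^'n" assume y: "y \<in> ball 0 \<rho>"
  have "\<psi> y \<in> \<Omega>'" by (rule psi_in(1)[OF _ \<rho>(2)]) (use y in simp)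
  from Qx_cont_x[OF this] show "continuous_on (pt ` \<Omega>) (\<lambda>p. Qx (xi p) (\<psi> y))"
    by (rule continuous_on_compose2) (use F.A.inj_inverse_continuous[OF pt_cont pt_inj F.doms(1)] xi in \<open>auto simp: xi_def\<close>)
qed

text \<open>With respect to orthonormal frames the Jacobian of \<open>pt\<close> is the mixed
  derivative up to sign, of norm at most N.\<close>

lemma vol_upper:
  assumes "A \<in> sets borel" "A \<subseteq> \<Omega>"
  shows "emeasure lborel (pt ` A) \<le> ennreal (fact CARD('n) * N ^ CARD('n)) * emeasure (riem_vol M) A"
proof (rule F.A.emeasure_image_le[OF F.doms(1) pt_inj pt_deriv _ _ F.A.inj_image_borel[OF pt_cont pt_inj F.doms(1)] _ assms])
  fix ct assume k: "ct \<in> charts M"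
  have "continuous_on (F.Dom ct) (\<lambda>y. F.Hm ct kb y zc)"
    by (rule F.Hm_cont1[OF k kb(1) kb(3)])
  then show "continuous_on (F.Dom ct) (Lp ct)" unfolding Lp_def by (intro continuous_on_minus continuous_on_minus_matmul)
  fix y assume y: "y \<in> F.Dom ct"
  obtain x where x: "y = snd ct x" "x \<in> fst ct" "x \<in> \<Omega>" using y by blast
  have ci: "chart_inv ct y = x" unfolding x(1) by (rule F.A.chart_inv1[OF k x(2)])
  show "\<bar>det (Lp ct y)\<bar> \<le> fact CARD('n) * N ^ CARD('n) * F.A.wt ct y"
  proof (rule F.A.det_le_wt[OF k _ _ N_nonneg])
    show "y \<in> snd ct ` fst ct" using y by blast
    fix v
    have "nrm (matrix_inv (gram M' xb)) (F.Hm ct kb y zc *v v) \<le> N * nrm (gram_in M ct x) v"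
    proof (rule dual_bound[OF F.B.posdef_gram])
      fix u
      show "(F.Hm ct kb y zc *v v) \<bullet> u \<le> N * nrm (gram_in M ct x) v * nrm (gram M' xb) u"
        using Rform(2)[OF x(3) xb, unfolded F.form_bound_def, rule_format, OF k kb(1) x(2) kb(2), of u v v]
        by (simp add: zc_def x(1) kb_def F.B.gram_in_chart_at abs_le_iff)
    qed
    then show "norm (Lp ct y *v v) \<le> N * nrm (gram_in M ct (chart_inv ct y)) v"
      unfolding ci chD(6) by (simp only: Lp_def matrix_vector_mult_minus matrix_vector_mul_assoc[symmetric] norm_minus_cancel)
  qed
qed (use N_nonneg in auto)

text \<open>Bounds the volume of a set of foci from below by that of its image. The Jacobian is the
  mixed derivative at w composed with the inverse of the one at xb, of norm at most K3 N.\<close>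

lemma vol_lower:
  assumes x: "x \<in> \<Omega>" and A: "A \<in> sets borel" "A \<subseteq> \<Omega>'"
  shows "emeasure lborel (Qx x ` A) \<le> ennreal (fact CARD('n) * (K3 * N) ^ CARD('n)) * emeasure (riem_vol M') A"
proof (rule F.B.emeasure_image_le[OF F.doms(2) Qx_inj[OF x] Qx_deriv[OF x] _ _ F.B.inj_image_borel[OF Qx_cont[OF x] Qx_inj[OF x] F.doms(2)] _ A])
  fix ct assume k: "ct \<in> charts M'"
  have "continuous_on (F.Dom' ct) (\<lambda>z. R.Hm ct (kx x) z (yx x))"
    by (rule R.Hm_cont1[OF k kx(1) kx(3)[OF x]])
  then show "continuous_on (F.Dom' ct) (Lq x ct)" unfolding Lq_def by (intro continuous_on_minus_matmul)
  fix z assume z: "z \<in> F.Dom' ct"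
  obtain w where w: "z = snd ct w" "w \<in> fst ct" "w \<in> \<Omega>'" using z by blast
  have ci: "chart_inv ct z = w" unfolding w(1) by (rule F.B.chart_inv1[OF k w(2)])
  have KN: "0 \<le> K3 * N" using K3_nonneg N_nonneg by simp
  show "\<bar>det (Lq x ct z)\<bar> \<le> fact CARD('n) * (K3 * N) ^ CARD('n) * F.B.wt ct z"
  proof (rule F.B.det_le_wt[OF k _ _ KN])
    show "z \<in> snd ct ` fst ct" using z by blast
    fix v
    let ?h = "R.Hm ct (kx x) z (yx x) *v v"
    have "norm (A0 *v (matrix_inv (Dm x) *v ?h)) \<le> K3 * (N * nrm (gram_in M' ct w) v)"
    proof (rule K3_bound[OF x])
      fix u
      have "Dm x *v (matrix_inv (Dm x) *v ?h) = ?h"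
        by (simp only: matrix_vector_mul_assoc matrix_mul_assoc matrix_inv_props(1)[OF Dm_det[OF x]] matrix_mul_lid)
      then show "(Dm x *v (matrix_inv (Dm x) *v ?h)) \<bullet> u \<le> N * nrm (gram_in M' ct w) v * nrm (gram M x) u"
        using Rform(1)[OF x w(3), unfolded R.form_bound_def, rule_format, OF k kx(1) w(2) kx(2), of u v v]
        by (simp add: w(1) kx(4) abs_le_iff) (simp add: kx_def F.A.gram_in_chart_at)
    qed
    then show "norm (Lq x ct z *v v) \<le> K3 * N * nrm (gram_in M' ct (chart_inv ct z)) v"
      unfolding ci Lq_def by (simp add: matrix_vector_mul_assoc[symmetric] mult.assoc)
  qed
qed (use K3_nonneg N_nonneg in auto)

lemma pt_bound:
  assumes x: "x \<in> \<Omega>"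
  shows "norm (pt x) \<le> N"
proof -
  have "nrm (matrix_inv (gram M' xb)) (- pm xb x) \<le> N"
  proof (rule dual_bound[OF F.B.posdef_gram])
    fix u
    have "- pm xb x = F.q (kx x) kb (snd (kx x) x) zc"
      by (simp add: mom_def F.Dc_q kx_def kb_def zc_def)
    then show "(- pm xb x) \<bullet> u \<le> N * nrm (gram M' xb) u"
      using Rform(2)[OF x xb, unfolded F.form_bound_def, rule_format, OF kx(1) kb(1) kx(2) kb(2), of u]
      by (simp add: zc_def kb_def F.B.gram_in_chart_at abs_le_iff)
  qed
  then show ?thesis unfolding chD(6) pt_def by (simp only: linear_neg[OF matrix_vector_mul_linear] norm_minus_cancel)
qed

end

section \<open>From directional estimates to distances of supporting hyperplanes\<close>

text \<open>T makes the inner product H Euclidean. Used for w and for -w, \<open>key\<close> bounds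
  hh L by the smaller of the distances d1, d2 from q0 to the two supporting hyperplanes, which the
  distance to their union dominates. The factor 2 N is the price of dividing by the distance between
  the hyperplanes, which is at most 2 N.\<close>

lemma section_geometry:
  fixes H T Ti :: "real^'n::finite^'n" and A :: "(real^'n) set"
  assumes T: "\<And>q. nrm H q = norm (T *v q)" "\<And>p q. ip H p q = (T *v p) \<bullet> (T *v q)"
    and Ti: "\<And>q. Ti *v (T *v q) = (q :: real^'n)" and A: "convex A" and K: "compact ((*v) T ` A)" and q0: "q0 \<in> A" "T *v q0 \<in> interior ((*v) T ` A)"
    and N: "\<And>q. q \<in> A \<Longrightarrow> norm (T *v q) \<le> N" and v: "nrm H v = 1" and Cst: "0 \<le> Cst" and hh: "0 \<le> hh"
    and key: "\<And>w a l p1. \<lbrakk>norm w = 1; a \<in> (*v) T ` A; a + l *\<^sub>R w \<in> (*v) T ` A; 0 < l; p1 \<in> (*v) T ` A;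
      \<And>x. x \<in> (*v) T ` A \<Longrightarrow> w \<bullet> x \<le> w \<bullet> p1\<rbrakk> \<Longrightarrow> hh * l \<le> Cst * (w \<bullet> (p1 - T *v q0))"
  defines "hp \<equiv> supporting_hyperplane H A"
  shows "hh \<le> 2 * N * Cst / max_segment H A v * (set_distance H {q0} (hp v \<union> hp (- v)) / set_distance H (hp v) (hp (- v)))"
    and "0 \<le> set_distance H {q0} (hp v \<union> hp (- v)) / set_distance H (hp v) (hp (- v))" and "0 < max_segment H A v" and "0 \<le> N"
proof -
  let ?K = "(*v) T ` A"
  define w where "w = T *v v"
  have w1: "norm w = 1" using v by (simp add: w_def T)
  have ne: "?K \<noteq> {}" using q0 by blast
  have mx: "\<exists>q\<in>A. \<forall>x\<in>?K. z \<bullet> x \<le> z \<bullet> (T *v q)" for z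
  proof -
    have "continuous_on ?K (\<lambda>x. z \<bullet> x)" by (intro continuous_intros)
    from continuous_attains_sup[OF K ne this] show ?thesis by blast
  qed
  obtain q1 where q1: "q1 \<in> A" "\<And>x. x \<in> ?K \<Longrightarrow> w \<bullet> x \<le> w \<bullet> (T *v q1)" using mx[of w] by blast
  obtain q2 where q2: "q2 \<in> A" "\<And>x. x \<in> ?K \<Longrightarrow> (- w) \<bullet> x \<le> (- w) \<bullet> (T *v q2)" using mx[of "- w"] by blast
  have Tm: "T *v (- v) = - w" by (simp add: w_def linear_neg[OF matrix_vector_mul_linear])
  have sup: "q \<in> hp z \<longleftrightarrow> (T *v z) \<bullet> (T *v q) = (T *v z) \<bullet> (T *v a)"
    if "a \<in> A" "\<And>x. x \<in> ?K \<Longrightarrow> (T *v z) \<bullet> x \<le> (T *v z) \<bullet> (T *v a)" for q z a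
  proof -
    have "(SUP q\<in>A. ip H q z) = (T *v a) \<bullet> (T *v z)"
      by (rule cSup_eq_maximum) (use that in \<open>auto simp: T inner_commute\<close>)
    then show ?thesis unfolding hp_def supporting_hyperplane_def by (simp add: T inner_commute)
  qed
  have hp1: "q \<in> hp v \<longleftrightarrow> w \<bullet> (T *v q) = w \<bullet> (T *v q1)" for q
    using sup[of q1 v q] q1 unfolding w_def by blast
  have hp2: "q \<in> hp (- v) \<longleftrightarrow> w \<bullet> (T *v q) = w \<bullet> (T *v q2)" for q
    using sup[of q2 "- v" q] q2 unfolding Tm by simp
  define d1 where "d1 = w \<bullet> (T *v q1 - T *v q0)"
  define d2 where "d2 = w \<bullet> (T *v q0 - T *v q2)"
  \<comment> \<open>A ball around the image of q0 makes d1, d2, the width and the longest segment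
    positive.\<close>
  obtain r where r: "0 < r" "cball (T *v q0) r \<subseteq> ?K" using q0(2) unfolding mem_interior_cball by blast
  have rp: "T *v q0 + r *\<^sub>R w \<in> ?K" "T *v q0 - r *\<^sub>R w \<in> ?K" using r w1 by (auto intro!: subsetD[OF r(2)] simp: dist_norm)
  have ww: "w \<bullet> w = 1" using w1 by (simp add: dot_square_norm)
  have d1: "r \<le> d1" using q1(2)[OF rp(1)] by (simp add: d1_def inner_diff_right inner_add_right ww)
  have d2: "r \<le> d2" using q2(2)[OF rp(2)] by (simp add: d2_def inner_diff_right ww)
  have cs: "\<bar>w \<bullet> z\<bar> \<le> norm z" for z using Cauchy_Schwarz_ineq2[of w z] w1 by simp
  have Td: "nrm H (p - q) = norm (T *v p - T *v q)" for p q by (simp add: T matrix_vector_mult_diff_distrib)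
  let ?D = "set_distance H {q0} (hp v \<union> hp (- v))" and ?W = "set_distance H (hp v) (hp (- v))" and ?l = "max_segment H A v"
  have D: "min d1 d2 \<le> ?D"
    unfolding set_distance_def
  proof (rule cInf_greatest)
    have "q1 \<in> hp v" by (simp add: hp1)
    then show "{nrm H (p - q) |p q. p \<in> {q0} \<and> q \<in> hp v \<union> hp (- v)} \<noteq> {}" by blast
    fix x assume "x \<in> {nrm H (p - q) |p q. p \<in> {q0} \<and> q \<in> hp v \<union> hp (- v)}"
    then obtain q where q: "x = nrm H (q0 - q)" "q \<in> hp v \<union> hp (- v)" by blast
    from q(2) have "d1 \<le> x \<or> d2 \<le> x"
      unfolding Un_iff hp1 hp2 using cs[of "T *v q0 - T *v q"] q(1)
      by (auto simp: Td d1_def d2_def inner_diff_right abs_le_iff)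
    then show "min d1 d2 \<le> x" by auto
  qed
  have W1: "d1 + d2 \<le> ?W"
    unfolding set_distance_def
  proof (rule cInf_greatest)
    have "q1 \<in> hp v" "q2 \<in> hp (- v)" by (simp_all add: hp1 hp2)
    then show "{nrm H (p - q) |p q. p \<in> hp v \<and> q \<in> hp (- v)} \<noteq> {}" by blast
    fix x assume "x \<in> {nrm H (p - q) |p q. p \<in> hp v \<and> q \<in> hp (- v)}"
    then obtain p q where q: "x = nrm H (p - q)" "p \<in> hp v" "q \<in> hp (- v)" by blast
    show "d1 + d2 \<le> x" using q(2,3) cs[of "T *v p - T *v q"] unfolding hp1 hp2 q(1) Td
      by (simp add: d1_def d2_def inner_diff_right abs_le_iff)
  qed
  have n0: "0 \<le> nrm H q" for q by (simp add: T)
  have W2: "?W \<le> 2 * N"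
  proof -
    have "?W \<le> nrm H (q1 - q2)"
      unfolding set_distance_def
    proof (rule cInf_lower)
      show "nrm H (q1 - q2) \<in> {nrm H (p - q) |p q. p \<in> hp v \<and> q \<in> hp (- v)}"
        by (rule CollectI, intro exI conjI, rule refl) (simp_all add: hp1 hp2)
      show "bdd_below {nrm H (p - q) |p q. p \<in> hp v \<and> q \<in> hp (- v)}" by (rule bdd_belowI[of _ 0]) (use n0 in auto)
    qed
    also have "\<dots> \<le> 2 * N" unfolding Td using norm_triangle_ineq4[of "T *v q1" "T *v q2"] N[OF q1(1)] N[OF q2(1)] by linarith
    finally show ?thesis .
  qed
  define LS where "LS = {nrm H (q - p) | p q. closed_segment p q \<subseteq> A \<and> (\<exists>t. q - p = t *\<^sub>R v)}"
  have lE: "?l = Sup LS" unfolding max_segment_def LS_def ..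
  have LSe: "\<exists>p q t. L = nrm H (q - p) \<and> p \<in> A \<and> q \<in> A \<and> q - p = t *\<^sub>R v \<and> L = \<bar>t\<bar>" if L: "L \<in> LS" for L
  proof -
    obtain p q t where t: "L = nrm H (q - p)" "closed_segment p q \<subseteq> A" "q - p = t *\<^sub>R v" using L unfolding LS_def by blast
    have "p \<in> A" "q \<in> A" using t(2) by auto
    moreover have "L = \<bar>t\<bar>" unfolding t(1,3) nrm_scaleR v by simp
    ultimately show ?thesis using t by blast
  qed
  have bdd: "bdd_above LS"
  proof (rule bdd_aboveI)
    fix L assume "L \<in> LS"
    then obtain p q where "L = nrm H (q - p)" "p \<in> A" "q \<in> A" using LSe by blast
    then show "L \<le> 2 * N" unfolding Td using norm_triangle_ineq4[of "T *v q" "T *v p"] N[of p] N[of q] by linarith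
  qed
  have rL: "r \<in> LS"
  proof -
    have "T *v (q0 + r *\<^sub>R v) = T *v q0 + r *\<^sub>R w" by (simp add: w_def matrix_vector_right_distrib matrix_vector_mult_scaleR)
    then obtain q where q: "T *v (q0 + r *\<^sub>R v) = T *v q" "q \<in> A" using rp(1) by auto
    have "q0 + r *\<^sub>R v \<in> A" using arg_cong[OF q(1), of "(*v) Ti"] q(2) unfolding Ti by simp
    then have "closed_segment q0 (q0 + r *\<^sub>R v) \<subseteq> A" by (rule closed_segment_subset[OF q0(1) _ A])
    moreover have "r = nrm H (q0 + r *\<^sub>R v - q0)" using r(1) by (simp add: nrm_scaleR v)
    moreover have "q0 + r *\<^sub>R v - q0 = r *\<^sub>R v" by simp
    ultimately show ?thesis unfolding LS_def by blast
  qed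
  have l0: "0 < ?l" using cSup_upper[OF rL bdd] r(1) unfolding lE by linarith
  then show "0 < ?l" .
  \<comment> \<open>A segment may run along v or against it; exchanging its end points covers the
    second case.\<close>
  have keyL: "hh * L \<le> Cst * min d1 d2" if L: "L \<in> LS" for L
  proof -
    obtain p q t where t: "p \<in> A" "q \<in> A" "q - p = t *\<^sub>R v" "L = \<bar>t\<bar>" using LSe[OF L] by blast
    have Tt: "T *v q - T *v p = t *\<^sub>R w" using arg_cong[OF t(3), of "(*v) T"] by (simp add: w_def matrix_vector_mult_diff_distrib matrix_vector_mult_scaleR)
    have m0: "0 \<le> min d1 d2" using d1 d2 r(1) by simp
    have main: "hh * t \<le> Cst * min d1 d2" if t: "0 < t" "p \<in> A" "q \<in> A" "T *v q - T *v p = t *\<^sub>R w" for p q t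
    proof -
      have e1: "T *v q = T *v p + t *\<^sub>R w" and e2: "T *v p = T *v q + t *\<^sub>R (- w)" using t(4) by (simp_all add: algebra_simps)
      have "hh * t \<le> Cst * (w \<bullet> (T *v q1 - T *v q0))"
        by (rule key[OF w1 imageI[OF t(2)] _ t(1) imageI[OF q1(1)] q1(2)]) (unfold e1[symmetric], rule imageI[OF t(3)])
      moreover have "hh * t \<le> Cst * ((- w) \<bullet> (T *v q2 - T *v q0))"
        by (rule key[OF _ imageI[OF t(3)] _ t(1) imageI[OF q2(1)] q2(2)]) (use w1 in simp, unfold e2[symmetric], rule imageI[OF t(2)])
      ultimately have "hh * t \<le> Cst * d1" "hh * t \<le> Cst * d2" by (simp_all add: d1_def d2_def inner_diff_right)
      then show ?thesis by (simp add: min_def)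
    qed
    have Tt': "T *v p - T *v q = (- t) *\<^sub>R w" using Tt by (simp add: algebra_simps)
    show ?thesis using main[OF _ t(1,2) Tt] main[OF _ t(2,1) Tt'] t(4) Cst m0 by (cases "0 < t"; cases "t = 0") auto
  qed
  have hl: "hh * ?l \<le> Cst * ?D"
  proof (cases "hh = 0")
    case True
    then show ?thesis using Cst D d1 d2 r(1) by simp
  next
    case False
    then have h0: "0 < hh" using hh by simp
    have "?l \<le> Cst * min d1 d2 / hh" unfolding lE
    proof (rule cSup_least)
      show "LS \<noteq> {}" using rL by blast
      show "L \<le> Cst * min d1 d2 / hh" if "L \<in> LS" for L using keyL[OF that] h0 by (simp add: field_simps)
    qed
    then have "hh * ?l \<le> Cst * min d1 d2" using h0 by (simp add: field_simps)
    also have "\<dots> \<le> Cst * ?D" using D Cst by (rule mult_left_mono)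
    finally show ?thesis .
  qed
  show "0 \<le> N" using N[OF q0(1)] norm_ge_zero order_trans by blast
  show "0 \<le> ?D / ?W" using D W1 d1 d2 r(1) by auto
  have W0: "0 < ?W" using W1 d1 d2 r(1) by linarith
  have D0: "0 \<le> ?D" using D d1 d2 r(1) by linarith
  have "hh * ?l * ?W \<le> Cst * ?D * ?W" using hl W0 by (intro mult_right_mono) auto
  also have "\<dots> \<le> Cst * ?D * (2 * N)" using W2 Cst D0 by (intro mult_left_mono) auto
  finally have "hh * (?l * ?W) \<le> 2 * N * Cst * ?D" by (simp add: mult_ac)
  moreover have "0 < ?l * ?W" using l0 W0 by simp
  ultimately have "hh \<le> 2 * N * Cst * ?D / (?l * ?W)" by (simp add: pos_le_divide_eq)
  then show "hh \<le> 2 * N * Cst / ?l * (?D / ?W)" by simp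
qed

context ot_coord
begin

lemma section_image:
  assumes "ot_section M M' \<Omega> \<Omega>' c X' M0 u m xb S x0"
  shows "compact (pt ` S)" "pt x0 \<in> interior (pt ` S)"
proof -
  interpret sec: ot_section M M' \<Omega> \<Omega>' c X' M0 u m xb S x0 by (rule assms)
  show "compact (pt ` S)" by (rule compact_continuous_image[OF continuous_on_subset[OF pt_cont sec.S_sub] sec.S_compact])
  have "interior S \<subseteq> \<Omega>" using interior_subset sec.S_sub by blast
  from F.A.inj_open_map[OF pt_cont pt_inj open_interior this] have "open (pt ` interior S)" .
  moreover have "pt ` interior S \<subseteq> pt ` S" using interior_subset by blast
  moreover have "pt x0 \<in> pt ` interior S" using sec.x0 by blast
  ultimately show "pt x0 \<in> interior (pt ` S)" by (meson interior_maximal subsetD)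
qed

text \<open>The foci found in the patch lie in the c-subdifferential by
  \<open>subdiff_contains\<close>; \<open>vol_lower\<close> passes from their volume to that of the
  subdifferential and \<open>vol_upper\<close> from the image of the section to the section.\<close>

lemma section_estimate:
  assumes sec: "ot_section M M' \<Omega> \<Omega>' c X' M0 u m xb S x0"
    and h: "u x0 < m x0" and \<rho>: "0 < \<rho>" "2 * B\<^sup>2 * \<rho> \<le> 1" and \<epsilon>: "2 * K3 * N * B ^ 4 * \<rho> \<le> \<epsilon>" "\<epsilon> \<le> 1/4"
    and k: "(1 - 1 / (2 * M0)) ^ k * (K3 * (2 * N)) \<le> \<rho> / 8"
    and \<delta>: "\<forall>(e :: 'n \<Rightarrow> real^'n) g. (\<forall>i j. e i \<bullet> e j = (if i = j then 1 else 0)) \<longrightarrow> (\<forall>i. norm (g i) \<le> \<delta>) \<longrightarrow>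
       1 / 2 \<le> \<bar>det (\<chi> i. e i + g i)\<bar>" and \<epsilon>\<delta>: "3 * \<epsilon> \<le> \<delta>"
    and w: "norm w = 1" "a \<in> pt ` S" "a + l *\<^sub>R w \<in> pt ` S" "0 < l" "p1 \<in> pt ` S" "\<And>x. x \<in> pt ` S \<Longrightarrow> w \<bullet> x \<le> w \<bullet> p1"
  shows "(m x0 - u x0) ^ CARD('n) * l \<le> (2 ^ k * 8) ^ CARD('n) * 2 * real CARD('n) ^ CARD('n) * real CARD('n) ^ CARD('n) *
     (fact CARD('n) * (K3 * N) ^ CARD('n)) * (fact CARD('n) * N ^ CARD('n)) *
     measure (riem_vol M) S * measure (riem_vol M') (subdiff u S) * (w \<bullet> (p1 - pt x0))"
proof -
  interpret sec: ot_section M M' \<Omega> \<Omega>' c X' M0 u m xb S x0 by (rule sec)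
  let ?n = "CARD('n)" and ?A = "subdiff u S" and ?K = "pt ` S"
  let ?Q = "\<lambda>p. Qx (xi p)" and ?\<Lambda> = "2 * K3 * N * B ^ 4" and ?D = "K3 * (2 * N)"
  have cb_pt: "cb (pt x) z = - c x z + c x xb" if "x \<in> \<Omega>" for x z by (simp add: cb_def xi[OF that])
  interpret cs: cost_patch "pt ` \<Omega>" \<Omega>' xb cb ?Q \<psi> \<rho> \<epsilon> ?\<Lambda> M0 ?D by (rule patch[OF \<rho> \<epsilon>])
  interpret cs: cost_section "pt ` \<Omega>" \<Omega>' xb cb ?Q \<psi> \<rho> \<epsilon> ?\<Lambda> M0 ?D ?K "pt x0" "m x0 - u x0" k
  proof
    show "?K \<subseteq> pt ` \<Omega>" using sec.S_sub by blast
    show "compact ?K" "pt x0 \<in> interior ?K" by (rule section_image[OF sec])+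
    show "convex ?K" by (rule pt_convex[OF sec.section_convex])
    show "0 < m x0 - u x0" using h by simp
    show "(1 - 1 / (2 * M0)) ^ k * ?D \<le> \<rho> / 8" by (rule k)
    fix p assume "p \<in> pt ` \<Omega> - ?K"
    then obtain x where x: "p = pt x" "x \<in> \<Omega>" "x \<notin> S" by blast
    obtain z where z: "z \<in> \<Omega>'" "\<And>y. y \<in> S \<Longrightarrow> (- c y z + c y xb) - (- c x z + c x xb) \<le> 0"
      "(- c x0 z + c x0 xb) - (- c x z + c x xb) \<le> - (m x0 - u x0)" by (rule sec.outside_support[OF x(2,3)], rule that)
    have "cb q z - cb p z \<le> 0" if q: "q \<in> ?K" for q
    proof -
      obtain y where y: "q = pt y" "y \<in> S" using q by blast
      have yO: "y \<in> \<Omega>" using y(2) sec.S_sub by blast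
      from z(2)[OF y(2)] show ?thesis unfolding y(1) x(1) cb_pt[OF yO] cb_pt[OF x(2)] .
    qed
    moreover have "cb (pt x0) z - cb p z \<le> - (m x0 - u x0)" using z(3) unfolding x(1) cb_pt[OF sec.x0_in(2)] cb_pt[OF x(2)] .
    ultimately show "\<exists>w\<in>\<Omega>'. (\<forall>x\<in>?K. cb x w - cb p w \<le> 0) \<and> cb (pt x0) w - cb p w \<le> - (m x0 - u x0)" using z(1) by blast
  qed
  obtain Bc m0 where Bc: "Bc \<subseteq> (\<lambda>y. ?Q (pt x0) (\<psi> y)) ` cs.E0" "compact Bc" "0 \<le> m0" "emeasure lborel Bc = ennreal m0"
    "(m x0 - u x0) ^ ?n * l \<le> (2 ^ k * 8) ^ ?n * 2 * real ?n ^ ?n * real ?n ^ ?n * m0 * (w \<bullet> (p1 - pt x0)) * measure lborel ?K"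
  proof (rule cs.aleksandrov_core[OF w(1-5), where \<delta> = \<delta>])
    show "w \<bullet> x \<le> w \<bullet> p1" if "x \<in> ?K" for x by (rule w(6)[OF that])
    show "1 / 2 \<le> \<bar>det (\<chi> i. e i + g i)\<bar>" if "\<And>i j. e i \<bullet> e j = (if i = j then 1 else 0)" "\<And>i. norm (g i) \<le> \<delta>"
      for e g :: "'n \<Rightarrow> real^'n"
      by (rule \<delta>[rule_format]) (rule that)+
    show "3 * \<epsilon> \<le> \<delta>" by (rule \<epsilon>\<delta>)
  qed (rule that)
  have E: "\<psi> y \<in> ?A" if "y \<in> cs.E0" for y
  proof (rule sec.subdiff_contains[OF h])
    have y: "y \<in> ball 0 \<rho>" "\<And>q. q \<in> ?K \<Longrightarrow> cb q (\<psi> y) - cb (pt x0) (\<psi> y) \<le> m x0 - u x0"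
      using that unfolding cs.E0_def cs.E_def by blast+
    show "\<psi> y \<in> \<Omega>'" by (rule cs.psi(1)[OF y(1)])
    fix x assume x: "x \<in> S"
    have xO: "x \<in> \<Omega>" using x sec.S_sub by blast
    from y(2)[OF imageI[OF x]] show "- c x (\<psi> y) + c x xb - (- c x0 (\<psi> y) + c x0 xb) \<le> m x0 - u x0"
      unfolding cb_pt[OF xO] cb_pt[OF sec.x0_in(2)] .
  qed
  \<comment> \<open>\<open>measure\<close> is 0 on sets of infinite measure, so finiteness is
    required before leaving \<open>emeasure\<close>.\<close>
  have fin: "emeasure (riem_vol M') ?A < \<infinity>"
  proof -
    have "emeasure (riem_vol M') ?A \<le> emeasure (riem_vol M') (closure \<Omega>')"
      by (rule emeasure_mono) (use sec.subdiff_sub closure_subset[of \<Omega>'] F.B.riem_vol_sets[of "closure \<Omega>'"] in auto)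
    also have "\<dots> < \<infinity>" by (rule F.B.riem_vol_compact_finite[OF F.doms(4)])
    finally show ?thesis .
  qed
  let ?C1 = "fact ?n * (K3 * N) ^ ?n :: real" and ?C2 = "fact ?n * N ^ ?n :: real"
  have C: "0 \<le> ?C1" "0 \<le> ?C2" using K3_nonneg N_nonneg by simp_all
  have m0: "m0 \<le> ?C1 * measure (riem_vol M') ?A"
  proof -
    have "ennreal m0 \<le> emeasure lborel (Qx x0 ` ?A)"
      unfolding Bc(4)[symmetric]
    proof (rule emeasure_mono)
      show "Bc \<subseteq> Qx x0 ` ?A" using Bc(1) E unfolding xi[OF sec.x0_in(2)] by blast
      show "Qx x0 ` ?A \<in> sets lborel"
        using F.B.inj_image_borel[OF Qx_cont[OF sec.x0_in(2)] Qx_inj[OF sec.x0_in(2)] F.doms(2) sec.subdiff_borel sec.subdiff_sub] by simp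
    qed
    also have "\<dots> \<le> ennreal ?C1 * emeasure (riem_vol M') ?A" by (rule vol_lower[OF sec.x0_in(2) sec.subdiff_borel sec.subdiff_sub])
    also have "\<dots> = ennreal (?C1 * measure (riem_vol M') ?A)"
    proof -
      have "emeasure (riem_vol M') ?A = ennreal (measure (riem_vol M') ?A)" by (rule emeasure_eq_ennreal_measure) (use fin in auto)
      then show ?thesis by (simp only: ennreal_mult[OF C(1) measure_nonneg])
    qed
    finally show ?thesis using C(1) by (simp add: ennreal_le_iff)
  qed
  have Sb: "S \<in> sets borel" using sec.S_compact by (simp add: borel_compact)
  have finS: "emeasure (riem_vol M) S < \<infinity>" by (rule F.A.riem_vol_compact_finite[OF sec.S_compact])
  have mK: "measure lborel ?K \<le> ?C2 * measure (riem_vol M) S"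
  proof -
    have "emeasure lborel ?K < \<infinity>" by (rule emeasure_compact_finite[OF section_image(1)[OF sec]])
    then have "ennreal (measure lborel ?K) = emeasure lborel ?K" by (simp add: emeasure_eq_ennreal_measure)
    also have "\<dots> \<le> ennreal ?C2 * emeasure (riem_vol M) S" by (rule vol_upper[OF Sb sec.S_sub])
    also have "\<dots> = ennreal (?C2 * measure (riem_vol M) S)"
    proof -
      have "emeasure (riem_vol M) S = ennreal (measure (riem_vol M) S)" by (rule emeasure_eq_ennreal_measure) (use finS in auto)
      then show ?thesis by (simp only: ennreal_mult[OF C(2) measure_nonneg])
    qed
    finally show ?thesis using C(2) by (simp add: ennreal_le_iff)
  qed
  let ?c = "(2 ^ k * 8) ^ ?n * 2 * real ?n ^ ?n * real ?n ^ ?n" and ?d = "w \<bullet> (p1 - pt x0)"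
  have d: "0 \<le> ?d" using w(6)[of "pt x0"] sec.x0_in(1) by (simp add: inner_diff_right)
  note Bc(5)
  also have "?c * m0 * ?d * measure lborel ?K \<le> ?c * (?C1 * measure (riem_vol M') ?A) * ?d * (?C2 * measure (riem_vol M) S)"
    by (intro mult_mono m0 mK order_refl mult_nonneg_nonneg d C measure_nonneg Bc(3)) auto
  finally show ?thesis by (simp only: mult_ac)
qed

end

section \<open>Choice of the constants and the conclusion\<close>

context ot_cost
begin

text \<open>The summand sup |c| is seen to be nonnegative because c is bounded, by compactness of
  the closures; the supremum of an unbounded set of reals would be unspecified.\<close>

lemma C3_norm_bounds:
  "C3_half_norm M M' \<Omega> \<Omega>' c \<le> C3_norm M M' \<Omega> \<Omega>' c" "C3_half_norm M' M \<Omega>' \<Omega> (flip c) \<le> C3_norm M M' \<Omega> \<Omega>' c"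
proof -
  have cpt: "compact ((\<lambda>(x, x'). c x x') ` (closure \<Omega> \<times> closure \<Omega>'))"
    by (rule compact_continuous_image[OF ccont compact_Times[OF F.doms(3,4)]])
  obtain b where b: "\<And>t. t \<in> (\<lambda>(x, x'). c x x') ` (closure \<Omega> \<times> closure \<Omega>') \<Longrightarrow> \<bar>t\<bar> \<le> b"
    using compact_imp_bounded[OF cpt] unfolding bounded_iff real_norm_def by blast
  have cb: "\<bar>c x x'\<bar> \<le> b" if "x \<in> \<Omega>" "x' \<in> \<Omega>'" for x x'
  proof -
    have "(x, x') \<in> closure \<Omega> \<times> closure \<Omega>'" using that closure_subset[of \<Omega>] closure_subset[of \<Omega>'] by blast
    from b[OF imageI[OF this]] show ?thesis by simp
  qed
  obtain x x' where x: "x \<in> \<Omega>" "x' \<in> \<Omega>'" using F.doms by blast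
  have "0 \<le> \<bar>c x x'\<bar>" by simp
  also have "\<dots> = (case (x, x') of (x, x') \<Rightarrow> \<bar>c x x'\<bar>)" by simp
  also have "\<dots> \<le> (SUP (x, x') \<in> \<Omega> \<times> \<Omega>'. \<bar>c x x'\<bar>)"
  proof (rule cSUP_upper)
    show "(x, x') \<in> \<Omega> \<times> \<Omega>'" using x by simp
    show "bdd_above ((\<lambda>(x, x'). \<bar>c x x'\<bar>) ` (\<Omega> \<times> \<Omega>'))" by (rule bdd_aboveI2[of _ _ b]) (use cb in auto)
  qed
  finally have "0 \<le> (SUP (x, x') \<in> \<Omega> \<times> \<Omega>'. \<bar>c x x'\<bar>)" .
  then show "C3_half_norm M M' \<Omega> \<Omega>' c \<le> C3_norm M M' \<Omega> \<Omega>' c" "C3_half_norm M' M \<Omega>' \<Omega> (flip c) \<le> C3_norm M M' \<Omega> \<Omega>' c"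
    unfolding C3_norm_def using F.half_norm_nonneg R.half_norm_nonneg by linarith+
qed

end

lemma ot_costI:
  assumes "riemannian_manifold M" "riemannian_manifold M'" "bounded_domain \<Omega>" "bounded_domain \<Omega>'" "1 \<le> M0"
    "C3_cost M M' \<Omega> \<Omega>' c" "twist M M' \<Omega> \<Omega>' c" "nondeg M M' \<Omega> \<Omega>' c" "dom_conv M M' \<Omega> \<Omega>' X' c" "qqconv M M' \<Omega> \<Omega>' M0 c"
  shows "ot_cost M M' \<Omega> \<Omega>' c X' M0"
  using assms unfolding bounded_domain_def C3_cost_def
  by unfold_locales simp_all

theorem theorem4p1:
  fixes M :: "('m::{t2_space,second_countable_topology}, 'n::finite) rmfd"
    and M' :: "('k::{t2_space,second_countable_topology}, 'n) rmfd"
    and \<Omega> X :: "'m set" and \<Omega>' X' :: "'k set"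
    and \<alpha>1 \<alpha>2 M0 K1 K2 K3 K4 K5 :: real
  assumes "riemannian_manifold M" and "riemannian_manifold M'"
    and "bounded_domain \<Omega>" and "bounded_domain \<Omega>'"
    and "0 < \<alpha>1" and "\<alpha>1 \<le> \<alpha>2" and "1 \<le> M0"
  shows "\<exists>C>0. \<forall>\<rho> \<rho>' c.
    prob_density M \<rho> \<and> prob_density M' \<rho>' \<and>
    spt M \<rho> = X \<and> spt M' \<rho>' = X' \<and> X \<subseteq> \<Omega> \<and> X' \<subseteq> \<Omega>' \<and>
    ratio_bounds M M' \<alpha>1 \<alpha>2 \<rho> \<rho>' \<and>
    C3_cost M M' \<Omega> \<Omega>' c \<and>
    twist M M' \<Omega> \<Omega>' c \<and> nondeg M M' \<Omega> \<Omega>' c \<and> dom_conv M M' \<Omega> \<Omega>' X' c \<and>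
    qqconv M M' \<Omega> \<Omega>' M0 c \<and>
    sup_det M M' \<Omega> \<Omega>' c = K1 \<and> sup_inv_det M M' \<Omega> \<Omega>' c = K2 \<and>
    sup_norm M M' \<Omega> \<Omega>' c = K3 \<and> sup_inv_norm M M' \<Omega> \<Omega>' c = K4 \<and>
    C3_norm M M' \<Omega> \<Omega>' c = K5 \<longrightarrow>
    (\<forall>u m x' S x0 v.
      c_convex_fun \<Omega> \<Omega>' c u \<and> x' \<in> X' \<and> c_function \<Omega> c x' m \<and>
      S = {x\<in>\<Omega>. u x \<le> m x} \<and> compactly_contained S \<Omega> \<and> x0 \<in> interior S \<and>
      nrm (cogram M' x') v = 1 \<longrightarrow>
      (let H = cogram M' x';
           p = mom M' (flip c) x';
           hp = supporting_hyperplane H (p ` S)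
       in (m x0 - u x0) ^ CARD('n)
          \<le> C / max_segment H (p ` S) v
             * (set_distance H {p x0} (hp v \<union> hp (- v)) / set_distance H (hp v) (hp (- v)))
             * measure (riem_vol M) S * measure (riem_vol M') (c_subdiff \<Omega> \<Omega>' c u S)))"
proof (cases "compactly_contained X' \<Omega>'")
  case False
  \<comment> \<open>(DomConv) includes compact containment, so no cost satisfies the hypotheses and
    any positive constant serves.\<close>
  then show ?thesis unfolding dom_conv_def by (intro exI[of _ 1]) simp
next
  case True
  interpret A: rmanifold M by unfold_locales (rule assms(1))
  interpret B: rmanifold M' by unfold_locales (rule assms(2))
  have O': "open \<Omega>'" using assms(4) by (simp add: bounded_domain_def)
  have X': "compact (closure X')" "closure X' \<subseteq> \<Omega>'" using True interior_subset[of \<Omega>'] unfolding compactly_contained_def by auto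
  \<comment> \<open>Determined by the second manifold, \<Omega>' and X' alone, hence available
    before c.\<close>
  obtain B where B: "1 \<le> B" "\<And>x. x \<in> closure X' \<Longrightarrow> \<exists>ct. B.uniform_at \<Omega>' B x ct"
    by (rule B.uniform_charts[OF X' O'], rule that)
  obtain \<delta> where \<delta>: "\<delta> > 0" "\<forall>(e :: 'n \<Rightarrow> real^'n) g. (\<forall>i j. e i \<bullet> e j = (if i = j then 1 else 0)) \<longrightarrow> (\<forall>i. norm (g i) \<le> \<delta>) \<longrightarrow>
       1 / 2 \<le> \<bar>det (\<chi> i. e i + g i)\<bar>"
  proof (rule det_near_orthonormal)
    fix d :: real
    assume d: "d > 0" "\<And>(e :: 'n \<Rightarrow> real^'n) g. \<lbrakk>\<And>i j. e i \<bullet> e j = (if i = j then 1 else 0); \<And>i. norm (g i) \<le> d\<rbrakk> \<Longrightarrow>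
      1 / 2 \<le> \<bar>det (\<chi> i. e i + g i)\<bar>"
    show thesis
    proof (rule that[OF d(1)], intro allI impI)
      fix e g :: "'n \<Rightarrow> real^'n"
      assume "\<forall>i j. e i \<bullet> e j = (if i = j then 1 else 0)" "\<forall>i. norm (g i) \<le> d"
      then show "1 / 2 \<le> \<bar>det (\<chi> i. e i + g i)\<bar>" by (intro d(2)) (erule spec | erule allE)+
    qed
  qed
  let ?n = "CARD('n)"
  \<comment> \<open>K3 and K5 are arbitrary reals at this stage; the maximum and the absolute value
    supply signs that are known only once a cost with these constants is given.\<close>
  define N where "N = max 1 K5"
  define K where "K = \<bar>K3\<bar>"
  define \<epsilon> where "\<epsilon> = min (1/4) (\<delta> / 3)"
  define \<Lambda> where "\<Lambda> = 2 * K * N * B ^ 4"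
  \<comment> \<open>Keeps \<psi> inside the chart ball and makes the deviation \<Lambda> \<rho> from
    the identity at most \<epsilon>; \<Lambda> + 1 is positive even if K = 0.\<close>
  define \<rho> where "\<rho> = min (1 / (2 * B\<^sup>2)) (\<epsilon> / (\<Lambda> + 1))"
  have N: "1 \<le> N" "K5 \<le> N" by (auto simp: N_def)
  have K: "0 \<le> K" by (simp add: K_def)
  have \<epsilon>: "0 < \<epsilon>" "\<epsilon> \<le> 1/4" "3 * \<epsilon> \<le> \<delta>" using \<delta>(1) by (auto simp: \<epsilon>_def)
  have \<Lambda>: "0 \<le> \<Lambda>" using N K B(1) by (simp add: \<Lambda>_def)
  have \<rho>: "0 < \<rho>" "2 * B\<^sup>2 * \<rho> \<le> 1" "\<Lambda> * \<rho> \<le> \<epsilon>"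
  proof -
    show "0 < \<rho>" using B(1) \<epsilon>(1) \<Lambda> by (simp add: \<rho>_def)
    have "\<rho> \<le> 1 / (2 * B\<^sup>2)" by (simp add: \<rho>_def)
    then show "2 * B\<^sup>2 * \<rho> \<le> 1" using B(1) by (simp add: field_simps)
    have "\<rho> \<le> \<epsilon> / (\<Lambda> + 1)" by (simp add: \<rho>_def)
    then have "(\<Lambda> + 1) * \<rho> \<le> \<epsilon>" using \<Lambda> by (simp add: field_simps)
    then show "\<Lambda> * \<rho> \<le> \<epsilon>" using \<open>0 < \<rho>\<close> by (simp add: distrib_right)
  qed
  \<comment> \<open>The number of contractions that brings every gradient, of norm at most 2 K N,
    within \<rho> / 8.\<close>
  have "\<exists>k. (1 - 1 / (2 * M0)) ^ k < \<rho> / (8 * (2 * K * N + 1))"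
    by (rule real_arch_pow_inv) (use assms(7) \<rho>(1) K N in \<open>auto intro!: divide_pos_pos add_nonneg_pos\<close>)
  then obtain k where k0: "(1 - 1 / (2 * M0)) ^ k < \<rho> / (8 * (2 * K * N + 1))" by (rule exE)
  have k: "(1 - 1 / (2 * M0)) ^ k * (K * (2 * N)) \<le> \<rho> / 8"
  proof -
    have p: "0 < 2 * K * N + 1" using K N by (intro add_nonneg_pos) auto
    have "0 \<le> (1 - 1 / (2 * M0)) ^ k" using assms(7) by simp
    then have "(1 - 1 / (2 * M0)) ^ k * (K * (2 * N)) \<le> (1 - 1 / (2 * M0)) ^ k * (2 * K * N + 1)" by (intro mult_left_mono) auto
    also have "\<dots> \<le> \<rho> / 8" using k0 p by (simp add: field_simps)
    finally show ?thesis .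
  qed
  define C0 where "C0 = (2 ^ k * 8) ^ ?n * 2 * real ?n ^ ?n * real ?n ^ ?n * (fact ?n * (K * N) ^ ?n) * (fact ?n * N ^ ?n)"
  have C0: "0 \<le> C0" using K N by (simp add: C0_def)
  show ?thesis
  \<comment> \<open>2 N comes from the width of the section; adding 1 makes the constant
    positive.\<close>
  proof (intro exI[of _ "2 * N * C0 + 1"] conjI allI impI, goal_cases)
    case 1
    have "0 \<le> 2 * N * C0" using N C0 by simp
    then show ?case by linarith
  next
    case (2 \<rho>' \<rho>'' c u m xb S x0 v)
    interpret ot_cost M M' \<Omega> \<Omega>' c X' M0
      by (rule ot_costI) (use 2(1) assms in \<open>simp_all\<close>)
    have xbX: "xb \<in> X'" and xb: "xb \<in> \<Omega>'" and nv: "nrm (cogram M' xb) v = 1" using 2 by auto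
    have "xb \<in> closure X'" using xbX closure_subset by blast
    from B(2)[OF this] obtain ct' where kap: "B.uniform_at \<Omega>' B xb ct'" by (rule exE)
    obtain A0 Ai where ch: "chol (gram M' xb) A0 Ai" by (rule posdef_cholesky[OF B.posdef_gram])
    have K5: "C3_norm M M' \<Omega> \<Omega>' c = K5" and K3: "sup_norm M M' \<Omega> \<Omega>' c = K3" using 2(1) by simp_all
    interpret co: ot_coord M M' \<Omega> \<Omega>' c X' M0 xb A0 Ai ct' B N K3
    proof
      show "xb \<in> \<Omega>'" "chol (gram M' xb) A0 Ai" "1 \<le> B" "B.uniform_at \<Omega>' B xb ct'" "sup_norm M M' \<Omega> \<Omega>' c = K3" by (rule xb ch B(1) kap K3)+
      show "C3_half_norm M' M \<Omega>' \<Omega> (flip c) \<le> N" "C3_half_norm M M' \<Omega> \<Omega>' c \<le> N"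
        using C3_norm_bounds N(2) unfolding K5 by linarith+
    qed
    have KK: "K = K3" using co.K3_nonneg by (simp add: K_def)
    have sec: "ot_section M M' \<Omega> \<Omega>' c X' M0 u m xb S x0"
    proof unfold_locales
      show "c_convex_fun \<Omega> \<Omega>' c u" "xb \<in> \<Omega>'" "c_function \<Omega> c xb m" "S = {x \<in> \<Omega>. u x \<le> m x}" "compactly_contained S \<Omega>" "x0 \<in> interior S"
        using 2(2) xb by blast+
    qed
    interpret se: ot_section M M' \<Omega> \<Omega>' c X' M0 u m xb S x0 by (rule sec)
    let ?H = "cogram M' xb" and ?p = "mom M' (flip c) xb" and ?T = "transpose Ai"
    let ?hp = "supporting_hyperplane ?H (?p ` S)"
    let ?V = "measure (riem_vol M) S * measure (riem_vol M') (c_subdiff \<Omega> \<Omega>' c u S)"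
    have V: "0 \<le> ?V" by simp
    have im: "(*v) ?T ` (?p ` S) = co.pt ` S" by (rule co.pt_image[symmetric])
    have T1: "nrm ?H q = norm (?T *v q)" for q unfolding cogram_def by (rule co.chD(6))
    have T2: "ip ?H p q = (?T *v p) \<bullet> (?T *v q)" for p q
      unfolding cogram_def ip_def co.chD(4) by (simp only: matrix_vector_mul_assoc[symmetric] inner_transpose_left)
    have h: "0 \<le> m x0 - u x0" using se.x0_in(1) by (simp add: se.S)
    have pos: "0 < ?n" by simp
    note G = section_geometry[where H = ?H and T = ?T and Ti = "transpose A0" and A = "?p ` S" and ?q0.0 = "?p x0" and N = N and v = v
      and Cst = "C0 * ?V" and hh = "(m x0 - u x0) ^ ?n", OF T1 T2 co.Ait(1) se.section_convex]
    have int: "?T *v ?p x0 \<in> interior ((*v) ?T ` (?p ` S))"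
      using co.section_image(2)[OF sec] unfolding im by (simp only: co.pt_def)
    have comp: "compact ((*v) ?T ` (?p ` S))" unfolding im by (rule co.section_image(1)[OF sec])
    have nb: "norm (?T *v q) \<le> N" if q: "q \<in> ?p ` S" for q
    proof -
      obtain x where x: "q = ?p x" "x \<in> S" using q by blast
      show ?thesis using co.pt_bound[of x] x se.S_sub unfolding co.pt_def by blast
    qed
    have key: "(m x0 - u x0) ^ ?n * l \<le> C0 * ?V * (w \<bullet> (p1 - ?T *v ?p x0))"
      if w: "norm w = 1" "a \<in> (*v) ?T ` (?p ` S)" "a + l *\<^sub>R w \<in> (*v) ?T ` (?p ` S)" "0 < l" "p1 \<in> (*v) ?T ` (?p ` S)"
        "\<And>x. x \<in> (*v) ?T ` (?p ` S) \<Longrightarrow> w \<bullet> x \<le> w \<bullet> p1" for w a l p1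
    proof (cases "m x0 - u x0 = 0")
      \<comment> \<open>u may equal m at an interior point of S. The left side is then 0 because n
        \<ge> 1, and only nonnegativity of the right side is left.\<close>
      case True
      have "?T *v ?p x0 \<in> (*v) ?T ` (?p ` S)" using se.x0_in(1) by blast
      from w(6)[OF this] have "0 \<le> w \<bullet> (p1 - ?T *v ?p x0)" by (simp add: inner_diff_right)
      then have "0 \<le> C0 * ?V * (w \<bullet> (p1 - ?T *v ?p x0))" using C0 V by (intro mult_nonneg_nonneg) auto
      then show ?thesis unfolding True using pos by (simp add: power_0_left)
    next
      case False
      have hp: "u x0 < m x0" using False h by simp
      have "(m x0 - u x0) ^ ?n * l \<le> C0 * measure (riem_vol M) S * measure (riem_vol M') (c_subdiff \<Omega> \<Omega>' c u S) * (w \<bullet> (p1 - co.pt x0))"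
        unfolding C0_def KK
        by (rule co.section_estimate[OF sec hp \<rho>(1,2) \<rho>(3)[unfolded \<Lambda>_def KK] \<epsilon>(2) k[unfolded KK] \<delta>(2) \<epsilon>(3) w[unfolded im]])
      then show ?thesis by (simp only: co.pt_def mult.assoc)
    qed
    have q0: "?p x0 \<in> ?p ` S" using se.x0_in(1) by blast
    have CV: "0 \<le> C0 * ?V" using C0 V by simp
    note G' = G[OF comp q0 int nb nv CV zero_le_power[OF h] key]
    let ?R = "set_distance ?H {?p x0} (?hp v \<union> ?hp (- v)) / set_distance ?H (?hp v) (?hp (- v))" and ?l = "max_segment ?H (?p ` S) v"
    have "(m x0 - u x0) ^ ?n \<le> 2 * N * (C0 * ?V) / ?l * ?R" by (rule G'(1))
    also have "\<dots> = 2 * N * C0 / ?l * ?R * ?V" by simp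
    also have "\<dots> \<le> (2 * N * C0 + 1) / ?l * ?R * ?V"
      by (intro mult_right_mono divide_right_mono V G'(2) less_imp_le[OF G'(3)]) simp
    finally show ?case unfolding Let_def by (simp only: mult.assoc)
  qed
qed

end
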